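(* Let $V$ be a vertex operator algebra of strong CFT-type, and let $$G_m(\mathbf z)=G_m(z_1,\ldots,z_m)=Z_V^{(2)}(\widetilde\omega,z_1;\ldots;\widetilde\omega,z_m)\,dz_1^2\cdots dz_m^2$$ be the formal differential given by the genus two $m$-point correlation function of the (square bracket) Virasoro vector $\widetilde\omega$. Then $G_m(\mathbf z)$ is symmetric in the $z_i$ and is a generating function for all genus two $n$-point correlation functions for Virasoro vacuum descendants.
   Context: $V=(V,Y,\mathbf 1,\omega)$ is a vertex operator algebra (VOA) with central charge $c$; strong CFT-type means $V_{(n)}=0$ for $n<0$, $V_{(0)}=\mathbb C\mathbf 1$, and $V$ is simple and self-dual. Zhu's isomorphic square bracket VOA $(V,Y[\,,\,],\mathbf 1,\widetilde\omega)$ has vertex operators $Y[v,z]=Y(e^{zL(0)}v,e^z-1)=\sum_n v[n]z^{-n-1}$ and conformal vector $\widetilde\omega=\omega-\frac{c}{24}\mathbf 1$, with Virasoro modes $L[n]$ given by $Y[\widetilde\omega,z]=\sum_n L[n]z^{-n-2}$. A Virasoro vacuum descendant is a vector of the form $L[-k_1]\cdots L[-k_r]\mathbf 1$ with all $k_j\ge 2$. Genus one 1-point function: $Z_V^{(1)}(v;\tau)=\mathrm{Tr}_V\left(o(v)q^{L(0)-c/24}\right)$ with $q=e^{2\pi i\tau}$, where $o(v)=v(k-1)$ for $v$ of conformal weight $k$, extended linearly. Genus two surface: tori $\mathcal S_a=\mathbb C/2\pi i(\mathbb Z\tau_a\oplus\mathbb Z)$, $a=1,2$, with local coordinates $z_a$,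 are sewn together via $z_1z_2=\epsilon$, where $|\epsilon|\le r_1r_2$. The punctured tori are $\widehat{\mathcal S}_1=\mathcal S_1\setminus\{|z_1|\le|\epsilon|/r_2\}$ and $\widehat{\mathcal S}_2=\mathcal S_2\setminus\{|z_2|\le|\epsilon|/r_1\}$, and the annuli $|\epsilon|/r_2\le|z_1|\le r_1$ and $|\epsilon|/r_1\le|z_2|\le r_2$ are identified. Genus two correlation functions: for $a_1,\ldots,a_L\in V$ inserted at $x_1,\ldots,x_L\in\widehat{\mathcal S}_1$ and $b_1,\ldots,b_R\in V$ inserted at $y_1,\ldots,y_R\in\widehat{\mathcal S}_2$, the genus two $n$-point correlation function ($n=L+R$) is formally $$Z_V^{(2)}(a_1,x_1;\ldots;a_L,x_L\,|\,b_1,y_1;\ldots;b_R,y_R)=\sum_{u}Z_V^{(1)}(Y[a_1,x_1]\cdots Y[a_L,x_L]u;\tau_1)\,Z_V^{(1)}(Y[b_R,y_R]\cdots Y[b_1,y_1]\overline u;\tau_2),$$ where $u$ runs over any basis of $V$ and $\overline u$ is the dual of $u$ with respect to an invariant invertible bilinear form associated with the Möbius map $z\mapsto\epsilon/z$. The dependence on $\tau_1,\tau_2,\epsilon$ is suppressed. In particular, for $z_1,\ldots,z_m\in\widehat{\mathcal S}_1$, $$Z_V^{(2)}(\widetilde\omega,z_1;\ldots;\widetilde\omega,z_m)=\sum_{u}Z_V^{(1)}(Y[\widetilde\omega,z_1]\cdots Y[\widetilde\omega,z_m]u;\tau_1)\,Z_V^{(1)}(\overline u;\tau_2).$$ $G_m(\mathbf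 z)$ is independent of whether $\widetilde\omega$ is formally inserted at $z_i\in\widehat{\mathcal S}_1$ or at $\epsilon/z_i\in\widehat{\mathcal S}_2$. "Generating function" means that, as $m$ varies, the correlation functions of Virasoro vacuum descendants occur as coefficients in formal expansions of the Virasoro $m$-point functions. *)

theory Defs
  imports
    Complex_Main
    "HOL-Library.Groups_Big_Fun"
    "HOL-Combinatorics.Permutations"
    "HOL-Computational_Algebra.Formal_Laurent_Series"
begin

section \<open>Vertex operator algebras\<close>

text \<open>
  The underlying complex vector space is the whole type, with scalar multiplication \<open>scal\<close>.
  \<open>vmode V a n\<close> is the mode \<open>a(n)\<close> of \<open>Y(a,z) = \<Sum>\<^sub>n a(n) z^(-n-1)\<close>.
\<close>

record 'v voa_data =
  scal :: "complex \<Rightarrow> 'v \<Rightarrow> 'v"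
  vmode :: "'v \<Rightarrow> int \<Rightarrow> 'v \<Rightarrow> 'v"
  vac :: "'v"
  conf :: "'v"
  cc :: "complex"

definition Lm :: "'v voa_data \<Rightarrow> int \<Rightarrow> 'v \<Rightarrow> 'v" where
  "Lm V n = vmode V (conf V) (n + 1)"

definition wtspace :: "'v voa_data \<Rightarrow> complex \<Rightarrow> 'v set" where
  "wtspace V s = {v. Lm V 0 v = scal V s v}"

definition homog_decomp :: "'v::ab_group_add voa_data \<Rightarrow> 'v \<Rightarrow> (int \<Rightarrow> 'v) \<Rightarrow> bool" where
  "homog_decomp V v f \<longleftrightarrow>
     finite {k. f k \<noteq> 0} \<and> (\<forall>k. f k \<in> wtspace V (of_int k)) \<and> v = Sum_any f"

definition hcomp :: "'v::ab_group_add voa_data \<Rightarrow> 'v \<Rightarrow> int \<Rightarrow> 'v" where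
  "hcomp V v = (THE f. homog_decomp V v f)"

text \<open>
  The Jacobi identity is written in modes (Borcherds identity); all sums over \<open>i\<close> have finite
  support because of lower truncation.
\<close>

definition voa :: "'v::ab_group_add voa_data \<Rightarrow> bool" where
  "voa V \<longleftrightarrow>
     vector_space (scal V) \<and>
     \<comment> \<open>bilinearity\<close>
     (\<forall>a b c n. vmode V (a + b) n c = vmode V a n c + vmode V b n c) \<and>
     (\<forall>r a c n. vmode V (scal V r a) n c = scal V r (vmode V a n c)) \<and>
     (\<forall>a b c n. vmode V a n (b + c) = vmode V a n b + vmode V a n c) \<and>
     (\<forall>r a c n. vmode V a n (scal V r c) = scal V r (vmode V a n c)) \<and>
     \<comment> \<open>lower truncation, vacuum, creativity\<close>
     (\<forall>a b. \<exists>N. \<forall>n\<ge>N. vmode V a n b = 0) \<and>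
     (\<forall>n b. vmode V (vac V) n b = (if n = -1 then b else 0)) \<and>
     (\<forall>a. vmode V a (-1) (vac V) = a \<and> (\<forall>n\<ge>0. vmode V a n (vac V) = 0)) \<and>
     \<comment> \<open>Jacobi identity\<close>
     (\<forall>a b c l m n.
        Sum_any (\<lambda>i::nat. scal V (of_int m gchoose i)
          (vmode V (vmode V a (l + int i) b) (m + n - int i) c)) =
        Sum_any (\<lambda>i::nat. scal V ((-1) ^ i * (of_int l gchoose i))
          (vmode V a (m + l - int i) (vmode V b (n + int i) c)
            - scal V ((-1) powi l) (vmode V b (n + l - int i) (vmode V a (m + int i) c))))) \<and>
     \<comment> \<open>Virasoro algebra and translation\<close>
     (\<forall>m n v. Lm V m (Lm V n v) - Lm V n (Lm V m v) =
        scal V (of_int (m - n)) (Lm V (m + n) v) +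
        (if m + n = 0 then scal V (of_int (m ^ 3 - m) / 12 * cc V) v else 0)) \<and>
     (\<forall>a n b. vmode V (Lm V (-1) a) n b = scal V (- of_int n) (vmode V a (n - 1) b)) \<and>
     \<comment> \<open>grading by \<open>L(0)\<close>\<close>
     (\<forall>v. \<exists>f. homog_decomp V v f) \<and>
     (\<forall>k::int. \<exists>S. finite S \<and> module.span (scal V) S = wtspace V (of_int k)) \<and>
     (\<exists>N::int. \<forall>k<N. wtspace V (of_int k) = {0})"

text \<open>
  For \<open>a\<close> of weight \<open>k\<close>, \<open>opp_mode V k a n\<close> is the coefficient of \<open>z^(-n-1)\<close> in
  \<open>Y(e^(z L(1)) (-z^(-2))^k a, z^(-1))\<close>.
\<close>

definition opp_mode :: "'v::ab_group_add voa_data \<Rightarrow> int \<Rightarrow> 'v \<Rightarrow> int \<Rightarrow> 'v \<Rightarrow> 'v" where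
  "opp_mode V k a n w =
     Sum_any (\<lambda>j::nat. scal V ((-1) powi k / fact j)
       (vmode V ((Lm V 1 ^^ j) a) (2 * k - int j - n - 2) w))"

definition contragredient :: "'v::ab_group_add voa_data \<Rightarrow> ('v \<Rightarrow> complex) set" where
  "contragredient V = {\<phi>.
     (\<forall>v w. \<phi> (v + w) = \<phi> v + \<phi> w) \<and> (\<forall>r v. \<phi> (scal V r v) = r * \<phi> v) \<and>
     (\<exists>N::int. \<forall>k. N < \<bar>k\<bar> \<longrightarrow> (\<forall>v\<in>wtspace V (of_int k). \<phi> v = 0))}"

definition contra_mode ::
    "'v::ab_group_add voa_data \<Rightarrow> 'v \<Rightarrow> int \<Rightarrow> ('v \<Rightarrow> complex) \<Rightarrow> 'v \<Rightarrow> complex" where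
  "contra_mode V a n \<phi> = (\<lambda>w. \<phi> (Sum_any (\<lambda>k. opp_mode V k (hcomp V a k) n w)))"

definition self_dual :: "'v::ab_group_add voa_data \<Rightarrow> bool" where
  "self_dual V \<longleftrightarrow> (\<exists>\<Phi>. bij_betw \<Phi> UNIV (contragredient V) \<and>
     (\<forall>v w. \<Phi> (v + w) = (\<lambda>x. \<Phi> v x + \<Phi> w x)) \<and>
     (\<forall>r v. \<Phi> (scal V r v) = (\<lambda>x. r * \<Phi> v x)) \<and>
     (\<forall>a n v. \<Phi> (vmode V a n v) = contra_mode V a n (\<Phi> v)))"

definition simple_voa :: "'v::ab_group_add voa_data \<Rightarrow> bool" where
  "simple_voa V \<longleftrightarrow> vac V \<noteq> 0 \<and>
     (\<forall>I. module.subspace (scal V) I \<and> (\<forall>a n. \<forall>v\<in>I. vmode V a n v \<in> I) \<longrightarrow> I = {0} \<or> I = UNIV)"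

definition strong_cft_type :: "'v::ab_group_add voa_data \<Rightarrow> bool" where
  "strong_cft_type V \<longleftrightarrow> voa V \<and>
     (\<forall>k::int. k < 0 \<longrightarrow> wtspace V (of_int k) = {0}) \<and>
     wtspace V 0 = module.span (scal V) {vac V} \<and>
     simple_voa V \<and> self_dual V"


section \<open>Zhu's square bracket vertex operator algebra\<close>

text \<open>
  \<open>Y[v,z] = Y(e^(z L(0)) v, e^z - 1)\<close>: a component \<open>v\<^sub>k\<close> of weight \<open>k\<close> contributes
  \<open>e^(k z) \<Sum>\<^sub>j v\<^sub>k(j) (e^z - 1)^(-j-1)\<close>, and \<open>v[n]\<close> is the coefficient of \<open>z^(-n-1)\<close>.
\<close>

definition sq_coeff :: "int \<Rightarrow> int \<Rightarrow> int \<Rightarrow> complex" where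
  "sq_coeff k j n =
     fls_nth (fps_to_fls (fps_exp (of_int k)) * (fps_to_fls (fps_exp 1 - 1)) powi (- j - 1)) (- n - 1)"

definition sq_mode :: "'v::ab_group_add voa_data \<Rightarrow> 'v \<Rightarrow> int \<Rightarrow> 'v \<Rightarrow> 'v" where
  "sq_mode V v n w =
     Sum_any (\<lambda>k. Sum_any (\<lambda>j. scal V (sq_coeff k j n) (vmode V (hcomp V v k) j w)))"

definition sq_conf :: "'v::ab_group_add voa_data \<Rightarrow> 'v" where
  "sq_conf V = conf V - scal V (cc V / 24) (vac V)"

definition sq_voa :: "'v::ab_group_add voa_data \<Rightarrow> 'v voa_data" where
  "sq_voa V = V\<lparr>vmode := sq_mode V, conf := sq_conf V\<rparr>"

text \<open>\<open>L[-k\<^sub>1] \<dots> L[-k\<^sub>r] \<one>\<close>\<close>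

definition vir_desc :: "'v::ab_group_add voa_data \<Rightarrow> int list \<Rightarrow> 'v" where
  "vir_desc V ks = foldr (\<lambda>k w. Lm (sq_voa V) (- k) w) ks (vac V)"


section \<open>Genus one 1-point functions\<close>

definition trace_on :: "'v::ab_group_add voa_data \<Rightarrow> 'v set \<Rightarrow> ('v \<Rightarrow> 'v) \<Rightarrow> complex" where
  "trace_on V S T =
     (let B = (SOME B. \<not> module.dependent (scal V) B \<and> module.span (scal V) B = S)
      in \<Sum>b\<in>B. module.representation (scal V) B (T b) b)"

definition zero_mode :: "'v::ab_group_add voa_data \<Rightarrow> 'v \<Rightarrow> 'v \<Rightarrow> 'v" where
  "zero_mode V v w = Sum_any (\<lambda>k. vmode V (hcomp V v k) (k - 1) w)"

text \<open>
  \<open>Z1 V v s\<close> is the coefficient of \<open>q^s\<close> in \<open>Tr (o(v) q^(L(0) - c/24))\<close>, a formal series in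
  complex powers of \<open>q\<close>: it is the trace over the \<open>L(0)\<close>-eigenspace for \<open>s + c/24\<close>.
\<close>

definition Z1 :: "'v::ab_group_add voa_data \<Rightarrow> 'v \<Rightarrow> complex \<Rightarrow> complex" where
  "Z1 V v s = trace_on V (wtspace V (s + cc V / 24)) (zero_mode V v)"


section \<open>Genus two correlation functions\<close>

text \<open>
  The sewing parameter \<open>\<epsilon>\<close> is formal (\<open>fls_X\<close>).  The bilinear form on the square bracket VOA that is
  invariant for \<open>z \<mapsto> \<epsilon>/z\<close> satisfies
  \<open>\<langle>Y[a,z]b, c\<rangle> = \<langle>b, Y[e^(z L[1]/\<epsilon>) (-\<epsilon>/z\<^sup>2)^(L[0]) a, \<epsilon>/z] c\<rangle>\<close>;
  the coefficient of \<open>z^(-n-1)\<close>, for \<open>a\<close> of \<open>L[0]\<close>-weight \<open>k\<close>, is the identity below.  Such a form is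
  unique up to a scalar, which is only required not to depend on \<open>\<epsilon>\<close>.
\<close>

definition sewing_form :: "'v::ab_group_add voa_data \<Rightarrow> ('v \<Rightarrow> 'v \<Rightarrow> complex fls) \<Rightarrow> bool" where
  "sewing_form V F \<longleftrightarrow>
     (\<forall>a b c. F (a + b) c = F a c + F b c) \<and>
     (\<forall>r a c. F (scal V r a) c = fls_const r * F a c) \<and>
     (\<forall>a b c. F a (b + c) = F a b + F a c) \<and>
     (\<forall>r a c. F a (scal V r c) = fls_const r * F a c) \<and>
     (\<forall>b. (\<forall>c. F b c = 0) \<longrightarrow> b = 0) \<and> (\<forall>c. (\<forall>b. F b c = 0) \<longrightarrow> c = 0) \<and>
     (\<forall>k. \<forall>a\<in>wtspace (sq_voa V) (of_int k). \<forall>b c n.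
        F (sq_mode V a n b) c = fls_X_intpow (n + 1 - k) * F b (opp_mode (sq_voa V) k a n c)) \<and>
     (\<exists>r. F (vac V) (vac V) = fls_const r)"

definition graded_basis :: "'v::ab_group_add voa_data \<Rightarrow> (int \<Rightarrow> 'v set) \<Rightarrow> bool" where
  "graded_basis V B \<longleftrightarrow> (\<forall>k. \<not> module.dependent (scal V) (B k) \<and>
     module.span (scal V) (B k) = wtspace (sq_voa V) (of_int k))"

text \<open>
  On the weight \<open>k\<close> space of \<open>L[0]\<close> the form is \<open>\<epsilon>^(-k)\<close> times a complex valued form, so the dual of a
  basis vector \<open>u\<close> of weight \<open>k\<close> is \<open>\<epsilon>^k\<close> times a vector of \<open>V\<close>; \<open>dual_vec\<close> is that vector.
\<close>

definition dual_vec ::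
    "'v::ab_group_add voa_data \<Rightarrow> ('v \<Rightarrow> 'v \<Rightarrow> complex fls) \<Rightarrow> (int \<Rightarrow> 'v set) \<Rightarrow> int \<Rightarrow> 'v \<Rightarrow> 'v" where
  "dual_vec V F B k u = (THE w. w \<in> wtspace (sq_voa V) (of_int k) \<and>
     (\<forall>u'\<in>B k. fls_X_intpow k * F u' w = (if u' = u then 1 else 0)))"

text \<open>
  A formal series in variables indexed by \<open>'i\<close> is given by its coefficients as a function of the
  exponents.
\<close>

type_synonym 'i fseries = "('i \<Rightarrow> int) \<Rightarrow> complex"

definition series_in :: "'i set \<Rightarrow> 'i fseries \<Rightarrow> bool" where
  "series_in I f \<longleftrightarrow> (\<forall>e. f e \<noteq> 0 \<longrightarrow> (\<forall>v. v \<notin> I \<longrightarrow> e v = 0))"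

text \<open>
  \<open>Z2 V F B as bs s1 s2 k e\<close> is the coefficient of \<open>q\<^sub>1^s1 q\<^sub>2^s2 \<epsilon>^k\<close> and of the monomial with
  exponents \<open>e\<close> in the insertion points, in the correlation function of \<open>as\<close> on the left and \<open>bs\<close> on
  the right.  The insertion points are numbered consecutively from 0, left ones first.
\<close>

definition Z2 ::
    "'v::ab_group_add voa_data \<Rightarrow> ('v \<Rightarrow> 'v \<Rightarrow> complex fls) \<Rightarrow> (int \<Rightarrow> 'v set) \<Rightarrow> 'v list \<Rightarrow> 'v list \<Rightarrow>
     complex \<Rightarrow> complex \<Rightarrow> int \<Rightarrow> nat fseries" where
  "Z2 V F B as bs s1 s2 k e =
     (if \<forall>v\<ge>length as + length bs. e v = 0 then
        (\<Sum>u\<in>B k.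
           Z1 V (foldr (\<lambda>i w. sq_mode V (as ! i) (- e i - 1) w) [0..<length as] u) s1 *
           Z1 V (fold (\<lambda>j w. sq_mode V (bs ! j) (- e (length as + j) - 1) w) [0..<length bs]
                   (dual_vec V F B k u)) s2)
      else 0)"

definition vir_G ::
    "'v::ab_group_add voa_data \<Rightarrow> ('v \<Rightarrow> 'v \<Rightarrow> complex fls) \<Rightarrow> (int \<Rightarrow> 'v set) \<Rightarrow> nat \<Rightarrow>
     complex \<Rightarrow> complex \<Rightarrow> int \<Rightarrow> nat fseries" where
  "vir_G V F B m = Z2 V F B (replicate m (sq_conf V)) []"

text \<open>
  Rewriting the differential \<open>g(z) dz\<^sub>0\<^sup>2 \<dots> dz\<^sub>m\<^sub>-\<^sub>1\<^sup>2\<close> in terms of \<open>w\<^sub>v = \<epsilon>/z\<^sub>v\<close> for \<open>l \<le> v < m\<close>: as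
  \<open>dz\<^sup>2 = \<epsilon>\<^sup>2 w^(-4) dw\<^sup>2\<close>, the monomial \<open>\<epsilon>^k z^a\<close> becomes \<open>\<epsilon>^(k+a+2) w^(-4-a)\<close>.
\<close>

definition move_right ::
    "nat \<Rightarrow> nat \<Rightarrow> (int \<Rightarrow> nat fseries) \<Rightarrow> int \<Rightarrow> nat fseries" where
  "move_right l m g k e =
     g (k + (\<Sum>v\<in>{l..<m}. e v + 2)) (\<lambda>v. if l \<le> v \<and> v < m then - 4 - e v else e v)"


section \<open>Formal functions with poles on the diagonals and their expansions\<close>

text \<open>A list \<open>[(c\<^sub>1,v\<^sub>1),\<dots>]\<close> stands for the linear form \<open>c\<^sub>1 v\<^sub>1 + \<dots>\<close> in the variables.\<close>

definition mul_lin :: "(complex \<times> 'i) list \<Rightarrow> 'i fseries \<Rightarrow> 'i fseries" where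
  "mul_lin p f = (\<lambda>e. \<Sum>(c, v)\<leftarrow>p. c * f (e(v := e v - 1)))"

definition mul_lins :: "(complex \<times> 'i) list list \<Rightarrow> 'i fseries \<Rightarrow> 'i fseries" where
  "mul_lins ps f = foldr mul_lin ps f"

text \<open>
  \<open>iterated_laurent [v\<^sub>1,\<dots>,v\<^sub>n] f\<close>: membership in \<open>\<complex>((v\<^sub>1))\<dots>((v\<^sub>n))\<close>, the space of expansions in
  the domain \<open>|v\<^sub>1| > \<dots> > |v\<^sub>n|\<close>.  The auxiliary predicate takes the variables in the opposite order.
\<close>

fun iterated_laurent_rev :: "'i list \<Rightarrow> 'i fseries \<Rightarrow> bool" where
  "iterated_laurent_rev [] f = True"
| "iterated_laurent_rev (v # vs) f =
     ((\<exists>N. \<forall>e. f e \<noteq> 0 \<longrightarrow> N \<le> e v) \<and>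
      (\<forall>n. iterated_laurent_rev vs (\<lambda>e. if e v = n then f e else 0)))"

definition iterated_laurent :: "'i list \<Rightarrow> 'i fseries \<Rightarrow> bool" where
  "iterated_laurent vs f \<longleftrightarrow> series_in (set vs) f \<and> iterated_laurent_rev (rev vs) f"

text \<open>
  The points \<open>0,\<dots>,m-1\<close> comprise \<open>l\<close> left points followed by right points, the coordinate of \<open>v\<close>
  being the linear form \<open>X v\<close>.  A formal function is \<open>f / D\<^sub>N\<close> with \<open>f\<close> a formal power series and
  \<open>D\<^sub>N = \<Prod> X\<^sub>v^N \<Prod> (X\<^sub>v - X\<^sub>w)^(2N)\<close>, the second product over pairs \<open>v < w\<close> on the same
  side (coordinates on different sides never coincide, \<open>\<epsilon>\<close> being formal).  As \<open>D\<^sub>N\<close> is symmetric on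
  each side, the function is symmetric iff \<open>f\<close> is.
\<close>

definition pole_forms ::
    "(nat \<Rightarrow> (complex \<times> 'i) list) \<Rightarrow> nat \<Rightarrow> nat \<Rightarrow> nat \<Rightarrow> (complex \<times> 'i) list list" where
  "pole_forms X l m N =
     concat [replicate N (X v). v \<leftarrow> [0..<m]] @
     concat [replicate (2 * N) (X v @ map (\<lambda>(c, i). (- c, i)) (X w)).
               v \<leftarrow> [0..<m], w \<leftarrow> [0..<m], v < w \<and> (w < l \<or> l \<le> v)]"

definition power_series :: "nat \<Rightarrow> nat fseries \<Rightarrow> bool" where
  "power_series m f \<longleftrightarrow> series_in {..<m} f \<and> (\<forall>e. f e \<noteq> 0 \<longrightarrow> (\<forall>v. 0 \<le> e v))"

text \<open>
  \<open>A\<close> is the expansion of \<open>f / D\<^sub>N\<close> in the domain of the operator product defining \<open>Z2\<close>: moduli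
  decrease from left to right on the left and increase on the right.
\<close>

definition represents :: "nat \<Rightarrow> nat \<Rightarrow> nat \<Rightarrow> nat fseries \<Rightarrow> nat fseries \<Rightarrow> bool" where
  "represents l m N f A \<longleftrightarrow>
     power_series m f \<and> iterated_laurent ([0..<l] @ rev [l..<m]) A \<and>
     mul_lins (pole_forms (\<lambda>v. [(1, v)]) l m N) A = f"

definition symmetric_series :: "nat \<Rightarrow> nat fseries \<Rightarrow> bool" where
  "symmetric_series m f \<longleftrightarrow> (\<forall>p. p permutes {..<m} \<longrightarrow> (\<forall>e. f (e \<circ> p) = f e))"

definition symmetric_function :: "nat \<Rightarrow> nat fseries \<Rightarrow> bool" where
  "symmetric_function m A \<longleftrightarrow> (\<exists>N f. represents m m N f A \<and> symmetric_series m f)"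

text \<open>
  Points in clusters: the point \<open>v\<close>, in cluster \<open>c\<close>, has coordinate \<open>Base c + Local v\<close>, where
  \<open>Base c\<close> is the position of the cluster and \<open>Local v\<close> is small.
\<close>

datatype cvar = Base nat | Local nat

definition cluster_of :: "nat list \<Rightarrow> nat \<Rightarrow> nat" where
  "cluster_of sizes v = concat (map (\<lambda>c. replicate (sizes ! c) c) [0..<length sizes]) ! v"

text \<open>
  The power series \<open>f(Base (cl 0) + Local 0, Base (cl 1) + Local 1, \<dots>)\<close>, by the binomial theorem.
\<close>

definition cluster_subst :: "nat \<Rightarrow> (nat \<Rightarrow> nat) \<Rightarrow> nat fseries \<Rightarrow> cvar fseries" where
  "cluster_subst m cl f h =
     (if \<forall>v\<ge>m. h (Local v) = 0 then
        (\<Sum>e\<in>{e. (\<forall>v\<ge>m. e v = 0) \<and> (\<forall>v<m. 0 \<le> h (Local v) \<and> h (Local v) \<le> e v) \<and>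
                 (\<forall>c. (\<Sum>v | v < m \<and> cl v = c. e v - h (Local v)) = h (Base c))}.
           f e * (\<Prod>v<m. of_nat (nat (e v) choose nat (h (Local v)))))
      else 0)"

text \<open>
  \<open>cluster_expansion rs ss A H\<close>: \<open>A\<close> is the expansion of a formal function of left points, grouped in
  clusters of sizes \<open>rs\<close>, and right points, grouped in clusters of sizes \<open>ss\<close>; \<open>H\<close> is the expansion
  of the same function in the domain where the positions of the clusters are ordered as in \<open>Z2\<close>, the
  local coordinates are small compared to them, and their moduli decrease within each cluster.
\<close>

definition cluster_expansion :: "nat list \<Rightarrow> nat list \<Rightarrow> nat fseries \<Rightarrow> cvar fseries \<Rightarrow> bool" where
  "cluster_expansion rs ss A H \<longleftrightarrow>
     (let l = sum_list rs; m = l + sum_list ss; L = length rs; n = L + length ss;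
          cl = cluster_of (rs @ ss)
      in iterated_laurent (map Base ([0..<L] @ rev [L..<n]) @ map Local [0..<m]) H \<and>
         (\<exists>N f. represents l m N f A \<and>
            mul_lins (pole_forms (\<lambda>v. [(1, Base (cl v)), (1, Local v)]) l m N) H =
              cluster_subst m cl f))"

text \<open>
  As \<open>Y[\<omega>,t] = \<Sum> L[-k] t^(k-2)\<close>, the descendants given by the lists \<open>kss\<close> correspond to the
  exponents \<open>k - 2\<close> of the local coordinates; \<open>p\<close> gives the exponents of the positions.
\<close>

definition desc_exponents :: "int list list \<Rightarrow> (nat \<Rightarrow> int) \<Rightarrow> cvar \<Rightarrow> int" where
  "desc_exponents kss p x = (case x of
       Base c \<Rightarrow> p c
     | Local v \<Rightarrow> if v < length (concat kss) then concat kss ! v - 2 else 0)"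

definition generates_descendants ::
    "'v::ab_group_add voa_data \<Rightarrow> ('v \<Rightarrow> 'v \<Rightarrow> complex fls) \<Rightarrow> (int \<Rightarrow> 'v set) \<Rightarrow>
     (nat \<Rightarrow> complex \<Rightarrow> complex \<Rightarrow> int \<Rightarrow> nat fseries) \<Rightarrow> bool" where
  "generates_descendants V F B g \<longleftrightarrow>
     (\<forall>rs ss s1 s2 k.
        let l = sum_list rs; m = l + sum_list ss; A = move_right l m (g m s1 s2) k
        in (\<exists>!H. cluster_expansion rs ss A H) \<and>
           (\<forall>H kss lss p.
              cluster_expansion rs ss A H \<and> map length kss = rs \<and> map length lss = ss \<and>
              (\<forall>ks\<in>set (kss @ lss). \<forall>j\<in>set ks. 2 \<le> j) \<longrightarrow>
              Z2 V F B (map (vir_desc V) kss) (map (vir_desc V) lss) s1 s2 k p =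
                H (desc_exponents (kss @ lss) p)))"

end

theory Submission imports Defs
begin

text \<open>
  In terms of the test functions \<open>ln(1+w)^n (1+w)^(k-1)\<close> the square bracket modes are residues of
  ordinary vertex operators.  Hence they satisfy the associativity identity, and those of the Virasoro
  vector satisfy the Virasoro relations.  The pole of order four in the commutator of two Virasoro
  fields is killed by \<open>(z-x)^4\<close>, so after multiplication by the denominator the operators may be put in
  any order; the rightmost one then bounds the exponents of its variable below, and the product is a
  symmetric power series.  Invariance of the sewing form moves an insertion to the other torus.

  To reach descendants the points are moved into clusters one at a time.  By associativity the series
  with one more merged point is obtained from the two orderings \<open>P\<close>, \<open>P'\<close> of the unmerged point and the
  cluster as a difference \<open>assoc1 P - assoc2 P'\<close>.  Both operators commute with multiplication by the
  denominator, after which \<open>P\<close> and \<open>P'\<close> are the same power series; there \<open>assoc2\<close> vanishes, and \<open>assoc1\<close>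
  is the Taylor substitution.  Uniqueness holds because multiplication by a nonzero linear form is
  injective on iterated Laurent series.
\<close>

section \<open>Formal series in several variables: multiplication by and cancellation of linear
  forms\<close>

section \<open>Multiplication by linear forms\<close>

text \<open>Everything is formal, so there is no analytic continuation between expansions in
  different domains; two expansions are compared only through the numerators left after clearing
  denominators. The power \<open>N\<close> in the denominator is dictated by the order
  \<open>k\<close> in \<epsilon>: on a vector of L[0]-weight \<open>k\<close> a Virasoro field has a
  pole of order at most \<open>k + 2\<close>, and differences need the fourth power, hence
  \<open>N = max 2 (nat (k + 2))\<close>. This bound and the dual bases rest on L[0] being
  diagonalizable with finite dimensional eigenspaces of nonnegative weight. That is inherited from
  L(0), because L[0] - L(0) strictly lowers L(0)-weights.

  The identities for square bracket modes come from two explicit computations. Associativity reduces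
  to the two expansions of \<open>(ln(1+z) - ln(1+x))^l (1+z)^(k-1)\<close>. The Virasoro relations
  reduce to the bracket of the vector fields \<open>z^n d/dz\<close> in the coordinate
  \<open>w = e^z - 1\<close>, and the shift by c/24 in \<open>sq_conf\<close> absorbs the Schwarzian
  derivative of this change of coordinates.\<close>

lemma mul_lin_Nil [simp]: "mul_lin [] f = (\<lambda>e. 0)"
  by (simp add: mul_lin_def)

lemma mul_lin_Cons: "mul_lin ((c, v) # p) f e = c * f (e(v := e v - 1)) + mul_lin p f e"
  by (simp add: mul_lin_def)

lemma mul_lin_append: "mul_lin (p @ q) f e = mul_lin p f e + mul_lin q f e"
  by (simp add: mul_lin_def)

lemma mul_lin_lincomb:
  "mul_lin p (\<lambda>e. a * f e + b * g e) e = a * mul_lin p f e + b * mul_lin p g e"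
  by (induction p) (auto simp: mul_lin_Cons algebra_simps)

lemma mul_lin_zero [simp]: "mul_lin p (\<lambda>e. 0) = (\<lambda>e. 0)"
  by (rule ext, induction p) (auto simp: mul_lin_Cons)

lemma mul_lin_scale: "mul_lin p (\<lambda>e. a * f e) e = a * mul_lin p f e"
  using mul_lin_lincomb[of p a f 0 f e] by simp

lemma mul_lin_shift: "mul_lin q f (e(v := e v - 1)) = mul_lin q (\<lambda>e. f (e(v := e v - 1))) e"
proof (induction q)
  case (Cons a q)
  obtain c w where a: "a = (c, w)" by (cases a)
  have "f ((e(v := e v - 1))(w := (e(v := e v - 1)) w - 1)) = f ((e(w := e w - 1))(v := (e(w := e w - 1)) v - 1))"
    by (rule arg_cong[of _ _ f]) (auto simp: fun_eq_iff)
  then show ?case unfolding a mul_lin_Cons Cons.IH by (simp only:)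
qed simp

lemma mul_lin_commute: "mul_lin p (mul_lin q f) = mul_lin q (mul_lin p f)"
proof (rule ext)
  fix e show "mul_lin p (mul_lin q f) e = mul_lin q (mul_lin p f) e"
  proof (induction p)
    case (Cons a p)
    obtain c w where a: "a = (c, w)" by (cases a)
    have "mul_lin (a # p) f = (\<lambda>e. c * f (e(w := e w - 1)) + 1 * mul_lin p f e)"
      using a by (auto simp: mul_lin_Cons)
    then have "mul_lin q (mul_lin (a # p) f) e = c * mul_lin q (\<lambda>e. f (e(w := e w - 1))) e + mul_lin q (mul_lin p f) e"
      by (simp add: mul_lin_lincomb del: mult_1)
    then show ?case unfolding a mul_lin_Cons[of c w p "mul_lin q f" e] mul_lin_shift Cons.IH by simp
  qed simp
qed

abbreviation neg :: "(complex \<times> 'i) list \<Rightarrow> (complex \<times> 'i) list" where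
  "neg p \<equiv> map (\<lambda>(c, i). (- c, i)) p"

lemma mul_lin_neg: "mul_lin (neg p) f e = - mul_lin p f e"
  by (induction p) (auto simp: mul_lin_Cons)

lemma mul_lins_Nil [simp]: "mul_lins [] f = f"
  by (simp add: mul_lins_def)

lemma mul_lins_Cons [simp]: "mul_lins (p # ps) f = mul_lin p (mul_lins ps f)"
  by (simp add: mul_lins_def)

lemma mul_lins_append: "mul_lins (ps @ qs) f = mul_lins ps (mul_lins qs f)"
  by (simp add: mul_lins_def)

lemma mul_lins_lincomb:
  "mul_lins ps (\<lambda>e. a * f e + b * g e) = (\<lambda>e. a * mul_lins ps f e + b * mul_lins ps g e)"
  by (induction ps) (auto simp: mul_lin_lincomb)

lemma mul_lins_zero [simp]: "mul_lins ps (\<lambda>e. 0) = (\<lambda>e. 0)"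
  by (induction ps) auto

lemma mul_lins_scale: "mul_lins ps (\<lambda>e. a * f e) = (\<lambda>e. a * mul_lins ps f e)"
  using mul_lins_lincomb[of ps a f 0 f] by simp

lemma mul_lins_diff: "mul_lins ps (\<lambda>e. f e - g e) = (\<lambda>e. mul_lins ps f e - mul_lins ps g e)"
  using mul_lins_lincomb[of ps 1 f "-1" g] by simp

lemma mul_lin_mul_lins: "mul_lin p (mul_lins ps f) = mul_lins ps (mul_lin p f)"
  by (induction ps) (auto simp: mul_lin_commute)

lemma mul_lins_commute: "mul_lins ps (mul_lins qs f) = mul_lins qs (mul_lins ps f)"
  by (induction ps) (auto simp: mul_lin_mul_lins)

text \<open>Since multiplications by linear forms commute, only the multiset of forms matters. This
  allows any factors to be split off a denominator.\<close>

interpretation mul_lin: comp_fun_commute mul_lin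
  by unfold_locales (auto simp: fun_eq_iff mul_lin_commute)

lemma mul_lins_fold_mset: "mul_lins ps f = fold_mset mul_lin f (mset ps)"
  by (induction ps) auto

lemma mul_lins_mset_cong: "mset ps = mset qs \<Longrightarrow> mul_lins ps f = mul_lins qs f"
  by (simp add: mul_lins_fold_mset)

lemma mul_lins_sub_mset:
  assumes "mset qs \<subseteq># mset ps"
  obtains rs where "mset ps = mset (rs @ qs)" "set rs \<subseteq> set ps"
proof -
  obtain rs where rs: "mset rs = mset ps - mset qs" by (metis ex_mset)
  have "mset ps = mset (rs @ qs)" using assms rs by simp
  moreover have "set rs \<subseteq> set ps" by (metis rs diff_subset_eq_self mset_subset_eqD set_mset_mset subsetI)
  ultimately show ?thesis using that by blast
qed

section \<open>Lower bounds for exponents\<close>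

text \<open>A linear form only raises exponents, so a lower bound in one variable survives every
  multiplication.\<close>

lemma mul_lin_ge:
  assumes "\<And>e. f e \<noteq> 0 \<Longrightarrow> K \<le> e v" "mul_lin p f e \<noteq> 0"
  shows "K \<le> e v"
  using assms(2)
proof (induction p)
  case (Cons a p)
  obtain c w where a: "a = (c, w)" by (cases a)
  show ?case
  proof (cases "f (e(w := e w - 1)) = 0")
    case True then show ?thesis using Cons a by (simp add: mul_lin_Cons)
  next
    case False from assms(1)[OF this] show ?thesis by (auto split: if_splits)
  qed
qed simp

lemma mul_lins_ge:
  assumes "\<And>e. f e \<noteq> 0 \<Longrightarrow> K \<le> e v" "mul_lins ps f e \<noteq> 0"
  shows "K \<le> e v"
  using assms(2)
proof (induction ps arbitrary: e)
  case (Cons p ps)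
  then show ?case using mul_lin_ge[of "mul_lins ps f" K v p e] by auto
qed (use assms in auto)

lemma mul_lins_replicate_ge:
  assumes "\<And>e. f e \<noteq> 0 \<Longrightarrow> K \<le> e v" "mul_lins (replicate N [(1, v)]) f e \<noteq> 0"
  shows "K + int N \<le> e v"
  using assms(2)
proof (induction N arbitrary: e)
  case (Suc N)
  have "mul_lins (replicate N [(1, v)]) f (e(v := e v - 1)) \<noteq> 0"
    using Suc.prems by (simp add: mul_lin_Cons)
  from Suc.IH[OF this] show ?case by simp
qed (use assms in auto)

lemma mul_lin_series_in:
  assumes "series_in I f" "snd ` set p \<subseteq> I"
  shows "series_in I (mul_lin p f)"
proof -
  have "\<forall>v. v \<notin> I \<longrightarrow> e v = 0" if "mul_lin p f e \<noteq> 0" for e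
    using that assms(2)
  proof (induction p)
    case (Cons a p)
    obtain c w where a: "a = (c, w)" by (cases a)
    show ?case
    proof (cases "f (e(w := e w - 1)) = 0")
      case True then show ?thesis using Cons a by (simp add: mul_lin_Cons)
    next
      case False
      then have *: "\<And>v. v \<notin> I \<Longrightarrow> (e(w := e w - 1)) v = 0" using assms(1) unfolding series_in_def by blast
      have "w \<in> I" using Cons.prems a by auto
      then show ?thesis using * by (metis fun_upd_other)
    qed
  qed simp
  then show ?thesis by (auto simp: series_in_def)
qed

lemma mul_lins_series_in:
  assumes "series_in I f" "\<And>p. p \<in> set ps \<Longrightarrow> snd ` set p \<subseteq> I"
  shows "series_in I (mul_lins ps f)"
  using assms(2) by (induction ps) (auto intro!: mul_lin_series_in assms(1))

lemma mul_lins_power_series: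
  assumes "power_series m f" "\<And>p. p \<in> set ps \<Longrightarrow> snd ` set p \<subseteq> {..<m}"
  shows "power_series m (mul_lins ps f)"
  using mul_lins_series_in[of "{..<m}" f ps] mul_lins_ge[of f 0 _ ps] assms
  unfolding power_series_def by blast

section \<open>Iterated Laurent series\<close>

lemma iterated_laurent_rev_lincomb:
  "iterated_laurent_rev vs f \<Longrightarrow> iterated_laurent_rev vs g \<Longrightarrow>
   iterated_laurent_rev vs (\<lambda>e. a * f e + b * g e)"
proof (induction vs arbitrary: f g)
  case (Cons v vs)
  obtain N1 N2 where N: "\<forall>e. f e \<noteq> 0 \<longrightarrow> N1 \<le> e v" "\<forall>e. g e \<noteq> 0 \<longrightarrow> N2 \<le> e v"
    using Cons.prems by auto
  have "\<forall>e. a * f e + b * g e \<noteq> 0 \<longrightarrow> min N1 N2 \<le> e v"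
  proof (intro allI impI)
    fix e assume "a * f e + b * g e \<noteq> 0"
    then have "f e \<noteq> 0 \<or> g e \<noteq> 0" by auto
    then show "min N1 N2 \<le> e v" using N by (meson min.coboundedI1 min.coboundedI2)
  qed
  moreover have "iterated_laurent_rev vs (\<lambda>e. if e v = n then a * f e + b * g e else 0)" for n
  proof -
    have "(\<lambda>e. if e v = n then a * f e + b * g e else 0) =
      (\<lambda>e. a * (if e v = n then f e else 0) + b * (if e v = n then g e else 0))" by auto
    then show ?thesis using Cons.IH[of "\<lambda>e. if e v = n then f e else 0" "\<lambda>e. if e v = n then g e else 0"] Cons.prems
      by simp
  qed
  ultimately show ?case unfolding iterated_laurent_rev.simps by blast
qed simp

lemma iterated_laurent_rev_shift:
  "iterated_laurent_rev vs f \<Longrightarrow> iterated_laurent_rev vs (\<lambda>e. f (e(w := e w - 1)))"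
proof (induction vs arbitrary: f)
  case (Cons v vs)
  obtain N where N: "\<forall>e. f e \<noteq> 0 \<longrightarrow> N \<le> e v" using Cons.prems by auto
  have "\<forall>e. f (e(w := e w - 1)) \<noteq> 0 \<longrightarrow> N \<le> e v"
  proof (intro allI impI)
    fix e assume "f (e(w := e w - 1)) \<noteq> 0"
    then have "N \<le> (e(w := e w - 1)) v" using N by blast
    then show "N \<le> e v" by (auto split: if_splits)
  qed
  moreover have "iterated_laurent_rev vs (\<lambda>e. if e v = n then f (e(w := e w - 1)) else 0)" for n
  proof -
    define n' where "n' = (if w = v then n - 1 else n)"
    have "(\<lambda>e. if e v = n then f (e(w := e w - 1)) else 0) =
      (\<lambda>e. (\<lambda>e. if e v = n' then f e else 0) (e(w := e w - 1)))"
      by (auto simp: n'_def fun_eq_iff)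
    then show ?thesis using Cons.IH[of "\<lambda>e. if e v = n' then f e else 0"] Cons.prems by simp
  qed
  ultimately show ?case unfolding iterated_laurent_rev.simps by blast
qed simp

lemma iterated_laurent_rev_zero: "iterated_laurent_rev vs (\<lambda>e. 0)"
  by (induction vs) auto

lemma iterated_laurent_rev_mul_lin:
  assumes "iterated_laurent_rev vs f" shows "iterated_laurent_rev vs (mul_lin p f)"
proof (induction p)
  case (Cons a p)
  obtain c w where a: "a = (c, w)" by (cases a)
  have "mul_lin (a # p) f = (\<lambda>e. c * f (e(w := e w - 1)) + 1 * mul_lin p f e)"
    using a by (auto simp: mul_lin_Cons)
  then show ?case
    by (simp only: iterated_laurent_rev_lincomb[OF iterated_laurent_rev_shift[OF assms] Cons])
qed (simp add: iterated_laurent_rev_zero)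

lemma iterated_laurent_rev_mul_lins:
  "iterated_laurent_rev vs f \<Longrightarrow> iterated_laurent_rev vs (mul_lins ps f)"
  by (induction ps) (auto simp: iterated_laurent_rev_mul_lin)

lemma iterated_laurent_revI:
  assumes "\<And>xs v ys o'. vs = xs @ v # ys \<Longrightarrow> \<exists>N. \<forall>e. (\<forall>w\<in>set xs. e w = o' w) \<longrightarrow> f e \<noteq> 0 \<longrightarrow> N \<le> e v"
  shows "iterated_laurent_rev vs f"
  using assms
proof (induction vs arbitrary: f)
  case (Cons v vs)
  have 1: "\<exists>N. \<forall>e. f e \<noteq> 0 \<longrightarrow> N \<le> e v" using Cons.prems[of "[]" v vs] by auto
  have "iterated_laurent_rev vs (\<lambda>e. if e v = n then f e else 0)" for n
  proof (rule Cons.IH)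
    fix xs y ys o' assume "vs = xs @ y # ys"
    from Cons.prems[of "v # xs" y ys "o'(v := n)"] this obtain N where
      N: "\<forall>e. (\<forall>w\<in>set (v # xs). e w = (o'(v := n)) w) \<longrightarrow> f e \<noteq> 0 \<longrightarrow> N \<le> e y" by auto
    show "\<exists>N. \<forall>e. (\<forall>w\<in>set xs. e w = o' w) \<longrightarrow> (if e v = n then f e else 0) \<noteq> 0 \<longrightarrow> N \<le> e y"
      by (rule exI[of _ N]) (use N in \<open>auto split: if_splits\<close>)
  qed
  then show ?case using 1 by simp
qed simp

text \<open>A variable may occur repeatedly in a list, as \<open>Base c\<close> does with
  coefficients 1 and -1 in the difference of two points of one cluster. The total coefficient
  decides whether the form is zero.\<close>

definition coef :: "(complex \<times> 'i) list \<Rightarrow> 'i \<Rightarrow> complex" where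
  "coef p v = (\<Sum>(c, w)\<leftarrow>p. if w = v then c else 0)"

lemma coef_Cons: "coef ((c, w) # p) v = (if w = v then c else 0) + coef p v"
  by (simp add: coef_def)

lemma mul_lin_coef:
  assumes "finite A" "snd ` set p \<subseteq> A"
  shows "mul_lin p f e = (\<Sum>v\<in>A. coef p v * f (e(v := e v - 1)))"
  using assms(2)
proof (induction p)
  case (Cons a p)
  obtain c w where a: "a = (c, w)" by (cases a)
  have "(\<Sum>v\<in>A. coef (a # p) v * f (e(v := e v - 1))) =
    (\<Sum>v\<in>A. (if v = w then c * f (e(w := e w - 1)) else 0) + coef p v * f (e(v := e v - 1)))"
    by (rule sum.cong) (auto simp: a coef_Cons algebra_simps)
  also have "\<dots> = c * f (e(w := e w - 1)) + (\<Sum>v\<in>A. coef p v * f (e(v := e v - 1)))"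
    using Cons.prems a assms(1) by (simp add: sum.distrib)
  also have "(\<Sum>v\<in>A. coef p v * f (e(v := e v - 1))) = mul_lin p f e" by (rule Cons.IH[symmetric]) (use Cons.prems in auto)
  finally show ?case unfolding a mul_lin_Cons by (rule sym)
qed (simp add: coef_def)

text \<open>The lowest coefficient with respect to the smallest variable of a product with a linear
  form is, up to a constant, the product of the lowest coefficients.\<close>

lemma mul_lin_eq_0:
  assumes "iterated_laurent_rev vs f" "snd ` set p \<subseteq> set vs" "\<exists>v. coef p v \<noteq> 0"
    "mul_lin p f = (\<lambda>e. 0)"
  shows "f = (\<lambda>e. 0)"
  using assms
proof (induction vs arbitrary: f p)
  case Nil then show ?case by (auto simp: coef_def)
next
  case (Cons v vs)
  \<comment> \<open>The head \<open>v\<close> is the smallest variable; \<open>q\<close> is the part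
    of the form in the larger ones.\<close>
  define q where "q = filter (\<lambda>a. snd a \<noteq> v) p"
  have q: "snd ` set q \<subseteq> set vs - {v}" using Cons.prems(2) by (auto simp: q_def)
  have cq: "coef q w = (if w = v then 0 else coef p w)" for w
    unfolding q_def by (induction p) (auto simp: coef_Cons coef_def)
  have mp: "mul_lin p f e = coef p v * f (e(v := e v - 1)) + mul_lin q f e" for e
    unfolding q_def
  proof (induction p)
    case (Cons a p)
    obtain c w where a: "a = (c, w)" by (cases a)
    show ?case
      by (cases "w = v") (simp_all add: a coef_Cons mul_lin_Cons Cons.IH algebra_simps del: fun_upd_apply)
  qed (simp add: coef_def)
  show ?case
  proof (cases "\<exists>w. coef q w \<noteq> 0")
    case False
    \<comment> \<open>If only \<open>v\<close> occurs, the multiplication is a shift times a nonzero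
      constant.\<close>
    then have "coef q w = 0" for w by auto
    then have "mul_lin q f e = 0" for e using mul_lin_coef[OF _ q, of f e] by simp
    moreover have "coef p v \<noteq> 0" using False Cons.prems(3) cq by (metis (full_types))
    ultimately have "f (e(v := e v - 1)) = 0" for e
      using mp[of e] Cons.prems(4) by (simp add: fun_eq_iff)
    from this[of "e(v := e v + 1)" for e] show ?thesis by (simp add: fun_eq_iff)
  next
    case True
    show ?thesis
    proof (rule ccontr)
      assume "f \<noteq> (\<lambda>e. 0)"
      then obtain e0 where e0: "f e0 \<noteq> 0" by auto
      obtain N where N: "\<forall>e. f e \<noteq> 0 \<longrightarrow> N \<le> e v" using Cons.prems(1) by auto
      define P where "P k \<longleftrightarrow> (\<exists>e. f e \<noteq> 0 \<and> e v = N + int k)" for k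
      have "P (nat (e0 v - N))" unfolding P_def using N e0 by (intro exI[of _ e0]) auto
      then have L: "P (Least P)" "\<And>k. k < Least P \<Longrightarrow> \<not> P k" by (rule LeastI) (rule not_less_Least)
      define K where "K = N + int (Least P)"
      have K: "K \<le> e v" if "f e \<noteq> 0" for e
      proof (rule ccontr)
        assume "\<not> K \<le> e v"
        moreover have "N \<le> e v" using N that by auto
        ultimately have "nat (e v - N) < Least P" "P (nat (e v - N))"
          using that by (auto simp: K_def P_def intro!: exI[of _ e])
        then show False using L by blast
      qed
      define g where "g = (\<lambda>e. if e v = K then f e else 0)"
      have "mul_lin q g e = (if e v = K then mul_lin q f e else 0)" for e
        using q by (induction q) (auto simp: mul_lin_Cons g_def)
      \<comment> \<open>On the slice \<open>e v = K\<close> the term of the form in \<open>v\<close>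
        reads \<open>f\<close> at exponent \<open>K - 1\<close>, below its minimum, so only
        \<open>q\<close> acts there.\<close>
      moreover have "mul_lin q f e = 0" if "e v = K" for e
      proof -
        have "f (e(v := e v - 1)) = 0" using K[of "e(v := e v - 1)"] that by auto
        then show ?thesis using mp[of e] Cons.prems(4) by simp
      qed
      ultimately have "mul_lin q g = (\<lambda>e. 0)" by auto
      moreover have "iterated_laurent_rev vs g" using Cons.prems(1) by (simp add: g_def)
      ultimately have "g = (\<lambda>e. 0)" using Cons.IH[of g q] q True by blast
      then have "g e = 0" for e by simp
      moreover obtain e where "f e \<noteq> 0" "e v = K" using L(1) by (auto simp: P_def K_def)
      ultimately show False unfolding g_def by metis
    qed
  qed
qed

lemma mul_lins_eq_0:
  assumes "iterated_laurent_rev vs f" "\<And>p. p \<in> set ps \<Longrightarrow> snd ` set p \<subseteq> set vs \<and> (\<exists>v. coef p v \<noteq> 0)"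
    "mul_lins ps f = (\<lambda>e. 0)"
  shows "f = (\<lambda>e. 0)"
  using assms(2,3)
proof (induction ps)
  case (Cons p ps)
  have "mul_lins ps f = (\<lambda>e. 0)"
    by (rule mul_lin_eq_0[of vs _ p])
      (use Cons.prems in \<open>auto simp: iterated_laurent_rev_mul_lins[OF assms(1)]\<close>)
  then show ?case using Cons by auto
qed simp

section \<open>Borcherds' identity as an operator on series, and Taylor substitution\<close>

section \<open>Moving a point into a cluster\<close>

text \<open>This is the coefficient \<open>(-1)^i (l choose i)\<close> of Borcherds' identity for
  the mode \<open>l = - j - 1\<close> that belongs to the exponent \<open>j\<close>. For
  \<open>j \<ge> 0\<close> it is \<open>j + i choose j\<close>, the coefficient of
  \<open>t^j x^i\<close> in \<open>(x + t)^(j + i)\<close>, which makes \<open>assoc1\<close> a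
  Taylor substitution on power series.\<close>

definition derivative_coeff :: "int \<Rightarrow> nat \<Rightarrow> complex" where
  "derivative_coeff j i = (-1) ^ i * (of_int (- j - 1) gchoose i)"

lemma derivative_coeff_0 [simp]: "derivative_coeff j 0 = 1"
  by (simp add: derivative_coeff_def)

lemma derivative_coeff_Suc: "derivative_coeff j (Suc i) = derivative_coeff j i + derivative_coeff (j - 1) (Suc i)"
proof -
  have "(of_int (-j) :: complex) = of_int (-j - 1) + 1" by simp
  then have "(of_int (-j) :: complex) gchoose Suc i = (of_int (-j - 1) gchoose i) + (of_int (-j - 1) gchoose Suc i)"
    using gbinomial_Suc_Suc[of "of_int (-j - 1) :: complex" i] by simp
  then show ?thesis by (simp add: derivative_coeff_def algebra_simps)
qed

lemma derivative_coeff_nonneg: "0 \<le> j \<Longrightarrow> derivative_coeff j i = of_nat ((nat j + i) choose nat j)"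
proof -
  assume "0 \<le> j"
  then obtain n where n: "j = int n" by (metis nonneg_int_cases)
  have "(of_int (- j - 1) :: complex) = - of_nat (n + 1)" by (simp add: n)
  then have "derivative_coeff j i = (-1) ^ i * ((-1) ^ i * ((of_nat (n + 1) + of_nat i - 1) gchoose i))"
    unfolding derivative_coeff_def by (simp only: gbinomial_minus)
  also have "(of_nat (n + 1) + of_nat i - 1 :: complex) = of_nat (n + i)" by simp
  also have "(-1) ^ i * ((-1) ^ i * ((of_nat (n + i) :: complex) gchoose i)) = of_nat ((n + i) choose i)"
    unfolding binomial_gbinomial by (cases "even i") auto
  also have "(n + i) choose i = (n + i) choose n"
    using binomial_symmetric[of n "n + i"] by simp
  finally show ?thesis by (simp add: n)
qed

text \<open>Here \<open>- j - 1\<close> is a natural number below \<open>i\<close>. In terms of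
  substitution, a nonnegative power of \<open>x + t\<close> contains no negative power of
  \<open>t\<close>.\<close>

lemma derivative_coeff_neg: "j < 0 \<Longrightarrow> 0 \<le> j + int i \<Longrightarrow> derivative_coeff j i = 0"
proof -
  assume a: "j < 0" "0 \<le> j + int i"
  define n where "n = nat (- j - 1)"
  have n: "- j - 1 = int n" using a by (simp add: n_def)
  have "n < i" using a n by auto
  have "(of_int (- j - 1) :: complex) = of_nat n" unfolding n by simp
  then have "(of_int (- j - 1) :: complex) gchoose i = of_nat (n choose i)" by (simp only: binomial_gbinomial)
  then show ?thesis using \<open>n < i\<close> by (simp add: derivative_coeff_def)
qed

text \<open>With \<open>P\<close> and \<open>P'\<close> the series of \<open>Y(a,z) Y(b,x)\<close> and \<open>Y(b,x) Y(a,z)\<close>, Borcherds' identity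
  says that the series of \<open>Y(Y(a,t)b,x)\<close> is the difference of \<open>assoc1 P\<close> and \<open>assoc2 P'\<close>; the new
  variable \<open>t\<close> reuses the name \<open>z\<close>.\<close>

definition assoc1 :: "'i \<Rightarrow> 'i \<Rightarrow> 'i fseries \<Rightarrow> 'i fseries" where
  "assoc1 z x P e = Sum_any (\<lambda>i. derivative_coeff (e z) i * P (e(z := e z + int i, x := e x - int i)))"

definition assoc2 :: "'i \<Rightarrow> 'i \<Rightarrow> 'i fseries \<Rightarrow> 'i fseries" where
  "assoc2 z x P e = Sum_any (\<lambda>i. (-1) powi (- e z - 1) * derivative_coeff (e z) i *
     P (e(z := - 1 - int i, x := e x + e z + 1 + int i)))"

text \<open>\<open>assoc1\<close> and \<open>assoc2\<close> move only the exponents of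
  \<open>z\<close> and \<open>x\<close>. A lower bound along each such plane makes their sums
  finite: in \<open>y = x\<close> for the first and in \<open>y = z\<close> for the second.\<close>

definition fibre_bdd :: "'i \<Rightarrow> 'i \<Rightarrow> 'i \<Rightarrow> 'i fseries \<Rightarrow> bool" where
  "fibre_bdd z x y P \<longleftrightarrow> (\<forall>e. \<exists>N. \<forall>n q. P (e(z := n, x := q)) \<noteq> 0 \<longrightarrow> N \<le> (e(z := n, x := q)) y)"

lemma fibre_bdd_mul_lin:
  assumes "fibre_bdd z x y P" "z \<noteq> x" shows "fibre_bdd z x y (mul_lin p P)"
  unfolding fibre_bdd_def
proof
  fix e show "\<exists>N. \<forall>n q. mul_lin p P (e(z := n, x := q)) \<noteq> 0 \<longrightarrow> N \<le> (e(z := n, x := q)) y"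
  proof (induction p)
    case (Cons a p)
    have "\<exists>N. \<forall>n q. mul_lin p P (e(z := n, x := q)) \<noteq> 0 \<longrightarrow> N \<le> (e(z := n, x := q)) y"
      by (rule Cons.IH)
    then obtain N1 where N1: "\<And>n q. mul_lin p P (e(z := n, x := q)) \<noteq> 0 \<Longrightarrow> N1 \<le> (e(z := n, x := q)) y"
      by blast
    obtain c w where a: "a = (c, w)" by (cases a)
    have "\<exists>N. \<forall>n q. P ((e(w := e w - 1))(z := n, x := q)) \<noteq> 0 \<longrightarrow> N \<le> ((e(w := e w - 1))(z := n, x := q)) y"
      using assms(1) unfolding fibre_bdd_def by blast
    then obtain N2 where N2: "\<And>n q. P ((e(w := e w - 1))(z := n, x := q)) \<noteq> 0 \<Longrightarrow> N2 \<le> ((e(w := e w - 1))(z := n, x := q)) y"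
      by blast
    have N3: "min N1 N2 \<le> (e(z := n, x := q)) y"
      if "P ((e(z := n, x := q))(w := (e(z := n, x := q)) w - 1)) \<noteq> 0" for n q
    proof -
      define n' q' where "n' = (if w = z then n - 1 else n)" "q' = (if w = x then q - 1 else q)"
      have *: "(e(z := n, x := q))(w := (e(z := n, x := q)) w - 1) = (e(w := e w - 1))(z := n', x := q')"
        using assms(2) by (auto simp: fun_eq_iff n'_q'_def)
      have "N2 \<le> ((e(w := e w - 1))(z := n', x := q')) y" using N2 that * by simp
      also have "\<dots> \<le> (e(z := n, x := q)) y" using assms(2) by (auto simp: n'_q'_def)
      finally show ?thesis by simp
    qed
    show ?case
    proof (rule exI[of _ "min N1 N2"], intro allI impI)
      fix n q assume "mul_lin (a # p) P (e(z := n, x := q)) \<noteq> 0"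
      then have "P ((e(z := n, x := q))(w := (e(z := n, x := q)) w - 1)) \<noteq> 0 \<or> mul_lin p P (e(z := n, x := q)) \<noteq> 0"
        by (auto simp: a mul_lin_Cons)
      then show "min N1 N2 \<le> (e(z := n, x := q)) y" using N1[of n q] N3[of n q] by (meson min.coboundedI1)
    qed
  qed simp
qed

lemma fibre_bdd_mul_lins:
  "fibre_bdd z x y P \<Longrightarrow> z \<noteq> x \<Longrightarrow> fibre_bdd z x y (mul_lins ps P)"
  by (induction ps) (auto intro: fibre_bdd_mul_lin)

lemma Sum_any_lessThan:
  assumes "\<And>i. i \<ge> K \<Longrightarrow> f i = 0"
  shows "Sum_any f = sum f {..<(K::nat)}"
  by (rule Sum_any.expand_superset) (use assms in \<open>auto simp: not_less[symmetric]\<close>)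

text \<open>The cut-off is stated for every \<open>L\<close> from some \<open>K\<close> on, so that
  several such sums can be taken over a common range.\<close>

lemma assoc1_lessThan:
  assumes "fibre_bdd z x x P" "z \<noteq> x"
  obtains K where "\<And>L. K \<le> L \<Longrightarrow>
    assoc1 z x P e = (\<Sum>i<L. derivative_coeff (e z) i * P (e(z := e z + int i, x := e x - int i)))"
    "\<And>i. K \<le> i \<Longrightarrow> P (e(z := e z + int i, x := e x - int i)) = 0"
proof -
  obtain N where N: "\<And>n q. P (e(z := n, x := q)) \<noteq> 0 \<Longrightarrow> N \<le> q"
    using assms by (fastforce simp: fibre_bdd_def)
  define K where "K = nat (e x - N + 1)"
  have K: "P (e(z := e z + int i, x := e x - int i)) = 0" if "K \<le> i" for i
  proof (rule ccontr)
    assume "P (e(z := e z + int i, x := e x - int i)) \<noteq> 0"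
    from N[OF this] that show False by (simp add: K_def)
  qed
  show ?thesis
    by (rule that[of K]) (auto simp: assoc1_def K intro!: Sum_any_lessThan)
qed

lemma assoc2_lessThan:
  assumes "fibre_bdd z x z P" "z \<noteq> x"
  obtains K where "\<And>L. K \<le> L \<Longrightarrow>
    assoc2 z x P e = (\<Sum>i<L. (-1) powi (- e z - 1) * derivative_coeff (e z) i * P (e(z := - 1 - int i, x := e x + e z + 1 + int i)))"
    "\<And>i. K \<le> i \<Longrightarrow> P (e(z := - 1 - int i, x := e x + e z + 1 + int i)) = 0"
proof -
  obtain N where N: "\<And>n q. P (e(z := n, x := q)) \<noteq> 0 \<Longrightarrow> N \<le> n"
    using assms by (fastforce simp: fibre_bdd_def)
  define K where "K = nat (- N)"
  have K: "P (e(z := - 1 - int i, x := e x + e z + 1 + int i)) = 0" if "K \<le> i" for i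
  proof (rule ccontr)
    assume "P (e(z := - 1 - int i, x := e x + e z + 1 + int i)) \<noteq> 0"
    then have "P (e(z := - 1 - int i, x := e x + e z + 1 + int i)) \<noteq> 0" by simp
    from N[OF this] that show False by (simp add: K_def)
  qed
  show ?thesis
    by (rule that[of K]) (auto simp: assoc2_def K intro!: Sum_any_lessThan)
qed

lemma assoc1_lincomb:
  assumes "fibre_bdd z x x P" "fibre_bdd z x x Q" "z \<noteq> x"
  shows "assoc1 z x (\<lambda>e. a * P e + b * Q e) e = a * assoc1 z x P e + b * assoc1 z x Q e"
proof -
  obtain K1 where K1: "\<And>L. K1 \<le> L \<Longrightarrow>
    assoc1 z x P e = (\<Sum>i<L. derivative_coeff (e z) i * P (e(z := e z + int i, x := e x - int i)))"
    "\<And>i. K1 \<le> i \<Longrightarrow> P (e(z := e z + int i, x := e x - int i)) = 0"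
    using assoc1_lessThan[OF assms(1,3)] by blast
  obtain K2 where K2: "\<And>L. K2 \<le> L \<Longrightarrow>
    assoc1 z x Q e = (\<Sum>i<L. derivative_coeff (e z) i * Q (e(z := e z + int i, x := e x - int i)))"
    "\<And>i. K2 \<le> i \<Longrightarrow> Q (e(z := e z + int i, x := e x - int i)) = 0"
    using assoc1_lessThan[OF assms(2,3)] by blast
  have "assoc1 z x (\<lambda>e. a * P e + b * Q e) e = (\<Sum>i<max K1 K2. derivative_coeff (e z) i *
    (a * P (e(z := e z + int i, x := e x - int i)) + b * Q (e(z := e z + int i, x := e x - int i))))"
    unfolding assoc1_def by (rule Sum_any_lessThan) (simp add: K1(2) K2(2))
  then show ?thesis
    using K1(1)[of "max K1 K2"] K2(1)[of "max K1 K2"]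
    by (simp add: sum_distrib_left sum.distrib algebra_simps)
qed

lemma assoc2_lincomb:
  assumes "fibre_bdd z x z P" "fibre_bdd z x z Q" "z \<noteq> x"
  shows "assoc2 z x (\<lambda>e. a * P e + b * Q e) e = a * assoc2 z x P e + b * assoc2 z x Q e"
proof -
  obtain K1 where K1: "\<And>L. K1 \<le> L \<Longrightarrow>
    assoc2 z x P e = (\<Sum>i<L. (-1) powi (- e z - 1) * derivative_coeff (e z) i * P (e(z := - 1 - int i, x := e x + e z + 1 + int i)))"
    "\<And>i. K1 \<le> i \<Longrightarrow> P (e(z := - 1 - int i, x := e x + e z + 1 + int i)) = 0"
    using assoc2_lessThan[OF assms(1,3)] by blast
  obtain K2 where K2: "\<And>L. K2 \<le> L \<Longrightarrow>
    assoc2 z x Q e = (\<Sum>i<L. (-1) powi (- e z - 1) * derivative_coeff (e z) i * Q (e(z := - 1 - int i, x := e x + e z + 1 + int i)))"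
    "\<And>i. K2 \<le> i \<Longrightarrow> Q (e(z := - 1 - int i, x := e x + e z + 1 + int i)) = 0"
    using assoc2_lessThan[OF assms(2,3)] by blast
  have "assoc2 z x (\<lambda>e. a * P e + b * Q e) e = (\<Sum>i<max K1 K2. (-1) powi (- e z - 1) * derivative_coeff (e z) i *
    (a * P (e(z := - 1 - int i, x := e x + e z + 1 + int i)) + b * Q (e(z := - 1 - int i, x := e x + e z + 1 + int i))))"
    unfolding assoc2_def by (rule Sum_any_lessThan) (simp add: K1(2) K2(2))
  then show ?thesis
    using K1(1)[of "max K1 K2"] K2(1)[of "max K1 K2"]
    by (simp add: sum_distrib_left sum.distrib algebra_simps)
qed

lemma assoc1_shift:
  assumes "i \<noteq> z" "z \<noteq> x"
  shows "assoc1 z x (\<lambda>e. P (e(i := e i - 1))) e = assoc1 z x P (e(i := e i - 1))"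
proof -
  have "(e(z := e z + int k, x := e x - int k))(i := (e(z := e z + int k, x := e x - int k)) i - 1) =
    (e(i := e i - 1))(z := (e(i := e i - 1)) z + int k, x := (e(i := e i - 1)) x - int k)" for k
    using assms by (auto simp: fun_eq_iff)
  then show ?thesis using assms unfolding assoc1_def by simp
qed

lemma assoc2_shift:
  assumes "i \<noteq> z" "z \<noteq> x"
  shows "assoc2 z x (\<lambda>e. P (e(i := e i - 1))) e = assoc2 z x P (e(i := e i - 1))"
proof -
  have "(e(z := - 1 - int k, x := e x + e z + 1 + int k))(i := (e(z := - 1 - int k, x := e x + e z + 1 + int k)) i - 1) =
    (e(i := e i - 1))(z := - 1 - int k, x := (e(i := e i - 1)) x + (e(i := e i - 1)) z + 1 + int k)" for k
    using assms by (auto simp: fun_eq_iff)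
  then show ?thesis using assms unfolding assoc2_def by simp
qed

text \<open>Multiplication by the old \<open>z\<close> becomes multiplication by
  \<open>x + t\<close>, with \<open>t\<close> again named \<open>z\<close>. After an index shift
  this is Pascal's rule \<open>derivative_coeff_Suc\<close>.\<close>

lemma assoc1_shift_z:
  assumes "fibre_bdd z x x P" "z \<noteq> x"
  shows "assoc1 z x (\<lambda>e. P (e(z := e z - 1))) e =
    assoc1 z x P (e(x := e x - 1)) + assoc1 z x P (e(z := e z - 1))"
proof -
  define a where "a i = P (e(z := e z - 1 + int i, x := e x - int i))" for i
  obtain N where N: "\<And>n q. P (e(z := n, x := q)) \<noteq> 0 \<Longrightarrow> N \<le> q"
    using assms by (fastforce simp: fibre_bdd_def)
  define K where "K = nat (e x - N + 1)"
  have K: "a i = 0" if "K \<le> i" for i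
  proof (rule ccontr)
    assume "a i \<noteq> 0"
    then have "P (e(z := e z - 1 + int i, x := e x - int i)) \<noteq> 0" by (simp add: a_def)
    from N[OF this] that show False by (simp add: K_def)
  qed
  have 1: "assoc1 z x (\<lambda>e. P (e(z := e z - 1))) e = Sum_any (\<lambda>i. derivative_coeff (e z) i * a i)"
    using assms(2) by (simp add: assoc1_def a_def fun_upd_twist algebra_simps)
  have 2: "assoc1 z x P (e(x := e x - 1)) = Sum_any (\<lambda>i. derivative_coeff (e z) i * a (Suc i))"
    using assms(2) by (simp add: assoc1_def a_def fun_upd_twist algebra_simps)
  have 3: "assoc1 z x P (e(z := e z - 1)) = Sum_any (\<lambda>i. derivative_coeff (e z - 1) i * a i)"
    using assms(2) by (simp add: assoc1_def a_def fun_upd_twist algebra_simps)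
  have "Sum_any (\<lambda>i. derivative_coeff (e z) i * a i) = (\<Sum>i<Suc K. derivative_coeff (e z) i * a i)"
    by (rule Sum_any_lessThan) (simp add: K)
  moreover have "Sum_any (\<lambda>i. derivative_coeff (e z) i * a (Suc i)) = (\<Sum>i<K. derivative_coeff (e z) i * a (Suc i))"
    by (rule Sum_any_lessThan) (simp add: K)
  moreover have "Sum_any (\<lambda>i. derivative_coeff (e z - 1) i * a i) = (\<Sum>i<Suc K. derivative_coeff (e z - 1) i * a i)"
    by (rule Sum_any_lessThan) (simp add: K)
  ultimately show ?thesis
    unfolding 1 2 3
    by (simp add: sum.lessThan_Suc_shift derivative_coeff_Suc[of "e z"] algebra_simps sum.distrib del: sum.lessThan_Suc)
qed

text \<open>Again Pascal's rule. Now the index shift falls on the term with the factor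
  \<open>z\<close> on the left, and the sign \<open>(-1) powi (- e z - 1)\<close>, which flips when
  \<open>e z\<close> drops by one, turns the required sum into the available difference.\<close>

lemma assoc2_shift_z:
  assumes "fibre_bdd z x z P" "z \<noteq> x"
  shows "assoc2 z x (\<lambda>e. P (e(z := e z - 1))) e =
    assoc2 z x P (e(x := e x - 1)) + assoc2 z x P (e(z := e z - 1))"
proof -
  define s where "s = ((-1) powi (- e z - 1) :: complex)"
  have s: "(-1) powi (- (e z - 1) - 1) = - s"
    by (simp add: s_def power_int_minus power_int_diff power_int_add)
  define a where "a i = P (e(z := - 1 - int i, x := e x + e z + int i))" for i
  obtain N where N: "\<And>n q. P (e(z := n, x := q)) \<noteq> 0 \<Longrightarrow> N \<le> n"
    using assms by (fastforce simp: fibre_bdd_def)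
  define K where "K = nat (- N)"
  have K: "a i = 0" if "K \<le> i" for i
  proof (rule ccontr)
    assume "a i \<noteq> 0"
    then have "P (e(z := - 1 - int i, x := e x + e z + int i)) \<noteq> 0" by (simp add: a_def)
    from N[OF this] that show False by (simp add: K_def)
  qed
  have 1: "assoc2 z x (\<lambda>e. P (e(z := e z - 1))) e = Sum_any (\<lambda>i. s * derivative_coeff (e z) i * a (Suc i))"
    using assms(2) by (simp add: assoc2_def a_def s_def fun_upd_twist algebra_simps)
  have 2: "assoc2 z x P (e(x := e x - 1)) = Sum_any (\<lambda>i. s * derivative_coeff (e z) i * a i)"
    using assms(2) by (simp add: assoc2_def a_def s_def fun_upd_twist algebra_simps)
  have 3: "assoc2 z x P (e(z := e z - 1)) = Sum_any (\<lambda>i. - s * derivative_coeff (e z - 1) i * a i)"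
    using assms(2) s by (simp add: assoc2_def a_def fun_upd_twist algebra_simps)
  have "Sum_any (\<lambda>i. s * derivative_coeff (e z) i * a (Suc i)) = (\<Sum>i<K. s * derivative_coeff (e z) i * a (Suc i))"
    by (rule Sum_any_lessThan) (simp add: K)
  moreover have "Sum_any (\<lambda>i. s * derivative_coeff (e z) i * a i) = (\<Sum>i<Suc K. s * derivative_coeff (e z) i * a i)"
    by (rule Sum_any_lessThan) (simp add: K)
  moreover have "Sum_any (\<lambda>i. - s * derivative_coeff (e z - 1) i * a i) = (\<Sum>i<Suc K. - s * derivative_coeff (e z - 1) i * a i)"
    by (rule Sum_any_lessThan) (simp add: K)
  ultimately show ?thesis
    unfolding 1 2 3
    by (simp add: sum.lessThan_Suc_shift derivative_coeff_Suc[of "e z"] algebra_simps sum.distrib sum_negf del: sum.lessThan_Suc)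
qed

definition subst_lin :: "'i \<Rightarrow> 'i \<Rightarrow> (complex \<times> 'i) list \<Rightarrow> (complex \<times> 'i) list" where
  "subst_lin z x p = concat (map (\<lambda>(c, i). if i = z then [(c, x), (c, z)] else [(c, i)]) p)"

lemma fibre_bdd_shift:
  "fibre_bdd z x y P \<Longrightarrow> z \<noteq> x \<Longrightarrow> fibre_bdd z x y (\<lambda>e. P (e(w := e w - 1)))"
  using fibre_bdd_mul_lin[of z x y P "[(1, w)]"] by (simp add: mul_lin_Cons[abs_def])

lemma assoc1_mul_lin:
  assumes "fibre_bdd z x x P" "z \<noteq> x"
  shows "assoc1 z x (mul_lin p P) = mul_lin (subst_lin z x p) (assoc1 z x P)"
proof
  fix e
  show "assoc1 z x (mul_lin p P) e = mul_lin (subst_lin z x p) (assoc1 z x P) e"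
  proof (induction p)
    case Nil then show ?case by (simp add: subst_lin_def assoc1_def)
  next
    case (Cons a p)
    obtain c w where a: "a = (c, w)" by (cases a)
    have eq: "mul_lin (a # p) P = (\<lambda>e. c * P (e(w := e w - 1)) + 1 * mul_lin p P e)"
      using a by (auto simp: mul_lin_Cons)
    have "assoc1 z x (mul_lin (a # p) P) e =
      c * assoc1 z x (\<lambda>e. P (e(w := e w - 1))) e + 1 * assoc1 z x (mul_lin p P) e"
      unfolding eq by (intro assoc1_lincomb fibre_bdd_shift fibre_bdd_mul_lin assms)
    also have "assoc1 z x (mul_lin p P) e = mul_lin (subst_lin z x p) (assoc1 z x P) e" by (rule Cons.IH)
    also have "assoc1 z x (\<lambda>e. P (e(w := e w - 1))) e =
      (if w = z then assoc1 z x P (e(x := e x - 1)) + assoc1 z x P (e(z := e z - 1)) else assoc1 z x P (e(w := e w - 1)))"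
      using assoc1_shift[of w z x P e] assoc1_shift_z[OF assms] assms(2) by (simp del: fun_upd_apply)
    finally show ?case
      by (cases "w = z") (simp_all add: a subst_lin_def mul_lin_append mul_lin_Cons algebra_simps del: fun_upd_apply)
  qed
qed

lemma assoc2_mul_lin:
  assumes "fibre_bdd z x z P" "z \<noteq> x"
  shows "assoc2 z x (mul_lin p P) = mul_lin (subst_lin z x p) (assoc2 z x P)"
proof
  fix e
  show "assoc2 z x (mul_lin p P) e = mul_lin (subst_lin z x p) (assoc2 z x P) e"
  proof (induction p)
    case Nil then show ?case by (simp add: subst_lin_def assoc2_def)
  next
    case (Cons a p)
    obtain c w where a: "a = (c, w)" by (cases a)
    have eq: "mul_lin (a # p) P = (\<lambda>e. c * P (e(w := e w - 1)) + 1 * mul_lin p P e)"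
      using a by (auto simp: mul_lin_Cons)
    have "assoc2 z x (mul_lin (a # p) P) e =
      c * assoc2 z x (\<lambda>e. P (e(w := e w - 1))) e + 1 * assoc2 z x (mul_lin p P) e"
      unfolding eq by (intro assoc2_lincomb fibre_bdd_shift fibre_bdd_mul_lin assms)
    also have "assoc2 z x (mul_lin p P) e = mul_lin (subst_lin z x p) (assoc2 z x P) e" by (rule Cons.IH)
    also have "assoc2 z x (\<lambda>e. P (e(w := e w - 1))) e =
      (if w = z then assoc2 z x P (e(x := e x - 1)) + assoc2 z x P (e(z := e z - 1)) else assoc2 z x P (e(w := e w - 1)))"
      using assoc2_shift[of w z x P e] assoc2_shift_z[OF assms] assms(2) by (simp del: fun_upd_apply)
    finally show ?case
      by (cases "w = z") (simp_all add: a subst_lin_def mul_lin_append mul_lin_Cons algebra_simps del: fun_upd_apply)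
  qed
qed

lemma assoc1_mul_lins:
  assumes "fibre_bdd z x x P" "z \<noteq> x"
  shows "assoc1 z x (mul_lins ps P) = mul_lins (map (subst_lin z x) ps) (assoc1 z x P)"
  by (induction ps) (auto simp: assoc1_mul_lin fibre_bdd_mul_lins assms)

lemma assoc2_mul_lins:
  assumes "fibre_bdd z x z P" "z \<noteq> x"
  shows "assoc2 z x (mul_lins ps P) = mul_lins (map (subst_lin z x) ps) (assoc2 z x P)"
  by (induction ps) (auto simp: assoc2_mul_lin fibre_bdd_mul_lins assms)

text \<open>\<open>assoc2\<close> reads \<open>P\<close> only at the exponents
  \<open>- 1 - i\<close> of \<open>z\<close>, all of them negative.\<close>

lemma assoc2_power_series:
  assumes "\<And>e. P e \<noteq> 0 \<Longrightarrow> 0 \<le> e z" "z \<noteq> x"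
  shows "assoc2 z x P = (\<lambda>e. 0)"
proof
  fix e
  have "P (e(z := - 1 - int i, x := q)) = 0" for i q using assms(1)[of "e(z := - 1 - int i, x := q)"] assms(2) by auto
  then show "assoc2 z x P e = 0" by (simp add: assoc2_def)
qed

section \<open>Partial substitution of cluster coordinates\<close>

text \<open>Only the points in \<open>M\<close> have been moved into their clusters; the coordinate of any other point \<open>v\<close>
  is still \<open>Local v\<close> alone.\<close>

definition partial_subst_set :: "nat \<Rightarrow> (nat \<Rightarrow> nat) \<Rightarrow> nat set \<Rightarrow> (cvar \<Rightarrow> int) \<Rightarrow> (nat \<Rightarrow> int) set" where
  "partial_subst_set m cl M h = {e. (\<forall>v\<ge>m. e v = 0) \<and> (\<forall>v. v < m \<and> v \<notin> M \<longrightarrow> e v = h (Local v)) \<and>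
     (\<forall>v\<in>M. 0 \<le> h (Local v) \<and> h (Local v) \<le> e v) \<and>
     (\<forall>c. (\<Sum>v | v \<in> M \<and> cl v = c. e v - h (Local v)) = h (Base c))}"

definition partial_subst :: "nat \<Rightarrow> (nat \<Rightarrow> nat) \<Rightarrow> nat set \<Rightarrow> nat fseries \<Rightarrow> cvar fseries" where
  "partial_subst m cl M f h =
     (if \<forall>v\<ge>m. h (Local v) = 0 then
        (\<Sum>e\<in>partial_subst_set m cl M h. f e * (\<Prod>v\<in>M. of_nat (nat (e v) choose nat (h (Local v)))))
      else 0)"

lemma cluster_subst_eq_partial_subst: "cluster_subst m cl f = partial_subst m cl {..<m} f"
proof
  fix h
  have *: "{v. v \<in> {..<m} \<and> cl v = c} = {v. v < m \<and> cl v = c}" for c by auto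
  show "cluster_subst m cl f h = partial_subst m cl {..<m} f h"
    unfolding cluster_subst_def partial_subst_def partial_subst_set_def * by (auto intro!: sum.cong)
qed

lemma partial_subst_set_Base_nonneg:
  assumes "e \<in> partial_subst_set m cl M h" shows "0 \<le> h (Base c)"
proof -
  have "(\<Sum>v | v \<in> M \<and> cl v = c. e v - h (Local v)) = h (Base c)" using assms by (simp add: partial_subst_set_def)
  moreover have "0 \<le> (\<Sum>v | v \<in> M \<and> cl v = c. e v - h (Local v))"
    by (rule sum_nonneg) (use assms in \<open>auto simp: partial_subst_set_def\<close>)
  ultimately show ?thesis by simp
qed

lemma partial_subst_set_le:
  assumes "e \<in> partial_subst_set m cl M h" "finite M" "v \<in> M"
  shows "e v \<le> h (Local v) + h (Base (cl v))"
proof -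
  have "(\<Sum>w | w \<in> M \<and> cl w = cl v. e w - h (Local w)) = h (Base (cl v))" using assms by (simp add: partial_subst_set_def)
  moreover have "e v - h (Local v) \<le> (\<Sum>w | w \<in> M \<and> cl w = cl v. e w - h (Local w))"
    by (rule member_le_sum) (use assms in \<open>auto simp: partial_subst_set_def\<close>)
  ultimately show ?thesis by simp
qed

lemma finite_partial_subst_set:
  assumes "M \<subseteq> {..<m}" shows "finite (partial_subst_set m cl M h)"
proof -
  have fM: "finite M" using assms finite_subset by blast
  define S where "S = (\<Union>v\<in>{..<m}. {h (Local v)..h (Local v) + h (Base (cl v))} \<union> {h (Local v)})"
  have "partial_subst_set m cl M h \<subseteq> {e. \<forall>v. (v \<in> {..<m} \<longrightarrow> e v \<in> S) \<and> (v \<notin> {..<m} \<longrightarrow> e v = 0)}"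
  proof
    fix e assume e: "e \<in> partial_subst_set m cl M h"
    have "e v \<in> S" if "v < m" for v
    proof (cases "v \<in> M")
      case True
      then have "h (Local v) \<le> e v" "e v \<le> h (Local v) + h (Base (cl v))"
        using e partial_subst_set_le[OF e fM] by (auto simp: partial_subst_set_def)
      then show ?thesis using that by (auto simp: S_def)
    next
      case False then show ?thesis using e that by (auto simp: S_def partial_subst_set_def)
    qed
    then show "e \<in> {e. \<forall>v. (v \<in> {..<m} \<longrightarrow> e v \<in> S) \<and> (v \<notin> {..<m} \<longrightarrow> e v = 0)}"
      using e by (auto simp: partial_subst_set_def)
  qed
  moreover have "finite {e. \<forall>v. (v \<in> {..<m} \<longrightarrow> e v \<in> S) \<and> (v \<notin> {..<m} \<longrightarrow> e v = (0::int))}"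
    by (rule finite_set_of_finite_funs) (auto simp: S_def)
  ultimately show ?thesis by (rule finite_subset)
qed

lemma partial_subst_nonneg:
  assumes "power_series m f" "partial_subst m cl M f h \<noteq> 0"
  shows "0 \<le> h y"
proof -
  from assms(2) obtain e where e: "e \<in> partial_subst_set m cl M h" "f e \<noteq> 0" and h: "\<forall>v\<ge>m. h (Local v) = 0"
    unfolding partial_subst_def by (metis (mono_tags, lifting) mult_eq_0_iff sum.neutral)
  have e0: "0 \<le> e v" for v using assms(1) e(2) by (auto simp: power_series_def)
  show ?thesis
  proof (cases y)
    case (Base c) then show ?thesis using partial_subst_set_Base_nonneg[OF e(1)] by simp
  next
    case (Local v)
    then show ?thesis
      using e(1) e0[of v] h unfolding partial_subst_set_def by (cases "v < m"; cases "v \<in> M") auto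
  qed
qed

lemma fibre_bdd_nonneg:
  assumes "\<And>e. P e \<noteq> 0 \<Longrightarrow> 0 \<le> e y" shows "fibre_bdd z x y P"
  unfolding fibre_bdd_def using assms by blast

lemma partial_subst_empty:
  "partial_subst m cl {} f h = (if (\<forall>v\<ge>m. h (Local v) = 0) \<and> (\<forall>c. h (Base c) = 0) then f (\<lambda>v. h (Local v)) else 0)"
proof (cases "(\<forall>v\<ge>m. h (Local v) = 0) \<and> (\<forall>c. h (Base c) = 0)")
  case True
  then have "partial_subst_set m cl {} h = {\<lambda>v. h (Local v)}"
    by (auto simp: partial_subst_set_def fun_eq_iff) (metis not_le)
  then show ?thesis using True by (simp add: partial_subst_def)
next
  case False
  have "partial_subst m cl {} f h = 0"
  proof (cases "\<forall>v\<ge>m. h (Local v) = 0")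
    case True
    then have "partial_subst_set m cl {} h = {}" using False by (auto simp: partial_subst_set_def)
    then show ?thesis by (simp add: partial_subst_def)
  qed (unfold partial_subst_def, simp only: if_False)
  then show ?thesis unfolding if_not_P[OF False] .
qed

text \<open>The sum defining the left side is grouped by \<open>i = e w - h (Local w)\<close>, the
  part of the exponent of \<open>w\<close> that goes to its base. The binomial factor of
  \<open>w\<close> is then \<open>derivative_coeff (h (Local w)) i\<close>.\<close>

lemma partial_subst_insert:
  assumes f: "power_series m f" and M: "M \<subseteq> {..<m}" and w: "w < m" "w \<notin> M"
  shows "partial_subst m cl (insert w M) f = assoc1 (Local w) (Base (cl w)) (partial_subst m cl M f)"
proof
  fix h
  define z x where "z = Local w" and "x = Base (cl w)"
  have zx: "z \<noteq> x" by (simp add: z_def x_def)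
  define hh where "hh i = h(z := h z + int i, x := h x - int i)" for i
  have hhz: "hh i z = h z + int i" "hh i x = h x - int i" for i using zx by (auto simp: hh_def)
  have hhl: "hh i (Local v) = h (Local v)" if "v \<noteq> w" for i v using that by (simp add: hh_def z_def x_def)
  have hho: "hh i y = h y" if "y \<noteq> z" "y \<noteq> x" for i y using that by (simp add: hh_def)
  have fM: "finite M" using M finite_subset by blast
  have bdd: "fibre_bdd z x x (partial_subst m cl M f)" by (intro fibre_bdd_nonneg partial_subst_nonneg[OF f])
  show "partial_subst m cl (insert w M) f h = assoc1 (Local w) (Base (cl w)) (partial_subst m cl M f) h"
  proof (cases "(\<forall>v\<ge>m. h (Local v) = 0) \<and> 0 \<le> h z")
    \<comment> \<open>Here both sides vanish. For \<open>h z < 0\<close> a term on the right dies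
      either through its coefficient, by \<open>derivative_coeff_neg\<close>, or because
      \<open>partial_subst\<close> has no negative exponents.\<close>
    case False
    have "partial_subst m cl (insert w M) f h = 0"
    proof (cases "\<forall>v\<ge>m. h (Local v) = 0")
      case True
      then have "partial_subst_set m cl (insert w M) h = {}" using False by (auto simp: partial_subst_set_def z_def)
      then show ?thesis by (simp add: partial_subst_def)
    next
      case F: False
      then show ?thesis unfolding partial_subst_def by (simp only: if_False)
    qed
    moreover have "derivative_coeff (h z) i * partial_subst m cl M f (hh i) = 0" for i
    proof (cases "\<forall>v\<ge>m. h (Local v) = 0")
      case True
      then have neg: "h z < 0" using False by simp
      show ?thesis
      proof (cases "0 \<le> h z + int i")
        case True then show ?thesis using derivative_coeff_neg[OF neg] by simp
      next
        case F: False
        have "partial_subst m cl M f (hh i) = 0"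
          using partial_subst_nonneg[OF f, of cl M "hh i" z] F hhz by force
        then show ?thesis by simp
      qed
    next
      case F: False
      then obtain v where "v \<ge> m" "h (Local v) \<noteq> 0" by auto
      then have "v \<ge> m" "hh i (Local v) \<noteq> 0" using hho[of "Local v" i] w by (auto simp: z_def x_def)
      then have "\<not> (\<forall>v\<ge>m. hh i (Local v) = 0)" by blast
      then show ?thesis unfolding partial_subst_def by (simp only: if_False if_not_P mult_zero_right)
    qed
    ultimately show ?thesis
      unfolding assoc1_def z_def[symmetric] x_def[symmetric] hh_def[symmetric] by (simp only: Sum_any.neutral)
  next
    case True
    then have hm: "\<forall>v\<ge>m. h (Local v) = 0" and hz: "0 \<le> h z" by auto
    have hhm: "\<forall>v\<ge>m. hh i (Local v) = 0" for i
      using hm hho w by (auto simp: z_def x_def)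
    obtain K where K: "\<And>L. K \<le> L \<Longrightarrow> assoc1 z x (partial_subst m cl M f) h = (\<Sum>i<L. derivative_coeff (h z) i * partial_subst m cl M f (hh i))"
      by (rule assoc1_lessThan[OF bdd zx, of h]) (rule that, unfold hh_def, assumption)
    \<comment> \<open>The second bound makes room for every \<open>e\<close> on the left, since
      \<open>e w - h z\<close> is at most \<open>h x\<close> there.\<close>
    define L where "L = max K (nat (h x + 1))"
    define c where "c e M' = (\<Prod>v\<in>M'. of_nat (nat (e v) choose nat (h (Local v))) :: complex)" for e :: "nat \<Rightarrow> int" and M'
    \<comment> \<open>The exponents in the sum before \<open>w\<close> is merged are those in the
      sum after it, sorted by the value of \<open>e w\<close>.\<close>
    have mem: "e \<in> partial_subst_set m cl M (hh i) \<longleftrightarrow> e \<in> partial_subst_set m cl (insert w M) h \<and> e w = h z + int i" for e i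
    proof -
      have s: "(\<Sum>v | v \<in> insert w M \<and> cl v = d. e v - h (Local v)) =
        (if d = cl w then e w - h z else 0) + (\<Sum>v | v \<in> M \<and> cl v = d. e v - h (Local v))" for d
      proof -
        have "{v. v \<in> insert w M \<and> cl v = d} = (if d = cl w then insert w {v. v \<in> M \<and> cl v = d} else {v. v \<in> M \<and> cl v = d})"
          by auto
        then show ?thesis using w fM by (simp add: z_def)
      qed
      have s2: "(\<Sum>v | v \<in> M \<and> cl v = d. e v - hh i (Local v)) = (\<Sum>v | v \<in> M \<and> cl v = d. e v - h (Local v))" for d
        by (rule sum.cong) (use w hhl in \<open>metis (mono_tags, lifting) mem_Collect_eq\<close>)+
      have b: "(\<forall>d. (\<Sum>v | v \<in> insert w M \<and> cl v = d. e v - h (Local v)) = h (Base d)) \<longleftrightarrow>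
        (\<forall>d. (\<Sum>v | v \<in> M \<and> cl v = d. e v - hh i (Local v)) = hh i (Base d))" if "e w = h z + int i"
      proof -
        have "h (Base d) = (if d = cl w then e w - h z else 0) + hh i (Base d)" for d
          using that hhz hho[of "Base d" i] by (auto simp: x_def z_def)
        then show ?thesis unfolding s s2 by simp
      qed
      have l: "h (Local v) = hh i (Local v)" if "v \<noteq> w" for v using that hho by (simp add: z_def x_def)
      show ?thesis
      proof (cases "e w = h z + int i")
        case True
        have "(\<forall>v. v < m \<and> v \<notin> insert w M \<longrightarrow> e v = h (Local v)) \<longleftrightarrow> (\<forall>v. v < m \<and> v \<notin> M \<longrightarrow> e v = hh i (Local v))"
          using l hhz(1)[of i] True unfolding z_def by (metis insert_iff)
        moreover have "(\<forall>v\<in>insert w M. 0 \<le> h (Local v) \<and> h (Local v) \<le> e v) \<longleftrightarrow>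
           (\<forall>v\<in>M. 0 \<le> hh i (Local v) \<and> hh i (Local v) \<le> e v)"
          using l hz True w by (force simp: z_def)
        ultimately show ?thesis using True b[OF True] unfolding partial_subst_set_def by blast
      next
        case False
        then have "e \<notin> partial_subst_set m cl M (hh i)" using w hhz(1)[of i] by (auto simp: partial_subst_set_def z_def)
        then show ?thesis using False by simp
      qed
    qed
    have trm: "derivative_coeff (h z) i * partial_subst m cl M f (hh i) =
      (\<Sum>e\<in>partial_subst_set m cl M (hh i). f e * c e (insert w M))" for i
    proof -
      have "f e * c e (insert w M) = derivative_coeff (h z) i * (f e * (\<Prod>v\<in>M. of_nat (nat (e v) choose nat (hh i (Local v)))))"
        if e: "e \<in> partial_subst_set m cl M (hh i)" for e
      proof -
        have "e w = h z + int i" using mem e by blast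
        then have "nat (e w) = nat (h z) + i" using hz by simp
        moreover have "c e M = (\<Prod>v\<in>M. of_nat (nat (e v) choose nat (hh i (Local v))))"
          unfolding c_def by (rule prod.cong) (use w hhl in \<open>metis\<close>)+
        ultimately show ?thesis
          using w fM hz by (simp add: c_def derivative_coeff_nonneg z_def)
      qed
      then show ?thesis unfolding partial_subst_def if_P[OF hhm] sum_distrib_left
        by (intro sum.cong refl) (simp only:)
    qed
    have "assoc1 z x (partial_subst m cl M f) h = (\<Sum>i<L. \<Sum>e\<in>partial_subst_set m cl M (hh i). f e * c e (insert w M))"
      using K[of L] by (simp add: L_def trm)
    also have "\<dots> = (\<Sum>(i, e)\<in>(SIGMA i:{..<L}. partial_subst_set m cl M (hh i)). f e * c e (insert w M))"
      by (rule sum.Sigma) (use finite_partial_subst_set[OF M] in auto)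
    also have "\<dots> = (\<Sum>e\<in>partial_subst_set m cl (insert w M) h. f e * c e (insert w M))"
    proof (rule sum.reindex_bij_witness[of _ "\<lambda>e. (nat (e w - h z), e)" snd])
      fix e assume e: "e \<in> partial_subst_set m cl (insert w M) h"
      have "e w \<le> h z + h x" using partial_subst_set_le[OF e, of w] fM by (simp add: z_def x_def)
      moreover have "h z \<le> e w" using e by (auto simp: partial_subst_set_def z_def)
      ultimately show "(nat (e w - h z), e) \<in> (SIGMA i:{..<L}. partial_subst_set m cl M (hh i))"
        using e by (auto simp: mem L_def)
    qed (auto simp: mem)
    also have "\<dots> = partial_subst m cl (insert w M) f h" unfolding partial_subst_def c_def using hm by simp
    finally show ?thesis by (simp add: z_def x_def)
  qed
qed

definition merge_lin :: "(nat \<Rightarrow> nat) \<Rightarrow> nat set \<Rightarrow> (complex \<times> nat) list \<Rightarrow> (complex \<times> cvar) list" where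
  "merge_lin cl M p = concat (map (\<lambda>(c, v). if v \<in> M then [(c, Base (cl v)), (c, Local v)] else [(c, Local v)]) p)"

lemma subst_merge_lin:
  assumes "w \<notin> M"
  shows "subst_lin (Local w) (Base (cl w)) (merge_lin cl M p) = merge_lin cl (insert w M) p"
  by (induction p) (use assms in \<open>auto simp: subst_lin_def merge_lin_def\<close>)

lemma partial_subst_empty_mul_lin:
  assumes "snd ` set p \<subseteq> {..<m}"
  shows "partial_subst m cl {} (mul_lin p f) h = mul_lin (merge_lin cl {} p) (partial_subst m cl {} f) h"
  using assms
proof (induction p)
  case Nil then show ?case by (simp add: merge_lin_def partial_subst_empty)
next
  case (Cons a p)
  obtain c w where a: "a = (c, w)" by (cases a)
  have w: "w < m" using Cons.prems a by simp
  have e: "partial_subst m cl {} f (h(Local w := h (Local w) - 1)) =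
    (if (\<forall>v\<ge>m. h (Local v) = 0) \<and> (\<forall>c. h (Base c) = 0) then f ((\<lambda>v. h (Local v))(w := h (Local w) - 1)) else 0)"
  proof -
    have "(\<lambda>v. (h(Local w := h (Local w) - 1)) (Local v)) = (\<lambda>v. h (Local v))(w := h (Local w) - 1)" by auto
    moreover have "(\<forall>v\<ge>m. (h(Local w := h (Local w) - 1)) (Local v) = 0) \<longleftrightarrow> (\<forall>v\<ge>m. h (Local v) = 0)"
      using w by auto
    ultimately show ?thesis unfolding partial_subst_empty by (simp only:) simp
  qed
  have IH: "partial_subst m cl {} (mul_lin p f) h = mul_lin (merge_lin cl {} p) (partial_subst m cl {} f) h"
    by (rule Cons.IH) (use Cons.prems in auto)
  have "merge_lin cl {} (a # p) = (c, Local w) # merge_lin cl {} p" by (simp add: a merge_lin_def)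
  then have "mul_lin (merge_lin cl {} (a # p)) (partial_subst m cl {} f) h =
      c * partial_subst m cl {} f (h(Local w := h (Local w) - 1)) + partial_subst m cl {} (mul_lin p f) h"
    by (simp only: mul_lin_Cons IH)
  also have "\<dots> = partial_subst m cl {} (mul_lin (a # p) f) h"
    unfolding e partial_subst_empty[where h = h] a mul_lin_Cons 
    by (cases "(\<forall>v\<ge>m. h (Local v) = 0) \<and> (\<forall>c. h (Base c) = 0)", unfold if_P if_not_P, simp_all)
  finally show ?case by (rule sym)
qed

text \<open>Inserting points into \<open>M\<close> one at a time reduces this to
  \<open>assoc1_mul_lin\<close>; for empty \<open>M\<close> the substitution only renames
  variables.\<close>

lemma partial_subst_mul_lin:
  assumes "power_series m f" "snd ` set p \<subseteq> {..<m}" "M \<subseteq> {..<m}"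
  shows "partial_subst m cl M (mul_lin p f) = mul_lin (merge_lin cl M p) (partial_subst m cl M f)"
proof -
  have "finite M" using assms(3) finite_subset by blast
  then show ?thesis using assms(3)
  proof (induction M)
    case empty then show ?case using partial_subst_empty_mul_lin[OF assms(2)] by auto
  next
    case (insert w M)
    have pf: "power_series m (mul_lin p f)" using mul_lins_power_series[OF assms(1), of "[p]"] assms(2) by simp
    have "partial_subst m cl (insert w M) (mul_lin p f) = assoc1 (Local w) (Base (cl w)) (partial_subst m cl M (mul_lin p f))"
      by (rule partial_subst_insert[OF pf]) (use insert in auto)
    also have "partial_subst m cl M (mul_lin p f) = mul_lin (merge_lin cl M p) (partial_subst m cl M f)"
      using insert by simp
    also have "assoc1 (Local w) (Base (cl w)) \<dots> =
      mul_lin (subst_lin (Local w) (Base (cl w)) (merge_lin cl M p)) (assoc1 (Local w) (Base (cl w)) (partial_subst m cl M f))"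
      by (intro assoc1_mul_lin fibre_bdd_nonneg partial_subst_nonneg[OF assms(1)]) auto
    also have "assoc1 (Local w) (Base (cl w)) (partial_subst m cl M f) = partial_subst m cl (insert w M) f"
      by (rule partial_subst_insert[OF assms(1), symmetric]) (use insert in auto)
    finally show ?case using insert by (simp add: subst_merge_lin)
  qed
qed

lemma partial_subst_mul_lins:
  assumes "power_series m f" "\<And>p. p \<in> set ps \<Longrightarrow> snd ` set p \<subseteq> {..<m}" "M \<subseteq> {..<m}"
  shows "partial_subst m cl M (mul_lins ps f) = mul_lins (map (merge_lin cl M) ps) (partial_subst m cl M f)"
  using assms(2)
proof (induction ps)
  case (Cons p ps)
  have "power_series m (mul_lins ps f)" by (rule mul_lins_power_series[OF assms(1)]) (use Cons.prems in auto)
  then show ?case using Cons partial_subst_mul_lin[of m "mul_lins ps f" p M cl] assms(3) by simp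
qed simp

unbundle fps_syntax

section \<open>Zhu's change of coordinates \<open>w = e^z - 1\<close> and the kernels it
  produces\<close>

section \<open>The change of coordinates\<close>

definition log_series :: "complex fls" where "log_series = fps_to_fls (fps_ln 1)"

definition one_plus_X :: "complex fls" where "one_plus_X = 1 + fls_X"

text \<open>For \<open>a\<close> of weight \<open>k\<close>, \<open>a[n]\<close> is the residue of \<open>Y(a,w)\<close> against \<open>ln(1+w)^n (1+w)^(k-1)\<close>.\<close>

definition test_series :: "int \<Rightarrow> int \<Rightarrow> complex fls" where
  "test_series k n = log_series powi n * one_plus_X powi (k - 1)"

lemma fps_ln_nonzero: "fps_ln 1 \<noteq> (0 :: complex fps)"
proof
  assume "fps_ln 1 = (0 :: complex fps)"
  then have "fps_nth (fps_ln 1 :: complex fps) 1 = 0" by simp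
  then show False by (simp add: fps_ln_nth)
qed

lemma log_series_nonzero [simp]: "log_series \<noteq> 0"
  using fps_ln_nonzero by (simp add: log_series_def)

lemma one_plus_X_nonzero [simp]: "one_plus_X \<noteq> 0"
proof
  assume "one_plus_X = 0"
  then have "one_plus_X $$ 0 = 0" by simp
  then show False by (simp add: one_plus_X_def)
qed

lemma subdegree_log_series [simp]: "fls_subdegree log_series = 1"
proof -
  have "fls_subdegree (fps_to_fls (fps_ln 1 :: complex fps)) = int (subdegree (fps_ln 1 :: complex fps))"
    by (rule fls_subdegree_fls_to_fps)
  also have "subdegree (fps_ln 1 :: complex fps) = 1"
    by (rule subdegreeI) (auto simp: fps_ln_nth)
  finally show ?thesis by (simp add: log_series_def)
qed

lemma one_plus_X_powi_nth: "(one_plus_X powi s) $$ j = (if j < 0 then 0 else of_int s gchoose nat j)"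
  by (simp add: one_plus_X_def one_plus_fls_X_powi_eq)

lemma subdegree_one_plus_X [simp]: "fls_subdegree one_plus_X = 0"
  by (rule fls_subdegree_eqI) (auto simp: one_plus_X_def)

lemma subdegree_test_series [simp]: "fls_subdegree (test_series k n) = n"
  by (simp add: test_series_def)

lemma test_series_below: "j < n \<Longrightarrow> test_series k n $$ j = 0"
  by (rule fls_eq0_below_subdegree) simp

lemma log_series_lead: "log_series $$ 1 = 1"
  by (simp add: log_series_def fps_ln_nth)

lemma log_series_powi_below: "j < n \<Longrightarrow> (log_series powi n) $$ j = 0"
  by (rule fls_eq0_below_subdegree) simp

lemma fls_deriv_power_int:
  fixes f :: "'a::field_char_0 fls"
  assumes "f \<noteq> 0"
  shows "fls_deriv (f powi n) = of_int n * f powi (n - 1) * fls_deriv f"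
proof (cases "n \<ge> 0")
  case True
  then obtain k where k: "n = int k" using nonneg_int_cases by blast
  show ?thesis
  proof (cases k)
    case (Suc l)
    have "f powi n = f ^ Suc l" unfolding k Suc by (rule power_int_of_nat)
    moreover have "f powi (n - 1) = f ^ l" unfolding k Suc by simp
    ultimately show ?thesis by (simp add: k Suc fls_deriv_power del: power_Suc)
  qed (simp add: k)
next
  case False
  define k where "k = nat (- n)"
  have n: "n = - int k" and k0: "k > 0" using False by (auto simp: k_def)
  have "fls_deriv (f powi n) = fls_deriv (inverse (f ^ k))" by (simp add: n power_int_minus)
  also have "\<dots> = - inverse (f ^ k) * (of_nat k * f ^ (k - 1) * fls_deriv f) * inverse (f ^ k)"
    by (simp add: fls_inverse_deriv_divring fls_deriv_power)
  also have "\<dots> = of_int n * (inverse (f ^ k) * f ^ (k - 1) * inverse (f ^ k)) * fls_deriv f"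
    by (simp add: n algebra_simps)
  also have "inverse (f ^ k) * f ^ (k - 1) * inverse (f ^ k) = f powi (- int k + (int k - 1) + - int k)"
    using assms k0 by (simp add: power_int_add power_int_minus power_int_diff of_nat_diff flip: power_int_of_nat)
      (simp add: field_simps power_int_of_nat)
  also have "- int k + (int k - 1) + - int k = n - 1" by (simp add: n)
  finally show ?thesis .
qed

text \<open>In the coordinate \<open>z = ln(1+w)\<close> the derivation \<open>(1+w) d/dw\<close> is
  \<open>d/dz\<close>. All coefficient recursions below are obtained by applying it to powers of
  \<open>ln(1+w)\<close> and \<open>1+w\<close>.\<close>

lemma one_plus_X_deriv_log_series: "one_plus_X * fls_deriv log_series = 1"
proof -
  have "fls_deriv log_series = fps_to_fls (inverse (1 + fps_X))"
    by (simp add: log_series_def fls_deriv_fps_to_fls fps_ln_deriv)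
  moreover have "one_plus_X = fps_to_fls (1 + fps_X)" by (simp add: one_plus_X_def)
  moreover have "(1 + fps_X) * inverse (1 + fps_X) = (1 :: complex fps)"
    by (rule inverse_mult_eq_1') simp
  ultimately show ?thesis by (metis fps_one_to_fls fls_times_fps_to_fls)
qed

lemma one_plus_X_deriv_log_series_powi: "one_plus_X * fls_deriv (log_series powi n) = of_int n * log_series powi (n - 1)"
proof -
  have "one_plus_X * fls_deriv (log_series powi n) = of_int n * log_series powi (n - 1) * (one_plus_X * fls_deriv log_series)"
    by (simp add: fls_deriv_power_int)
  then show ?thesis unfolding one_plus_X_deriv_log_series by simp
qed

lemma deriv_one_plus_X [simp]: "fls_deriv one_plus_X = 1"
  by (simp add: one_plus_X_def)

lemma one_plus_X_deriv_test_series: "one_plus_X * fls_deriv (test_series k n) = of_int n * test_series k (n - 1) + of_int (k - 1) * test_series k n"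
proof -
  have "one_plus_X * fls_deriv (test_series k n) =
    (one_plus_X * fls_deriv (log_series powi n)) * one_plus_X powi (k - 1) + log_series powi n * (of_int (k - 1) * (one_plus_X powi (k - 1 - 1) * one_plus_X))"
    unfolding test_series_def by (simp add: fls_deriv_power_int deriv_one_plus_X algebra_simps)
  also have "one_plus_X powi (k - 1 - 1) * one_plus_X = one_plus_X powi (k - 1)"
    using power_int_add_1[of one_plus_X "k - 1 - 1"] by simp
  finally show ?thesis unfolding one_plus_X_deriv_log_series_powi by (simp add: test_series_def algebra_simps)
qed

lemma one_plus_X_deriv_nth: "(one_plus_X * fls_deriv g) $$ m = of_int (m + 1) * g $$ (m + 1) + of_int m * g $$ m"
  by (simp add: one_plus_X_def algebra_simps fls_X_times_conv_shift)

lemma fls_of_int_times_nth: "(of_int n * f :: complex fls) $$ m = of_int n * f $$ m"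
  unfolding fls_of_int by (rule fls_mult_const_nth)

lemma test_series_rec:
  "of_int (m + 1) * test_series k n $$ (m + 1) = of_int n * test_series k (n - 1) $$ m + of_int (k - 1 - m) * test_series k n $$ m"
proof -
  have "of_int (m + 1) * test_series k n $$ (m + 1) + of_int m * test_series k n $$ m =
    of_int n * test_series k (n - 1) $$ m + of_int (k - 1) * test_series k n $$ m"
    unfolding one_plus_X_deriv_nth[symmetric] one_plus_X_deriv_test_series by (simp add: fls_of_int_times_nth del: of_int_diff)
  then show ?thesis by (simp add: algebra_simps)
qed

lemma log_series_powi_eq_test_series: "log_series powi n = test_series 1 n"
  by (simp add: test_series_def)

lemma log_series_powi_rec:
  "of_int (q + 1) * (log_series powi n) $$ (q + 1) = of_int n * (log_series powi (n - 1)) $$ q - of_int q * (log_series powi n) $$ q"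
  using test_series_rec[of q 1 n] by (simp add: log_series_powi_eq_test_series)

lemma test_series_0: "test_series k (int i) $$ 0 = (if i = 0 then 1 else 0)"
  using test_series_below[of 0 "int i" k] by (cases "i = 0") (auto simp: test_series_def one_plus_X_powi_nth simp del: power_int_of_nat)

text \<open>Any finite set that catches all nonzero terms may serve as index range, so that
  different convolutions can share one.\<close>

lemma fls_conv_nth:
  fixes f g :: "complex fls"
  assumes "finite I" "\<And>i. i \<notin> I \<Longrightarrow> f $$ i * g $$ (n - i) = 0"
  shows "(f * g) $$ n = (\<Sum>i\<in>I. f $$ i * g $$ (n - i))"
proof -
  define J where "J = {fls_subdegree f..n - fls_subdegree g}"
  have J: "f $$ i * g $$ (n - i) = 0" if "i \<notin> J" for i
  proof -
    have "i < fls_subdegree f \<or> n - i < fls_subdegree g" using that by (auto simp: J_def)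
    then show ?thesis by (auto simp: fls_eq0_below_subdegree)
  qed
  have "(f * g) $$ n = (\<Sum>i\<in>J. f $$ i * g $$ (n - i))" unfolding J_def by (rule fls_times_nth(2))
  also have "\<dots> = (\<Sum>i\<in>I \<union> J. f $$ i * g $$ (n - i))"
    by (rule sum.mono_neutral_left) (use assms(1) J in \<open>auto simp: J_def\<close>)
  also have "\<dots> = (\<Sum>i\<in>I. f $$ i * g $$ (n - i))"
    by (rule sum.mono_neutral_right) (use assms in \<open>auto simp: J_def\<close>)
  finally show ?thesis .
qed

section \<open>Invariance of the residue\<close>

text \<open>Writing \<open>F\<close> as a power series times \<open>X^n\<close> reduces the chain
  rule for Laurent series to the one for power series and the derivative of an integer
  power.\<close>

lemma fls_deriv_compose_fps:
  fixes F :: "complex fls"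
  assumes G: "G \<noteq> 0" "fps_nth G 0 = 0"
  shows "fls_deriv (fls_compose_fps F G) = fls_compose_fps (fls_deriv F) G * fps_to_fls (fps_deriv G)"
proof -
  define n where "n = fls_subdegree F"
  define f where "f = fls_base_factor_to_fps F"
  have G': "fps_to_fls G \<noteq> 0" using G by simp
  have F: "F = fps_to_fls f * fls_X powi n"
  proof (rule fls_eqI)
    fix m
    show "F $$ m = (fps_to_fls f * fls_X powi n) $$ m"
      unfolding f_def fls_X_power_int fls_X_intpow_times_conv_shift
      by (auto simp: n_def fls_eq0_below_subdegree algebra_simps)
  qed
  have cX: "fls_compose_fps (fls_X powi j) G = fps_to_fls G powi j" for j
    unfolding fls_compose_fps_powi[OF G] by simp
  have c: "fls_compose_fps F G = fps_to_fls (f oo G) * fps_to_fls G powi n"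
    by (subst F) (simp add: fls_compose_fps_mult G cX del: fls_X_power_int)
  have dX: "fls_deriv (fls_X powi n :: complex fls) = of_int n * fls_X powi (n - 1)"
    by (simp add: fls_deriv_power_int del: fls_X_power_int)
  have "fls_deriv F = fps_to_fls (fps_deriv f) * fls_X powi n + fps_to_fls f * (of_int n * fls_X powi (n - 1))"
    unfolding arg_cong[OF F, of fls_deriv] fls_deriv_mult dX fls_deriv_fps_to_fls by simp
  then have "fls_compose_fps (fls_deriv F) G =
     fps_to_fls (fps_deriv f oo G) * fps_to_fls G powi n + fps_to_fls (f oo G) * (of_int n * fps_to_fls G powi (n - 1))"
    by (simp add: fls_compose_fps_add fls_compose_fps_mult G cX del: fls_X_power_int)
  moreover have "fls_deriv (fls_compose_fps F G) = fps_to_fls ((fps_deriv f oo G) * fps_deriv G) * fps_to_fls G powi n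
     + fps_to_fls (f oo G) * (of_int n * fps_to_fls G powi (n - 1) * fps_to_fls (fps_deriv G))"
    unfolding c by (simp add: fls_deriv_fps_to_fls fps_compose_deriv G fls_deriv_power_int G')
  ultimately show ?thesis by (simp add: algebra_simps fls_times_fps_to_fls)
qed

text \<open>After removal of its residue term \<open>H\<close> is a derivative, and derivatives stay
  derivatives under substitution and have residue zero. The residue term becomes
  \<open>G'/G\<close>, whose residue is the order of vanishing of \<open>G\<close>, here 1.\<close>

lemma fls_residue_compose_fps:
  fixes H :: "complex fls"
  assumes G: "G \<noteq> 0" "subdegree G = 1"
  shows "(fls_compose_fps H G * fps_to_fls (fps_deriv G)) $$ (-1) = H $$ (-1)"
proof -
  have G0: "fps_nth G 0 = 0" by (rule nth_less_subdegree_zero) (simp add: G(2))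
  define r where "r = H $$ (-1)"
  define H' where "H' = H - fls_const r * inverse fls_X"
  have "fls_residue H' = 0" by (simp add: H'_def r_def fls_mult_const_nth fls_inverse_X)
  then obtain K where K: "fls_deriv K = H'" using fls_residue_nonzero_ex_antiderivative by blast
  have H: "H = fls_deriv K + fls_const r * inverse fls_X" by (simp add: K H'_def)
  have "fls_compose_fps H G * fps_to_fls (fps_deriv G) = fls_deriv (fls_compose_fps K G) +
     fls_const r * (fls_deriv (fps_to_fls G) * inverse (fps_to_fls G))"
    unfolding H by (simp add: fls_compose_fps_add fls_compose_fps_mult fls_compose_fps_inverse G G0
        fls_deriv_compose_fps fls_deriv_fps_to_fls algebra_simps)
  moreover have "fls_deriv (fls_compose_fps K G) $$ (-1) = 0" by (rule fls_deriv_residue)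
  moreover have "(fls_deriv (fps_to_fls G) * inverse (fps_to_fls G)) $$ (-1) = 1"
    using fls_residue_deriv_times_inverse_eq_subdegree[of "fps_to_fls G"] G
    by (simp add: fls_subdegree_fls_to_fps)
  ultimately show ?thesis by (simp add: r_def)
qed

lemma fps_exp_powi: "fps_to_fls (fps_exp (c::complex)) powi n = fps_to_fls (fps_exp (of_int n * c))"
proof (cases "n \<ge> 0")
  case True
  then obtain k where "n = int k" using nonneg_int_cases by blast
  then show ?thesis by (simp add: fps_exp_power_mult flip: fps_to_fls_power)
next
  case False
  define k where "k = nat (- n)"
  have n: "n = - int k" using False by (auto simp: k_def)
  have "inverse (fps_exp (of_nat k * c)) = fps_exp (- (of_nat k * c))" by (simp add: fps_exp_neg)
  then show ?thesis
    by (simp add: n power_int_minus fps_exp_power_mult fls_inverse_fps_to_fls flip: fps_to_fls_power)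
qed

text \<open>The coefficient defining \<open>a[n]\<close> is a residue in \<open>z\<close>; under
  \<open>w = e^z - 1\<close>, where \<open>dw = e^z dz\<close>, it becomes a residue in
  \<open>w\<close>. The Jacobian accounts for the exponent \<open>k - 1\<close> in place of
  \<open>k\<close>.\<close>

lemma sq_coeff_eq_test_series: "sq_coeff k j n = test_series k n $$ j"
proof -
  define E where "E = fps_exp 1 - (1 :: complex fps)"
  have E1: "fps_nth E 1 = 1" by (simp add: E_def)
  have E0: "fps_nth E 0 = 0" by (simp add: E_def)
  have En: "E \<noteq> 0" using E1 by auto
  have Es: "subdegree E = 1" by (rule subdegreeI) (use E0 E1 in auto)
  have En': "fps_to_fls E \<noteq> 0" using En by simp
  have "fps_ln 1 oo E = fps_X"
    unfolding E_def by (simp add: fps_ln_fps_exp_inv fps_inv)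
  then have lE: "fls_compose_fps log_series E = fls_X"
    by (simp add: log_series_def fls_compose_fps_to_fls[OF En E0])
  have oE: "fls_compose_fps one_plus_X E = fps_to_fls (fps_exp 1)"
    by (simp add: one_plus_X_def fls_compose_fps_add En E0) (simp add: E_def fps_to_fls_minus)
  \<comment> \<open>Its residue is the coefficient of \<open>X^j\<close> in the test series.\<close>
  define H where "H = fls_X powi (- j - 1) * test_series k n"
  have "fls_compose_fps H E = fps_to_fls E powi (- j - 1) * (fls_X powi n * fps_to_fls (fps_exp (of_int (k - 1))))"
    unfolding H_def test_series_def
    by (simp add: fls_compose_fps_mult fls_compose_fps_powi En E0 lE oE fps_exp_powi del: fls_X_power_int)
  moreover have "fps_deriv E = fps_exp 1" by (simp add: E_def)
  moreover have "fps_to_fls (fps_exp (of_int (k - 1))) * fps_to_fls (fps_exp 1) = fps_to_fls (fps_exp (of_int k :: complex))"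
    unfolding fls_times_fps_to_fls[symmetric] fps_exp_add_mult[symmetric] by simp
  ultimately have "fls_compose_fps H E * fps_to_fls (fps_deriv E) =
     fls_X powi n * (fps_to_fls (fps_exp (of_int k)) * fps_to_fls E powi (- j - 1))"
    by (simp only: mult.assoc) (simp only: mult_ac)
  moreover have e1: "- 1 - n = - n - 1" by simp
  ultimately have "(fls_compose_fps H E * fps_to_fls (fps_deriv E)) $$ (-1) = sq_coeff k j n"
    unfolding sq_coeff_def E_def[symmetric]
    by (simp add: fls_X_intpow_times_conv_shift e1)
  moreover have "H $$ (-1) = test_series k n $$ j"
    unfolding H_def fls_X_power_int fls_X_intpow_times_conv_shift by simp
  ultimately show ?thesis using fls_residue_compose_fps[OF En Es, of H] by simp
qed

section \<open>Kernels of the square bracket Borcherds identity\<close>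

text \<open>The lower index is an integer, with value zero for negative ones, so that
  \<open>gb_rec\<close> and the convolutions below hold without case distinctions.\<close>

definition gb :: "int \<Rightarrow> int \<Rightarrow> complex" where
  "gb s j = (if j < 0 then 0 else of_int s gchoose nat j)"

lemma one_plus_X_powi_nth_gb: "(one_plus_X powi s) $$ j = gb s j"
  by (simp add: one_plus_X_powi_nth gb_def)

lemma gb_neg: "j < 0 \<Longrightarrow> gb s j = 0"
  by (simp add: gb_def)

lemma gb_0 [simp]: "gb s 0 = 1"
  by (simp add: gb_def)

lemma gb_rec: "of_int (j + 1) * gb s (j + 1) = of_int (s - j) * gb s j"
proof (cases "j < 0")
  case True
  then show ?thesis by (cases "j = -1") (auto simp: gb_def)
next
  case False
  then obtain i where i: "j = int i" by (metis nonneg_int_cases not_less)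
  have "of_nat (Suc i) * (of_int s gchoose Suc i) = (of_int s - of_nat i) * (of_int s gchoose i :: complex)"
    using gbinomial_absorb_comp[of "of_int s :: complex" i] gbinomial_absorption[of i "of_int s :: complex"]
    by (simp add: algebra_simps)
  moreover have "nat (int i + 1) = Suc i" by simp
  ultimately show ?thesis by (simp add: gb_def i add.commute)
qed

text \<open>\<open>expand_zx p m\<close> is the coefficient of \<open>z^m x^(p-m)\<close> in the expansion of \<open>(z-x)^p\<close> for
  \<open>|z| > |x|\<close>, and \<open>expand_xz p m\<close> the one for \<open>|x| > |z|\<close>.\<close>

definition expand_zx :: "int \<Rightarrow> int \<Rightarrow> complex" where
  "expand_zx p m = (-1) powi (p - m) * gb p (p - m)"

definition expand_xz :: "int \<Rightarrow> int \<Rightarrow> complex" where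
  "expand_xz p m = (-1) powi (p - m) * gb p m"

lemma minus_one_powi_Suc: "(-1) powi (n + 1) = - ((-1) powi n :: complex)"
  by (simp add: power_int_add)

text \<open>Each term \<open>(z-x)^p (1+x)^(s-p)\<close> is an eigenvector, with eigenvalue \<open>s\<close>, of the derivation
  \<open>(1+z) d/dz + (1+x) d/dx\<close>; so are the products of powers of logarithms on the other side.\<close>

lemma expand_zx_term_rec:
  "of_int (q + 1) * (expand_zx p m * gb (s - p) (q + 1 - p + m)) +
   of_int (m + 1) * (expand_zx p (m + 1) * gb (s - p) (q - p + (m + 1))) =
   of_int (s - m - q) * (expand_zx p m * gb (s - p) (q - p + m))"
proof -
  define i where "i = p - m"
  define S where "S = ((-1) powi i :: complex)"
  have a: "of_int (m + 1) * gb p (i - 1) = of_int i * gb p i"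
    using gb_rec[of "i - 1" p] by (simp add: i_def)
  have b: "of_int (q - i + 1) * gb (s - p) (q - i + 1) = of_int (s - p - (q - i)) * gb (s - p) (q - i)"
    by (rule gb_rec)
  have z1: "expand_zx p m = S * gb p i" by (simp add: expand_zx_def i_def S_def)
  have z2: "expand_zx p (m + 1) = - S * gb p (i - 1)"
    using minus_one_powi_Suc[of "i - 1"] by (simp add: expand_zx_def i_def S_def algebra_simps)
  have e: "q + 1 - p + m = q - i + 1" "q - p + (m + 1) = q - i + 1" "q - p + m = q - i"
    by (auto simp: i_def)
  have "of_int (q + 1) * (S * gb p i * gb (s - p) (q - i + 1)) +
     of_int (m + 1) * (- S * gb p (i - 1) * gb (s - p) (q - i + 1)) =
     S * gb (s - p) (q - i + 1) * (of_int (q + 1) * gb p i - of_int (m + 1) * gb p (i - 1))"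
    by (simp add: algebra_simps)
  also have "\<dots> = S * gb p i * (of_int (q - i + 1) * gb (s - p) (q - i + 1))"
    unfolding a by (simp add: algebra_simps)
  also have "\<dots> = of_int (s - m - q) * (S * gb p i * gb (s - p) (q - i))"
    unfolding b by (simp add: i_def)
  finally show ?thesis unfolding z1 z2 e .
qed

lemma expand_xz_term_rec:
  "of_int (q + 1) * (expand_xz p m * gb (s - p) (q + 1 - p + m)) +
   of_int (m + 1) * (expand_xz p (m + 1) * gb (s - p) (q - p + (m + 1))) =
   of_int (s - m - q) * (expand_xz p m * gb (s - p) (q - p + m))"
proof -
  define j where "j = q - p + m"
  define S where "S = ((-1) powi (p - m) :: complex)"
  have a: "of_int (m + 1) * gb p (m + 1) = of_int (p - m) * gb p m" by (rule gb_rec)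
  have b: "of_int (j + 1) * gb (s - p) (j + 1) = of_int (s - p - j) * gb (s - p) j" by (rule gb_rec)
  have z1: "expand_xz p m = S * gb p m" by (simp add: expand_xz_def S_def)
  have z2: "expand_xz p (m + 1) = - S * gb p (m + 1)"
    using minus_one_powi_Suc[of "p - (m + 1)"] by (simp add: expand_xz_def S_def)
  have e: "q + 1 - p + m = j + 1" "q - p + (m + 1) = j + 1" "q - p + m = j"
    by (auto simp: j_def)
  have "of_int (q + 1) * (S * gb p m * gb (s - p) (j + 1)) +
     of_int (m + 1) * (- S * gb p (m + 1) * gb (s - p) (j + 1)) =
     S * gb (s - p) (j + 1) * (of_int (q + 1) * gb p m - of_int (m + 1) * gb p (m + 1))"
    by (simp add: algebra_simps)
  also have "\<dots> = S * gb p m * (of_int (j + 1) * gb (s - p) (j + 1))"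
    unfolding a by (simp add: j_def algebra_simps)
  also have "\<dots> = of_int (s - m - q) * (S * gb p m * gb (s - p) j)"
    unfolding b by (simp add: j_def)
  finally show ?thesis unfolding z1 z2 e .
qed

text \<open>The coefficients of \<open>(A - B)^l = \<Sum>i lcoef l i A^(l-i) B^i\<close>; the same
  numbers as \<open>derivative_coeff (- l - 1) i\<close>.\<close>

definition lcoef :: "int \<Rightarrow> nat \<Rightarrow> complex" where
  "lcoef l i = (-1) ^ i * (of_int l gchoose i)"

lemma lcoef_0 [simp]: "lcoef l 0 = 1"
  by (simp add: lcoef_def)

lemma lcoef_rec: "of_nat (Suc i) * lcoef l (Suc i) = - of_int (l - int i) * lcoef l i"
proof -
  have "nat (int i + 1) = Suc i" by simp
  then have h: "of_nat (Suc i) * (of_int l gchoose Suc i) = of_int (l - int i) * (of_int l gchoose i :: complex)"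
    using gb_rec[of "int i" l] by (simp add: gb_def add.commute)
  have "of_nat (Suc i) * lcoef l (Suc i) = - ((-1) ^ i * (of_nat (Suc i) * (of_int l gchoose Suc i)))"
    by (simp add: lcoef_def del: of_nat_Suc)
  also have "\<dots> = - ((-1) ^ i * (of_int (l - int i) * (of_int l gchoose i)))" by (simp only: h)
  also have "\<dots> = - of_int (l - int i) * lcoef l i" by (simp add: lcoef_def algebra_simps)
  finally show ?thesis .
qed

text \<open>\<open>T n\<close> and \<open>P n\<close> behave like \<open>ln(1+z)^n (1+z)^a\<close>
  and \<open>ln(1+x)^n (1+x)^b\<close>, and the sum like the expansion of
  \<open>(ln(1+z) - ln(1+x))^l (1+z)^a (1+x)^b\<close>. The derivation lowers one logarithm in each
  factor; by \<open>lcoef_rec\<close> these contributions cancel in neighbouring terms, except for a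
  boundary term that is zero by \<open>z\<close>. What remains is the eigenvalue
  \<open>a + b\<close>.\<close>

lemma log_kernel_rec:
  fixes T :: "int \<Rightarrow> int \<Rightarrow> complex" and P :: "int \<Rightarrow> int \<Rightarrow> complex"
  assumes T: "\<And>n m. of_int (m + 1) * T n (m + 1) = of_int n * T (n - 1) m + of_int (a - m) * T n m"
    and P: "\<And>n q. of_int (q + 1) * P n (q + 1) = of_int n * P (n - 1) q + of_int (b - q) * P n q"
    and z: "T (l - int L - 1) m * P (int L) q = 0"
  shows "(\<Sum>i<Suc L. lcoef l i * (of_int (q + 1) * (T (l - int i) m * P (int i) (q + 1)) + of_int (m + 1) * (T (l - int i) (m + 1) * P (int i) q)))
    = of_int (a + b - m - q) * (\<Sum>i<Suc L. lcoef l i * (T (l - int i) m * P (int i) q))"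
proof -
  define t where "t i = T (l - int i - 1) m * P (int i) q" for i
  have "lcoef l i * (of_int (q + 1) * (T (l - int i) m * P (int i) (q + 1)) + of_int (m + 1) * (T (l - int i) (m + 1) * P (int i) q))
    = of_int (a + b - m - q) * (lcoef l i * (T (l - int i) m * P (int i) q))
      + (lcoef l i * of_nat i * (T (l - int i) m * P (int i - 1) q) + lcoef l i * of_int (l - int i) * t i)" for i
  proof -
    have "of_int (q + 1) * (T (l - int i) m * P (int i) (q + 1)) + of_int (m + 1) * (T (l - int i) (m + 1) * P (int i) q)
      = T (l - int i) m * (of_int (q + 1) * P (int i) (q + 1)) + (of_int (m + 1) * T (l - int i) (m + 1)) * P (int i) q"
      by (simp only: mult_ac)
    also have "\<dots> = of_int (a + b - m - q) * (T (l - int i) m * P (int i) q) +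
        (of_nat i * (T (l - int i) m * P (int i - 1) q) + of_int (l - int i) * t i)"
      unfolding T P t_def by (simp add: algebra_simps)
    finally show ?thesis by (simp only: distrib_left mult_ac)
  qed
  moreover have "(\<Sum>i<Suc L. lcoef l i * of_nat i * (T (l - int i) m * P (int i - 1) q) + lcoef l i * of_int (l - int i) * t i) = 0"
  proof -
    have "(\<Sum>i<Suc L. lcoef l i * of_nat i * (T (l - int i) m * P (int i - 1) q)) =
      (\<Sum>i<L. lcoef l (Suc i) * of_nat (Suc i) * (T (l - int (Suc i)) m * P (int (Suc i) - 1) q))"
      by (simp add: sum.lessThan_Suc_shift del: sum.lessThan_Suc of_nat_Suc)
    also have "\<dots> = (\<Sum>i<L. - (lcoef l i * of_int (l - int i) * t i))"
    proof (rule sum.cong)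
      fix i
      have "lcoef l (Suc i) * of_nat (Suc i) = - of_int (l - int i) * lcoef l i"
        using lcoef_rec[of i l] by (simp add: mult.commute)
      moreover have "l - int (Suc i) = l - int i - 1" "int (Suc i) - 1 = int i" by auto
      ultimately show "lcoef l (Suc i) * of_nat (Suc i) * (T (l - int (Suc i)) m * P (int (Suc i) - 1) q) =
        - (lcoef l i * of_int (l - int i) * t i)"
        unfolding t_def by (simp only:) (simp add: algebra_simps)
    qed simp
    also have "\<dots> = - (\<Sum>i<Suc L. lcoef l i * of_int (l - int i) * t i)"
      using z by (simp add: sum_negf t_def)
    finally show ?thesis by (simp add: sum.distrib del: sum.lessThan_Suc)
  qed
  ultimately show ?thesis by (simp add: sum.distrib sum_distrib_left del: sum.lessThan_Suc)
qed

text \<open>With \<open>y = (z-x)/(1+x)\<close> one has \<open>1 + y = (1+z)/(1+x)\<close>, so the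
  test series evaluated at \<open>y\<close> and multiplied by \<open>(1+x)^(k-1)\<close> is
  \<open>(ln(1+z) - ln(1+x))^l (1+z)^(k-1)\<close>. The lemma compares coefficients of
  \<open>z^m x^q\<close> for \<open>|z| > |x|\<close>. Both sides are eigenvectors of
  \<open>(1+z) d/dz + (1+x) d/dx\<close> with eigenvalue \<open>k - 1\<close>; they agree at
  \<open>x^0\<close>, and the eigenvalue equation determines the coefficient of
  \<open>x^(q+1)\<close> because \<open>q + 1\<close> is nonzero.\<close>

lemma kernel1:
  assumes "q < int L" "m + q \<le> R"
  shows "(\<Sum>p\<in>{l..R}. test_series k l $$ p * (expand_zx p m * gb (k - 1 - p) (q - p + m))) =
    (\<Sum>i<L. lcoef l i * (test_series k (l - int i) $$ m * (log_series powi int i) $$ q))"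
proof -
  define A where "A R m q = (\<Sum>p\<in>{l..R}. test_series k l $$ p * (expand_zx p m * gb (k - 1 - p) (q - p + m)))" for R m q
  define B where "B L m q = (\<Sum>i<L. lcoef l i * (test_series k (l - int i) $$ m * (log_series powi int i) $$ q))" for L m q
  have Aneg: "A R m q = 0" if "q < 0" for R m q
    unfolding A_def
  proof (intro sum.neutral ballI)
    fix p
    have "expand_zx p m = 0 \<or> gb (k - 1 - p) (q - p + m) = 0"
      using that by (cases "p < m") (auto simp: expand_zx_def gb_neg)
    then show "test_series k l $$ p * (expand_zx p m * gb (k - 1 - p) (q - p + m)) = 0" by auto
  qed
  have Bneg: "B L m q = 0" if "q < 0" for L m q
    unfolding B_def by (intro sum.neutral ballI) (use that in \<open>simp add: log_series_powi_below del: power_int_of_nat\<close>)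
  \<comment> \<open>The tails of both sums vanish, so \<open>R\<close> and \<open>L\<close> may
    change in the course of the induction.\<close>
  have Aind: "A R m q = A (m + q) m q" if "m + q \<le> R" for R m q
    unfolding A_def by (rule sum.mono_neutral_right) (use that in \<open>auto simp: gb_neg\<close>)
  have Bind: "B L m q = B (Suc (nat q)) m q" if "q < int L" "0 \<le> q" for L m q
    unfolding B_def by (rule sum.mono_neutral_right)
      (use that in \<open>auto simp: not_less log_series_powi_below simp del: power_int_of_nat\<close>)
  have A0: "A R m 0 = test_series k l $$ m" if "m \<le> R" for R m
  proof -
    have "test_series k l $$ p * (expand_zx p m * gb (k - 1 - p) (0 - p + m)) = (if p = m then test_series k l $$ m else 0)" for p
      by (cases "p < m"; cases "p = m") (auto simp: expand_zx_def gb_neg)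
    then have "A R m 0 = (\<Sum>p\<in>{l..R}. if p = m then test_series k l $$ m else 0)" unfolding A_def by simp
    also have "\<dots> = test_series k l $$ m" using that test_series_below[of m l k] by auto
    finally show ?thesis .
  qed
  have B0: "B L m 0 = test_series k l $$ m" if "0 < L" for L m
  proof -
    have "B L m 0 = B (Suc 0) m 0" using Bind[of 0 L m] that by simp
    then show ?thesis by (simp add: B_def)
  qed
  have main: "\<forall>m R L. q < int L \<longrightarrow> m + q \<le> R \<longrightarrow> A R m q = B L m q" if "0 \<le> q" for q
    using that
  proof (induction q rule: int_ge_induct)
    case base then show ?case using A0 B0 by auto
  next
    case (step q)
    show ?case
    proof (intro allI impI)
      fix m R L assume L: "q + 1 < int L" and R: "m + (q + 1) \<le> R"
      obtain L' where L': "L = Suc L'" using L step.hyps by (cases L) auto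
      have "of_int (q + 1) * A R m (q + 1) + of_int (m + 1) * A R (m + 1) q =
        of_int (k - 1 - m - q) * A R m q"
        unfolding A_def sum_distrib_left sum.distrib[symmetric]
      proof (rule sum.cong)
        fix p
        show "of_int (q + 1) * (test_series k l $$ p * (expand_zx p m * gb (k - 1 - p) (q + 1 - p + m))) +
          of_int (m + 1) * (test_series k l $$ p * (expand_zx p (m + 1) * gb (k - 1 - p) (q - p + (m + 1)))) =
          of_int (k - 1 - m - q) * (test_series k l $$ p * (expand_zx p m * gb (k - 1 - p) (q - p + m)))"
          using arg_cong[OF expand_zx_term_rec[of q p m "k - 1"], of "\<lambda>x. test_series k l $$ p * x"]
          by (simp only: distrib_left mult.left_commute)
      qed simp
      moreover have "of_int (q + 1) * B L m (q + 1) + of_int (m + 1) * B L (m + 1) q =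
        of_int (k - 1 - m - q) * B L m q"
      proof -
        have "(\<Sum>i<Suc L'. lcoef l i * (of_int (q + 1) * (test_series k (l - int i) $$ m * (log_series powi int i) $$ (q + 1)) +
            of_int (m + 1) * (test_series k (l - int i) $$ (m + 1) * (log_series powi int i) $$ q)))
          = of_int (k - 1 + 0 - m - q) * (\<Sum>i<Suc L'. lcoef l i * (test_series k (l - int i) $$ m * (log_series powi int i) $$ q))"
        proof (rule log_kernel_rec[where T = "\<lambda>n m. test_series k n $$ m" and P = "\<lambda>n q. (log_series powi n) $$ q"])
          show "test_series k (l - int L' - 1) $$ m * (log_series powi int L') $$ q = 0"
            using L L' by (simp add: log_series_powi_below del: power_int_of_nat)
        qed (use test_series_rec log_series_powi_rec in auto)
        then show ?thesis unfolding B_def L'[symmetric]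
          by (simp add: sum_distrib_left sum.distrib[symmetric] distrib_left mult.left_commute del: power_int_of_nat)
      qed
      moreover have "A R (m + 1) q = B L (m + 1) q" "A R m q = B L m q" using step.IH L R by auto
      ultimately have "of_int (q + 1) * A R m (q + 1) = of_int (q + 1) * B L m (q + 1)"
        by (metis (no_types, lifting) add_right_imp_eq)
      moreover have "(of_int (q + 1) :: complex) \<noteq> 0" using step.hyps by (simp only: of_int_eq_0_iff)
      ultimately show "A R m (q + 1) = B L m (q + 1)" by (simp only: mult_cancel_left) blast
    qed
  qed
  show ?thesis
  proof (cases "q < 0")
    case True
    from Aneg[OF this, of R m] Bneg[OF this, of L m] show ?thesis unfolding A_def B_def by (simp only:)
  next
    case False then show ?thesis using main[of q] assms unfolding A_def B_def by auto
  qed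
qed

text \<open>The involution \<open>x \<mapsto> -x/(1+x)\<close> inverts \<open>1+x\<close> and changes the sign of \<open>ln(1+x)\<close>.\<close>

definition inv_fps :: "complex fps" where "inv_fps = - (fps_X * inverse (1 + fps_X))"

lemma inv_fps_0: "fps_nth inv_fps 0 = 0"
  by (simp add: inv_fps_def)

lemma inverse_one_plus_X: "inverse one_plus_X = fps_to_fls (inverse (1 + fps_X))"
proof -
  have "one_plus_X = fps_to_fls (1 + fps_X)" by (simp add: one_plus_X_def)
  moreover have "subdegree (1 + fps_X :: complex fps) = 0" by (rule subdegreeI) auto
  then have "inverse (fps_to_fls (1 + fps_X)) = fps_to_fls (inverse (1 + fps_X :: complex fps))"
    by (rule fls_inverse_fps_to_fls)
  ultimately show ?thesis by metis
qed

lemma inv_fps_fls: "fps_to_fls inv_fps = - (fls_X * inverse one_plus_X)"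
  by (simp add: inv_fps_def inverse_one_plus_X fls_times_fps_to_fls)

lemma inv_fps_nonzero: "inv_fps \<noteq> 0"
  using inv_fps_fls by (metis fls_X_nonzero fps_zero_to_fls inverse_nonzero_iff_nonzero mult_eq_0_iff neg_equal_0_iff_equal one_plus_X_nonzero)

lemma one_plus_inv_fps: "1 + inv_fps = inverse (1 + fps_X)"
proof -
  have "(1 + fps_X) * inverse (1 + fps_X) = (1 :: complex fps)" by (rule inverse_mult_eq_1') simp
  then show ?thesis unfolding inv_fps_def by (simp add: algebra_simps)
qed

lemma one_plus_X_compose_inv: "fls_compose_fps one_plus_X inv_fps = inverse one_plus_X"
proof -
  have "fls_compose_fps one_plus_X inv_fps = fps_to_fls (1 + inv_fps)"
    by (simp add: one_plus_X_def fls_compose_fps_add inv_fps_0 inv_fps_nonzero)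
  then show ?thesis by (simp only: one_plus_inv_fps inverse_one_plus_X)
qed

lemma log_series_compose_inv: "fls_compose_fps log_series inv_fps = - log_series"
proof -
  define u where "u = inverse (1 + fps_X :: complex fps)"
  have u: "(1 + fps_X) * u = 1" unfolding u_def by (rule inverse_mult_eq_1') simp
  have c: "inverse (1 + fps_X) oo inv_fps = 1 + fps_X"
  proof -
    have "inverse (1 + fps_X) oo inv_fps = inverse ((1 + fps_X) oo inv_fps)"
      by (rule fps_inverse_compose) (auto simp: inv_fps_0)
    also have "(1 + fps_X) oo inv_fps = u"
      by (simp add: fps_compose_add_distrib inv_fps_0 one_plus_inv_fps u_def)
    also have "inverse u = 1 + fps_X" unfolding u_def by (rule fps_inverse_idempotent) simp
    finally show ?thesis .
  qed
  have du: "fps_deriv inv_fps = - (u * u)"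
  proof -
    have "inv_fps = u - 1" using one_plus_inv_fps by (simp add: u_def algebra_simps)
    from arg_cong[OF this, of fps_deriv] have "fps_deriv inv_fps = fps_deriv u" by simp
    moreover have "fps_deriv u = - fps_deriv (1 + fps_X) * u\<^sup>2"
      unfolding u_def by (rule fps_inverse_deriv) simp
    ultimately show ?thesis by (simp add: power2_eq_square)
  qed
  have "fps_deriv (fps_ln 1 oo inv_fps) = (1 + fps_X) * - (u * u)"
    by (simp add: fps_compose_deriv inv_fps_0 fps_ln_deriv c du)
  also have "\<dots> = - (((1 + fps_X) * u) * u)" by (simp add: algebra_simps)
  also have "\<dots> = fps_deriv (- fps_ln 1)" unfolding u by (simp add: fps_ln_deriv u_def)
  finally have "fps_ln 1 oo inv_fps = - fps_ln 1"
    unfolding fps_deriv_eq_iff by simp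
  then show ?thesis by (simp add: log_series_def fls_compose_fps_to_fls[OF inv_fps_nonzero inv_fps_0])
qed

text \<open>Substitution can be carried out term by term on the finite part, while the remainder
  stays divisible by the power \<open>R + 1\<close> of the substituted series.\<close>

lemma fls_trunc_decomp:
  fixes f :: "complex fls"
  assumes "\<And>j. j < l \<Longrightarrow> f $$ j = 0"
  obtains h where "f = (\<Sum>p\<in>{l..R}. fls_const (f $$ p) * fls_X powi p) + fls_X powi (R + 1) * fps_to_fls h"
proof -
  define g where "g = f - (\<Sum>p\<in>{l..R}. fls_const (f $$ p) * fls_X powi p)"
  have gn: "g $$ j = (if j \<in> {l..R} then 0 else f $$ j)" for j
  proof -
    have "(\<Sum>p\<in>{l..R}. fls_const (f $$ p) * fls_X powi p) $$ j = (\<Sum>p\<in>{l..R}. if p = j then f $$ p else 0)"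
      unfolding fls_nth_sum by (rule sum.cong) auto
    then show ?thesis by (auto simp: g_def)
  qed
  define h where "h = fls_regpart (fls_shift (R + 1) g)"
  have "g = fls_X powi (R + 1) * fps_to_fls h"
    unfolding fls_X_power_int fls_X_intpow_times_conv_shift
    by (rule fls_eqI) (use assms in \<open>auto simp: h_def fls_X_power_int fls_X_intpow_times_conv_shift gn\<close>)
  then have "f = (\<Sum>p\<in>{l..R}. fls_const (f $$ p) * fls_X powi p) + fls_X powi (R + 1) * fps_to_fls h"
    by (simp add: g_def algebra_simps)
  then show ?thesis by (rule that)
qed

lemma fls_compose_sum:
  "H \<noteq> 0 \<Longrightarrow> fps_nth H 0 = 0 \<Longrightarrow> fls_compose_fps (\<Sum>i\<in>A. f i) H = (\<Sum>i\<in>A. fls_compose_fps (f i) (H :: complex fps))"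
  by (induction A rule: infinite_finite_induct) (auto simp: fls_compose_fps_add)

text \<open>This is the slice \<open>z = 0\<close> of the expansion for \<open>|x| > |z|\<close>.
  There \<open>(z-x)/(1+x)\<close> becomes \<open>inv_fps\<close>, so the identity says that the
  test series composed with the involution, times \<open>(1+x)^(k-1)\<close>, is
  \<open>(- ln(1+x))^l\<close>.\<close>

lemma kernel2_base:
  assumes "q \<le> R"
  shows "(\<Sum>p\<in>{l..R}. test_series k l $$ p * ((-1) powi p * gb (k - 1 - p) (q - p))) = (-1) powi l * (log_series powi l) $$ q"
proof -
  note C = inv_fps_nonzero inv_fps_0
  define y where "y = fps_to_fls inv_fps"
  have y: "y powi p * one_plus_X powi (k - 1) = fls_const ((-1) powi p) * (fls_X powi p * one_plus_X powi (k - 1 - p))" for p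
  proof -
    have "y = (- 1) * (fls_X * inverse one_plus_X)" by (simp add: y_def inv_fps_fls)
    then have "y powi p = (- 1) powi p * (fls_X powi p * inverse one_plus_X powi p)"
      by (simp only: power_int_mult_distrib)
    also have "(- 1 :: complex fls) powi p = fls_const ((-1) powi p)"
      by (simp add: fls_const_power_int)
    also have "inverse one_plus_X powi p = one_plus_X powi (- p)" by (simp add: power_int_minus power_int_inverse)
    finally have "y powi p * one_plus_X powi (k - 1) = fls_const ((-1) powi p) * (fls_X powi p * (one_plus_X powi (- p) * one_plus_X powi (k - 1)))"
      by (simp only: mult_ac)
    also have "one_plus_X powi (- p) * one_plus_X powi (k - 1) = one_plus_X powi (k - 1 - p)"
      by (simp add: power_int_add[symmetric])
    finally show ?thesis .
  qed
  have cX: "fls_compose_fps (fls_X powi p) inv_fps = y powi p" for p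
    unfolding fls_compose_fps_powi[OF C] by (simp add: y_def)
  have "fls_compose_fps (test_series k l) inv_fps * one_plus_X powi (k - 1) =
      (- log_series) powi l * (inverse one_plus_X powi (k - 1) * one_plus_X powi (k - 1))"
    unfolding test_series_def by (simp add: fls_compose_fps_mult[OF C] fls_compose_fps_powi[OF C] log_series_compose_inv one_plus_X_compose_inv)
  also have "inverse one_plus_X powi (k - 1) * one_plus_X powi (k - 1) = 1"
    by (simp add: power_int_mult_distrib[symmetric])
  also have "(- log_series) powi l * 1 = fls_const ((-1) powi l) * log_series powi l"
  proof -
    have "(- log_series) powi l = (-1) powi l * log_series powi l"
      using power_int_mult_distrib[of "-1" log_series l] by simp
    also have "(- 1 :: complex fls) powi l = fls_const ((-1) powi l)"
      by (simp add: fls_const_power_int)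
    finally show ?thesis by simp
  qed
  finally have e1: "(fls_compose_fps (test_series k l) inv_fps * one_plus_X powi (k - 1)) $$ q = (-1) powi l * (log_series powi l) $$ q"
    by simp
  obtain h where h: "test_series k l = (\<Sum>p\<in>{l..R}. fls_const (test_series k l $$ p) * fls_X powi p) + fls_X powi (R + 1) * fps_to_fls h"
    using fls_trunc_decomp[of l "test_series k l"] test_series_below by blast
  have "fls_compose_fps (test_series k l) inv_fps =
     (\<Sum>p\<in>{l..R}. fls_const (test_series k l $$ p) * y powi p) + y powi (R + 1) * fps_to_fls (h oo inv_fps)"
    by (subst h) (simp only: fls_compose_fps_add[OF C] fls_compose_sum[OF C] fls_compose_fps_mult[OF C] cX
        fls_compose_fps_to_fls[OF C] fls_compose_fps_const)
  then have "fls_compose_fps (test_series k l) inv_fps * one_plus_X powi (k - 1) =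
     (\<Sum>p\<in>{l..R}. fls_const (test_series k l $$ p) * (y powi p * one_plus_X powi (k - 1))) + (y powi (R + 1) * one_plus_X powi (k - 1)) * fps_to_fls (h oo inv_fps)"
    by (simp only: distrib_left distrib_right sum_distrib_left sum_distrib_right mult_ac)
  then have "(fls_compose_fps (test_series k l) inv_fps * one_plus_X powi (k - 1)) $$ q =
     (\<Sum>p\<in>{l..R}. test_series k l $$ p * ((-1) powi p * (fls_X powi p * one_plus_X powi (k - 1 - p)) $$ q)) +
     (fls_const ((-1) powi (R + 1)) * (fls_X powi (R + 1) * (one_plus_X powi (k - 1 - (R + 1)) * fps_to_fls (h oo inv_fps)))) $$ q"
    unfolding y by (simp add: fls_nth_sum mult.assoc del: fls_X_power_int)
  \<comment> \<open>The remainder starts at exponent \<open>R + 1\<close>, which exceeds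
    \<open>q\<close>.\<close>
  also have "(fls_const ((-1) powi (R + 1)) * (fls_X powi (R + 1) * (one_plus_X powi (k - 1 - (R + 1)) * fps_to_fls (h oo inv_fps)))) $$ q = 0"
  proof -
    have "(one_plus_X powi s * fps_to_fls g) $$ j = 0" if "j < 0" for s g j
      unfolding one_plus_X_def one_plus_fls_X_powi_eq fls_times_fps_to_fls[symmetric] using that by simp
    then show ?thesis using assms
      unfolding fls_mult_const_nth fls_X_power_int fls_X_intpow_times_conv_shift by simp
  qed
  finally show ?thesis using e1
    unfolding fls_X_power_int fls_X_intpow_times_conv_shift by (simp add: one_plus_X_powi_nth_gb)
qed

text \<open>The same function as in \<open>kernel1\<close>, expanded for \<open>|x| > |z|\<close>,
  with the induction now on the exponent of \<open>z\<close>. The base case is deeper than before: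
  at \<open>x^0\<close> only one \<open>p\<close> contributed, at \<open>z^0\<close> all of them
  do.\<close>

lemma kernel2:
  assumes "m < int L" "m + q \<le> R"
  shows "(\<Sum>p\<in>{l..R}. test_series k l $$ p * (expand_xz p m * gb (k - 1 - p) (q - p + m))) =
    (-1) powi l * (\<Sum>i<L. lcoef l i * (test_series k (int i) $$ m * (log_series powi (l - int i)) $$ q))"
proof -
  define A where "A R m q = (\<Sum>p\<in>{l..R}. test_series k l $$ p * (expand_xz p m * gb (k - 1 - p) (q - p + m)))" for R m q
  define B where "B L m q = (-1) powi l * (\<Sum>i<L. lcoef l i * ((log_series powi (l - int i)) $$ q * test_series k (int i) $$ m))" for L m q
  have Aneg: "A R m q = 0" if "m < 0" for R m q
    unfolding A_def by (intro sum.neutral ballI) (use that in \<open>simp add: expand_xz_def gb_neg\<close>)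
  have Bneg: "B L m q = 0" if "m < 0" for L m q
    unfolding B_def mult_eq_0_iff by (intro disjI2 sum.neutral ballI) (use that in \<open>simp add: test_series_below\<close>)
  have A0: "A R 0 q = (-1) powi l * (log_series powi l) $$ q" if "q \<le> R" for R q
    using kernel2_base[OF that, of k l] by (simp add: A_def expand_xz_def)
  have B0: "B L 0 q = (-1) powi l * (log_series powi l) $$ q" if "0 < L" for L q
  proof -
    have "(\<Sum>i<L. lcoef l i * ((log_series powi (l - int i)) $$ q * test_series k (int i) $$ 0)) =
      (\<Sum>i<L. if i = 0 then (log_series powi l) $$ q else 0)"
      by (rule sum.cong) (auto simp: test_series_0)
    then show ?thesis using that by (simp add: B_def)
  qed
  have main: "\<forall>q R L. m < int L \<longrightarrow> m + q \<le> R \<longrightarrow> A R m q = B L m q" if "0 \<le> m" for m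
    using that
  proof (induction m rule: int_ge_induct)
    case base then show ?case using A0 B0 by auto
  next
    case (step m)
    show ?case
    proof (intro allI impI)
      fix q R L assume L: "m + 1 < int L" and R: "m + 1 + q \<le> R"
      obtain L' where L': "L = Suc L'" using L step.hyps by (cases L) auto
      have "of_int (q + 1) * A R m (q + 1) + of_int (m + 1) * A R (m + 1) q =
        of_int (k - 1 - m - q) * A R m q"
        unfolding A_def sum_distrib_left sum.distrib[symmetric]
      proof (rule sum.cong)
        fix p
        show "of_int (q + 1) * (test_series k l $$ p * (expand_xz p m * gb (k - 1 - p) (q + 1 - p + m))) +
          of_int (m + 1) * (test_series k l $$ p * (expand_xz p (m + 1) * gb (k - 1 - p) (q - p + (m + 1)))) =
          of_int (k - 1 - m - q) * (test_series k l $$ p * (expand_xz p m * gb (k - 1 - p) (q - p + m)))"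
          using arg_cong[OF expand_xz_term_rec[of q p m "k - 1"], of "\<lambda>x. test_series k l $$ p * x"]
          by (simp only: distrib_left mult.left_commute)
      qed simp
      moreover have "of_int (q + 1) * B L m (q + 1) + of_int (m + 1) * B L (m + 1) q =
        of_int (k - 1 - m - q) * B L m q"
      proof -
        define S where "S g = (\<Sum>i<Suc L'. lcoef l i * g i)" for g
        have *: "S (\<lambda>i. of_int (m + 1) * ((log_series powi (l - int i)) $$ q * test_series k (int i) $$ (m + 1)) +
            of_int (q + 1) * ((log_series powi (l - int i)) $$ (q + 1) * test_series k (int i) $$ m))
          = of_int (0 + (k - 1) - q - m) * S (\<lambda>i. (log_series powi (l - int i)) $$ q * test_series k (int i) $$ m)"
          unfolding S_def
        proof (rule log_kernel_rec[where T = "\<lambda>n m. (log_series powi n) $$ m" and P = "\<lambda>n q. test_series k n $$ q"])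
          show "(log_series powi (l - int L' - 1)) $$ q * test_series k (int L') $$ m = 0"
            using L L' by (simp add: test_series_below)
        qed (use test_series_rec log_series_powi_rec in auto)
        have S2: "S (\<lambda>i. a * f i + b * g i) = b * S g + a * S f" for a b f g
          unfolding S_def sum_distrib_left sum.distrib[symmetric] by (simp only: distrib_left mult_ac add_ac)
        have BS: "B L m' q' = (-1) powi l * S (\<lambda>i. (log_series powi (l - int i)) $$ q' * test_series k (int i) $$ m')" for m' q'
          by (simp only: B_def S_def L')
        have "0 + (k - 1) - q - m = k - 1 - m - q" by simp
        then show ?thesis using arg_cong[OF *[unfolded S2], of "\<lambda>x. (-1) powi l * x"] unfolding BS
          by (simp only: distrib_left mult.left_commute)
      qed
      moreover have "A R m (q + 1) = B L m (q + 1)" "A R m q = B L m q" using step.IH L R by auto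
      ultimately have "of_int (m + 1) * A R (m + 1) q = of_int (m + 1) * B L (m + 1) q"
        by (metis (no_types, lifting) add_left_imp_eq)
      moreover have "(of_int (m + 1) :: complex) \<noteq> 0" using step.hyps by (simp only: of_int_eq_0_iff)
      ultimately show "A R (m + 1) q = B L (m + 1) q" by (simp only: mult_cancel_left) blast
    qed
  qed
  have "A R m q = B L m q"
  proof (cases "m < 0")
    case True
    from Aneg[OF this, of R q] Bneg[OF this, of L q] show ?thesis by (simp only:)
  next
    case False then show ?thesis using main[of m] assms by auto
  qed
  then show ?thesis unfolding A_def B_def by (simp only: mult.commute)
qed

section \<open>Ordinary modes, square bracket modes and associativity\<close>

section \<open>Modes and smeared modes\<close>

locale voa_loc =
  fixes V :: "'v::ab_group_add voa_data"
  assumes voa: "voa V"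
begin

abbreviation "sc \<equiv> scal V"
abbreviation "md \<equiv> vmode V"

lemma vsp: "vector_space sc"
  by (rule voa[unfolded voa_def, THEN conjunct1])

end

sublocale voa_loc \<subseteq> vs: vector_space "scal V"
  by (rule vsp)

context voa_loc begin

lemma md_add1: "md (a + b) n c = md a n c + md b n c"
  by (rule voa[unfolded voa_def, THEN conjunct2, THEN conjunct1, rule_format])

lemma md_scale1: "md (sc r a) n c = sc r (md a n c)"
  by (rule voa[unfolded voa_def, THEN conjunct2, THEN conjunct2, THEN conjunct1, rule_format])

lemma md_add2: "md a n (b + c) = md a n b + md a n c"
  by (rule voa[unfolded voa_def, THEN conjunct2, THEN conjunct2, THEN conjunct2, THEN conjunct1, rule_format])

lemma md_scale2: "md a n (sc r c) = sc r (md a n c)"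
  by (rule voa[unfolded voa_def, THEN conjunct2, THEN conjunct2, THEN conjunct2, THEN conjunct2, THEN conjunct1, rule_format])

lemma md_trunc: "\<exists>N. \<forall>n\<ge>N. md a n b = 0"
  by (rule voa[unfolded voa_def, THEN conjunct2, THEN conjunct2, THEN conjunct2, THEN conjunct2, THEN conjunct2, THEN conjunct1, rule_format])

lemma md_vac: "md (vac V) n b = (if n = -1 then b else 0)"
  by (rule voa[unfolded voa_def, THEN conjunct2, THEN conjunct2, THEN conjunct2, THEN conjunct2, THEN conjunct2, THEN conjunct2, THEN conjunct1, rule_format])

lemma md_creation: "md a (-1) (vac V) = a" "n \<ge> 0 \<Longrightarrow> md a n (vac V) = 0"
  by (rule voa[unfolded voa_def, THEN conjunct2, THEN conjunct2, THEN conjunct2, THEN conjunct2, THEN conjunct2, THEN conjunct2, THEN conjunct2, THEN conjunct1, THEN spec, THEN conjunct1], rule voa[unfolded voa_def, THEN conjunct2, THEN conjunct2, THEN conjunct2, THEN conjunct2, THEN conjunct2, THEN conjunct2, THEN conjunct2, THEN conjunct1, THEN spec, THEN conjunct2, rule_format])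

lemma jacobi: "Sum_any (\<lambda>i::nat. sc (of_int m gchoose i) (md (md a (l + int i) b) (m + n - int i) c)) =
  Sum_any (\<lambda>i::nat. sc ((-1) ^ i * (of_int l gchoose i))
    (md a (m + l - int i) (md b (n + int i) c) - sc ((-1) powi l) (md b (n + l - int i) (md a (m + int i) c))))"
  by (rule voa[unfolded voa_def, THEN conjunct2, THEN conjunct2, THEN conjunct2, THEN conjunct2, THEN conjunct2, THEN conjunct2, THEN conjunct2, THEN conjunct2, THEN conjunct1, rule_format])

lemma Lm_comm: "Lm V m (Lm V n v) - Lm V n (Lm V m v) =
   sc (of_int (m - n)) (Lm V (m + n) v) + (if m + n = 0 then sc (of_int (m ^ 3 - m) / 12 * cc V) v else 0)"
  by (rule voa[unfolded voa_def, THEN conjunct2, THEN conjunct2, THEN conjunct2, THEN conjunct2, THEN conjunct2, THEN conjunct2, THEN conjunct2, THEN conjunct2, THEN conjunct2, THEN conjunct1, rule_format])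

lemma md_deriv: "md (Lm V (-1) a) n b = sc (- of_int n) (md a (n - 1) b)"
  by (rule voa[unfolded voa_def, THEN conjunct2, THEN conjunct2, THEN conjunct2, THEN conjunct2, THEN conjunct2, THEN conjunct2, THEN conjunct2, THEN conjunct2, THEN conjunct2, THEN conjunct2, THEN conjunct1, rule_format])

lemma ex_homog_decomp: "\<exists>f. homog_decomp V v f"
  by (rule voa[unfolded voa_def, THEN conjunct2, THEN conjunct2, THEN conjunct2, THEN conjunct2, THEN conjunct2, THEN conjunct2, THEN conjunct2, THEN conjunct2, THEN conjunct2, THEN conjunct2, THEN conjunct2, THEN conjunct1, rule_format])

lemma wt_finite_span: "\<exists>S. finite S \<and> vs.span S = wtspace V (of_int k)"
  by (rule voa[unfolded voa_def, THEN conjunct2, THEN conjunct2, THEN conjunct2, THEN conjunct2, THEN conjunct2, THEN conjunct2, THEN conjunct2, THEN conjunct2, THEN conjunct2, THEN conjunct2, THEN conjunct2, THEN conjunct2, THEN conjunct1, rule_format])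

lemma md_zero1 [simp]: "md 0 n c = 0" using md_add1[of 0 0 n c] by simp
lemma md_zero2 [simp]: "md a n 0 = 0" using md_add2[of a n 0 0] by simp
lemma Sum_any_single:
  assumes "\<And>i. i \<noteq> j \<Longrightarrow> f i = 0" shows "Sum_any f = (f j :: 'b::comm_monoid_add)"
proof -
  have "Sum_any f = sum f {j}" by (rule Sum_any.expand_superset) (use assms in auto)
  then show ?thesis by simp
qed

text \<open>The case \<open>m = 0\<close> of the Jacobi identity, in which the left sum collapses to
  its first term.\<close>

lemma borcherds_assoc: "md (md a l b) n c =
  Sum_any (\<lambda>i. sc (lcoef l i) (md a (l - int i) (md b (n + int i) c) - sc ((-1) powi l) (md b (n + l - int i) (md a (int i) c))))"
proof -
  have "Sum_any (\<lambda>i::nat. sc (of_int 0 gchoose i) (md (md a (l + int i) b) (0 + n - int i) c)) = md (md a l b) n c"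
    by (subst Sum_any_single[of 0]) (auto simp: gbinomial_0_left)
  then show ?thesis using jacobi[of 0 a l b n c] by (simp add: lcoef_def)
qed

text \<open>The Jacobi identity for the conformal vector with \<open>m = 1\<close>,
  \<open>l = 0\<close>. Two terms survive on the left, and translation covariance evaluates the one
  with \<open>L(-1)\<close>.\<close>

lemma Lm0_comm: "Lm V 0 (md a n c) - md a n (Lm V 0 c) = md (Lm V 0 a) n c - sc (of_int (n + 1)) (md a n c)"
proof -
  have "Sum_any (\<lambda>i::nat. sc (of_int 1 gchoose i) (md (md (conf V) (0 + int i) a) (1 + n - int i) c)) =
    (\<Sum>i<2. sc (of_int 1 gchoose i) (md (md (conf V) (0 + int i) a) (1 + n - int i) c))"
  proof (rule Sum_any_lessThan)
    fix i :: nat assume "2 \<le> i"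
    then have "(of_int 1 gchoose i :: complex) = 0" by (metis One_nat_def binomial_eq_0 binomial_gbinomial less_eq_Suc_le numeral_2_eq_2 of_int_1 of_nat_0 of_nat_1)
    then show "sc (of_int 1 gchoose i) (md (md (conf V) (0 + int i) a) (1 + n - int i) c) = 0" by simp
  qed
  also have "\<dots> = md (Lm V (-1) a) (n + 1) c + md (Lm V 0 a) n c"
    by (simp add: numeral_2_eq_2 Lm_def add.commute)
  finally have l: "Sum_any (\<lambda>i::nat. sc (of_int 1 gchoose i) (md (md (conf V) (0 + int i) a) (1 + n - int i) c)) =
     sc (- of_int (n + 1)) (md a n c) + md (Lm V 0 a) n c"
    unfolding md_deriv by simp
  have "Sum_any (\<lambda>i::nat. sc ((-1) ^ i * (of_int 0 gchoose i))
    (md (conf V) (1 + 0 - int i) (md a (n + int i) c) - sc ((-1) powi 0) (md a (n + 0 - int i) (md (conf V) (1 + int i) c))))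
    = md (conf V) 1 (md a n c) - md a n (md (conf V) 1 c)"
    by (subst Sum_any_single[of 0]) (auto simp: gbinomial_0_left)
  from trans[OF trans[OF l[symmetric] jacobi[of 1 "conf V" 0 a n c]] this] show ?thesis
    by (simp add: Lm_def vs.scale_minus_left algebra_simps)
qed

lemma wtspace_iff: "v \<in> wtspace V s \<longleftrightarrow> Lm V 0 v = sc s v"
  by (simp add: wtspace_def)

lemma md_wt:
  assumes "a \<in> wtspace V (of_int k)" "c \<in> wtspace V s"
  shows "md a n c \<in> wtspace V (s + of_int (k - n - 1))"
proof -
  have "Lm V 0 (md a n c) = md a n (sc s c) + md (sc (of_int k) a) n c - sc (of_int (n + 1)) (md a n c)"
    using Lm0_comm[of a n c] assms by (simp add: wtspace_iff algebra_simps)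
  also have "\<dots> = sc (s + of_int k - of_int (n + 1)) (md a n c)"
    by (simp only: md_scale1 md_scale2 vs.scale_left_distrib vs.scale_left_diff_distrib)
  also have "s + of_int k - of_int (n + 1) = s + of_int (k - n - 1)" by simp
  finally show ?thesis by (simp only: wtspace_iff)
qed

lemma md_wt_int:
  assumes "a \<in> wtspace V (of_int k)" "c \<in> wtspace V (of_int h)"
  shows "md a n c \<in> wtspace V (of_int (h + k - n - 1))"
  using md_wt[OF assms, of n] by (simp add: algebra_simps)

definition linear_op :: "('v \<Rightarrow> 'v) \<Rightarrow> bool" where
  "linear_op T \<longleftrightarrow> (\<forall>v w. T (v + w) = T v + T w) \<and> (\<forall>r v. T (sc r v) = sc r (T v))"

lemma linear_op_0: "linear_op T \<Longrightarrow> T 0 = 0"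
  unfolding linear_op_def by (metis add_cancel_right_right)

lemma linear_op_sum: "linear_op T \<Longrightarrow> T (\<Sum>i\<in>A. f i) = (\<Sum>i\<in>A. T (f i))"
  by (induction A rule: infinite_finite_induct) (auto simp: linear_op_0 linear_op_def)

lemma linear_op_md: "linear_op (md a n)"
  by (simp add: linear_op_def md_add2 md_scale2)

lemma linear_op_Lm: "linear_op (Lm V n)"
  by (simp add: Lm_def linear_op_md)

text \<open>Applying \<open>T - k0\<close> removes the summand of \<open>k0\<close> and multiplies
  every other one by a nonzero number.\<close>

lemma eigenvectors_independent:
  assumes T: "linear_op T" and "finite S" "\<And>k::int. k \<in> S \<Longrightarrow> T (d k) = sc (of_int k) (d k)" "(\<Sum>k\<in>S. d k) = 0" "k \<in> S"
  shows "d k = 0"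
  using assms(2-5)
proof (induction S arbitrary: d k rule: finite_induct)
  case (insert k0 S)
  define d' where "d' k = sc (of_int (k - k0)) (d k)" for k
  have "T (\<Sum>k\<in>insert k0 S. d k) - sc (of_int k0) (\<Sum>k\<in>insert k0 S. d k) = 0"
    using insert.prems(2) by (simp add: linear_op_0[OF T])
  then have "(\<Sum>k\<in>insert k0 S. T (d k) - sc (of_int k0) (d k)) = 0"
    unfolding linear_op_sum[OF T] vs.scale_sum_right sum_subtractf .
  moreover have "T (d k) - sc (of_int k0) (d k) = d' k" if "k \<in> insert k0 S" for k
    using insert.prems(1)[OF that] by (simp add: d'_def vs.scale_left_diff_distrib)
  ultimately have "(\<Sum>k\<in>insert k0 S. d' k) = 0" by (metis (mono_tags, lifting) sum.cong)
  then have "(\<Sum>k\<in>S. d' k) = 0" using insert.hyps by (simp add: d'_def)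
  moreover have "T (d' k) = sc (of_int k) (d' k)" if "k \<in> S" for k
    using insert.prems(1)[of k] that T by (simp add: d'_def linear_op_def mult.commute)
  ultimately have "d' k = 0" if "k \<in> S" for k using insert.IH that by blast
  then have z: "d k = 0" if "k \<in> S" for k using that insert.hyps by (auto simp: d'_def)
  then have "d k0 = 0" using insert.prems(2) insert.hyps by simp
  then show ?case using z insert.prems(3) by auto
qed simp

lemma homog_decomp_unique:
  assumes "homog_decomp V v f" "homog_decomp V v g" shows "f = g"
proof
  fix k
  define S where "S = {k. f k \<noteq> 0} \<union> {k. g k \<noteq> 0}"
  have fin: "finite S" using assms by (simp add: S_def homog_decomp_def)
  have "Sum_any f = sum f S" "Sum_any g = sum g S"
    by (rule Sum_any.expand_superset; use fin in \<open>auto simp: S_def\<close>)+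
  then have "(\<Sum>k\<in>S. f k - g k) = 0" using assms by (simp add: homog_decomp_def sum_subtractf)
  moreover have "Lm V 0 (f k - g k) = sc (of_int k) (f k - g k)" for k
  proof -
    have "f k - g k = f k + sc (-1) (g k)" by simp
    then have "Lm V 0 (f k - g k) = Lm V 0 (f k) + sc (-1) (Lm V 0 (g k))"
      using linear_op_Lm[of 0] unfolding linear_op_def by metis
    then show ?thesis using assms by (simp add: homog_decomp_def wtspace_iff vs.scale_right_diff_distrib)
  qed
  ultimately have "f k - g k = 0" if "k \<in> S"
    using eigenvectors_independent[OF linear_op_Lm[of 0] fin, of "\<lambda>k. f k - g k" k] that by blast
  then show "f k = g k" by (cases "k \<in> S") (auto simp: S_def)
qed

lemma hcomp_homog_decomp: "homog_decomp V v (hcomp V v)"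
  unfolding hcomp_def using ex_homog_decomp homog_decomp_unique by (metis theI)

lemma hcomp_eqI: "homog_decomp V v f \<Longrightarrow> hcomp V v = f"
  using hcomp_homog_decomp homog_decomp_unique by blast

lemma hcomp_wt: "hcomp V v k \<in> wtspace V (of_int k)"
  using hcomp_homog_decomp[of v] by (simp add: homog_decomp_def)

lemma finite_hcomp: "finite {k. hcomp V v k \<noteq> 0}"
  using hcomp_homog_decomp[of v] by (simp add: homog_decomp_def)

lemma wt_zero: "0 \<in> wtspace V s"
  by (simp add: wtspace_iff linear_op_0[OF linear_op_Lm])

lemma wt_add: "v \<in> wtspace V s \<Longrightarrow> w \<in> wtspace V s \<Longrightarrow> v + w \<in> wtspace V s"
  using linear_op_Lm[of 0] by (simp add: wtspace_iff linear_op_def vs.scale_right_distrib)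

lemma wt_scale: "v \<in> wtspace V s \<Longrightarrow> sc r v \<in> wtspace V s"
  using linear_op_Lm[of 0] by (simp add: wtspace_iff linear_op_def mult.commute)

lemma hcomp_sum_superset:
  assumes "finite K" "{k. hcomp V v k \<noteq> 0} \<subseteq> K" shows "v = (\<Sum>k\<in>K. hcomp V v k)"
proof -
  have "v = Sum_any (hcomp V v)" using hcomp_homog_decomp[of v] by (simp add: homog_decomp_def)
  also have "\<dots> = (\<Sum>k\<in>K. hcomp V v k)" by (rule Sum_any.expand_superset) (use assms in auto)
  finally show ?thesis .
qed

lemma hcomp_add: "hcomp V (v + w) = (\<lambda>k. hcomp V v k + hcomp V w k)"
proof (rule hcomp_eqI)
  define S where "S = {k. hcomp V v k \<noteq> 0} \<union> {k. hcomp V w k \<noteq> 0}"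
  have S: "finite S" by (simp add: S_def finite_hcomp)
  have sub: "{k. hcomp V v k + hcomp V w k \<noteq> 0} \<subseteq> S" by (auto simp: S_def)
  have "v = (\<Sum>k\<in>S. hcomp V v k)" "w = (\<Sum>k\<in>S. hcomp V w k)"
    by (rule hcomp_sum_superset[OF S]; auto simp: S_def)+
  then have "v + w = (\<Sum>k\<in>S. hcomp V v k + hcomp V w k)" by (simp add: sum.distrib)
  also have "\<dots> = Sum_any (\<lambda>k. hcomp V v k + hcomp V w k)"
    by (rule Sum_any.expand_superset[symmetric]) (use S sub in auto)
  finally show "homog_decomp V (v + w) (\<lambda>k. hcomp V v k + hcomp V w k)"
    using S sub by (auto simp: homog_decomp_def wt_add hcomp_wt intro: finite_subset)
qed

lemma hcomp_scale: "hcomp V (sc r v) = (\<lambda>k. sc r (hcomp V v k))"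
proof (rule hcomp_eqI)
  define S where "S = {k. hcomp V v k \<noteq> 0}"
  have S: "finite S" by (simp add: S_def finite_hcomp)
  have sub: "{k. sc r (hcomp V v k) \<noteq> 0} \<subseteq> S" by (auto simp: S_def)
  have "v = (\<Sum>k\<in>S. hcomp V v k)" by (rule hcomp_sum_superset[OF S]) (auto simp: S_def)
  then have "sc r v = (\<Sum>k\<in>S. sc r (hcomp V v k))" by (metis vs.scale_sum_right)
  also have "\<dots> = Sum_any (\<lambda>k. sc r (hcomp V v k))"
    by (rule Sum_any.expand_superset[symmetric]) (use S sub in auto)
  finally show "homog_decomp V (sc r v) (\<lambda>k. sc r (hcomp V v k))"
    using S sub by (auto simp: homog_decomp_def wt_scale hcomp_wt intro: finite_subset)
qed

lemma hcomp_homogeneous: "v \<in> wtspace V (of_int k) \<Longrightarrow> hcomp V v = (\<lambda>i. if i = k then v else 0)"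
proof (rule hcomp_eqI)
  assume v: "v \<in> wtspace V (of_int k)"
  have "Sum_any (\<lambda>i. if i = k then v else 0) = v" by (subst Sum_any_single[of k]) auto
  then show "homog_decomp V v (\<lambda>i. if i = k then v else 0)"
    using v by (auto simp: homog_decomp_def wt_zero)
qed

text \<open>The residue of \<open>f(w) Y(a,w)\<close>.\<close>

definition tmode :: "'v \<Rightarrow> complex fls \<Rightarrow> 'v \<Rightarrow> 'v" where
  "tmode a f c = Sum_any (\<lambda>j. sc (f $$ j) (md a j c))"

text \<open>The window may be enlarged at will as long as the series vanishes below and the modes
  above it; different smeared modes can therefore be summed over one range.\<close>

lemma tmode_box:
  assumes "\<And>j. j < d \<Longrightarrow> f $$ j = 0" "\<And>j. N \<le> j \<Longrightarrow> md a j c = 0"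
  shows "tmode a f c = (\<Sum>j\<in>{d..<N}. sc (f $$ j) (md a j c))"
  unfolding tmode_def
proof (rule Sum_any.expand_superset)
  show "{j. sc (f $$ j) (md a j c) \<noteq> 0} \<subseteq> {d..<N}"
  proof
    fix j assume "j \<in> {j. sc (f $$ j) (md a j c) \<noteq> 0}"
    then show "j \<in> {d..<N}" using assms(1)[of j] assms(2)[of j] by (cases "j < d"; cases "N \<le> j") auto
  qed
qed simp

lemma tmode_lin2: "tmode a f (sc r c + sc s c') = sc r (tmode a f c) + sc s (tmode a f c')"
proof -
  obtain N where N: "\<forall>n\<ge>N. md a n c = 0" using md_trunc by blast
  obtain N' where N': "\<forall>n\<ge>N'. md a n c' = 0" using md_trunc by blast
  define M where "M = max N N'"
  have d: "\<And>j. j < fls_subdegree f \<Longrightarrow> f $$ j = 0" by (rule fls_eq0_below_subdegree)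
  have "tmode a f c = (\<Sum>j\<in>{fls_subdegree f..<M}. sc (f $$ j) (md a j c))"
    by (rule tmode_box[OF d]) (use N in \<open>auto simp: M_def\<close>)
  moreover have "tmode a f c' = (\<Sum>j\<in>{fls_subdegree f..<M}. sc (f $$ j) (md a j c'))"
    by (rule tmode_box[OF d]) (use N' in \<open>auto simp: M_def\<close>)
  moreover have "tmode a f (sc r c + sc s c') = (\<Sum>j\<in>{fls_subdegree f..<M}. sc (f $$ j) (md a j (sc r c + sc s c')))"
    by (rule tmode_box[OF d]) (use N N' in \<open>auto simp: M_def md_add2 md_scale2\<close>)
  ultimately show ?thesis
    by (simp add: md_add2 md_scale2 vs.scale_right_distrib sum.distrib vs.scale_sum_right mult.commute)
qed

lemma tmode_lin1: "tmode (sc r a + sc s a') f c = sc r (tmode a f c) + sc s (tmode a' f c)"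
proof -
  obtain N where N: "\<forall>n\<ge>N. md a n c = 0" using md_trunc by blast
  obtain N' where N': "\<forall>n\<ge>N'. md a' n c = 0" using md_trunc by blast
  define M where "M = max N N'"
  have d: "\<And>j. j < fls_subdegree f \<Longrightarrow> f $$ j = 0" by (rule fls_eq0_below_subdegree)
  have "tmode a f c = (\<Sum>j\<in>{fls_subdegree f..<M}. sc (f $$ j) (md a j c))"
    by (rule tmode_box[OF d]) (use N in \<open>auto simp: M_def\<close>)
  moreover have "tmode a' f c = (\<Sum>j\<in>{fls_subdegree f..<M}. sc (f $$ j) (md a' j c))"
    by (rule tmode_box[OF d]) (use N' in \<open>auto simp: M_def\<close>)
  moreover have "tmode (sc r a + sc s a') f c = (\<Sum>j\<in>{fls_subdegree f..<M}. sc (f $$ j) (md (sc r a + sc s a') j c))"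
    by (rule tmode_box[OF d]) (use N N' in \<open>auto simp: M_def md_add1 md_scale1\<close>)
  ultimately show ?thesis
    by (simp add: md_add1 md_scale1 vs.scale_right_distrib sum.distrib vs.scale_sum_right mult.commute)
qed

lemma tmode_zero1 [simp]: "tmode 0 f c = 0"
  by (simp add: tmode_def)

lemma linear_op_tmode: "linear_op (tmode a f)"
  using tmode_lin2[of a f 1 _ 1] tmode_lin2[of a f _ _ 0] by (simp add: linear_op_def)

section \<open>Square bracket modes\<close>

abbreviation "sq \<equiv> sq_mode V"

lemma sq_eq: "sq v n w = Sum_any (\<lambda>k. tmode (hcomp V v k) (test_series k n) w)"
  by (simp add: sq_mode_def tmode_def sq_coeff_eq_test_series)

lemma sq_homogeneous: "v \<in> wtspace V (of_int k) \<Longrightarrow> sq v n w = tmode v (test_series k n) w"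
  unfolding sq_eq by (subst Sum_any_single[of k]) (auto simp: hcomp_homogeneous)

lemma sq_superset:
  assumes "finite K" "{k. hcomp V v k \<noteq> 0} \<subseteq> K"
  shows "sq v n w = (\<Sum>k\<in>K. tmode (hcomp V v k) (test_series k n) w)"
  unfolding sq_eq by (rule Sum_any.expand_superset) (use assms in auto)

lemma sq_lin1: "sq (sc r a + sc s a') n w = sc r (sq a n w) + sc s (sq a' n w)"
proof -
  define K where "K = {k. hcomp V a k \<noteq> 0} \<union> {k. hcomp V a' k \<noteq> 0}"
  have K: "finite K" by (simp add: K_def finite_hcomp)
  have e: "sq a n w = (\<Sum>k\<in>K. tmode (hcomp V a k) (test_series k n) w)" "sq a' n w = (\<Sum>k\<in>K. tmode (hcomp V a' k) (test_series k n) w)"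
    by (rule sq_superset[OF K]; auto simp: K_def)+
  have "sq (sc r a + sc s a') n w = (\<Sum>k\<in>K. tmode (hcomp V (sc r a + sc s a') k) (test_series k n) w)"
    by (rule sq_superset[OF K]) (auto simp: K_def hcomp_add hcomp_scale)
  then show ?thesis unfolding e
    by (simp add: hcomp_add hcomp_scale tmode_lin1 sum.distrib vs.scale_sum_right)
qed

lemma linear_op_sq1: "linear_op (\<lambda>a. sq a n w)"
  using sq_lin1[of 1 _ 1] sq_lin1[of _ _ 0] by (simp add: linear_op_def)

lemma linear_op_sq: "linear_op (sq a n)"
proof -
  define K where "K = {k. hcomp V a k \<noteq> 0}"
  have "sq a n = (\<lambda>w. \<Sum>k\<in>K. tmode (hcomp V a k) (test_series k n) w)"
    by (rule ext, rule sq_superset) (auto simp: K_def finite_hcomp)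
  then show ?thesis using linear_op_tmode
    by (simp add: linear_op_def sum.distrib vs.scale_sum_right)
qed

lemmas sq_zero1 [simp] = linear_op_0[OF linear_op_sq1]
lemmas sq_zero2 [simp] = linear_op_0[OF linear_op_sq]
lemmas sq_sum1 = linear_op_sum[OF linear_op_sq1]
lemmas sq_sum2 = linear_op_sum[OF linear_op_sq]

lemma sq_add1: "sq (a + b) n w = sq a n w + sq b n w"
  and sq_scale1: "sq (sc r a) n w = sc r (sq a n w)"
  using linear_op_sq1[of n w] by (auto simp: linear_op_def)

lemma sq_add2: "sq a n (b + w) = sq a n b + sq a n w"
  and sq_scale2: "sq a n (sc r w) = sc r (sq a n w)"
  using linear_op_sq[of a n] by (auto simp: linear_op_def)

lemma sq_trunc: "\<exists>N. \<forall>n\<ge>N. sq v n w = 0"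
proof -
  define K where "K = {k. hcomp V v k \<noteq> 0}"
  have K: "finite K" by (simp add: K_def finite_hcomp)
  have "\<exists>N. \<forall>k\<in>K. \<forall>n\<ge>N. md (hcomp V v k) n w = 0" using K
  proof (induction K)
    case (insert k K)
    obtain N1 where N1: "\<forall>k\<in>K. \<forall>n\<ge>N1. md (hcomp V v k) n w = 0" using insert.IH by blast
    obtain N2 where "\<forall>n\<ge>N2. md (hcomp V v k) n w = 0" using md_trunc by blast
    then show ?case using N1 by (intro exI[of _ "max N1 N2"]) auto
  qed simp
  then obtain N where N: "\<forall>k\<in>K. \<forall>n\<ge>N. md (hcomp V v k) n w = 0" by blast
  have "sq v n w = 0" if "n \<ge> N" for n
  proof -
    have "tmode (hcomp V v k) (test_series k n) w = 0" if "k \<in> K" for k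
    proof -
      have "tmode (hcomp V v k) (test_series k n) w = (\<Sum>j\<in>{n..<N}. sc (test_series k n $$ j) (md (hcomp V v k) j w))"
        by (rule tmode_box) (use N that in \<open>auto simp: test_series_below\<close>)
      then show ?thesis using \<open>n \<ge> N\<close> by simp
    qed
    then show ?thesis using sq_superset[OF K, of v n w] by (simp add: K_def)
  qed
  then show ?thesis by blast
qed

lemma vac_wt: "vac V \<in> wtspace V (of_int 0)"
  by (simp add: wtspace_iff Lm_def md_creation)

lemma conf_wt: "conf V \<in> wtspace V (of_int 2)"
proof -
  have "Lm V (-2) (vac V) = conf V" by (simp add: Lm_def md_creation)
  moreover have "Lm V 0 (vac V) = 0" by (simp add: Lm_def md_creation)
  ultimately show ?thesis
    using Lm_comm[of 0 "-2" "vac V"] by (simp add: wtspace_iff linear_op_0[OF linear_op_Lm])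
qed

text \<open>For weight 0 the test series is \<open>ln(1+w)^n\<close> times the derivative of
  \<open>ln(1+w)\<close>. It is a derivative unless \<open>n = -1\<close>, when it is a logarithmic
  derivative of a series of order 1.\<close>

lemma residue_tst0: "test_series 0 n $$ (-1) = (if n = -1 then 1 else 0)"
proof -
  have d: "fls_deriv log_series = inverse one_plus_X" using one_plus_X_deriv_log_series by (metis inverse_unique)
  have t: "test_series 0 n = log_series powi n * fls_deriv log_series" by (simp add: test_series_def d power_int_minus)
  show ?thesis
  proof (cases "n = -1")
    case True
    then show ?thesis
      using fls_residue_deriv_times_inverse_eq_subdegree[of log_series] t by (simp add: mult.commute power_int_minus)
  next
    case False
    have "fls_deriv (log_series powi (n + 1)) = of_int (n + 1) * test_series 0 n"
      by (simp add: fls_deriv_power_int t)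
    then have "of_int (n + 1) * test_series 0 n $$ (-1) = fls_deriv (log_series powi (n + 1)) $$ (-1)"
      by (simp only: fls_of_int_times_nth)
    also have "\<dots> = 0" by (rule fls_deriv_residue)
    finally have "(of_int (n + 1) :: complex) = 0 \<or> test_series 0 n $$ (-1) = 0" by (simp only: mult_eq_0_iff)
    then show ?thesis using False by (metis add.inverse_unique add.commute of_int_eq_0_iff)
  qed
qed

lemma sq_vac: "sq (vac V) n w = (if n = -1 then w else 0)"
proof -
  have "sq (vac V) n w = tmode (vac V) (test_series 0 n) w" by (rule sq_homogeneous[OF vac_wt])
  also have "\<dots> = sc (test_series 0 n $$ (-1)) w"
    unfolding tmode_def by (subst Sum_any_single[of "-1"]) (auto simp: md_vac)
  finally show ?thesis by (simp add: residue_tst0)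
qed

text \<open>The test series for \<open>n\<close> starts at exponent \<open>n\<close>, and on the
  vacuum only negative modes survive. Thus nothing remains for \<open>n \<ge> 0\<close>, and for
  \<open>n = -1\<close> a single term.\<close>

lemma sq_creation: "n \<ge> 0 \<Longrightarrow> sq a n (vac V) = 0" and sq_creation_minus1: "sq a (-1) (vac V) = a"
proof -
  define K where "K = {k. hcomp V a k \<noteq> 0}"
  have K: "finite K" by (simp add: K_def finite_hcomp)
  have t: "tmode b (test_series k n) (vac V) = (if n = -1 then b else 0)" if "n \<ge> -1" for b k n
  proof -
    have "tmode b (test_series k n) (vac V) = (\<Sum>j\<in>{n..<0}. sc (test_series k n $$ j) (md b j (vac V)))"
      by (rule tmode_box) (auto simp: test_series_below md_creation)
    moreover have "{n..<0} = (if n = -1 then {-1} else {})" using that by auto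
    \<comment> \<open>Multiplication by \<open>log_series\<close>, which starts with
      \<open>X\<close>, moves this leading coefficient to the known constant term of
      \<open>test_series k 0\<close>.\<close>
    moreover have "test_series k (-1) $$ (-1) = 1"
    proof -
      have "of_int (-1 + 1) * test_series k 0 $$ (-1 + 1) = (0::complex)" by simp
      have "test_series k 0 $$ 0 = 1" using test_series_0[of k 0] by simp
      have "test_series k 0 = log_series * test_series k (-1)" by (simp add: test_series_def power_int_minus)
      moreover have "(log_series * test_series k (-1)) $$ 0 = (\<Sum>i\<in>{1}. log_series $$ i * test_series k (-1) $$ (0 - i))"
      proof (rule fls_conv_nth)
        fix i :: int assume "i \<notin> {1}"
        then have "i < 1 \<or> 0 - i < -1" by auto
        then show "log_series $$ i * test_series k (-1) $$ (0 - i) = 0"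
          using fls_eq0_below_subdegree[of i log_series] test_series_below[of "0 - i" "-1" k] by auto
      qed simp
      ultimately show ?thesis using \<open>test_series k 0 $$ 0 = 1\<close> by (simp add: log_series_lead)
    qed
    ultimately show ?thesis by (auto simp: md_creation)
  qed
  show "n \<ge> 0 \<Longrightarrow> sq a n (vac V) = 0"
    using sq_superset[OF K, of a n "vac V"] by (simp add: K_def t)
  have "a = (\<Sum>k\<in>K. hcomp V a k)" by (rule hcomp_sum_superset[OF K]) (simp add: K_def)
  then show "sq a (-1) (vac V) = a"
    using sq_superset[OF K, of a "-1" "vac V"] by (simp add: K_def t)
qed

section \<open>Borcherds' associativity identity for the square bracket\<close>

text \<open>The products in Borcherds' identity for \<open>(a(p)b)(n)\<close> are re-sorted by their
  two modes \<open>m = p - i\<close> and \<open>n' = n + i\<close>. The resulting rectangle does not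
  depend on \<open>p\<close>, so the sum over \<open>p\<close> can later be pulled inside.\<close>

lemma md_sum_reindex:
  fixes t :: "int \<Rightarrow> int \<Rightarrow> 'v"
  assumes "\<And>n i. r \<le> n \<Longrightarrow> n < N2 \<Longrightarrow> i < K \<Longrightarrow> h n i = t (p - int i) (n + int i)"
    "\<And>m n'. t m n' \<noteq> 0 \<Longrightarrow> m \<le> p \<and> r \<le> n' - p + m \<and> m < M1 \<and> n' < N1"
    "N1 \<le> N2" "N1 - r \<le> int K" "m0 \<le> p - int K"
  shows "(\<Sum>n\<in>{r..<N2}. \<Sum>i<K. h n i) = (\<Sum>m\<in>{m0..<M1}. \<Sum>n'\<in>{r..<N1}. t m n')"
proof -
  have "(\<Sum>n\<in>{r..<N2}. \<Sum>i<K. h n i) = (\<Sum>n\<in>{r..<N2}. \<Sum>i<K. t (p - int i) (n + int i))"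
    by (intro sum.cong refl) (use assms(1) in auto)
  also have "\<dots> = (\<Sum>(n, i)\<in>{r..<N2} \<times> {..<K}. t (p - int i) (n + int i))"
    by (rule sum.cartesian_product)
  also have "\<dots> = (\<Sum>(m, n')\<in>{m0..<M1} \<times> {r..<N1}. t m n')"
  proof (rule sum.reindex_bij_witness_not_neutral[where
        S' = "{x \<in> {r..<N2} \<times> {..<K}. t (p - int (snd x)) (fst x + int (snd x)) = 0}" and
        T' = "{y \<in> {m0..<M1} \<times> {r..<N1}. t (fst y) (snd y) = 0}" and
        i = "\<lambda>(m, n'). (n' - p + m, nat (p - m))" and j = "\<lambda>(n, i). (p - int i, n + int i)"])
    fix a assume a: "a \<in> {r..<N2} \<times> {..<K} - {x \<in> {r..<N2} \<times> {..<K}. t (p - int (snd x)) (fst x + int (snd x)) = 0}"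
    obtain n i where ni: "a = (n, i)" by (cases a)
    have "t (p - int i) (n + int i) \<noteq> 0" using a ni by auto
    from assms(2)[OF this] a ni assms(5)
    show "(case a of (n, i) \<Rightarrow> (p - int i, n + int i)) \<in> {m0..<M1} \<times> {r..<N1} - {y \<in> {m0..<M1} \<times> {r..<N1}. t (fst y) (snd y) = 0}"
      by auto
  next
    fix b assume b: "b \<in> {m0..<M1} \<times> {r..<N1} - {y \<in> {m0..<M1} \<times> {r..<N1}. t (fst y) (snd y) = 0}"
    obtain m n' where mn: "b = (m, n')" by (cases b)
    have t0: "t m n' \<noteq> 0" using b mn by auto
    note q = assms(2)[OF t0]
    show "(case case b of (m, n') \<Rightarrow> (n' - p + m, nat (p - m)) of (n, i) \<Rightarrow> (p - int i, n + int i)) = b"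
      using q mn by auto
    have "nat (p - m) < K" using q assms(4) b mn by auto
    then show "(case b of (m, n') \<Rightarrow> (n' - p + m, nat (p - m))) \<in> {r..<N2} \<times> {..<K} - {x \<in> {r..<N2} \<times> {..<K}. t (p - int (snd x)) (fst x + int (snd x)) = 0}"
      using q mn t0 assms(3) by auto
  qed auto
  also have "\<dots> = (\<Sum>m\<in>{m0..<M1}. \<Sum>n'\<in>{r..<N1}. t m n')"
    by (rule sum.cartesian_product[symmetric])
  finally show ?thesis .
qed

text \<open>The counterpart for the products in the opposite order, with modes \<open>m = i\<close>
  and \<open>n' = n + p - i\<close>.\<close>

lemma md_sum_reindex2:
  fixes t :: "int \<Rightarrow> int \<Rightarrow> 'v"
  assumes "\<And>n i. r \<le> n \<Longrightarrow> n < N2 \<Longrightarrow> i < K \<Longrightarrow> h n i = t (int i) (n + p - int i)"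
    "\<And>m n'. 0 \<le> m \<Longrightarrow> t m n' \<noteq> 0 \<Longrightarrow> r \<le> n' - p + m \<and> m < N3 \<and> n' < M2"
    "M2 - p + N3 \<le> N2" "N3 \<le> int K" "n0 \<le> r + p - N3"
  shows "(\<Sum>n\<in>{r..<N2}. \<Sum>i<K. h n i) = (\<Sum>m\<in>{0..<N3}. \<Sum>n'\<in>{n0..<M2}. t m n')"
proof -
  have "(\<Sum>n\<in>{r..<N2}. \<Sum>i<K. h n i) = (\<Sum>n\<in>{r..<N2}. \<Sum>i<K. t (int i) (n + p - int i))"
    by (intro sum.cong refl) (use assms(1) in auto)
  also have "\<dots> = (\<Sum>(n, i)\<in>{r..<N2} \<times> {..<K}. t (int i) (n + p - int i))"
    by (rule sum.cartesian_product)
  also have "\<dots> = (\<Sum>(m, n')\<in>{0..<N3} \<times> {n0..<M2}. t m n')"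
  proof (rule sum.reindex_bij_witness_not_neutral[where
        S' = "{x \<in> {r..<N2} \<times> {..<K}. t (int (snd x)) (fst x + p - int (snd x)) = 0}" and
        T' = "{y \<in> {0..<N3} \<times> {n0..<M2}. t (fst y) (snd y) = 0}" and
        i = "\<lambda>(m, n'). (n' - p + m, nat m)" and j = "\<lambda>(n, i). (int i, n + p - int i)"])
    fix a assume a: "a \<in> {r..<N2} \<times> {..<K} - {x \<in> {r..<N2} \<times> {..<K}. t (int (snd x)) (fst x + p - int (snd x)) = 0}"
    obtain n i where ni: "a = (n, i)" by (cases a)
    have "t (int i) (n + p - int i) \<noteq> 0" using a ni by auto
    from assms(2)[OF _ this] a ni assms(5)
    show "(case a of (n, i) \<Rightarrow> (int i, n + p - int i)) \<in> {0..<N3} \<times> {n0..<M2} - {y \<in> {0..<N3} \<times> {n0..<M2}. t (fst y) (snd y) = 0}"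
      by auto
  next
    fix b assume b: "b \<in> {0..<N3} \<times> {n0..<M2} - {y \<in> {0..<N3} \<times> {n0..<M2}. t (fst y) (snd y) = 0}"
    obtain m n' where mn: "b = (m, n')" by (cases b)
    have t0: "t m n' \<noteq> 0" "0 \<le> m" using b mn by auto
    note q = assms(2)[OF t0(2,1)]
    show "(case case b of (m, n') \<Rightarrow> (n' - p + m, nat m) of (n, i) \<Rightarrow> (int i, n + p - int i)) = b"
      using q mn t0 by auto
    have "nat m < K" using q assms(4) t0 by auto
    then show "(case b of (m, n') \<Rightarrow> (n' - p + m, nat m)) \<in> {r..<N2} \<times> {..<K} - {x \<in> {r..<N2} \<times> {..<K}. t (int (snd x)) (fst x + p - int (snd x)) = 0}"
      using q mn t0 assms(3) by auto
  qed auto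
  also have "\<dots> = (\<Sum>m\<in>{0..<N3}. \<Sum>n'\<in>{n0..<M2}. t m n')"
    by (rule sum.cartesian_product[symmetric])
  finally show ?thesis .
qed

text \<open>The summation window is independent of the shift \<open>d\<close>, hence common to all
  \<open>p\<close> when \<open>d = p - m\<close>.\<close>

lemma conv_one_plus_X:
  fixes T :: "complex fls"
  assumes T: "\<And>j. j < r \<Longrightarrow> T $$ j = 0" and J: "n - r \<le> b" "a \<le> d"
  shows "(one_plus_X powi s * T) $$ (n - d) = (\<Sum>q\<in>{a..b}. gb s (q - d) * T $$ (n - q))"
proof -
  have "(one_plus_X powi s * T) $$ (n - d) = (\<Sum>i\<in>(\<lambda>q. q - d) ` {a..b}. (one_plus_X powi s) $$ i * T $$ (n - d - i))"
  proof (rule fls_conv_nth)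
    fix i assume i: "i \<notin> (\<lambda>q. q - d) ` {a..b}"
    have "i + d \<notin> {a..b}"
    proof
      assume "i + d \<in> {a..b}"
      then have "(i + d) - d \<in> (\<lambda>q. q - d) ` {a..b}" by blast
      then show False using i by simp
    qed
    then have "i < 0 \<or> n - d - i < r" using J by auto
    then show "(one_plus_X powi s) $$ i * T $$ (n - d - i) = 0"
      using T by (auto simp: one_plus_X_powi_nth_gb gb_neg)
  qed simp
  also have "\<dots> = (\<Sum>q\<in>{a..b}. gb s (q - d) * T $$ (n - q))"
    by (subst sum.reindex) (auto simp: inj_on_def one_plus_X_powi_nth_gb)
  finally show ?thesis .
qed

lemma conv_log_series:
  fixes T :: "complex fls"
  assumes T: "\<And>j. j < r \<Longrightarrow> T $$ j = 0" and J: "n - r \<le> b" "a \<le> e"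
  shows "(log_series powi e * T) $$ n = (\<Sum>q\<in>{a..b}. (log_series powi e) $$ q * T $$ (n - q))"
proof (rule fls_conv_nth)
  fix i assume "i \<notin> {a..b}"
  then have "i < e \<or> n - i < r" using J by auto
  then show "(log_series powi e) $$ i * T $$ (n - i) = 0" using T log_series_powi_below by auto
qed simp

lemma test_series_one_plus_X: "test_series (k + h - p - 1) r = one_plus_X powi (k - 1 - p) * test_series h r"
  unfolding test_series_def using power_int_add[of one_plus_X "k - 1 - p" "h - 1"] by (simp add: algebra_simps)

lemma test_series_log_series: "test_series h (r + e) = log_series powi e * test_series h r"
  unfolding test_series_def using power_int_add[of log_series r e] by (simp add: algebra_simps)

text \<open>Both square bracket modes on the left are written in ordinary modes, Borcherds' identity
  is applied to each \<open>(a(p)b)(n)\<close>, and the coefficients of \<open>a(m)b(n')c\<close>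
  and \<open>b(n')a(m)c\<close> are collected. The sums over \<open>p\<close> are the kernels, so
  \<open>kernel1\<close> and \<open>kernel2\<close> turn them into products of test series, which
  are the coefficients of the right side.\<close>

lemma sq_assoc_homogeneous:
  assumes a: "a \<in> wtspace V (of_int k)" and b: "b \<in> wtspace V (of_int h)"
  shows "\<exists>L0. \<forall>L\<ge>L0. sq (sq a l b) r c =
    (\<Sum>i<L. sc (lcoef l i) (sq a (l - int i) (sq b (r + int i) c) - sc ((-1) powi l) (sq b (r + l - int i) (sq a (int i) c))))"
proof -
  obtain N1 where N1: "\<And>n. N1 \<le> n \<Longrightarrow> md b n c = 0" and N1r: "r \<le> N1"
    using md_trunc[of b c] by (metis max.bounded_iff max.cobounded2)
  obtain N3 where N3: "\<And>n. N3 \<le> n \<Longrightarrow> md a n c = 0" and N30: "0 \<le> N3"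
    using md_trunc[of a c] by (metis max.bounded_iff max.cobounded2)
  have ex_unif: "\<exists>M. \<forall>j\<in>J. \<forall>n\<ge>M. md (x j) n (y j) = 0" if "finite J" for J :: "int set" and x y
    using that
  proof (induction J)
    case (insert j J)
    obtain M where M: "\<forall>j\<in>J. \<forall>n\<ge>M. md (x j) n (y j) = 0" using insert.IH by blast
    obtain M' where "\<forall>n\<ge>M'. md (x j) n (y j) = 0" using md_trunc by blast
    then show ?case using M by (intro exI[of _ "max M M'"]) auto
  qed simp
  obtain M1 where M1: "\<forall>j\<in>{r..<N1}. \<forall>n\<ge>M1. md a n (md b j c) = 0" using ex_unif[of "{r..<N1}" "\<lambda>_. a" "\<lambda>j. md b j c"] by blast
  obtain M2 where M2: "\<forall>j\<in>{0..<N3}. \<forall>n\<ge>M2. md b n (md a j c) = 0" using ex_unif[of "{0..<N3}" "\<lambda>_. b" "\<lambda>j. md a j c"] by blast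
  have ab0: "md a m (md b n c) = 0" if "M1 \<le> m" "r \<le> n" for m n
    using M1 N1 that by (cases "n < N1") auto
  have ba0: "md b n (md a m c) = 0" if "M2 \<le> n" "0 \<le> m" for m n
    using M2 N3 that by (cases "m < N3") auto
  obtain P0 where P0: "\<And>n. P0 \<le> n \<Longrightarrow> md a n b = 0" using md_trunc by blast
  \<comment> \<open>From \<open>P0\<close> on \<open>a(p)b\<close> vanishes. The other two bounds
    give \<open>m + q \<le> P\<close>, required by the kernel lemmas, on both rectangles of
    modes.\<close>
  define P where "P = max P0 (max (M1 + N1 - r) (N3 + M2 - r))"
  have PP: "M1 + N1 - r \<le> P" "N3 + M2 - r \<le> P" by (auto simp: P_def)
  define T where "T = test_series h r"
  define f where "f p = test_series k l $$ p" for p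
  define g where "g p = one_plus_X powi (k - 1 - p) * T" for p
  have Tb: "\<And>j. j < r \<Longrightarrow> T $$ j = 0" by (simp add: T_def test_series_below)
  have gr: "g p $$ j = 0" if "j < r" for p j
    using that test_series_below[of j r "k + h - p - 1"] by (simp add: g_def T_def test_series_one_plus_X)
  obtain N2' where N2': "\<forall>p\<in>{l..P}. \<forall>n\<ge>N2'. md (md a p b) n c = 0" using ex_unif[of "{l..P}" "\<lambda>p. md a p b" "\<lambda>_. c"] by blast
  define N2 where "N2 = max N2' (max N1 (M2 - l + N3))"
  \<comment> \<open>Such \<open>L\<close> truncate Borcherds' sums and also satisfy
    \<open>q < L\<close> and \<open>m < L\<close> in the kernel lemmas.\<close>
  define L0 where "L0 = nat (N1 - r) + nat N3 + 1"
  show ?thesis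
  proof (intro exI[of _ L0] allI impI)
    fix L :: nat assume "L0 \<le> L"
    then have L: "N1 - r < int L" "N3 < int L" using N30 by (auto simp: L0_def)
    define X where "X m n = md a m (md b n c)" for m n
    define Y where "Y m n = md b n (md a m c)" for m n
    have bor: "md (md a p b) n c =
        (\<Sum>i<L. sc (lcoef p i) (X (p - int i) (n + int i))) - (\<Sum>i<L. sc (lcoef p i * (-1) powi p) (Y (int i) (n + p - int i)))"
      if "r \<le> n" for p n
    proof -
      have "md (md a p b) n c = (\<Sum>i<L. sc (lcoef p i) (md a (p - int i) (md b (n + int i) c) - sc ((-1) powi p) (md b (n + p - int i) (md a (int i) c))))"
        unfolding borcherds_assoc
      proof (rule Sum_any_lessThan)
        fix i assume "L \<le> i"
        then show "sc (lcoef p i) (md a (p - int i) (md b (n + int i) c) - sc ((-1) powi p) (md b (n + p - int i) (md a (int i) c))) = 0"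
          using L that N1[of "n + int i"] N3[of "int i"] by auto
      qed
      then show ?thesis unfolding X_def Y_def by (simp add: vs.scale_right_diff_distrib sum_subtractf)
    qed
    have lhs: "sq (sq a l b) r c = (\<Sum>p\<in>{l..P}. sc (f p) (\<Sum>n\<in>{r..<N2}. sc (g p $$ n) (md (md a p b) n c)))"
    proof -
      have "sq a l b = tmode a (test_series k l) b" by (rule sq_homogeneous[OF a])
      also have "\<dots> = (\<Sum>p\<in>{l..<P + 1}. sc (f p) (md a p b))"
        unfolding f_def by (rule tmode_box) (auto simp: test_series_below P0 P_def)
      also have "{l..<P + 1} = {l..P}" by auto
      finally have "sq (sq a l b) r c = (\<Sum>p\<in>{l..P}. sc (f p) (sq (md a p b) r c))"
        by (simp add: sq_sum1 sq_scale1)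
      also have "\<dots> = (\<Sum>p\<in>{l..P}. sc (f p) (\<Sum>n\<in>{r..<N2}. sc (g p $$ n) (md (md a p b) n c)))"
      proof (intro sum.cong refl arg_cong2[where f = sc])
        fix p assume p: "p \<in> {l..P}"
        \<comment> \<open>The weight of \<open>a(p)b\<close> depends on \<open>p\<close>; this is
          the source of the factor \<open>(1+x)^(k-1-p)\<close> in \<open>g p\<close>.\<close>
        have "md a p b \<in> wtspace V (of_int (k + h - p - 1))"
          using md_wt_int[OF a b, of p] by (simp add: add.commute)
        then have "sq (md a p b) r c = tmode (md a p b) (g p) c"
          using sq_homogeneous test_series_one_plus_X by (simp only: g_def T_def)
        also have "\<dots> = (\<Sum>n\<in>{r..<N2}. sc (g p $$ n) (md (md a p b) n c))"
          by (rule tmode_box) (use gr N2' p in \<open>auto simp: N2_def\<close>)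
        finally show "sq (md a p b) r c = (\<Sum>n\<in>{r..<N2}. sc (g p $$ n) (md (md a p b) n c))" .
      qed
      finally show ?thesis .
    qed
    define BX where "BX = {l - int L..<M1} \<times> {r..<N1}"
    define BY where "BY = {0..<N3} \<times> {r + l - int L..<M2}"
    have inner: "(\<Sum>n\<in>{r..<N2}. sc (g p $$ n) (md (md a p b) n c)) =
       (\<Sum>(m, n')\<in>BX. sc (expand_zx p m * g p $$ (n' - (p - m))) (X m n')) - (\<Sum>(m, n')\<in>BY. sc (expand_xz p m * g p $$ (n' - (p - m))) (Y m n'))"
      if p: "p \<in> {l..P}" for p
    proof -
      have "(\<Sum>n\<in>{r..<N2}. sc (g p $$ n) (md (md a p b) n c)) =
        (\<Sum>n\<in>{r..<N2}. \<Sum>i<L. sc (g p $$ n * lcoef p i) (X (p - int i) (n + int i))) -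
        (\<Sum>n\<in>{r..<N2}. \<Sum>i<L. sc (g p $$ n * (lcoef p i * (-1) powi p)) (Y (int i) (n + p - int i)))"
        by (simp add: bor vs.scale_right_diff_distrib sum_subtractf vs.scale_sum_right)
      also have "(\<Sum>n\<in>{r..<N2}. \<Sum>i<L. sc (g p $$ n * lcoef p i) (X (p - int i) (n + int i))) =
        (\<Sum>m\<in>{l - int L..<M1}. \<Sum>n'\<in>{r..<N1}. sc (expand_zx p m * g p $$ (n' - (p - m))) (X m n'))"
      proof (rule md_sum_reindex)
        fix n :: int and i :: nat
        have "expand_zx p (p - int i) = lcoef p i" by (simp add: expand_zx_def gb_def lcoef_def)
        then show "sc (g p $$ n * lcoef p i) (X (p - int i) (n + int i)) =
          sc (expand_zx p (p - int i) * g p $$ (n + int i - (p - (p - int i)))) (X (p - int i) (n + int i))"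
          by (simp add: mult.commute)
      next
        fix m n' assume nz: "sc (expand_zx p m * g p $$ (n' - (p - m))) (X m n') \<noteq> 0"
        then have z: "expand_zx p m \<noteq> 0" "g p $$ (n' - (p - m)) \<noteq> 0" "X m n' \<noteq> 0" by auto
        have mp: "m \<le> p" using z(1) by (auto simp: expand_zx_def gb_def split: if_splits)
        have rn: "r \<le> n' - (p - m)" using z(2) gr by (meson not_less)
        have "r \<le> n'" using mp rn by linarith
        then have "m < M1" using z(3) ab0[of m n'] unfolding X_def by (meson not_less)
        moreover have "n' < N1" using z(3) N1[of n'] unfolding X_def by (metis md_zero2 not_less)
        ultimately show "m \<le> p \<and> r \<le> n' - p + m \<and> m < M1 \<and> n' < N1" using mp rn by auto
      qed (use L p in \<open>auto simp: N2_def\<close>)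
      also have "(\<Sum>n\<in>{r..<N2}. \<Sum>i<L. sc (g p $$ n * (lcoef p i * (-1) powi p)) (Y (int i) (n + p - int i))) =
        (\<Sum>m\<in>{0..<N3}. \<Sum>n'\<in>{r + l - int L..<M2}. sc (expand_xz p m * g p $$ (n' - (p - m))) (Y m n'))"
      proof (rule md_sum_reindex2)
        fix n :: int and i :: nat
        have "(-1) powi (p - int i) = ((-1) powi p * (-1) ^ i :: complex)"
          by (simp add: power_int_diff power_int_of_nat) (simp add: field_simps power_mult_distrib[symmetric])
        then have "expand_xz p (int i) = lcoef p i * (-1) powi p" by (simp add: expand_xz_def gb_def lcoef_def)
        then show "sc (g p $$ n * (lcoef p i * (-1) powi p)) (Y (int i) (n + p - int i)) =
          sc (expand_xz p (int i) * g p $$ (n + p - int i - (p - int i))) (Y (int i) (n + p - int i))"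
          by (simp add: mult.commute)
      next
        fix m n' assume m0: "0 \<le> m" and nz: "sc (expand_xz p m * g p $$ (n' - (p - m))) (Y m n') \<noteq> 0"
        then have z: "g p $$ (n' - (p - m)) \<noteq> 0" "Y m n' \<noteq> 0" by auto
        have rn: "r \<le> n' - (p - m)" using z(1) gr by (meson not_less)
        have "m < N3" using z(2) N3[of m] unfolding Y_def by (metis md_zero2 not_less)
        moreover have "n' < M2" using z(2) ba0[of n' m] m0 unfolding Y_def by (meson not_less)
        ultimately show "r \<le> n' - p + m \<and> m < N3 \<and> n' < M2" using rn by auto
      qed (use L p in \<open>auto simp: N2_def\<close>)
      finally show ?thesis by (simp add: BX_def BY_def sum.cartesian_product)
    qed
    \<comment> \<open>The total coefficients of \<open>X m n'\<close> and of \<open>Y m n'\<close>,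
      after the sum over \<open>p\<close> has been moved inside.\<close>
    define K1 where "K1 m n' = (\<Sum>p\<in>{l..P}. f p * (expand_zx p m * g p $$ (n' - (p - m))))" for m n'
    define K2 where "K2 m n' = (\<Sum>p\<in>{l..P}. f p * (expand_xz p m * g p $$ (n' - (p - m))))" for m n'
    have lhs2: "sq (sq a l b) r c = (\<Sum>(m, n')\<in>BX. sc (K1 m n') (X m n')) - (\<Sum>(m, n')\<in>BY. sc (K2 m n') (Y m n'))"
    proof -
      have s: "(\<Sum>p\<in>{l..P}. \<Sum>x\<in>B. sc (F p x) (Z x)) = (\<Sum>x\<in>B. sc (\<Sum>p\<in>{l..P}. F p x) (Z x))"
        for F :: "int \<Rightarrow> int \<times> int \<Rightarrow> complex" and Z :: "int \<times> int \<Rightarrow> 'v" and B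
        by (subst sum.swap) (simp add: vs.scale_sum_left)
      have "sq (sq a l b) r c = (\<Sum>p\<in>{l..P}. \<Sum>x\<in>BX. sc (f p * (expand_zx p (fst x) * g p $$ (snd x - (p - fst x)))) (X (fst x) (snd x)))
        - (\<Sum>p\<in>{l..P}. \<Sum>x\<in>BY. sc (f p * (expand_xz p (fst x) * g p $$ (snd x - (p - fst x)))) (Y (fst x) (snd x)))"
        unfolding lhs sum_subtractf[symmetric]
        by (intro sum.cong refl) (simp add: inner vs.scale_right_diff_distrib vs.scale_sum_right case_prod_unfold)
      then show ?thesis unfolding s K1_def K2_def by (simp add: case_prod_unfold)
    qed
    have K1: "K1 m n' = (\<Sum>i<L. lcoef l i * (test_series k (l - int i) $$ m * test_series h (r + int i) $$ n'))" if "(m, n') \<in> BX" for m n'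
    proof -
      have q: "g p $$ (n' - (p - m)) = (\<Sum>q\<in>{0..N1 - r}. gb (k - 1 - p) (q - p + m) * T $$ (n' - q))" if "m \<le> p" for p
        using conv_one_plus_X[of r T n' "N1 - r" 0 "p - m" "k - 1 - p"] Tb that \<open>(m, n') \<in> BX\<close> by (simp add: g_def BX_def algebra_simps)
      have "K1 m n' = (\<Sum>p\<in>{l..P}. \<Sum>q\<in>{0..N1 - r}. T $$ (n' - q) * (f p * (expand_zx p m * gb (k - 1 - p) (q - p + m))))"
        unfolding K1_def
      proof (rule sum.cong)
        fix p
        show "f p * (expand_zx p m * g p $$ (n' - (p - m))) = (\<Sum>q\<in>{0..N1 - r}. T $$ (n' - q) * (f p * (expand_zx p m * gb (k - 1 - p) (q - p + m))))"
        proof (cases "m \<le> p")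
          case True
          then show ?thesis unfolding q[OF True] by (simp add: sum_distrib_left mult_ac)
        next
          case False
          then have "expand_zx p m = 0" by (simp add: expand_zx_def gb_def)
          then show ?thesis by simp
        qed
      qed simp
      also have "\<dots> = (\<Sum>q\<in>{0..N1 - r}. T $$ (n' - q) * (\<Sum>p\<in>{l..P}. f p * (expand_zx p m * gb (k - 1 - p) (q - p + m))))"
        by (subst sum.swap) (simp add: sum_distrib_left)
      also have "\<dots> = (\<Sum>q\<in>{0..N1 - r}. T $$ (n' - q) * (\<Sum>i<L. lcoef l i * (test_series k (l - int i) $$ m * (log_series powi int i) $$ q)))"
      proof (rule sum.cong)
        fix q assume "q \<in> {0..N1 - r}"
        then have "q < int L" "m + q \<le> P" using L that PP by (auto simp: BX_def)
        then show "T $$ (n' - q) * (\<Sum>p\<in>{l..P}. f p * (expand_zx p m * gb (k - 1 - p) (q - p + m))) =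
          T $$ (n' - q) * (\<Sum>i<L. lcoef l i * (test_series k (l - int i) $$ m * (log_series powi int i) $$ q))"
          unfolding f_def using kernel1[of q L m P k l] by simp
      qed simp
      also have "\<dots> = (\<Sum>i<L. lcoef l i * (test_series k (l - int i) $$ m * (\<Sum>q\<in>{0..N1 - r}. (log_series powi int i) $$ q * T $$ (n' - q))))"
        by (simp only: sum_distrib_left, subst sum.swap, simp only: mult_ac)
      also have "\<dots> = (\<Sum>i<L. lcoef l i * (test_series k (l - int i) $$ m * test_series h (r + int i) $$ n'))"
      proof (rule sum.cong)
        fix i
        have "test_series h (r + int i) $$ n' = (\<Sum>q\<in>{0..N1 - r}. (log_series powi int i) $$ q * T $$ (n' - q))"
          unfolding test_series_log_series T_def[symmetric] by (rule conv_log_series[of r]) (use that Tb in \<open>auto simp: BX_def\<close>)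
        then show "lcoef l i * (test_series k (l - int i) $$ m * (\<Sum>q\<in>{0..N1 - r}. (log_series powi int i) $$ q * T $$ (n' - q))) =
          lcoef l i * (test_series k (l - int i) $$ m * test_series h (r + int i) $$ n')" by (simp only:)
      qed simp
      finally show ?thesis .
    qed
    have K2: "K2 m n' = (\<Sum>i<L. (lcoef l i * (-1) powi l) * (test_series k (int i) $$ m * test_series h (r + l - int i) $$ n'))" if "(m, n') \<in> BY" for m n'
    proof -
      have q: "g p $$ (n' - (p - m)) = (\<Sum>q\<in>{l - int L..M2 - r}. gb (k - 1 - p) (q - p + m) * T $$ (n' - q))" if "p \<in> {l..P}" for p
        using conv_one_plus_X[of r T n' "M2 - r" "l - int L" "p - m" "k - 1 - p"] Tb that \<open>(m, n') \<in> BY\<close> L by (simp add: g_def BY_def algebra_simps)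
      have "K2 m n' = (\<Sum>p\<in>{l..P}. \<Sum>q\<in>{l - int L..M2 - r}. T $$ (n' - q) * (f p * (expand_xz p m * gb (k - 1 - p) (q - p + m))))"
        unfolding K2_def by (intro sum.cong refl, subst q, assumption) (simp add: sum_distrib_left mult_ac)
      also have "\<dots> = (\<Sum>q\<in>{l - int L..M2 - r}. T $$ (n' - q) * (\<Sum>p\<in>{l..P}. f p * (expand_xz p m * gb (k - 1 - p) (q - p + m))))"
        by (subst sum.swap) (simp add: sum_distrib_left)
      also have "\<dots> = (\<Sum>q\<in>{l - int L..M2 - r}. T $$ (n' - q) * ((-1) powi l * (\<Sum>i<L. lcoef l i * (test_series k (int i) $$ m * (log_series powi (l - int i)) $$ q))))"
      proof (rule sum.cong)
        fix q assume "q \<in> {l - int L..M2 - r}"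
        then have "m < int L" "m + q \<le> P" using L that PP by (auto simp: BY_def)
        then show "T $$ (n' - q) * (\<Sum>p\<in>{l..P}. f p * (expand_xz p m * gb (k - 1 - p) (q - p + m))) =
          T $$ (n' - q) * ((-1) powi l * (\<Sum>i<L. lcoef l i * (test_series k (int i) $$ m * (log_series powi (l - int i)) $$ q)))"
          unfolding f_def using kernel2[of m L q P k l] by simp
      qed simp
      also have "\<dots> = (\<Sum>i<L. (lcoef l i * (-1) powi l) * (test_series k (int i) $$ m * (\<Sum>q\<in>{l - int L..M2 - r}. (log_series powi (l - int i)) $$ q * T $$ (n' - q))))"
        by (simp only: sum_distrib_left, subst sum.swap, simp only: mult_ac)
      also have "\<dots> = (\<Sum>i<L. (lcoef l i * (-1) powi l) * (test_series k (int i) $$ m * test_series h (r + l - int i) $$ n'))"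
      proof (rule sum.cong)
        fix i assume "i \<in> {..<L}"
        then have "(log_series powi (l - int i) * T) $$ n' = (\<Sum>q\<in>{l - int L..M2 - r}. (log_series powi (l - int i)) $$ q * T $$ (n' - q))"
          by (intro conv_log_series[of r]) (use that Tb in \<open>auto simp: BY_def\<close>)
        moreover have "test_series h (r + l - int i) = log_series powi (l - int i) * T"
          using test_series_log_series[of h r "l - int i"] by (simp add: T_def algebra_simps)
        ultimately show "(lcoef l i * (-1) powi l) * (test_series k (int i) $$ m * (\<Sum>q\<in>{l - int L..M2 - r}. (log_series powi (l - int i)) $$ q * T $$ (n' - q))) =
          (lcoef l i * (-1) powi l) * (test_series k (int i) $$ m * test_series h (r + l - int i) $$ n')" by (simp only:)
      qed simp
      finally show ?thesis .
    qed
    have ab: "sq a (l - int i) (sq b (r + int i) c) = (\<Sum>(m, n')\<in>BX. sc (test_series k (l - int i) $$ m * test_series h (r + int i) $$ n') (X m n'))"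
      if "i < L" for i
    proof -
      have "sq b (r + int i) c = tmode b (test_series h (r + int i)) c" by (rule sq_homogeneous[OF b])
      also have "\<dots> = (\<Sum>n'\<in>{r..<N1}. sc (test_series h (r + int i) $$ n') (md b n' c))"
        by (rule tmode_box) (auto simp: test_series_below N1)
      finally have "sq a (l - int i) (sq b (r + int i) c) = (\<Sum>n'\<in>{r..<N1}. sc (test_series h (r + int i) $$ n') (sq a (l - int i) (md b n' c)))"
        by (simp add: sq_sum2 sq_scale2)
      also have "\<dots> = (\<Sum>n'\<in>{r..<N1}. \<Sum>m\<in>{l - int L..<M1}. sc (test_series k (l - int i) $$ m * test_series h (r + int i) $$ n') (X m n'))"
      proof (rule sum.cong)
        fix n' assume n': "n' \<in> {r..<N1}"
        have "sq a (l - int i) (md b n' c) = tmode a (test_series k (l - int i)) (md b n' c)" by (rule sq_homogeneous[OF a])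
        also have "\<dots> = (\<Sum>m\<in>{l - int L..<M1}. sc (test_series k (l - int i) $$ m) (X m n'))"
          unfolding X_def by (rule tmode_box) (use that n' ab0 in \<open>auto simp: test_series_below\<close>)
        finally show "sc (test_series h (r + int i) $$ n') (sq a (l - int i) (md b n' c)) =
          (\<Sum>m\<in>{l - int L..<M1}. sc (test_series k (l - int i) $$ m * test_series h (r + int i) $$ n') (X m n'))"
          by (simp add: vs.scale_sum_right mult.commute)
      qed simp
      finally show ?thesis by (subst (asm) sum.swap) (simp add: BX_def sum.cartesian_product)
    qed
    have ba: "sq b (r + l - int i) (sq a (int i) c) = (\<Sum>(m, n')\<in>BY. sc (test_series k (int i) $$ m * test_series h (r + l - int i) $$ n') (Y m n'))"
      if "i < L" for i
    proof -
      have "sq a (int i) c = tmode a (test_series k (int i)) c" by (rule sq_homogeneous[OF a])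
      also have "\<dots> = (\<Sum>m\<in>{0..<N3}. sc (test_series k (int i) $$ m) (md a m c))"
        by (rule tmode_box) (auto simp: test_series_below N3)
      finally have "sq b (r + l - int i) (sq a (int i) c) = (\<Sum>m\<in>{0..<N3}. sc (test_series k (int i) $$ m) (sq b (r + l - int i) (md a m c)))"
        by (simp add: sq_sum2 sq_scale2)
      also have "\<dots> = (\<Sum>m\<in>{0..<N3}. \<Sum>n'\<in>{r + l - int L..<M2}. sc (test_series k (int i) $$ m * test_series h (r + l - int i) $$ n') (Y m n'))"
      proof (rule sum.cong)
        fix m assume m: "m \<in> {0..<N3}"
        have "sq b (r + l - int i) (md a m c) = tmode b (test_series h (r + l - int i)) (md a m c)" by (rule sq_homogeneous[OF b])
        also have "\<dots> = (\<Sum>n'\<in>{r + l - int L..<M2}. sc (test_series h (r + l - int i) $$ n') (Y m n'))"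
          unfolding Y_def by (rule tmode_box) (use that m ba0 in \<open>auto simp: test_series_below\<close>)
        finally show "sc (test_series k (int i) $$ m) (sq b (r + l - int i) (md a m c)) =
          (\<Sum>n'\<in>{r + l - int L..<M2}. sc (test_series k (int i) $$ m * test_series h (r + l - int i) $$ n') (Y m n'))"
          by (simp add: vs.scale_sum_right)
      qed simp
      finally show ?thesis by (simp add: BY_def sum.cartesian_product)
    qed
    have s: "(\<Sum>x\<in>B. sc (\<Sum>i<L. F i x) (Z x)) = (\<Sum>i<L. \<Sum>x\<in>B. sc (F i x) (Z x))"
      for F :: "nat \<Rightarrow> int \<times> int \<Rightarrow> complex" and Z :: "int \<times> int \<Rightarrow> 'v" and B
      by (subst sum.swap) (simp add: vs.scale_sum_left)
    have "(\<Sum>(m, n')\<in>BX. sc (K1 m n') (X m n')) = (\<Sum>x\<in>BX. sc (\<Sum>i<L. lcoef l i * (test_series k (l - int i) $$ fst x * test_series h (r + int i) $$ snd x)) (X (fst x) (snd x)))"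
      by (rule sum.cong) (auto simp: K1)
    also have "\<dots> = (\<Sum>i<L. sc (lcoef l i) (sq a (l - int i) (sq b (r + int i) c)))"
      unfolding s by (rule sum.cong) (auto simp: ab vs.scale_sum_right case_prod_unfold)
    finally have e1: "(\<Sum>(m, n')\<in>BX. sc (K1 m n') (X m n')) = (\<Sum>i<L. sc (lcoef l i) (sq a (l - int i) (sq b (r + int i) c)))" .
    have "(\<Sum>(m, n')\<in>BY. sc (K2 m n') (Y m n')) = (\<Sum>x\<in>BY. sc (\<Sum>i<L. (lcoef l i * (-1) powi l) * (test_series k (int i) $$ fst x * test_series h (r + l - int i) $$ snd x)) (Y (fst x) (snd x)))"
      by (rule sum.cong) (auto simp: K2)
    also have "\<dots> = (\<Sum>i<L. sc (lcoef l i * (-1) powi l) (sq b (r + l - int i) (sq a (int i) c)))"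
      unfolding s by (rule sum.cong) (auto simp: ba vs.scale_sum_right case_prod_unfold)
    finally have e2: "(\<Sum>(m, n')\<in>BY. sc (K2 m n') (Y m n')) = (\<Sum>i<L. sc (lcoef l i * (-1) powi l) (sq b (r + l - int i) (sq a (int i) c)))" .
    show "sq (sq a l b) r c =
      (\<Sum>i<L. sc (lcoef l i) (sq a (l - int i) (sq b (r + int i) c) - sc ((-1) powi l) (sq b (r + l - int i) (sq a (int i) c))))"
      unfolding lhs2 e1 e2 by (simp add: vs.scale_right_diff_distrib sum_subtractf)
  qed
qed

end

context voa_loc begin

text \<open>Stated for all sufficiently large \<open>L\<close>, the identity passes to sums in
  \<open>a\<close> and in \<open>b\<close>, and hence from homogeneous to arbitrary vectors.\<close>

definition sq_assoc_holds :: "'v \<Rightarrow> 'v \<Rightarrow> int \<Rightarrow> int \<Rightarrow> 'v \<Rightarrow> bool" where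
  "sq_assoc_holds a b l r c \<longleftrightarrow> (\<exists>L0. \<forall>L\<ge>L0. sq (sq a l b) r c =
    (\<Sum>i<L. sc (lcoef l i) (sq a (l - int i) (sq b (r + int i) c) - sc ((-1) powi l) (sq b (r + l - int i) (sq a (int i) c)))))"

lemma sq_assoc_holds_add1:
  assumes "sq_assoc_holds a b l r c" "sq_assoc_holds a' b l r c"
  shows "sq_assoc_holds (a + a') b l r c"
proof -
  obtain L1 L2 where L: "\<And>L. L1 \<le> L \<Longrightarrow> sq (sq a l b) r c =
    (\<Sum>i<L. sc (lcoef l i) (sq a (l - int i) (sq b (r + int i) c) - sc ((-1) powi l) (sq b (r + l - int i) (sq a (int i) c))))"
    "\<And>L. L2 \<le> L \<Longrightarrow> sq (sq a' l b) r c =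
    (\<Sum>i<L. sc (lcoef l i) (sq a' (l - int i) (sq b (r + int i) c) - sc ((-1) powi l) (sq b (r + l - int i) (sq a' (int i) c))))"
    using assms unfolding sq_assoc_holds_def by blast
  have "sq (sq (a + a') l b) r c = (\<Sum>i<L. sc (lcoef l i) (sq (a + a') (l - int i) (sq b (r + int i) c) - sc ((-1) powi l) (sq b (r + l - int i) (sq (a + a') (int i) c))))"
    if "max L1 L2 \<le> L" for L
  proof -
    have le: "L1 \<le> L" "L2 \<le> L" using that by auto
    have "sq (sq (a + a') l b) r c = sq (sq a l b) r c + sq (sq a' l b) r c" by (simp add: sq_add1)
    also have "\<dots> = (\<Sum>i<L. sc (lcoef l i) (sq (a + a') (l - int i) (sq b (r + int i) c) - sc ((-1) powi l) (sq b (r + l - int i) (sq (a + a') (int i) c))))"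
      unfolding L(1)[OF le(1)] L(2)[OF le(2)] sum.distrib[symmetric]
      by (simp add: sq_add1 sq_add2 vs.scale_right_distrib vs.scale_right_diff_distrib algebra_simps)
    finally show ?thesis .
  qed
  then show ?thesis unfolding sq_assoc_holds_def by blast
qed

lemma sq_assoc_holds_add2:
  assumes "sq_assoc_holds a b l r c" "sq_assoc_holds a b' l r c"
  shows "sq_assoc_holds a (b + b') l r c"
proof -
  obtain L1 L2 where L: "\<And>L. L1 \<le> L \<Longrightarrow> sq (sq a l b) r c =
    (\<Sum>i<L. sc (lcoef l i) (sq a (l - int i) (sq b (r + int i) c) - sc ((-1) powi l) (sq b (r + l - int i) (sq a (int i) c))))"
    "\<And>L. L2 \<le> L \<Longrightarrow> sq (sq a l b') r c =
    (\<Sum>i<L. sc (lcoef l i) (sq a (l - int i) (sq b' (r + int i) c) - sc ((-1) powi l) (sq b' (r + l - int i) (sq a (int i) c))))"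
    using assms unfolding sq_assoc_holds_def by blast
  have "sq (sq a l (b + b')) r c = (\<Sum>i<L. sc (lcoef l i) (sq a (l - int i) (sq (b + b') (r + int i) c) - sc ((-1) powi l) (sq (b + b') (r + l - int i) (sq a (int i) c))))"
    if "max L1 L2 \<le> L" for L
  proof -
    have le: "L1 \<le> L" "L2 \<le> L" using that by auto
    have "sq (sq a l (b + b')) r c = sq (sq a l b) r c + sq (sq a l b') r c" by (simp add: sq_add1 sq_add2)
    also have "\<dots> = (\<Sum>i<L. sc (lcoef l i) (sq a (l - int i) (sq (b + b') (r + int i) c) - sc ((-1) powi l) (sq (b + b') (r + l - int i) (sq a (int i) c))))"
      unfolding L(1)[OF le(1)] L(2)[OF le(2)] sum.distrib[symmetric]
      by (simp add: sq_add1 sq_add2 vs.scale_right_distrib vs.scale_right_diff_distrib algebra_simps)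
    finally show ?thesis .
  qed
  then show ?thesis unfolding sq_assoc_holds_def by blast
qed

lemma sq_assoc: "sq_assoc_holds a b l r c"
proof -
  have 0: "sq_assoc_holds 0 b l r c" "sq_assoc_holds a 0 l r c" for a b
    by (simp_all add: sq_assoc_holds_def)
  have 1: "sq_assoc_holds (\<Sum>k\<in>K. hcomp V a k) (hcomp V b j) l r c" if "finite K" for K j
    using that by (induction K) (auto simp: 0 sq_assoc_holds_def sq_assoc_homogeneous[OF hcomp_wt hcomp_wt]
        intro!: sq_assoc_holds_add1[unfolded sq_assoc_holds_def])
  define K J where "K = {k. hcomp V a k \<noteq> 0}" and "J = {k. hcomp V b k \<noteq> 0}"
  have K: "finite K" "finite J" by (auto simp: K_def J_def finite_hcomp)
  have a: "a = (\<Sum>k\<in>K. hcomp V a k)" by (rule hcomp_sum_superset) (auto simp: K K_def finite_hcomp)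
  have b: "b = (\<Sum>k\<in>J. hcomp V b k)" by (rule hcomp_sum_superset) (auto simp: K J_def finite_hcomp)
  have "sq_assoc_holds (\<Sum>k\<in>K. hcomp V a k) (\<Sum>k\<in>J. hcomp V b k) l r c"
    using K(2) by (induction J) (auto simp: 0 1[OF K(1)] intro!: sq_assoc_holds_add2)
  then show ?thesis using a b by simp
qed

section \<open>The square bracket Virasoro algebra and its weight grading\<close>

section \<open>The square bracket Virasoro algebra\<close>

abbreviation om :: "int \<Rightarrow> 'v \<Rightarrow> 'v" where "om \<equiv> sq (sq_conf V)"

lemma om_eq: "om n w = tmode (conf V) (test_series 2 n) w - sc (cc V / 24) (if n = -1 then w else 0)"
proof -
  have "sq_conf V = sc 1 (conf V) + sc (- (cc V / 24)) (vac V)"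
    by (simp add: sq_conf_def vs.scale_minus_left)
  then have "om n w = sc 1 (sq (conf V) n w) + sc (- (cc V / 24)) (sq (vac V) n w)"
    by (simp only: sq_lin1)
  then show ?thesis
    using sq_homogeneous[OF conf_wt, of n w] by (simp add: sq_vac vs.scale_minus_left)
qed

lemma conf_comm: "md (conf V) m (md (conf V) n c) - md (conf V) n (md (conf V) m c) =
  sc (of_int (m - n)) (md (conf V) (m + n - 1) c) + sc (if m + n = 2 then of_int (m * (m - 1) * (m - 2)) / 12 * cc V else 0) c"
proof -
  have "(m - 1) ^ 3 - (m - 1) = m * (m - 1) * (m - 2)"
    by (simp add: algebra_simps power3_eq_cube)
  moreover have "(m - 1) + (n - 1) = 0 \<longleftrightarrow> m + n = 2" "m - 1 - (n - 1) = m - n" "m - 1 + (n - 1) + 1 = m + n - 1" by auto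
  ultimately show ?thesis using Lm_comm[of "m - 1" "n - 1" c] by (simp add: Lm_def)
qed

lemma tmode_scale2: "tmode a f (sc r v) = sc r (tmode a f v)"
  using linear_op_tmode[of a f] unfolding linear_op_def by blast

text \<open>The Virasoro algebra as a central extension of vector fields: \<open>f\<close> stands
  for \<open>f(w) d/dw\<close>, and the central term is the Gelfand-Fuks cocycle
  \<open>Res f''' g\<close>. In this form a change of coordinates only means inserting other test
  functions.\<close>

lemma tmode_conf_comm:
  "tmode (conf V) f (tmode (conf V) g c) - tmode (conf V) g (tmode (conf V) f c) =
   tmode (conf V) (fls_deriv f * g - f * fls_deriv g) c +
   sc (cc V / 12 * (fls_deriv (fls_deriv (fls_deriv f)) * g) $$ (-1)) c"
proof -
  define df dg where "df = fls_subdegree f" and "dg = fls_subdegree g"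
  have f0: "f $$ j = 0" if "j < df" for j using that by (simp add: df_def)
  have g0: "g $$ j = 0" if "j < dg" for j using that by (simp add: dg_def)
  obtain N where N: "\<And>n. N \<le> n \<Longrightarrow> md (conf V) n c = 0" using md_trunc by blast
  have ex: "\<exists>R. \<forall>n\<in>J. \<forall>m\<ge>R. md (conf V) m (md (conf V) n c) = 0" if "finite J" for J
    using that
  proof (induction J)
    case (insert j J)
    obtain M where M: "\<forall>n\<in>J. \<forall>m\<ge>M. md (conf V) m (md (conf V) n c) = 0" using insert.IH by blast
    obtain M' where "\<forall>m\<ge>M'. md (conf V) m (md (conf V) j c) = 0" using md_trunc by blast
    then show ?case using M by (intro exI[of _ "max M M'"]) auto
  qed simp
  obtain R1 where R1: "\<forall>n\<in>{min df dg..<N}. \<forall>m\<ge>R1. md (conf V) m (md (conf V) n c) = 0" using ex[of "{min df dg..<N}"] by auto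
  \<comment> \<open>One upper limit for all windows: \<open>N\<close> and \<open>R1\<close> truncate
    the modes, the bounds with \<open>N + 2\<close> leave room for \<open>n = j + 1 - m\<close>, and
    those with 3 for the central pairs \<open>m + n = 2\<close>.\<close>
  define R where "R = Max {N, R1, N + 2 - dg, N + 2 - df, 3 - dg, 3 - df}"
  have R: "N \<le> R" "R1 \<le> R" "N + 2 - dg \<le> R" "N + 2 - df \<le> R" "3 - dg \<le> R" "3 - df \<le> R"
    unfolding R_def by (rule Max_ge; simp)+
  define C where "C = md (conf V)"
  have CC: "C m (C n c) = 0" if "R \<le> m" "min df dg \<le> n" for m n
    using R R1 N that unfolding C_def by (cases "n < N") auto
  have two: "tmode (conf V) f (tmode (conf V) g c) = (\<Sum>m\<in>{d..<R}. \<Sum>n\<in>{e..<R}. sc (f $$ m * g $$ n) (C m (C n c)))"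
    if d: "d = fls_subdegree f" "e = fls_subdegree g" "min df dg \<le> e" for f g d e
  proof -
    have "tmode (conf V) g c = (\<Sum>n\<in>{e..<R}. sc (g $$ n) (C n c))"
      unfolding C_def by (rule tmode_box) (use N R d in auto)
    then have "tmode (conf V) f (tmode (conf V) g c) = (\<Sum>n\<in>{e..<R}. sc (g $$ n) (tmode (conf V) f (C n c)))"
      by (simp add: linear_op_sum[OF linear_op_tmode] tmode_scale2)
    also have "\<dots> = (\<Sum>n\<in>{e..<R}. \<Sum>m\<in>{d..<R}. sc (f $$ m * g $$ n) (C m (C n c)))"
    proof (rule sum.cong)
      fix n assume n: "n \<in> {e..<R}"
      have "tmode (conf V) f (C n c) = (\<Sum>m\<in>{d..<R}. sc (f $$ m) (C m (C n c)))"
        unfolding C_def by (rule tmode_box) (use CC n d in \<open>auto simp: C_def\<close>)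
      then show "sc (g $$ n) (tmode (conf V) f (C n c)) = (\<Sum>m\<in>{d..<R}. sc (f $$ m * g $$ n) (C m (C n c)))"
        by (simp add: vs.scale_sum_right mult.commute)
    qed simp
    finally show ?thesis by (subst (asm) sum.swap)
  qed
  have t1: "tmode (conf V) f (tmode (conf V) g c) = (\<Sum>m\<in>{df..<R}. \<Sum>n\<in>{dg..<R}. sc (f $$ m * g $$ n) (C m (C n c)))"
    by (rule two) (auto simp: df_def dg_def)
  have t2: "tmode (conf V) g (tmode (conf V) f c) = (\<Sum>m\<in>{df..<R}. \<Sum>n\<in>{dg..<R}. sc (f $$ m * g $$ n) (C n (C m c)))"
    by (subst two[of dg g df f]) (auto simp: df_def dg_def mult.commute intro: sum.swap)
  define z where "z m n = (if m + n = 2 then of_int (m * (m - 1) * (m - 2)) / 12 * cc V else 0)" for m n :: int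
  have "tmode (conf V) f (tmode (conf V) g c) - tmode (conf V) g (tmode (conf V) f c) =
     (\<Sum>m\<in>{df..<R}. \<Sum>n\<in>{dg..<R}. sc (f $$ m * g $$ n) (C m (C n c) - C n (C m c)))"
    unfolding t1 t2 by (simp add: sum_subtractf vs.scale_right_diff_distrib)
  also have "\<dots> = (\<Sum>m\<in>{df..<R}. \<Sum>n\<in>{dg..<R}. sc (f $$ m * g $$ n * of_int (m - n)) (C (m + n - 1) c)) +
     (\<Sum>m\<in>{df..<R}. \<Sum>n\<in>{dg..<R}. sc (f $$ m * g $$ n * z m n) c)"
    unfolding C_def conf_comm z_def[symmetric] by (simp add: vs.scale_right_distrib sum.distrib)
  also have "(\<Sum>m\<in>{df..<R}. \<Sum>n\<in>{dg..<R}. sc (f $$ m * g $$ n * of_int (m - n)) (C (m + n - 1) c)) =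
     tmode (conf V) (fls_deriv f * g - f * fls_deriv g) c"
  proof -
    define h where "h = fls_deriv f * g - f * fls_deriv g"
    \<comment> \<open>With \<open>n = j + 1 - m\<close> the factor \<open>m - n\<close> of the
      commutator is \<open>2 * m - j - 1\<close>.\<close>
    have h: "h $$ j = (\<Sum>m\<in>{df..<R}. f $$ m * g $$ (j + 1 - m) * of_int (2 * m - j - 1))" if "j < N" for j
    proof -
      have "(fls_deriv f * g) $$ j = (\<Sum>i\<in>(\<lambda>m. m - 1) ` {df..<R}. fls_deriv f $$ i * g $$ (j - i))"
      proof (rule fls_conv_nth)
        fix i assume i: "i \<notin> (\<lambda>m. m - 1) ` {df..<R}"
        have "i + 1 \<notin> {df..<R}"
        proof
          assume "i + 1 \<in> {df..<R}"
          then have "i + 1 - 1 \<in> (\<lambda>m. m - 1) ` {df..<R}" by blast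
          then show False using i by simp
        qed
        then have "i + 1 < df \<or> j - i < dg" using R that by auto
        then show "fls_deriv f $$ i * g $$ (j - i) = 0" using f0[of "i + 1"] g0[of "j - i"] by auto
      qed simp
      also have "\<dots> = (\<Sum>m\<in>{df..<R}. of_int m * f $$ m * g $$ (j + 1 - m))"
        by (subst sum.reindex) (auto simp: inj_on_def algebra_simps)
      finally have 1: "(fls_deriv f * g) $$ j = (\<Sum>m\<in>{df..<R}. of_int m * f $$ m * g $$ (j + 1 - m))" .
      have "(f * fls_deriv g) $$ j = (\<Sum>m\<in>{df..<R}. f $$ m * fls_deriv g $$ (j - m))"
      proof (rule fls_conv_nth)
        fix i assume "i \<notin> {df..<R}"
        then have "i < df \<or> j - i + 1 < dg" using R that by auto
        then show "f $$ i * fls_deriv g $$ (j - i) = 0" using f0[of i] g0[of "j - i + 1"] by auto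
      qed simp
      then show ?thesis unfolding h_def fls_minus_nth 1
        by (simp add: sum_subtractf[symmetric] algebra_simps)
    qed
    have h0: "h $$ j = 0" if "j < df + dg - 1" for j
    proof (cases "j < N")
      case True
      have "f $$ m * g $$ (j + 1 - m) * of_int (2 * m - j - 1) = 0" if "m \<in> {df..<R}" for m
        using g0[of "j + 1 - m"] that \<open>j < df + dg - 1\<close> by auto
      then show ?thesis unfolding h[OF True] by (intro sum.neutral) blast
    next
      case False
      have "(fls_deriv f * g) $$ j = (\<Sum>i\<in>{}. fls_deriv f $$ i * g $$ (j - i))"
      proof (rule fls_conv_nth)
        fix i have "i + 1 < df \<or> j - i < dg" using that by auto
        then show "fls_deriv f $$ i * g $$ (j - i) = 0" using f0[of "i + 1"] g0[of "j - i"] by auto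
      qed simp
      moreover have "(f * fls_deriv g) $$ j = (\<Sum>i\<in>{}. f $$ i * fls_deriv g $$ (j - i))"
      proof (rule fls_conv_nth)
        fix i have "i < df \<or> j - i + 1 < dg" using that by auto
        then show "f $$ i * fls_deriv g $$ (j - i) = 0" using f0[of i] g0[of "j - i + 1"] by auto
      qed simp
      ultimately show ?thesis by (simp add: h_def)
    qed
    have "tmode (conf V) h c = (\<Sum>j\<in>{df + dg - 1..<N}. sc (h $$ j) (C j c))"
      unfolding C_def by (rule tmode_box) (use h0 N in auto)
    also have "\<dots> = (\<Sum>j\<in>{df + dg - 1..<N}. \<Sum>m\<in>{df..<R}. sc (f $$ m * g $$ (j + 1 - m) * of_int (2 * m - j - 1)) (C j c))"
      by (rule sum.cong) (auto simp: h vs.scale_sum_left)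
    also have "\<dots> = (\<Sum>m\<in>{df..<R}. \<Sum>j\<in>{df + dg - 1..<N}. sc (f $$ m * g $$ (j + 1 - m) * of_int (2 * m - j - 1)) (C j c))"
      by (rule sum.swap)
    also have "\<dots> = (\<Sum>m\<in>{df..<R}. \<Sum>n\<in>{dg..<R}. sc (f $$ m * g $$ n * of_int (m - n)) (C (m + n - 1) c))"
    proof (rule sum.cong)
      fix m assume m: "m \<in> {df..<R}"
      show "(\<Sum>j\<in>{df + dg - 1..<N}. sc (f $$ m * g $$ (j + 1 - m) * of_int (2 * m - j - 1)) (C j c)) =
        (\<Sum>n\<in>{dg..<R}. sc (f $$ m * g $$ n * of_int (m - n)) (C (m + n - 1) c))"
      proof (rule sum.reindex_bij_witness_not_neutral[where
            S' = "{j \<in> {df + dg - 1..<N}. g $$ (j + 1 - m) = 0 \<or> C j c = 0}" and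
            T' = "{n \<in> {dg..<R}. g $$ n = 0 \<or> C (m + n - 1) c = 0}" and
            i = "\<lambda>n. m + n - 1" and j = "\<lambda>j. j + 1 - m"])
        fix j assume j: "j \<in> {df + dg - 1..<N} - {j \<in> {df + dg - 1..<N}. g $$ (j + 1 - m) = 0 \<or> C j c = 0}"
        then have "dg \<le> j + 1 - m" using g0[of "j + 1 - m"] by force
        moreover have "j + 1 - m < R" using j m R by auto
        ultimately show "j + 1 - m \<in> {dg..<R} - {n \<in> {dg..<R}. g $$ n = 0 \<or> C (m + n - 1) c = 0}" using j by auto
      next
        fix n assume n: "n \<in> {dg..<R} - {n \<in> {dg..<R}. g $$ n = 0 \<or> C (m + n - 1) c = 0}"
        then have "m + n - 1 < N" using N[of "m + n - 1"] unfolding C_def by force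
        then show "m + n - 1 \<in> {df + dg - 1..<N} - {j \<in> {df + dg - 1..<N}. g $$ (j + 1 - m) = 0 \<or> C j c = 0}"
          using n m by auto
      next
        fix j assume "j \<in> {df + dg - 1..<N}"
        show "sc (f $$ m * g $$ (j + 1 - m) * of_int (m - (j + 1 - m))) (C (m + (j + 1 - m) - 1) c) =
          sc (f $$ m * g $$ (j + 1 - m) * of_int (2 * m - j - 1)) (C j c)"
          by (simp add: algebra_simps)
      qed (auto intro: finite_subset[of _ "{df + dg - 1..<N}"] finite_subset[of _ "{dg..<R}"])
    qed simp
    finally show ?thesis by (simp add: h_def)
  qed
  also have "(\<Sum>m\<in>{df..<R}. \<Sum>n\<in>{dg..<R}. sc (f $$ m * g $$ n * z m n) c) =
    sc (cc V / 12 * (fls_deriv (fls_deriv (fls_deriv f)) * g) $$ (-1)) c"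
  proof -
    have "(fls_deriv (fls_deriv (fls_deriv f)) * g) $$ (-1) =
      (\<Sum>i\<in>(\<lambda>m. m - 3) ` {df..<R}. fls_deriv (fls_deriv (fls_deriv f)) $$ i * g $$ (- 1 - i))"
    proof (rule fls_conv_nth)
      fix i assume i: "i \<notin> (\<lambda>m. m - 3) ` {df..<R}"
      have "i + 3 \<notin> {df..<R}"
      proof
        assume "i + 3 \<in> {df..<R}"
        then have "i + 3 - 3 \<in> (\<lambda>m. m - 3) ` {df..<R}" by blast
        then show False using i by simp
      qed
      then have "i + 3 < df \<or> - 1 - i < dg" using R by auto
      then show "fls_deriv (fls_deriv (fls_deriv f)) $$ i * g $$ (- 1 - i) = 0"
        using f0[of "i + 1 + 1 + 1"] g0[of "- 1 - i"] by auto
    qed simp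
    also have "\<dots> = (\<Sum>m\<in>{df..<R}. of_int (m * (m - 1) * (m - 2)) * f $$ m * g $$ (2 - m))"
      by (subst sum.reindex) (auto simp: inj_on_def algebra_simps)
    finally have e: "(fls_deriv (fls_deriv (fls_deriv f)) * g) $$ (-1) =
      (\<Sum>m\<in>{df..<R}. of_int (m * (m - 1) * (m - 2)) * f $$ m * g $$ (2 - m))" .
    have "(\<Sum>n\<in>{dg..<R}. sc (f $$ m * g $$ n * z m n) c) =
      sc (cc V / 12 * (of_int (m * (m - 1) * (m - 2)) * f $$ m * g $$ (2 - m))) c" if "m \<in> {df..<R}" for m
    proof (cases "dg \<le> 2 - m")
      case True
      have "(\<Sum>n\<in>{dg..<R}. sc (f $$ m * g $$ n * z m n) c) = (\<Sum>n\<in>{dg..<R}. if n = 2 - m then sc (f $$ m * g $$ n * z m n) c else 0)"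
        by (rule sum.cong) (auto simp: z_def)
      also have "\<dots> = sc (f $$ m * g $$ (2 - m) * z m (2 - m)) c" using True R that by auto
      also have "f $$ m * g $$ (2 - m) * z m (2 - m) = cc V / 12 * (of_int (m * (m - 1) * (m - 2)) * f $$ m * g $$ (2 - m))"
        by (simp add: z_def)
      finally show ?thesis .
    next
      case False
      then have "g $$ n * z m n = 0" if "n \<in> {dg..<R}" for n using that by (auto simp: z_def)
      then have "(\<Sum>n\<in>{dg..<R}. sc (f $$ m * g $$ n * z m n) c) = 0"
        by (intro sum.neutral) (simp add: mult.assoc)
      then show ?thesis using False g0[of "2 - m"] by simp
    qed
    then show ?thesis unfolding e by (simp add: vs.scale_sum_left sum_distrib_left)
  qed
  finally show ?thesis .
qed

end

lemma deriv_test_series: "fls_deriv (test_series k n) = of_int n * test_series (k - 1) (n - 1) + of_int (k - 1) * test_series (k - 1) n"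
proof -
  have o: "test_series k m = one_plus_X * test_series (k - 1) m" for m
    using power_int_add_1[of one_plus_X "k - 1 - 1"] by (simp add: test_series_def algebra_simps)
  have "one_plus_X * fls_deriv (test_series k n) = of_int n * test_series k (n - 1) + of_int (k - 1) * test_series k n"
    by (rule one_plus_X_deriv_test_series)
  also have "\<dots> = one_plus_X * (of_int n * test_series (k - 1) (n - 1) + of_int (k - 1) * test_series (k - 1) n)"
    by (simp only: o distrib_left mult.left_commute)
  finally show ?thesis by (simp only: mult_cancel_left one_plus_X_nonzero simp_thms)
qed

lemma test_series_mult: "test_series j a * test_series k b = test_series (j + k - 1) (a + b)"
proof -
  have "one_plus_X powi (j - 1) * one_plus_X powi (k - 1) = one_plus_X powi (j + k - 1 - 1)"
    using power_int_add[of one_plus_X "j - 1" "k - 1"] by (simp add: algebra_simps)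
  moreover have "log_series powi a * log_series powi b = log_series powi (a + b)" using power_int_add[of log_series a b] by simp
  moreover have "(A * B) * (A' * B') = (A * A') * (B * B')" for A A' B B' :: "complex fls"
    by (simp only: mult_ac)
  ultimately show ?thesis unfolding test_series_def by (simp only:)
qed

text \<open>\<open>test_series 2 n\<close> is the vector field \<open>z^n d/dz\<close> expressed in
  the coordinate \<open>w\<close>, so the bracket is that of \<open>z^m d/dz\<close> and
  \<open>z^n d/dz\<close>.\<close>

lemma tst2_bracket: "fls_deriv (test_series 2 m) * test_series 2 n - test_series 2 m * fls_deriv (test_series 2 n) = of_int (m - n) * test_series 2 (m + n - 1)"
proof -
  have d: "fls_deriv (test_series 2 m) = of_int m * test_series 1 (m - 1) + test_series 1 m" for m by (simp add: deriv_test_series)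
  have t: "test_series 1 a * test_series 2 b = test_series 2 (a + b)" "test_series 2 a * test_series 1 b = test_series 2 (a + b)" for a b by (simp_all add: test_series_mult)
  have e: "m - 1 + n = m + n - 1" "m + (n - 1) = m + n - 1" by auto
  have "fls_deriv (test_series 2 m) * test_series 2 n = of_int m * test_series 2 (m + n - 1) + test_series 2 (m + n)"
    unfolding d distrib_right mult.assoc t e ..
  moreover have "test_series 2 m * fls_deriv (test_series 2 n) = of_int n * test_series 2 (m + n - 1) + test_series 2 (m + n)"
    unfolding d distrib_left mult.left_commute[of "test_series 2 m" "of_int n"] t e ..
  ultimately show ?thesis by (simp add: left_diff_distrib)
qed

text \<open>The first term is the cocycle in the coordinate \<open>z\<close>. The second is the
  Schwarzian correction of \<open>w = e^z - 1\<close>; its residue is nonzero only for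
  \<open>m + n = 0\<close>.\<close>

lemma tst2_schwarzian: "fls_deriv (fls_deriv (fls_deriv (test_series 2 m))) * test_series 2 n =
  of_int (m * (m - 1) * (m - 2)) * test_series 0 (m + n - 3) - of_int m * test_series 0 (m + n - 1)"
proof -
  have d1: "fls_deriv (test_series 2 m) = of_int m * test_series 1 (m - 1) + test_series 1 m" by (simp add: deriv_test_series)
  have d2: "fls_deriv (fls_deriv (test_series 2 m)) = of_int (m * (m - 1)) * test_series 0 (m - 2) + of_int m * test_series 0 (m - 1)"
    unfolding d1 by (simp add: deriv_test_series algebra_simps)
  have d3: "fls_deriv (fls_deriv (fls_deriv (test_series 2 m))) = of_int (m * (m - 1) * (m - 2)) * test_series (-1) (m - 3) - of_int m * test_series (-1) (m - 1)"
    unfolding d2 by (simp add: deriv_test_series algebra_simps)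
  have t: "test_series (-1) j * test_series 2 n = test_series 0 (j + n)" for j by (simp add: test_series_mult)
  have e: "m - 3 + n = m + n - 3" "m - 1 + n = m + n - 1" by auto
  show ?thesis unfolding d3 left_diff_distrib mult.assoc t e ..
qed

context voa_loc begin

lemma om_comm: "om m (om n w) - om n (om m w) =
  sc (of_int (m - n)) (om (m + n - 1) w) + sc (if m + n = 2 then of_int (m * (m - 1) * (m - 2)) / 12 * cc V else 0) w"
proof -
  define t where "t n = tmode (conf V) (test_series 2 n)" for n
  define e where "e n = cc V / 24 * (if n = -1 then 1 else 0 :: complex)" for n :: int
  have o: "om n w = t n w + sc (- e n) w" for n w
    by (simp add: om_eq t_def e_def vs.scale_minus_left)
  have lt: "t n (v + sc r v') = t n v + sc r (t n v')" for n v v' r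
    using linear_op_tmode[of "conf V" "test_series 2 n"] by (simp add: t_def linear_op_def)
  have "om m (om n w) - om n (om m w) = t m (t n w) - t n (t m w)"
    unfolding o lt by (simp add: vs.scale_right_distrib vs.scale_minus_left algebra_simps)
  also have "\<dots> = tmode (conf V) (of_int (m - n) * test_series 2 (m + n - 1)) w +
     sc (cc V / 12 * ((of_int (m * (m - 1) * (m - 2)) * test_series 0 (m + n - 3) - of_int m * test_series 0 (m + n - 1)) $$ (-1))) w"
    unfolding t_def tmode_conf_comm tst2_bracket tst2_schwarzian ..
  also have "tmode (conf V) (of_int (m - n) * test_series 2 (m + n - 1)) w = sc (of_int (m - n)) (t (m + n - 1) w)"
  proof -
    obtain N where N: "\<And>j. N \<le> j \<Longrightarrow> md (conf V) j w = 0" using md_trunc by blast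
    have "tmode (conf V) (of_int (m - n) * test_series 2 (m + n - 1)) w =
      (\<Sum>j\<in>{m + n - 1..<N}. sc ((of_int (m - n) * test_series 2 (m + n - 1)) $$ j) (md (conf V) j w))"
      by (rule tmode_box) (auto simp: N test_series_below fls_of_int_times_nth simp del: of_int_diff)
    moreover have "t (m + n - 1) w = (\<Sum>j\<in>{m + n - 1..<N}. sc (test_series 2 (m + n - 1) $$ j) (md (conf V) j w))"
      unfolding t_def by (rule tmode_box) (auto simp: N test_series_below)
    ultimately show ?thesis by (simp add: fls_of_int_times_nth vs.scale_sum_right del: of_int_diff)
  qed
  also have "(of_int (m * (m - 1) * (m - 2)) * test_series 0 (m + n - 3) - of_int m * test_series 0 (m + n - 1)) $$ (-1) =
    (if m + n = 2 then of_int (m * (m - 1) * (m - 2)) else 0) - (if m + n = 0 then of_int m else 0)"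
    by (simp add: fls_of_int_times_nth residue_tst0 del: of_int_mult of_int_diff)
  also have "sc (of_int (m - n)) (t (m + n - 1) w) + sc (cc V / 12 *
    ((if m + n = 2 then of_int (m * (m - 1) * (m - 2)) else 0) - (if m + n = 0 then of_int m else 0))) w =
    sc (of_int (m - n)) (om (m + n - 1) w) + sc (if m + n = 2 then of_int (m * (m - 1) * (m - 2)) / 12 * cc V else 0) w"
  proof -
    \<comment> \<open>Only \<open>m + n = 0\<close> matters, where \<open>m - n = 2 * m\<close>: the
      shift c/24 times \<open>2 * m\<close> is exactly the Schwarzian term c/12 times
      \<open>m\<close>.\<close>
    have "of_int (m - n) * - e (m + n - 1) = - (cc V / 12 * (if m + n = 0 then of_int m else 0))"
    proof (cases "m + n = 0")
      case True
      then have "n = - m" by simp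
      then show ?thesis by (simp add: e_def)
    next
      case False
      then have "m + n - 1 \<noteq> - 1" by simp
      then show ?thesis using False by (simp add: e_def)
    qed
    then have "sc (of_int (m - n)) (om (m + n - 1) w) = sc (of_int (m - n)) (t (m + n - 1) w) + sc (- (cc V / 12 * (if m + n = 0 then of_int m else 0))) w"
      unfolding o vs.scale_right_distrib vs.scale_scale by simp
    then show ?thesis
      by (auto simp: vs.scale_left_diff_distrib vs.scale_minus_left algebra_simps)
  qed
  finally show ?thesis .
qed

lemma om_vac: "om (-1) (vac V) = sq_conf V"
  by (rule sq_creation_minus1)

lemma om1_om: "om 1 (om n w) = om n (om 1 w) + sc (of_int (1 - n)) (om n w)"
  using om_comm[of 1 n w] by (simp add: algebra_simps)

text \<open>This is \<open>L[1]\<close> annihilating the conformal vector. It reduces the adjoint of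
  a Virasoro mode to a single term in \<open>opp_om\<close>.\<close>

lemma om2_conf: "om 2 (sq_conf V) = 0"
  using om_comm[of 2 "-1" "vac V"] by (simp add: om_vac sq_creation)

lemma om1_conf: "om 1 (sq_conf V) = sc 2 (sq_conf V)"
  using om_comm[of 1 "-1" "vac V"] by (simp add: om_vac sq_creation)

section \<open>The grading by the square bracket Virasoro algebra\<close>

abbreviation Wt :: "int \<Rightarrow> 'v set" where "Wt k \<equiv> wtspace (sq_voa V) (of_int k)"

lemma sq_voa_simps [simp]: "scal (sq_voa V) = sc" "vmode (sq_voa V) = sq" "conf (sq_voa V) = sq_conf V"
  "vac (sq_voa V) = vac V"
  by (simp_all add: sq_voa_def)

lemma Wt_iff: "v \<in> Wt k \<longleftrightarrow> om 1 v = sc (of_int k) v"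
  by (simp add: wtspace_def Lm_def)

lemma Wt_subspace: "vs.subspace (Wt k)"
proof -
  have "x + y \<in> Wt k" if "x \<in> Wt k" "y \<in> Wt k" for x y
    using that unfolding Wt_iff sq_add2 vs.scale_right_distrib by simp
  moreover have "sc c x \<in> Wt k" if "x \<in> Wt k" for c x
    using that unfolding Wt_iff sq_scale2 by (simp add: mult.commute)
  moreover have "0 \<in> Wt k" unfolding Wt_iff by simp
  ultimately show ?thesis unfolding vs.subspace_def by blast
qed

lemma om_Wt: "v \<in> Wt k \<Longrightarrow> om n v \<in> Wt (k - n + 1)"
proof -
  assume "v \<in> Wt k"
  then have "om 1 (om n v) = sc (of_int k) (om n v) + sc (of_int (1 - n)) (om n v)"
    unfolding om1_om by (simp only: Wt_iff sq_scale2)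
  also have "\<dots> = sc (of_int k + of_int (1 - n)) (om n v)"
    by (simp only: vs.scale_left_distrib)
  also have "of_int k + of_int (1 - n) = (of_int (k - n + 1) :: complex)" by simp
  finally show ?thesis unfolding Wt_iff .
qed

lemma om_kills:
  assumes "v \<in> Wt k" "\<And>j. j < 0 \<Longrightarrow> Wt j = {0}" "k + 1 < n" shows "om n v = 0"
  using om_Wt[OF assms(1), of n] assms(2)[of "k - n + 1"] assms(3) by simp

text \<open>\<open>L[0]\<close> does not preserve the weight spaces of \<open>L(0)\<close>, but it
  preserves this filtration and acts on the \<open>n\<close>th quotient as \<open>n\<close>.\<close>

definition weight_filtration :: "int \<Rightarrow> 'v set" where "weight_filtration n = {v. \<forall>k>n. hcomp V v k = 0}"

lemma hcomp_zero: "hcomp V 0 k = 0"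
  using hcomp_homogeneous[OF wt_zero, of k] by (simp add: fun_eq_iff split: if_splits)

lemma weight_filtration_subspace: "vs.subspace (weight_filtration n)"
  unfolding vs.subspace_def weight_filtration_def by (auto simp: hcomp_add hcomp_scale hcomp_zero)

lemma weight_filtration_mono: "m \<le> n \<Longrightarrow> weight_filtration m \<subseteq> weight_filtration n"
  by (auto simp: weight_filtration_def)

lemma wt_weight_filtration: "v \<in> wtspace V (of_int k) \<Longrightarrow> k \<le> n \<Longrightarrow> v \<in> weight_filtration n"
  by (auto simp: weight_filtration_def hcomp_homogeneous)

text \<open>\<open>L[0]\<close> is the residue against \<open>ln(1+w) (1+w) = w + ...\<close>. The
  leading term gives \<open>L(0)\<close>, and the higher modes of the conformal vector lower the
  weight.\<close>

lemma om1_wt_weight_filtration: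
  assumes v: "v \<in> wtspace V (of_int k)" shows "om 1 v - sc (of_int k) v \<in> weight_filtration (k - 1)"
proof -
  obtain N where N: "\<And>j. N \<le> j \<Longrightarrow> md (conf V) j v = 0" and N2: "2 \<le> N"
    using md_trunc[of "conf V" v] by (metis max.bounded_iff max.cobounded2)
  have one: "test_series 2 1 $$ 1 = 1"
  proof -
    have "of_int (0 + 1) * test_series 2 1 $$ (0 + 1) = of_int 1 * test_series 2 (1 - 1) $$ 0 + of_int (2 - 1 - 0) * test_series 2 1 $$ 0"
      by (rule test_series_rec)
    then show ?thesis using test_series_0[of 2 0] test_series_below[of 0 1 2] by simp
  qed
  have "om 1 v = (\<Sum>j\<in>{1..<N}. sc (test_series 2 1 $$ j) (md (conf V) j v))"
    unfolding om_eq using tmode_box[of 1 "test_series 2 1" N "conf V" v] N by (simp add: test_series_below)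
  also have "{1..<N} = insert 1 {2..<N}" using N2 by auto
  finally have "om 1 v = sc (of_int k) v + (\<Sum>j\<in>{2..<N}. sc (test_series 2 1 $$ j) (md (conf V) j v))"
    using v by (simp add: one wtspace_iff Lm_def)
  moreover have "(\<Sum>j\<in>{2..<N}. sc (test_series 2 1 $$ j) (md (conf V) j v)) \<in> weight_filtration (k - 1)"
  proof (intro vs.subspace_sum[OF weight_filtration_subspace] vs.subspace_scale[OF weight_filtration_subspace])
    fix j assume "j \<in> {2..<N}"
    then show "md (conf V) j v \<in> weight_filtration (k - 1)"
      using md_wt_int[OF conf_wt v, of j] by (intro wt_weight_filtration[of _ "k + 2 - j - 1"]) auto
  qed
  ultimately show ?thesis by simp
qed

lemma om1_weight_filtration:
  assumes v: "v \<in> weight_filtration n" shows "om 1 v - sc (of_int n) v \<in> weight_filtration (n - 1)"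
proof -
  define K where "K = {k. hcomp V v k \<noteq> 0}"
  have K: "finite K" by (simp add: K_def finite_hcomp)
  have Kn: "k \<le> n" if "k \<in> K" for k using v that by (force simp: K_def weight_filtration_def not_less[symmetric])
  have e: "v = (\<Sum>k\<in>K. hcomp V v k)" by (rule hcomp_sum_superset[OF K]) (simp add: K_def)
  have "om 1 v - sc (of_int n) v = (\<Sum>k\<in>K. (om 1 (hcomp V v k) - sc (of_int k) (hcomp V v k)) + sc (of_int (k - n)) (hcomp V v k))"
    by (subst (1 2) e)
      (simp add: sq_sum2 vs.scale_sum_right sum_subtractf[symmetric] vs.scale_left_diff_distrib)
  also have "\<dots> \<in> weight_filtration (n - 1)"
  proof (intro vs.subspace_sum[OF weight_filtration_subspace] vs.subspace_add[OF weight_filtration_subspace])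
    fix k assume k: "k \<in> K"
    show "om 1 (hcomp V v k) - sc (of_int k) (hcomp V v k) \<in> weight_filtration (n - 1)"
      using om1_wt_weight_filtration[OF hcomp_wt, of v k] weight_filtration_mono[of "k - 1" "n - 1"] Kn[OF k] by auto
    show "sc (of_int (k - n)) (hcomp V v k) \<in> weight_filtration (n - 1)"
    proof (cases "k = n")
      case True then show ?thesis using vs.subspace_0[OF weight_filtration_subspace] by simp
    next
      case False
      then have "hcomp V v k \<in> weight_filtration (n - 1)" using Kn[OF k] by (intro wt_weight_filtration[OF hcomp_wt]) auto
      then show ?thesis by (rule vs.subspace_scale[OF weight_filtration_subspace])
    qed
  qed
  finally show ?thesis .
qed

lemma weight_filtration_zero: "(\<And>k. hcomp V v k = 0) \<Longrightarrow> v = 0"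
  using hcomp_sum_superset[of "{}" v] by simp

text \<open>The eigenvalue is the weight \<open>n\<close> of the top component: if \<open>k\<close>
  and \<open>n\<close> differed, \<open>(k - n) v = L[0] v - n v\<close> would lie one step lower in
  the filtration.\<close>

lemma Wt_weight_filtration:
  assumes v: "v \<in> Wt k" shows "v \<in> weight_filtration k"
proof (cases "v = 0")
  case True then show ?thesis using vs.subspace_0[OF weight_filtration_subspace] by simp
next
  case False
  define K where "K = {k. hcomp V v k \<noteq> 0}"
  have K: "finite K" "K \<noteq> {}" using weight_filtration_zero False by (auto simp: K_def finite_hcomp)
  define n where "n = Max K"
  have n: "v \<in> weight_filtration n" unfolding weight_filtration_def
  proof (safe, rule ccontr)
    fix j assume "n < j" "hcomp V v j \<noteq> 0"
    then show False using Max_ge[OF K(1), of j] by (auto simp: n_def K_def)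
  qed
  have nn: "hcomp V v n \<noteq> 0" using Max_in[OF K] by (simp add: n_def K_def)
  have "n = k"
  proof (rule ccontr)
    assume nk: "n \<noteq> k"
    have "om 1 v - sc (of_int n) v = sc (of_int (k - n)) v"
      using v by (simp add: Wt_iff vs.scale_left_diff_distrib)
    then have "sc (of_int (k - n)) v \<in> weight_filtration (n - 1)" using om1_weight_filtration[OF n] by (simp only:)
    then have "sc (1 / of_int (k - n)) (sc (of_int (k - n)) v) \<in> weight_filtration (n - 1)"
      by (rule vs.subspace_scale[OF weight_filtration_subspace])
    moreover have "(of_int (k - n) :: complex) \<noteq> 0" using nk by simp
    ultimately have "v \<in> weight_filtration (n - 1)" by simp
    then show False using nn by (simp add: weight_filtration_def)
  qed
  then show ?thesis using n by simp
qed

lemma vac_Wt: "vac V \<in> Wt 0"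
  unfolding Wt_iff by (simp add: sq_creation)

lemma conf_Wt: "sq_conf V \<in> Wt 2"
  unfolding Wt_iff by (simp add: om1_conf)

end

locale cft_loc = voa_loc V for V :: "'v::ab_group_add voa_data" +
  assumes wt_neg: "k < 0 \<Longrightarrow> wtspace V (of_int k) = {0}"
    and wt_vac: "wtspace V 0 = module.span (scal V) {vac V}"
begin

lemma hcomp_neg: "k < 0 \<Longrightarrow> hcomp V v k = 0"
  using hcomp_wt[of v k] wt_neg[of k] by auto

lemma weight_filtration_neg: "n < 0 \<Longrightarrow> v \<in> weight_filtration n \<Longrightarrow> v = 0"
proof (rule weight_filtration_zero)
  fix k assume "n < 0" "v \<in> weight_filtration n"
  then show "hcomp V v k = 0" using hcomp_neg[of k v] by (cases "k < 0") (auto simp: weight_filtration_def)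
qed

lemma Wt_neg: "k < 0 \<Longrightarrow> Wt k = {0}"
  using Wt_weight_filtration weight_filtration_neg vs.subspace_0[OF Wt_subspace] by blast

text \<open>In filtration degree 0 only the \<open>L(0)\<close>-weight 0 component is left, and that
  space is spanned by the vacuum.\<close>

lemma Wt_0:
  assumes "v \<in> Wt 0" obtains r where "v = sc r (vac V)"
proof -
  have "v \<in> weight_filtration 0" by (rule Wt_weight_filtration[OF assms])
  then have "{k. hcomp V v k \<noteq> 0} \<subseteq> {0}" using hcomp_neg unfolding weight_filtration_def by (force simp: not_less[symmetric])
  then have "v = hcomp V v 0" using hcomp_sum_superset[of "{0}" v] by simp
  then have "v \<in> wtspace V 0" using hcomp_wt[of v 0] by simp
  then show ?thesis using that vs.span_singleton[of "vac V"] by (auto simp: wt_vac)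
qed

lemma weight_filtration_finite_span: "\<exists>S. finite S \<and> weight_filtration k \<subseteq> vs.span S"
proof -
  define T where "T i = (SOME S. finite S \<and> vs.span S = wtspace V (of_int i))" for i
  have T: "finite (T i)" "vs.span (T i) = wtspace V (of_int i)" for i
    using someI_ex[OF wt_finite_span[of i]] by (auto simp: T_def)
  define S where "S = (\<Union>i\<in>{0..k}. T i)"
  have "v \<in> vs.span S" if v: "v \<in> weight_filtration k" for v
  proof -
    have "v = (\<Sum>i\<in>{0..k}. hcomp V v i)"
    proof (rule hcomp_sum_superset)
      show "{i. hcomp V v i \<noteq> 0} \<subseteq> {0..k}"
        using v hcomp_neg unfolding weight_filtration_def by (auto simp: not_less[symmetric])
    qed simp
    also have "\<dots> \<in> vs.span S"
    proof (rule vs.span_sum)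
      fix i assume "i \<in> {0..k}"
      then have "vs.span (T i) \<subseteq> vs.span S" by (intro vs.span_mono) (auto simp: S_def)
      then show "hcomp V v i \<in> vs.span S" using hcomp_wt[of v i] T(2)[of i] by auto
    qed
    finally show ?thesis .
  qed
  moreover have "finite S" by (simp add: S_def T)
  ultimately show ?thesis by blast
qed

text \<open>\<open>L[0]\<close> is triangular for the filtration with diagonal entries that differ
  from step to step, hence diagonalizable. The induction subtracts the lower eigenvectors from a
  vector of filtration degree \<open>n\<close>.\<close>

lemma Wt_decomp: "\<exists>d n. v = (\<Sum>k<n. d k) \<and> (\<forall>k. d k \<in> Wt (int k))"
proof -
  have main: "\<exists>d. v = (\<Sum>k<n. d k) \<and> (\<forall>k. d k \<in> Wt (int k))" if "v \<in> weight_filtration (int n - 1)" for n v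
    using that
  proof (induction n arbitrary: v)
    case 0
    then have "v = 0" using weight_filtration_neg[of "-1"] by simp
    then show ?case by (intro exI[of _ "\<lambda>_. 0"] conjI allI vs.subspace_0[OF Wt_subspace]) simp
  next
    case (Suc n)
    define u where "u = om 1 v - sc (of_int (int n)) v"
    have "u \<in> weight_filtration (int n - 1)" using om1_weight_filtration[of v "int n"] Suc.prems by (simp add: u_def)
    from Suc.IH[OF this] obtain d where d: "u = (\<Sum>k<n. d k)" "\<And>k. d k \<in> Wt (int k)" by blast
    \<comment> \<open>The solution of \<open>(L[0] - n) w = u\<close>, component by component; the
      divisor is nonzero as \<open>k < n\<close>.\<close>
    define w where "w k = sc (1 / of_int (int k - int n)) (d k)" for k
    have w: "w k \<in> Wt (int k)" for k unfolding w_def by (rule vs.subspace_scale[OF Wt_subspace d(2)])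
    have "om 1 (w k) - sc (of_int (int n)) (w k) = d k" if "k < n" for k
    proof -
      have "om 1 (w k) - sc (of_int (int n)) (w k) = sc (of_int (int k - int n)) (w k)"
        using w[of k, unfolded Wt_iff] by (simp add: vs.scale_left_diff_distrib)
      moreover have "(of_int (int k - int n) :: complex) \<noteq> 0" using that by simp
      ultimately show ?thesis by (simp add: w_def)
    qed
    then have "(\<Sum>k<n. om 1 (w k) - sc (of_int (int n)) (w k)) = u" unfolding d(1) by (intro sum.cong) auto
    then have "om 1 (\<Sum>k<n. w k) - sc (of_int (int n)) (\<Sum>k<n. w k) = u"
      by (simp add: sq_sum2 vs.scale_sum_right sum_subtractf)
    then have "om 1 (v - (\<Sum>k<n. w k)) = sc (of_int (int n)) (v - (\<Sum>k<n. w k))"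
    proof -
      assume a: "om 1 (\<Sum>k<n. w k) - sc (of_int (int n)) (\<Sum>k<n. w k) = u"
      have "v - (\<Sum>k<n. w k) = v + sc (-1) (\<Sum>k<n. w k)" by simp
      then have "om 1 (v - (\<Sum>k<n. w k)) = om 1 v - om 1 (\<Sum>k<n. w k)"
        using sq_add2[of "sq_conf V" 1 v "sc (-1) (\<Sum>k<n. w k)"] sq_scale2[of "sq_conf V" 1 "-1" "\<Sum>k<n. w k"] by simp
      also have "\<dots> = (om 1 v - sc (of_int (int n)) v) - (om 1 (\<Sum>k<n. w k) - sc (of_int (int n)) (\<Sum>k<n. w k)) +
          (sc (of_int (int n)) v - sc (of_int (int n)) (\<Sum>k<n. w k))" by simp
      also have "\<dots> = sc (of_int (int n)) (v - (\<Sum>k<n. w k))"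
        unfolding a u_def vs.scale_right_diff_distrib by simp
      finally show ?thesis .
    qed
    then have "v - (\<Sum>k<n. w k) \<in> Wt (int n)" by (simp only: Wt_iff)
    then show ?case using w
      by (intro exI[of _ "\<lambda>k. if k = n then v - (\<Sum>k<n. w k) else w k"]) auto
  qed
  define K where "K = {k. hcomp V v k \<noteq> 0}"
  have K: "finite K" by (simp add: K_def finite_hcomp)
  define n where "n = nat (Max (insert 0 K) + 1)"
  have "k \<le> int n - 1" if "hcomp V v k \<noteq> 0" for k
    using Max_ge[of "insert 0 K" k] Max_ge[of "insert 0 K" 0] K that by (auto simp: n_def K_def)
  then have "v \<in> weight_filtration (int n - 1)" unfolding weight_filtration_def by force
  then show ?thesis using main by blast
qed

end

section \<open>Genus one traces, the sewing form and dual bases\<close>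

section \<open>Linearity of genus one functions\<close>

context voa_loc begin

lemma zero_mode_superset:
  assumes "finite K" "{k. hcomp V v k \<noteq> 0} \<subseteq> K"
  shows "zero_mode V v w = (\<Sum>k\<in>K. md (hcomp V v k) (k - 1) w)"
  unfolding zero_mode_def by (rule Sum_any.expand_superset) (use assms in auto)

lemma zero_mode_lin: "zero_mode V (sc r v + sc s v') w = sc r (zero_mode V v w) + sc s (zero_mode V v' w)"
proof -
  define K where "K = {k. hcomp V v k \<noteq> 0} \<union> {k. hcomp V v' k \<noteq> 0}"
  have K: "finite K" by (simp add: K_def finite_hcomp)
  have e: "zero_mode V v w = (\<Sum>k\<in>K. md (hcomp V v k) (k - 1) w)" "zero_mode V v' w = (\<Sum>k\<in>K. md (hcomp V v' k) (k - 1) w)"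
    by (rule zero_mode_superset[OF K]; auto simp: K_def)+
  have "zero_mode V (sc r v + sc s v') w = (\<Sum>k\<in>K. md (hcomp V (sc r v + sc s v') k) (k - 1) w)"
    by (rule zero_mode_superset[OF K]) (auto simp: K_def hcomp_add hcomp_scale)
  then show ?thesis unfolding e
    by (simp add: hcomp_add hcomp_scale md_add1 md_scale1 sum.distrib vs.scale_sum_right)
qed

lemma wt_subspace: "vs.subspace (wtspace V s)"
  unfolding vs.subspace_def using wt_zero wt_add wt_scale by blast

lemma zero_mode_wt:
  assumes w: "w \<in> wtspace V s" shows "zero_mode V v w \<in> wtspace V s"
proof -
  have "md (hcomp V v k) (k - 1) w \<in> wtspace V s" for k
    using md_wt[OF hcomp_wt w, of v k "k - 1"] by simp
  then show ?thesis
    unfolding zero_mode_superset[OF finite_hcomp subset_refl, of v w] by (intro vs.subspace_sum[OF wt_subspace])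
qed

text \<open>Basis coefficients are linear only on the span of the basis; therefore
  \<open>zero_mode\<close> must map the \<open>L(0)\<close>-eigenspace, for an arbitrary complex
  eigenvalue, to itself.\<close>

lemma Z1_lin: "Z1 V (sc r v + sc t v') s = r * Z1 V v s + t * Z1 V v' s"
proof -
  define S where "S = wtspace V (s + cc V / 24)"
  define B where "B = (SOME B. \<not> vs.dependent B \<and> vs.span B = S)"
  have "\<exists>B. \<not> vs.dependent B \<and> vs.span B = S"
  proof -
    obtain B where B: "B \<subseteq> S" "\<not> vs.dependent B" "S \<subseteq> vs.span B"
      using vs.maximal_independent_subset[of S] by blast
    have "vs.span B \<subseteq> S" by (rule vs.span_minimal[OF B(1)]) (simp add: S_def wt_subspace)
    then show ?thesis using B by blast
  qed
  then have B: "\<not> vs.dependent B" "vs.span B = S" unfolding B_def by (metis (mono_tags, lifting) someI_ex)+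
  have Z: "Z1 V v s = (\<Sum>b\<in>B. vs.representation B (zero_mode V v b) b)" for v
    unfolding Z1_def trace_on_def Let_def B_def S_def ..
  have "vs.representation B (zero_mode V (sc r v + sc t v') b) b =
    r * vs.representation B (zero_mode V v b) b + t * vs.representation B (zero_mode V v' b) b" if "b \<in> B" for b
  proof -
    have "b \<in> S" using that B(2) vs.span_base by blast
    then have "zero_mode V v b \<in> vs.span B" "zero_mode V v' b \<in> vs.span B"
      unfolding B(2) S_def by (auto intro: zero_mode_wt)
    then show ?thesis unfolding zero_mode_lin
      by (simp add: vs.representation_add[OF B(1)] vs.representation_scale[OF B(1)] vs.span_scale)
  qed
  then show ?thesis unfolding Z by (simp add: sum.distrib sum_distrib_left)
qed

definition lin_fun :: "('v \<Rightarrow> complex) \<Rightarrow> bool" where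
  "lin_fun \<alpha> \<longleftrightarrow> (\<forall>r v t v'. \<alpha> (sc r v + sc t v') = r * \<alpha> v + t * \<alpha> v')"

lemma lin_fun_Z1: "lin_fun (\<lambda>v. Z1 V v s)"
  by (simp add: lin_fun_def Z1_lin)

lemma lin_fun_zero: "lin_fun \<alpha> \<Longrightarrow> \<alpha> 0 = 0"
  unfolding lin_fun_def by (metis add.right_neutral mult_zero_left vs.scale_zero_left)

lemma lin_fun_add: "lin_fun \<alpha> \<Longrightarrow> \<alpha> (v + w) = \<alpha> v + \<alpha> w"
  unfolding lin_fun_def by (metis mult_1 vs.scale_one)

lemma lin_fun_scale: "lin_fun \<alpha> \<Longrightarrow> \<alpha> (sc r v) = r * \<alpha> v"
  unfolding lin_fun_def by (metis add.right_neutral mult_zero_left vs.scale_zero_left)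

lemma lin_fun_diff: "lin_fun \<alpha> \<Longrightarrow> \<alpha> (v - w) = \<alpha> v - \<alpha> w"
  using lin_fun_add[of \<alpha> "v - w" w] by simp

lemma lin_fun_sum: "lin_fun \<alpha> \<Longrightarrow> \<alpha> (\<Sum>i\<in>A. f i) = (\<Sum>i\<in>A. \<alpha> (f i))"
  by (induction A rule: infinite_finite_induct) (auto simp: lin_fun_add lin_fun_zero)

lemma lin_fun_op: "lin_fun \<alpha> \<Longrightarrow> linear_op T \<Longrightarrow> lin_fun (\<lambda>v. \<alpha> (T v))"
  unfolding lin_fun_def linear_op_def by simp

lemma lin_fun_const_mult: "lin_fun \<alpha> \<Longrightarrow> lin_fun (\<lambda>v. z * \<alpha> v)" "lin_fun \<alpha> \<Longrightarrow> lin_fun (\<lambda>v. \<alpha> v * z)"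
  unfolding lin_fun_def by (simp_all add: algebra_simps)

end

section \<open>The sewing form\<close>

locale sew_loc = cft_loc V for V :: "'v::ab_group_add voa_data" +
  fixes F :: "'v \<Rightarrow> 'v \<Rightarrow> complex fls" and B :: "int \<Rightarrow> 'v set"
  assumes F: "sewing_form V F" and B: "graded_basis V B"
begin

lemma F_add1: "F (a + b) c = F a c + F b c"
  by (rule F[unfolded sewing_form_def, THEN conjunct1, rule_format])
lemma F_scale1: "F (sc r a) c = fls_const r * F a c"
  by (rule F[unfolded sewing_form_def, THEN conjunct2, THEN conjunct1, rule_format])
lemma F_add2: "F a (b + c) = F a b + F a c"
  by (rule F[unfolded sewing_form_def, THEN conjunct2, THEN conjunct2, THEN conjunct1, rule_format])
lemma F_scale2: "F a (sc r c) = fls_const r * F a c"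
  by (rule F[unfolded sewing_form_def, THEN conjunct2, THEN conjunct2, THEN conjunct2, THEN conjunct1, rule_format])
lemma F_nondeg2: "(\<And>b. F b c = 0) \<Longrightarrow> c = 0"
  using F[unfolded sewing_form_def, THEN conjunct2, THEN conjunct2, THEN conjunct2, THEN conjunct2, THEN conjunct2, THEN conjunct1]
  by blast
lemma F_inv: "a \<in> Wt k \<Longrightarrow> F (sq a n b) c = fls_X_intpow (n + 1 - k) * F b (opp_mode (sq_voa V) k a n c)"
  using F[unfolded sewing_form_def, THEN conjunct2, THEN conjunct2, THEN conjunct2, THEN conjunct2, THEN conjunct2, THEN conjunct2, THEN conjunct1]
  by blast
lemma F_vac: "\<exists>r. F (vac V) (vac V) = fls_const r"
  by (rule F[unfolded sewing_form_def, THEN conjunct2, THEN conjunct2, THEN conjunct2, THEN conjunct2, THEN conjunct2, THEN conjunct2, THEN conjunct2])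

lemma F_zero1 [simp]: "F 0 c = 0" using F_add1[of 0 0 c] by simp
lemma F_zero2 [simp]: "F c 0 = 0" using F_add2[of c 0 0] by simp
lemma F_sum1: "F (\<Sum>i\<in>A. f i) c = (\<Sum>i\<in>A. F (f i) c)"
  by (induction A rule: infinite_finite_induct) (auto simp: F_add1)
lemma F_sum2: "F c (\<Sum>i\<in>A. f i) = (\<Sum>i\<in>A. F c (f i))"
  by (induction A rule: infinite_finite_induct) (auto simp: F_add2)

text \<open>Since \<open>L[1]\<close> kills the conformal vector, only the term \<open>j = 0\<close>
  is left, with sign \<open>(-1)^2\<close> and mode \<open>4 - n - 2\<close>.\<close>

lemma opp_om: "opp_mode (sq_voa V) 2 (sq_conf V) n c = om (2 - n) c"
proof -
  have p: "(Lm (sq_voa V) 1 ^^ j) (sq_conf V) = 0" if "j \<noteq> 0" for j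
  proof -
    have "(om 2 ^^ Suc i) (sq_conf V) = 0" for i by (induction i) (simp_all add: om2_conf)
    moreover have "Lm (sq_voa V) 1 = om 2" by (simp add: Lm_def)
    ultimately show ?thesis using that by (metis not0_implies_Suc)
  qed
  show ?thesis unfolding opp_mode_def
    by (subst Sum_any_single[of 0]) (auto simp: p power_int_def algebra_simps)
qed

lemma F_om: "F (om n b) c = fls_X_intpow (n - 1) * F b (om (2 - n) c)"
  using F_inv[OF conf_Wt, of n b c] by (simp add: opp_om)

text \<open>The case \<open>n = 1\<close> of \<open>F_om\<close> says that \<open>L[0]\<close> is
  self-adjoint.\<close>

lemma F_orthogonal:
  assumes "u \<in> Wt i" "w \<in> Wt j" "i \<noteq> j" shows "F u w = 0"
proof -
  have "F (om 1 u) w = F u (om 1 w)" using F_om[of 1 u w] by simp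
  then have "fls_const (of_int i) * F u w = fls_const (of_int j) * F u w"
    using assms(1,2) unfolding Wt_iff by (simp add: F_scale1 F_scale2)
  then show ?thesis using assms(3) by (metis fls_const_nth mult_cancel_right of_int_eq_iff)
qed

text \<open>By orthogonality only the weight 0 part of \<open>y\<close>, a multiple of the vacuum,
  pairs with the vacuum, so \<epsilon> does not appear.\<close>

lemma F_vac_const: "\<exists>r. F (vac V) y = fls_const r"
proof -
  obtain d n where d: "y = (\<Sum>k<n. d k)" "\<And>k. d k \<in> Wt (int k)" using Wt_decomp[of y] by blast
  have z: "F (vac V) (d k) = 0" if "k \<noteq> 0" for k
    by (rule F_orthogonal[OF vac_Wt d(2)]) (use that in simp)
  obtain r where r: "d 0 = sc r (vac V)" using Wt_0[of "d 0"] d(2)[of 0] by auto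
  obtain t where t: "F (vac V) (vac V) = fls_const t" using F_vac by blast
  have "F (vac V) y = (\<Sum>k<n. if k = 0 then fls_const (r * t) else 0)"
    unfolding d(1) F_sum2 by (rule sum.cong) (auto simp: z r F_scale2 t fls_const_mult_const)
  also have "\<dots> = fls_const (if n = 0 then 0 else r * t)" by simp
  finally show ?thesis by blast
qed

definition form :: "int \<Rightarrow> 'v \<Rightarrow> 'v \<Rightarrow> complex" where
  "form k u w = F u w $$ (- k)"

text \<open>Moving \<open>u = u[-1] \<one>\<close> to the other side of the form leaves a vector paired with the vacuum.\<close>

lemma F_eq_form: "u \<in> Wt k \<Longrightarrow> F u w = fls_const (form k u w) * fls_X_intpow (- k)"
proof -
  assume u: "u \<in> Wt k"
  obtain r where r: "F (vac V) (opp_mode (sq_voa V) k u (-1) w) = fls_const r" using F_vac_const by blast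
  have "F u w = fls_X_intpow (- k) * fls_const r"
    using F_inv[OF u, of "-1" "vac V" w] by (simp add: sq_creation_minus1 r)
  moreover from this have "form k u w = r"
    unfolding form_def by (simp add: fls_X_intpow_times_conv_shift)
  ultimately show ?thesis by (simp add: mult.commute)
qed

lemma form_lin: "lin_fun (\<lambda>w. form k u w)" "lin_fun (\<lambda>u. form k u w)"
  by (simp_all add: lin_fun_def form_def F_add1 F_add2 F_scale1 F_scale2)

lemma form_om: "form k (om n b) c = form (k + n - 1) b (om (2 - n) c)"
  unfolding form_def F_om fls_X_intpow_times_conv_shift by (simp add: algebra_simps)

lemma form_nondeg:
  assumes w: "w \<in> Wt k" and 0: "\<And>u. u \<in> Wt k \<Longrightarrow> form k u w = 0" shows "w = 0"
proof (rule F_nondeg2)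
  fix b
  obtain d n where d: "b = (\<Sum>k<n. d k)" "\<And>k. d k \<in> Wt (int k)" using Wt_decomp[of b] by blast
  have "F (d j) w = 0" for j
  proof (cases "int j = k")
    case True
    then have "d j \<in> Wt k" using d(2)[of j] by simp
    then show ?thesis using F_eq_form[of "d j" k w] 0 by simp
  next
    case False
    show ?thesis by (rule F_orthogonal[OF d(2) w False])
  qed
  then show "F b w = 0" unfolding d(1) F_sum1 by simp
qed

lemma B_indep: "\<not> vs.dependent (B k)" and B_span: "vs.span (B k) = Wt k"
  using B by (auto simp: graded_basis_def)

lemma B_Wt: "u \<in> B k \<Longrightarrow> u \<in> Wt k"
  using B_span[of k] vs.span_base by blast

lemma finite_B: "finite (B k)"
proof -
  obtain S where S: "finite S" "weight_filtration k \<subseteq> vs.span S" using weight_filtration_finite_span by blast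
  have "B k \<subseteq> vs.span S" using B_Wt Wt_weight_filtration S(2) by blast
  then show ?thesis using vs.independent_span_bound[OF S(1) B_indep] by blast
qed

lemma form_nondeg_B:
  assumes w: "w \<in> Wt k" and 0: "\<And>u. u \<in> B k \<Longrightarrow> form k u w = 0" shows "w = 0"
proof (rule form_nondeg[OF w])
  fix u assume "u \<in> Wt k"
  then have "u \<in> vs.span (B k)" by (simp add: B_span)
  then show "form k u w = 0"
  proof (induction rule: vs.span_induct_alt)
    case base then show ?case by (rule lin_fun_zero[OF form_lin(2)])
  next
    case (step c x y)
    then show ?case using 0 by (simp add: lin_fun_add[OF form_lin(2)] lin_fun_scale[OF form_lin(2)])
  qed
qed

text \<open>An injective endomorphism of the finite dimensional weight space is surjective.\<close>

lemma dual_exists: "u \<in> B k \<Longrightarrow> \<exists>w\<in>Wt k. \<forall>u'\<in>B k. form k u' w = (if u' = u then 1 else 0)"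
proof -
  assume u: "u \<in> B k"
  define g where "g w = (\<Sum>u\<in>B k. sc (form k u w) u)" for w
  have glin: "g (sc r v + sc t v') = sc r (g v) + sc t (g v')" for r v t v'
    using form_lin(1)[of k] unfolding g_def lin_fun_def
    by (simp add: vs.scale_left_distrib sum.distrib vs.scale_sum_right)
  have gW: "g w \<in> Wt k" for w
    unfolding g_def by (intro vs.subspace_sum[OF Wt_subspace] vs.subspace_scale[OF Wt_subspace] B_Wt)
  have coeff: "c u = 0" if "(\<Sum>u\<in>B k. sc (c u) u) = 0" "u \<in> B k" for c u
    using vs.independentD[OF B_indep finite_B subset_refl that] .
  have ginj: "w = 0" if "w \<in> Wt k" "g w = 0" for w
    by (rule form_nondeg_B[OF that(1)]) (rule coeff[OF that(2)[unfolded g_def]])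
  have g0: "g 0 = 0" using glin[of 0 0 0 0] by simp
  have gadd: "g (v + w) = g v + g w" for v w using glin[of 1 v 1 w] by simp
  have gsum: "g (\<Sum>i\<in>A. f i) = (\<Sum>i\<in>A. g (f i))" for A and f :: "'v \<Rightarrow> 'v"
    by (induction A rule: infinite_finite_induct) (auto simp: g0 gadd)
  have gscale: "g (sc r v) = sc r (g v)" for r v using glin[of r v 0 v] by simp
  have inj: "inj_on g (B k)"
  proof (rule inj_onI)
    fix x y assume xy: "x \<in> B k" "y \<in> B k" "g x = g y"
    have "x - y \<in> Wt k" using xy B_Wt vs.subspace_diff[OF Wt_subspace] by blast
    moreover have "g (x - y) = 0" using gadd[of "x - y" y] xy by simp
    ultimately show "x = y" using ginj by force
  qed
  have ind: "\<not> vs.dependent (g ` B k)"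
  proof
    assume "vs.dependent (g ` B k)"
    then obtain c v where c: "v \<in> g ` B k" "c v \<noteq> 0" "(\<Sum>v\<in>g ` B k. sc (c v) v) = 0"
      using vs.dependent_finite[of "g ` B k"] finite_B by auto
    then have "(\<Sum>u\<in>B k. sc (c (g u)) (g u)) = 0" using sum.reindex[OF inj, of "\<lambda>v. sc (c v) v"] by simp
    then have "g (\<Sum>u\<in>B k. sc (c (g u)) u) = 0" by (simp add: gsum gscale)
    moreover have "(\<Sum>u\<in>B k. sc (c (g u)) u) \<in> Wt k"
      by (intro vs.subspace_sum[OF Wt_subspace] vs.subspace_scale[OF Wt_subspace] B_Wt)
    ultimately have "(\<Sum>u\<in>B k. sc (c (g u)) u) = 0" using ginj by blast
    then have "c (g u) = 0" if "u \<in> B k" for u using coeff[of "\<lambda>u. c (g u)"] that by blast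
    then show False using c by auto
  qed
  have "g ` B k \<subseteq> vs.span (B k)" using gW by (auto simp: B_span)
  then have sub: "insert u (g ` B k) \<subseteq> vs.span (B k)" using u vs.span_base by blast
  have "u \<in> vs.span (g ` B k)"
  proof (rule ccontr)
    assume nu: "u \<notin> vs.span (g ` B k)"
    then have "\<not> vs.dependent (insert u (g ` B k))" using ind by (rule vs.independent_insertI)
    from vs.independent_span_bound[OF finite_B this sub]
    have "card (insert u (g ` B k)) \<le> card (B k)" by simp
    moreover have "u \<notin> g ` B k" using nu vs.span_base by blast
    ultimately show False using finite_B card_image[OF inj] by simp
  qed
  then obtain c where "u = (\<Sum>v\<in>g ` B k. sc (c v) v)"
    using vs.span_finite[of "g ` B k"] finite_B by auto
  then have gu: "u = g (\<Sum>x\<in>B k. sc (c (g x)) x)"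
    using sum.reindex[OF inj, of "\<lambda>v. sc (c v) v"] by (simp add: gsum gscale)
  define w where "w = (\<Sum>x\<in>B k. sc (c (g x)) x)"
  have w: "w \<in> Wt k" unfolding w_def by (intro vs.subspace_sum[OF Wt_subspace] vs.subspace_scale[OF Wt_subspace] B_Wt)
  have "(\<Sum>x\<in>B k. sc (form k x w - (if x = u then 1 else 0)) x) = g w - (\<Sum>x\<in>B k. if x = u then x else 0)"
    unfolding g_def sum_subtractf[symmetric]
    by (rule sum.cong) (auto simp: vs.scale_left_diff_distrib)
  also have "\<dots> = 0" using gu u finite_B by (simp add: w_def[symmetric])
  finally have "\<forall>u'\<in>B k. form k u' w - (if u' = u then 1 else 0) = 0"
    using coeff[of "\<lambda>x. form k x w - (if x = u then 1 else 0)"] by blast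
  then show ?thesis using w by (intro bexI[of _ w]) auto
qed

abbreviation "dv \<equiv> dual_vec V F B"

text \<open>The definite description denotes: existence is \<open>dual_exists\<close>, and
  uniqueness is nondegeneracy tested on the basis.\<close>

lemma dual_vec:
  assumes u: "u \<in> B k"
  shows "dv k u \<in> Wt k" "u' \<in> B k \<Longrightarrow> form k u' (dv k u) = (if u' = u then 1 else 0)"
proof -
  have e: "fls_X_intpow k * F u' w = (if u' = u then 1 else 0) \<longleftrightarrow> form k u' w = (if u' = u then 1 else 0)"
    if "u' \<in> B k" for u' w
  proof -
    have "fls_X_intpow k * F u' w = fls_const (form k u' w) * (fls_X_intpow k * fls_X_intpow (- k))"
      using F_eq_form[OF B_Wt[OF that]] by (simp only: mult_ac)
    also have "fls_X_intpow k * fls_X_intpow (- k) = (1 :: complex fls)"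
      unfolding fls_X_intpow_times_conv_shift by simp
    finally have x: "fls_X_intpow k * F u' w = fls_const (form k u' w)" by simp
    have "(fls_const a = (if P then 1 else 0)) = (a = (if P then 1 else 0))" for a :: complex and P
    proof -
      have "(if P then 1 else 0) = fls_const (if P then 1 else 0 :: complex)" by simp
      then show ?thesis by (metis fls_const_nth)
    qed
    then show ?thesis unfolding x .
  qed
  define Q where "Q w \<longleftrightarrow> w \<in> Wt k \<and> (\<forall>u'\<in>B k. fls_X_intpow k * F u' w = (if u' = u then 1 else 0))" for w
  have Q: "Q w \<longleftrightarrow> w \<in> Wt k \<and> (\<forall>u'\<in>B k. form k u' w = (if u' = u then 1 else 0))" for w
    unfolding Q_def using e by blast
  have "\<exists>!w. Q w"
  proof -
    obtain w where w: "Q w" using dual_exists[OF u] Q by blast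
    moreover have "w' = w" if "Q w'" for w'
    proof -
      have "w' - w = 0"
      proof (rule form_nondeg_B)
        show "w' - w \<in> Wt k" using Q w that vs.subspace_diff[OF Wt_subspace] by blast
        show "form k x (w' - w) = 0" if "x \<in> B k" for x
          using Q w \<open>Q w'\<close> that by (simp add: lin_fun_diff[OF form_lin(1)])
      qed
      then show ?thesis by simp
    qed
    ultimately show ?thesis by blast
  qed
  then have "Q (THE w. Q w)" by (rule theI')
  moreover have "dv k u = (THE w. Q w)" unfolding dual_vec_def Q_def ..
  ultimately have "Q (dv k u)" by simp
  then show "dv k u \<in> Wt k" "u' \<in> B k \<Longrightarrow> form k u' (dv k u) = (if u' = u then 1 else 0)"
    unfolding Q by auto
qed

lemma expand_left:
  assumes y: "y \<in> Wt k" shows "y = (\<Sum>u\<in>B k. sc (form k y (dv k u)) u)"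
proof -
  have "y \<in> vs.span (B k)" using y by (simp add: B_span)
  then obtain c where c: "y = (\<Sum>u\<in>B k. sc (c u) u)" using vs.span_finite[OF finite_B] by auto
  have "form k y (dv k u) = c u" if "u \<in> B k" for u
  proof -
    have "form k y (dv k u) = (\<Sum>x\<in>B k. c x * form k x (dv k u))"
      unfolding c by (simp add: lin_fun_sum[OF form_lin(2)] lin_fun_scale[OF form_lin(2)])
    also have "\<dots> = (\<Sum>x\<in>B k. if x = u then c u else 0)"
      by (rule sum.cong) (auto simp: dual_vec[OF that])
    finally show ?thesis using that finite_B by simp
  qed
  then show ?thesis using c by simp
qed

lemma expand_right:
  assumes y: "y \<in> Wt k" shows "y = (\<Sum>u\<in>B k. sc (form k u y) (dv k u))"
proof -
  have "y - (\<Sum>u\<in>B k. sc (form k u y) (dv k u)) = 0"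
  proof (rule form_nondeg_B)
    show "y - (\<Sum>u\<in>B k. sc (form k u y) (dv k u)) \<in> Wt k"
      by (intro vs.subspace_diff[OF Wt_subspace] y vs.subspace_sum[OF Wt_subspace] vs.subspace_scale[OF Wt_subspace] dual_vec)
    fix x assume x: "x \<in> B k"
    have "form k x (\<Sum>u\<in>B k. sc (form k u y) (dv k u)) = (\<Sum>u\<in>B k. if u = x then form k x y else 0)"
      unfolding lin_fun_sum[OF form_lin(1)] lin_fun_scale[OF form_lin(1)]
      by (rule sum.cong) (auto simp: dual_vec x)
    then show "form k x (y - (\<Sum>u\<in>B k. sc (form k u y) (dv k u))) = 0"
      using x finite_B by (simp add: lin_fun_diff[OF form_lin(1)])
  qed
  then show ?thesis by simp
qed

text \<open>\<open>om n u\<close> is expanded in the basis of weight \<open>k\<close>, the mode is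
  moved across the form, and the sum over \<open>u\<close> is collapsed by the expansion in dual
  vectors. The weight changes by \<open>n - 1\<close>, hence so does the power of
  \<epsilon>.\<close>

lemma move_om:
  assumes \<alpha>: "lin_fun \<alpha>" and \<beta>: "lin_fun \<beta>"
  shows "(\<Sum>u\<in>B (k + n - 1). \<alpha> (om n u) * \<beta> (dv (k + n - 1) u)) = (\<Sum>u\<in>B k. \<alpha> u * \<beta> (om (2 - n) (dv k u)))"
proof -
  define k' where "k' = k + n - 1"
  have "\<alpha> (om n u) = (\<Sum>x\<in>B k. form k' u (om (2 - n) (dv k x)) * \<alpha> x)" if "u \<in> B k'" for u
  proof -
    have "om n u \<in> Wt k" using om_Wt[OF B_Wt[OF that], of n] by (simp add: k'_def)
    from arg_cong[OF expand_left[OF this], of \<alpha>] show ?thesis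
      by (simp add: lin_fun_sum[OF \<alpha>] lin_fun_scale[OF \<alpha>] form_om k'_def)
  qed
  then have "(\<Sum>u\<in>B k'. \<alpha> (om n u) * \<beta> (dv k' u)) =
    (\<Sum>u\<in>B k'. \<Sum>x\<in>B k. \<alpha> x * (form k' u (om (2 - n) (dv k x)) * \<beta> (dv k' u)))"
    by (simp add: sum_distrib_left sum_distrib_right mult_ac)
  also have "\<dots> = (\<Sum>x\<in>B k. \<alpha> x * (\<Sum>u\<in>B k'. form k' u (om (2 - n) (dv k x)) * \<beta> (dv k' u)))"
    by (subst sum.swap) (simp add: sum_distrib_left)
  also have "\<dots> = (\<Sum>x\<in>B k. \<alpha> x * \<beta> (om (2 - n) (dv k x)))"
  proof (rule sum.cong)
    fix x assume "x \<in> B k"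
    then have "om (2 - n) (dv k x) \<in> Wt k'" using om_Wt[OF dual_vec(1), of x k "2 - n"] by (simp add: k'_def algebra_simps)
    from arg_cong[OF expand_right[OF this], of \<beta>]
    show "\<alpha> x * (\<Sum>u\<in>B k'. form k' u (om (2 - n) (dv k x)) * \<beta> (dv k' u)) = \<alpha> x * \<beta> (om (2 - n) (dv k x))"
      by (simp add: lin_fun_sum[OF \<beta>] lin_fun_scale[OF \<beta>])
  qed simp
  finally show ?thesis by (simp add: k'_def)
qed

end

section \<open>Clearing the denominators of Virasoro correlation functions\<close>

section \<open>Denominators\<close>

abbreviation raw_var :: "nat \<Rightarrow> (complex \<times> nat) list" where "raw_var v \<equiv> [(1, v)]"

abbreviation diff_form :: "(nat \<Rightarrow> (complex \<times> 'i) list) \<Rightarrow> nat \<Rightarrow> nat \<Rightarrow> (complex \<times> 'i) list" where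
  "diff_form X v w \<equiv> X v @ neg (X w)"

definition pairs :: "nat \<Rightarrow> nat \<Rightarrow> (nat \<times> nat) list" where
  "pairs l m = filter (\<lambda>(v, w). v < w \<and> (w < l \<or> l \<le> v)) (List.product [0..<m] [0..<m])"

lemma list_comprehension_product:
  "[h v w. v \<leftarrow> xs, w \<leftarrow> ys, P v w] = map (\<lambda>(v, w). h v w) (filter (\<lambda>(v, w). P v w) (List.product xs ys))"
proof (induction xs)
  case (Cons x xs)
  have "concat (map (\<lambda>w. if P x w then [h x w] else []) ys) = map (h x) (filter (P x) ys)"
    by (induction ys) auto
  then show ?case using Cons.IH by (simp add: filter_map comp_def)
qed simp

lemma set_pairs: "set (pairs l m) = {(v, w). v < w \<and> w < m \<and> (w < l \<or> l \<le> v)}"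
  by (auto simp: pairs_def)

lemma pole_forms_pairs: "pole_forms X l m N =
  concat (map (\<lambda>v. replicate N (X v)) [0..<m]) @
  concat (map (\<lambda>(v, w). replicate (2 * N) (diff_form X v w)) (pairs l m))"
  unfolding pole_forms_def list_comprehension_product pairs_def
  by (simp add: comp_def case_prod_unfold)

lemma set_pole_forms: "p \<in> set (pole_forms X l m N) \<Longrightarrow>
  (\<exists>v<m. p = X v) \<or> (\<exists>v w. v < w \<and> w < m \<and> (w < l \<or> l \<le> v) \<and> p = diff_form X v w)"
  unfolding pole_forms_pairs by (auto simp: set_pairs)

lemma pole_forms_vars: "p \<in> set (pole_forms raw_var l m N) \<Longrightarrow> snd ` set p \<subseteq> {..<m}"
  using set_pole_forms[of p raw_var l m N] by auto

lemma mset_concat_member: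
  assumes "replicate n p \<in> set xss" "k \<le> n" shows "mset (replicate k p) \<subseteq># mset (concat xss)"
proof -
  obtain as bs where "xss = as @ replicate n p # bs" using split_list[OF assms(1)] by blast
  moreover obtain d where "n = k + d" using le_Suc_ex[OF assms(2)] by blast
  ultimately have "mset (concat xss) = mset (concat as) + (mset (replicate k p) + mset (replicate d p)) + mset (concat bs)"
    by (simp add: replicate_add)
  then show ?thesis by simp
qed

lemma pole_forms_point: "v < m \<Longrightarrow> mset (replicate N (X v)) \<subseteq># mset (pole_forms X l m N)"
proof -
  assume "v < m"
  then have "mset (replicate N (X v)) \<subseteq># mset (concat (map (\<lambda>v. replicate N (X v)) [0..<m]))"
    by (intro mset_concat_member[of N]) auto
  then show ?thesis unfolding pole_forms_pairs by (simp add: subset_mset.add_increasing2)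
qed

text \<open>The requirement \<open>2 \<le> N\<close> makes room for the fourth power of each
  difference.\<close>

lemma pole_forms_pair:
  assumes "(v, w) \<in> set (pairs l m)" "2 \<le> N"
  shows "mset (replicate 4 (diff_form X v w)) \<subseteq># mset (pole_forms X l m N)"
proof -
  have "mset (replicate 4 (diff_form X v w)) \<subseteq># mset (concat (map (\<lambda>(v, w). replicate (2 * N) (diff_form X v w)) (pairs l m)))"
    by (intro mset_concat_member[of "2 * N"]) (use assms in force)+
  then show ?thesis unfolding pole_forms_pairs by (simp add: subset_mset.add_increasing)
qed

lemma mul_lins_factor:
  assumes "mset qs \<subseteq># mset ps" "mul_lins qs f = mul_lins qs g" shows "mul_lins ps f = mul_lins ps g"
proof -
  obtain rs where "mset ps = mset (rs @ qs)" using mul_lins_sub_mset[OF assms(1)] by blast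
  then have "mul_lins ps h = mul_lins rs (mul_lins qs h)" for h
    using mul_lins_mset_cong[of ps "rs @ qs"] by (simp add: mul_lins_append)
  then show ?thesis using assms(2) by simp
qed

lemma mul_lin_diff_swap: "mul_lin (diff_form X w v) f e = - mul_lin (diff_form X v w) f e"
  by (simp add: mul_lin_append mul_lin_neg)

lemma mul_lins_replicate_diff_swap:
  "mul_lins (replicate n (diff_form X w v)) f e = (-1) ^ n * mul_lins (replicate n (diff_form X v w)) f e"
proof (induction n arbitrary: e)
  case (Suc n)
  have "mul_lins (replicate n (diff_form X w v)) f = (\<lambda>e. (-1) ^ n * mul_lins (replicate n (diff_form X v w)) f e)"
    using Suc.IH by blast
  then show ?case by (simp add: mul_lin_scale mul_lin_diff_swap[of X w v])
qed simp

text \<open>Along a line of constant \<open>a + b\<close>, multiplication by \<open>x - y\<close> is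
  a difference operator. Its fourth power annihilates cubic polynomials, and 3 is the degree of the
  central term in the Virasoro relations.\<close>

lemma diff_power4_eq_0:
  assumes "x \<noteq> y"
    and f: "\<And>a b :: int. a + b = e x + e y - 4 \<Longrightarrow> f (e(x := a, y := b)) = pa + pb * of_int a + pc * of_int (a ^ 2) + pd * of_int (a ^ 3)"
  shows "mul_lins (replicate 4 (diff_form raw_var x y)) f e = 0"
proof -
  have d: "mul_lin (diff_form raw_var x y) g (e(x := a, y := b)) = g (e(x := a - 1, y := b)) - g (e(x := a, y := b - 1))" for g a b
  proof -
    have "(e(x := a, y := b))(x := (e(x := a, y := b)) x - 1) = e(x := a - 1, y := b)"
      "(e(x := a, y := b))(y := (e(x := a, y := b)) y - 1) = e(x := a, y := b - 1)"
      using assms(1) by (auto simp: fun_eq_iff)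
    moreover have "diff_form raw_var x y = [(1, x), (- 1, y)]" by simp
    ultimately show ?thesis
      by (simp only: mul_lin_Cons mul_lin_Nil mult_1_left mult_minus1 add_0_right diff_conv_add_uminus)
  qed
  define D where "D = mul_lin (diff_form raw_var x y)"
  define X Y where "X = e x" and "Y = e y"
  have "mul_lins (replicate 4 (diff_form raw_var x y)) f = D (D (D (D f)))"
    by (simp add: D_def numeral_eq_Suc)
  moreover have "D (D (D (D f))) (e(x := X, y := Y)) =
    f (e(x := X - 4, y := Y)) - 4 * f (e(x := X - 3, y := Y - 1)) + 6 * f (e(x := X - 2, y := Y - 2))
    - 4 * f (e(x := X - 1, y := Y - 3)) + f (e(x := X, y := Y - 4))"
  proof -
    define h where "h a b = f (e(x := a, y := b))" for a b
    have e4: "D (D (D (D f))) (e(x := X, y := Y)) =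
      h (X - 1 - 1 - 1 - 1) Y - h (X - 1 - 1 - 1) (Y - 1) - (h (X - 1 - 1 - 1) (Y - 1) - h (X - 1 - 1) (Y - 1 - 1))
      - (h (X - 1 - 1 - 1) (Y - 1) - h (X - 1 - 1) (Y - 1 - 1) - (h (X - 1 - 1) (Y - 1 - 1) - h (X - 1) (Y - 1 - 1 - 1)))
      - (h (X - 1 - 1 - 1) (Y - 1) - h (X - 1 - 1) (Y - 1 - 1) - (h (X - 1 - 1) (Y - 1 - 1) - h (X - 1) (Y - 1 - 1 - 1))
      - (h (X - 1 - 1) (Y - 1 - 1) - h (X - 1) (Y - 1 - 1 - 1) - (h (X - 1) (Y - 1 - 1 - 1) - h X (Y - 1 - 1 - 1 - 1))))"
      unfolding D_def d h_def ..
    have "X - 1 - 1 - 1 - 1 = X - 4" "X - 1 - 1 - 1 = X - 3" "X - 1 - 1 = X - 2"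
      "Y - 1 - 1 - 1 - 1 = Y - 4" "Y - 1 - 1 - 1 = Y - 3" "Y - 1 - 1 = Y - 2" by auto
    note e4[unfolded this]
    then show ?thesis unfolding h_def[symmetric] by (simp add: algebra_simps)
  qed
  moreover have "\<dots> = 0"
  proof -
    have f': "f (e(x := a, y := b)) = pa + pb * of_int a + pc * of_int (a ^ 2) + pd * of_int (a ^ 3)" if "a + b = X + Y - 4" for a b
      using f[of a b] that by (simp add: X_def Y_def)
    show ?thesis
      unfolding f'[of "X - 4" Y, simplified] f'[of "X - 3" "Y - 1", simplified] f'[of "X - 2" "Y - 2", simplified]
        f'[of "X - 1" "Y - 3", simplified] f'[of X "Y - 4", simplified]
      by (simp add: algebra_simps power2_eq_square power3_eq_cube)
  qed
  ultimately have "mul_lins (replicate 4 (diff_form raw_var x y)) f (e(x := e x, y := e y)) = 0"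
    by (simp only: X_def Y_def)
  then show ?thesis by simp
qed

text \<open>Sorting by exchanges of neighbours. Invariance is asked only for lists with the fixed
  multiset \<open>M\<close>, where the entries are known to be distinct points of one side.\<close>

lemma adjacent_swaps:
  assumes Q: "\<And>as x y bs. mset (as @ x # y # bs) = M \<Longrightarrow> Q (as @ x # y # bs) = Q (as @ y # x # bs)"
    and "mset xs = M" "mset ys = M"
  shows "Q xs = Q ys"
proof -
  have front: "Q (as @ bs @ x # cs) = Q (as @ x # bs @ cs)" if "mset (as @ bs @ x # cs) = M" for as bs x cs
    using that
  proof (induction bs arbitrary: as)
    case (Cons b bs)
    have "Q (as @ (b # bs) @ x # cs) = Q ((as @ [b]) @ bs @ x # cs)" by simp
    also have "\<dots> = Q ((as @ [b]) @ x # bs @ cs)" by (rule Cons.IH) (use Cons.prems in simp)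
    also have "\<dots> = Q (as @ b # x # bs @ cs)" by simp
    also have "\<dots> = Q (as @ x # b # bs @ cs)" by (rule Q) (use Cons.prems in \<open>simp add: add_ac\<close>)
    finally show ?case by simp
  qed simp
  have "Q (as @ xs) = Q (as @ ys)" if "mset (as @ xs) = M" "mset xs = mset ys" for as
    using that
  proof (induction xs arbitrary: as ys)
    case (Cons x xs)
    have "x \<in> set ys" using Cons.prems(2) by (metis list.set_intros(1) set_mset_mset)
    then obtain bs cs where ys: "ys = bs @ x # cs" using split_list by fastforce
    have "mset xs = mset (bs @ cs)" using Cons.prems(2) ys by simp
    moreover have "mset ((as @ [x]) @ xs) = M" using Cons.prems(1) by simp
    ultimately have "Q ((as @ [x]) @ xs) = Q ((as @ [x]) @ bs @ cs)" using Cons.IH by blast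
    also have "\<dots> = Q (as @ bs @ x # cs)"
      using front[of as bs x cs] Cons.prems ys by simp
    finally show ?case by (simp add: ys)
  qed simp
  from this[of "[]"] show ?thesis using assms(2,3) by simp
qed

section \<open>Permuting variables\<close>

definition rename :: "(nat \<Rightarrow> nat) \<Rightarrow> (complex \<times> nat) list \<Rightarrow> (complex \<times> nat) list" where
  "rename p q = map (\<lambda>(c, v). (c, p v)) q"

lemma mul_lin_rename:
  assumes "inj p"
  shows "mul_lin q f (e \<circ> p) = mul_lin (rename p q) (\<lambda>e. f (e \<circ> p)) e"
proof (induction q)
  case (Cons a q)
  obtain c v where a: "a = (c, v)" by (cases a)
  have "(e \<circ> p)(v := (e \<circ> p) v - 1) = (e(p v := e (p v) - 1)) \<circ> p"
    using assms by (auto simp: fun_eq_iff inj_def)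
  then show ?case
    unfolding a rename_def list.map prod.case mul_lin_Cons Cons.IH[unfolded rename_def] by simp
qed (simp add: rename_def)

lemma mul_lins_rename:
  assumes "inj p"
  shows "mul_lins ps f (e \<circ> p) = mul_lins (map (rename p) ps) (\<lambda>e. f (e \<circ> p)) e"
proof (induction ps arbitrary: e)
  case (Cons q ps)
  have "(\<lambda>e. mul_lins ps f (e \<circ> p)) = mul_lins (map (rename p) ps) (\<lambda>e. f (e \<circ> p))"
    using Cons.IH by blast
  then show ?case by (simp only: mul_lins_Cons list.map mul_lin_rename[OF assms])
qed simp

definition sym_forms :: "(nat \<Rightarrow> (complex \<times> 'i) list) \<Rightarrow> nat \<Rightarrow> nat \<Rightarrow> (complex \<times> 'i) list multiset" where
  "sym_forms X m N = (\<Sum>v<m. replicate_mset N (X v)) +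
     (\<Sum>(v, w)\<in>{(v, w). v < m \<and> w < m \<and> v \<noteq> w}. replicate_mset N (diff_form X v w))"

lemma mset_concat_map: "distinct xs \<Longrightarrow> mset (concat (map f xs)) = (\<Sum>x\<in>set xs. mset (f x))"
  by (induction xs) auto

text \<open>Up to sign, a squared difference is the product of the differences in both orders, which makes
  the denominator visibly symmetric.\<close>

lemma pole_forms_symmetric:
  "\<exists>c. \<forall>(X :: nat \<Rightarrow> (complex \<times> 'i) list) f e. mul_lins (pole_forms X m m N) f e = c * fold_mset mul_lin f (sym_forms X m N) e"
proof -
  define A where "A = (\<lambda>(X :: nat \<Rightarrow> (complex \<times> 'i) list) (v, w). replicate N (diff_form X v w) @ replicate N (diff_form X w v))"
  \<comment> \<open>Each pair contributes a sign \<open>(-1)^N\<close> from reversing half of its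
    differences. The total depends only on the number of pairs, so one constant serves all
    \<open>X\<close>.\<close>
  define c where "c n = (((-1) ^ N) ^ n :: complex)" for n :: nat
  have step: "mul_lins (concat (map (\<lambda>(v, w). replicate (2 * N) (diff_form X v w)) ps)) f =
    (\<lambda>e. c (length ps) * mul_lins (concat (map (A X) ps)) f e)" for X :: "nat \<Rightarrow> (complex \<times> 'i) list" and ps f
  proof (induction ps)
    case (Cons q ps)
    obtain v w where q: "q = (v, w)" by (cases q)
    define g where "g = mul_lins (concat (map (A X) ps)) f"
    have IH: "mul_lins (concat (map (\<lambda>(v, w). replicate (2 * N) (diff_form X v w)) ps)) f = (\<lambda>e. c (length ps) * g e)"
      unfolding g_def by (rule Cons.IH)
    have "mul_lins (replicate (2 * N) (diff_form X v w)) (\<lambda>e. c (length ps) * g e) e =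
      c (Suc (length ps)) * mul_lins (A X q) g e" for e
    proof -
      have "mul_lins (replicate N (diff_form X v w)) g = (\<lambda>e. (-1) ^ N * mul_lins (replicate N (diff_form X w v)) g e)"
        using mul_lins_replicate_diff_swap[of N X v w g] by blast
      moreover have "replicate (2 * N) (diff_form X v w) = replicate N (diff_form X v w) @ replicate N (diff_form X v w)"
        by (simp only: mult_2 replicate_add)
      ultimately have "mul_lins (replicate (2 * N) (diff_form X v w)) (\<lambda>e. c (length ps) * g e) e =
        c (length ps) * ((-1) ^ N * mul_lins (replicate N (diff_form X v w)) (mul_lins (replicate N (diff_form X w v)) g) e)"
        by (simp only: mul_lins_append mul_lins_scale)
      then show ?thesis by (simp add: A_def q mul_lins_append c_def mult_ac)
    qed
    then show ?case by (simp add: q mul_lins_append IH g_def[symmetric])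
  qed (simp add: c_def)
  define NE where "NE = {(v, w). v < m \<and> w < m \<and> v \<noteq> w}"
  have fs: "mset (concat (map (\<lambda>v. replicate N (X v)) [0..<m]) @ concat (map (A X) (pairs m m))) = sym_forms X m N" for X :: "nat \<Rightarrow> (complex \<times> 'i) list"
  proof -
    define R where "R = (\<lambda>(v, w). replicate_mset N (diff_form X v w))"
    define S where "S = set (pairs m m)"
    have S: "S = {(v, w). v < w \<and> w < m}" by (auto simp: S_def set_pairs)
    have fin: "finite S" by (simp add: S_def)
    have "distinct (pairs m m)" by (simp add: pairs_def distinct_product)
    then have "mset (concat (map (A X) (pairs m m))) = (\<Sum>x\<in>S. mset (A X x))"
      unfolding S_def by (rule mset_concat_map)
    also have "\<dots> = (\<Sum>x\<in>S. R x + R (prod.swap x))"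
      by (rule sum.cong) (auto simp: A_def R_def)
    also have "\<dots> = (\<Sum>x\<in>S. R x) + (\<Sum>x\<in>prod.swap ` S. R x)"
      by (subst sum.reindex) (auto simp: sum.distrib)
    also have "\<dots> = (\<Sum>x\<in>S \<union> prod.swap ` S. R x)"
      by (rule sum.union_disjoint[symmetric]) (use fin in \<open>auto simp: S\<close>)
    also have "S \<union> prod.swap ` S = NE" by (force simp: S NE_def image_iff)
    finally show ?thesis
      by (simp add: sym_forms_def NE_def R_def mset_concat_map atLeast0LessThan)
  qed
  have "mul_lins (pole_forms X m m N) f e = c (length (pairs m m)) * fold_mset mul_lin f (sym_forms X m N) e" for X :: "nat \<Rightarrow> (complex \<times> 'i) list" and f e
    unfolding pole_forms_pairs mul_lins_append step mul_lins_scale fs[symmetric] mul_lins_fold_mset[symmetric] ..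
  then show ?thesis by blast
qed

lemma sym_forms_permute:
  assumes p: "p permutes {..<m}"
  shows "sym_forms (\<lambda>v. raw_var (p v)) m N = sym_forms raw_var m N"
proof -
  have "(\<Sum>v<m. replicate_mset N (raw_var (p v))) = (\<Sum>v<m. replicate_mset N (raw_var v))"
    by (rule sum.reindex_bij_betw[OF permutes_imp_bij[OF p]])
  moreover have "(\<Sum>(v, w)\<in>{(v, w). v < m \<and> w < m \<and> v \<noteq> w}. replicate_mset N (diff_form (\<lambda>v. raw_var (p v)) v w)) =
    (\<Sum>(v, w)\<in>{(v, w). v < m \<and> w < m \<and> v \<noteq> w}. replicate_mset N (diff_form raw_var v w))"
  proof (rule sum.reindex_bij_witness[of _ "map_prod (inv p) (inv p)" "map_prod p p"])
    fix a assume a: "a \<in> {(v, w). v < m \<and> w < m \<and> v \<noteq> w}"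
    obtain v w where vw: "a = (v, w)" by (cases a)
    show "map_prod (inv p) (inv p) (map_prod p p a) = a" using permutes_inverses[OF p] by (simp add: vw)
    show "map_prod p p (map_prod (inv p) (inv p) a) = a" using permutes_inverses[OF p] by (simp add: vw)
    show "map_prod p p a \<in> {(v, w). v < m \<and> w < m \<and> v \<noteq> w}"
      using a permutes_in_image[OF p] permutes_inj[OF p] by (auto simp: vw inj_eq)
    show "map_prod (inv p) (inv p) a \<in> {(v, w). v < m \<and> w < m \<and> v \<noteq> w}"
      using a permutes_in_image[OF permutes_inv[OF p]] permutes_inj[OF permutes_inv[OF p]] by (auto simp: vw inj_eq)
    show "(case map_prod p p a of (v, w) \<Rightarrow> replicate_mset N (diff_form raw_var v w)) =
      (case a of (v, w) \<Rightarrow> replicate_mset N (diff_form (\<lambda>v. raw_var (p v)) v w))" by (simp add: vw)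
  qed
  ultimately show ?thesis by (simp add: sym_forms_def)
qed

text \<open>The constant in \<open>pole_forms_symmetric\<close> is the same for the coordinates
  \<open>v\<close> and \<open>p v\<close>, so the invariance of \<open>sym_forms\<close> carries
  over.\<close>

lemma pole_forms_rename:
  assumes "p permutes {..<m}"
  shows "mul_lins (map (rename p) (pole_forms raw_var m m N)) f = mul_lins (pole_forms raw_var m m N) f"
proof -
  have "map (rename p) (pole_forms raw_var m m N) = pole_forms (\<lambda>v. raw_var (p v)) m m N"
    unfolding pole_forms_pairs by (simp add: map_concat comp_def rename_def case_prod_unfold)
  moreover obtain c where "\<forall>(X :: nat \<Rightarrow> (complex \<times> nat) list) f e. mul_lins (pole_forms X m m N) f e = c * fold_mset mul_lin f (sym_forms X m N) e"
    using pole_forms_symmetric by blast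
  ultimately show ?thesis using sym_forms_permute[OF assms] by (auto simp: fun_eq_iff)
qed

section \<open>Products of Virasoro vertex operators\<close>

definition supp_below :: "nat \<Rightarrow> (nat \<Rightarrow> int) \<Rightarrow> bool" where
  "supp_below m e \<longleftrightarrow> (\<forall>v\<ge>m. e v = 0)"

context sew_loc begin

definition omegas_op :: "nat list \<Rightarrow> (nat \<Rightarrow> int) \<Rightarrow> 'v \<Rightarrow> 'v" where
  "omegas_op vs e u = foldr (\<lambda>v w. om (- e v - 1) w) vs u"

lemma omegas_op_Nil [simp]: "omegas_op [] e u = u"
  and omegas_op_Cons: "omegas_op (v # vs) e u = om (- e v - 1) (omegas_op vs e u)"
  and omegas_op_append: "omegas_op (vs @ ws) e u = omegas_op vs e (omegas_op ws e u)"
  by (simp_all add: omegas_op_def)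

lemma linear_op_omegas_op: "linear_op (omegas_op vs e)"
  by (induction vs) (auto simp: linear_op_def omegas_op_Cons sq_add2 sq_scale2)

lemma omegas_op_cong: "(\<And>v. v \<in> set vs \<Longrightarrow> e v = e' v) \<Longrightarrow> omegas_op vs e u = omegas_op vs e' u"
  by (induction vs) (auto simp: omegas_op_Cons)

lemma omegas_op_upd: "x \<notin> set vs \<Longrightarrow> y \<notin> set vs \<Longrightarrow> omegas_op vs (e(x := a, y := b)) u = omegas_op vs e u"
  by (rule omegas_op_cong) auto

text \<open>The lists fix the order of the operators independently of the names of the points, so
  that a series can be compared with its reorderings.\<close>

definition omega_series :: "complex \<Rightarrow> complex \<Rightarrow> int \<Rightarrow> nat \<Rightarrow> nat list \<Rightarrow> nat list \<Rightarrow> nat fseries" where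
  "omega_series s1 s2 k m xs ys e = (if supp_below m e then
     (\<Sum>u\<in>B k. Z1 V (omegas_op xs e u) s1 * Z1 V (omegas_op ys e (dv k u)) s2) else 0)"

text \<open>\<Lambda> collects everything applied after the two modes and \<open>w\<close> the
  vector they act on; neither involves the exponents of \<open>x\<close> and \<open>y\<close>. In
  this form the lemma covers both tori.\<close>

lemma commutator_killed:
  fixes \<Lambda> :: "'v \<Rightarrow> (nat \<Rightarrow> int) \<Rightarrow> 'v \<Rightarrow> complex" and w :: "'v \<Rightarrow> (nat \<Rightarrow> int) \<Rightarrow> 'v"
  assumes xy: "x \<noteq> y" "x < m" "y < m"
    and lin: "\<And>u e. lin_fun (\<Lambda> u e)"
    and inv: "\<And>u (e :: nat \<Rightarrow> int) a b. \<Lambda> u (e(x := a, y := b)) = \<Lambda> u e" "\<And>u (e :: nat \<Rightarrow> int) a b. w u (e(x := a, y := b)) = w u e"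
    and f: "\<And>e. f e = (if supp_below m e then \<Sum>u\<in>U. \<Lambda> u e (om (- e x - 1) (om (- e y - 1) (w u e)) - om (- e y - 1) (om (- e x - 1) (w u e))) else 0)"
  shows "mul_lins (replicate 4 (diff_form raw_var x y)) f = (\<lambda>e. 0)"
proof
  fix e :: "nat \<Rightarrow> int"
  define S where "S \<longleftrightarrow> supp_below m e"
  define t where "t = e x + e y - 4"
  define A where "A = (if S then \<Sum>u\<in>U. \<Lambda> u e (om (- t - 3) (w u e)) else 0)"
  define C where "C = (if S \<and> t = -4 then cc V / 12 * (\<Sum>u\<in>U. \<Lambda> u e (w u e)) else 0)"
  show "mul_lins (replicate 4 (diff_form raw_var x y)) f e = 0"
  \<comment> \<open>With \<open>a + b = t\<close> the commutator is
    \<open>(t - 2a) A - (a+1)(a+2)(a+3) C\<close>; the constants are its coefficients, the cubic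
    being \<open>a^3 + 6a^2 + 11a + 6\<close>.\<close>
  proof (rule diff_power4_eq_0[OF xy(1), where pa = "of_int t * A - 6 * C" and pb = "- 2 * A - 11 * C" and pc = "- 6 * C" and pd = "- C"])
    fix a b assume "a + b = e x + e y - 4"
    then have b: "b = t - a" by (simp add: t_def)
    define e' where "e' = e(x := a, y := b)"
    have e': "e' x = a" "e' y = b" using xy by (auto simp: e'_def)
    have S': "supp_below m e' \<longleftrightarrow> S" using xy by (auto simp: e'_def S_def supp_below_def)
    have term1: "\<Lambda> u e (om (- a - 1) (om (- b - 1) (w u e)) - om (- b - 1) (om (- a - 1) (w u e))) =
      of_int (t - 2 * a) * \<Lambda> u e (om (- t - 3) (w u e)) -
      (if t = -4 then cc V / 12 * of_int ((a + 1) * (a + 2) * (a + 3)) * \<Lambda> u e (w u e) else 0)" for u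
    proof -
      have i: "(- a - 1) - (- b - 1) = t - 2 * a" "(- a - 1) + (- b - 1) - 1 = - t - 3" "(- a - 1) + (- b - 1) = 2 \<longleftrightarrow> t = -4"
        "(- a - 1) * (- a - 1 - 1) * (- a - 1 - 2) = - ((a + 1) * (a + 2) * (a + 3))"
        by (auto simp: b algebra_simps)
      show ?thesis
        unfolding om_comm i lin_fun_add[OF lin] lin_fun_scale[OF lin] by simp
    qed
    have "f e' = (if S then \<Sum>u\<in>U. \<Lambda> u e (om (- a - 1) (om (- b - 1) (w u e)) - om (- b - 1) (om (- a - 1) (w u e))) else 0)"
      unfolding f S' e' unfolding e'_def inv ..
    also have "\<dots> = of_int (t - 2 * a) * A - of_int ((a + 1) * (a + 2) * (a + 3)) * C"
      unfolding term1 A_def C_def by (simp add: sum_subtractf sum_distrib_left mult_ac)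
    also have "\<dots> = of_int t * A - 6 * C + (- 2 * A - 11 * C) * of_int a + (- 6 * C) * of_int (a ^ 2) + (- C) * of_int (a ^ 3)"
      by (simp add: algebra_simps power2_eq_square power3_eq_cube)
    finally show "f (e(x := a, y := b)) = of_int t * A - 6 * C + (- 2 * A - 11 * C) * of_int a + (- 6 * C) * of_int (a ^ 2) + (- C) * of_int (a ^ 3)"
      by (simp only: e'_def)
  qed
qed

lemma omega_series_swap_left:
  assumes "distinct (as @ x # y # bs @ ys)" "x < m" "y < m"
  shows "mul_lins (replicate 4 (diff_form raw_var x y)) (\<lambda>e. omega_series s1 s2 k m (as @ x # y # bs) ys e - omega_series s1 s2 k m (as @ y # x # bs) ys e) = (\<lambda>e. 0)"
proof (rule commutator_killed[where U = "B k" and \<Lambda> = "\<lambda>u e w. Z1 V (omegas_op as e w) s1 * Z1 V (omegas_op ys e (dv k u)) s2" and w = "\<lambda>u e. omegas_op bs e u" and m = m])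
  show "lin_fun (\<lambda>w. Z1 V (omegas_op as e w) s1 * Z1 V (omegas_op ys e (dv k u)) s2)" for u e
    by (intro lin_fun_const_mult lin_fun_op[OF lin_fun_Z1] linear_op_omegas_op)
  show "(\<lambda>w. Z1 V (omegas_op as (e(x := a, y := b)) w) s1 * Z1 V (omegas_op ys (e(x := a, y := b)) (dv k u)) s2) =
     (\<lambda>w. Z1 V (omegas_op as e w) s1 * Z1 V (omegas_op ys e (dv k u)) s2)" for u e a b
    using assms(1) by (simp add: omegas_op_upd)
  show "omegas_op bs (e(x := a, y := b)) u = omegas_op bs e u" for u e a b
    using assms(1) by (simp add: omegas_op_upd)
  show "omega_series s1 s2 k m (as @ x # y # bs) ys e - omega_series s1 s2 k m (as @ y # x # bs) ys e =
    (if supp_below m e then \<Sum>u\<in>B k. Z1 V (omegas_op as e (om (- e x - 1) (om (- e y - 1) (omegas_op bs e u)) - om (- e y - 1) (om (- e x - 1) (omegas_op bs e u)))) s1 *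
      Z1 V (omegas_op ys e (dv k u)) s2 else 0)" for e
    unfolding omega_series_def omegas_op_append omegas_op_Cons lin_fun_diff[OF lin_fun_op[OF lin_fun_Z1 linear_op_omegas_op]]
    by (simp add: sum_subtractf left_diff_distrib)
qed (use assms in auto)

lemma omega_series_swap_right:
  assumes "distinct (xs @ as @ x # y # bs)" "x < m" "y < m"
  shows "mul_lins (replicate 4 (diff_form raw_var x y)) (\<lambda>e. omega_series s1 s2 k m xs (as @ x # y # bs) e - omega_series s1 s2 k m xs (as @ y # x # bs) e) = (\<lambda>e. 0)"
proof (rule commutator_killed[where U = "B k" and \<Lambda> = "\<lambda>u e w. Z1 V (omegas_op xs e u) s1 * Z1 V (omegas_op as e w) s2" and w = "\<lambda>u e. omegas_op bs e (dv k u)" and m = m])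
  show "lin_fun (\<lambda>w. Z1 V (omegas_op xs e u) s1 * Z1 V (omegas_op as e w) s2)" for u e
    by (intro lin_fun_const_mult lin_fun_op[OF lin_fun_Z1] linear_op_omegas_op)
  show "(\<lambda>w. Z1 V (omegas_op xs (e(x := a, y := b)) u) s1 * Z1 V (omegas_op as (e(x := a, y := b)) w) s2) =
     (\<lambda>w. Z1 V (omegas_op xs e u) s1 * Z1 V (omegas_op as e w) s2)" for u e a b
    using assms(1) by (simp add: omegas_op_upd)
  show "omegas_op bs (e(x := a, y := b)) (dv k u) = omegas_op bs e (dv k u)" for u e a b
    using assms(1) by (simp add: omegas_op_upd)
  show "omega_series s1 s2 k m xs (as @ x # y # bs) e - omega_series s1 s2 k m xs (as @ y # x # bs) e =
    (if supp_below m e then \<Sum>u\<in>B k. Z1 V (omegas_op xs e u) s1 *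
      Z1 V (omegas_op as e (om (- e x - 1) (om (- e y - 1) (omegas_op bs e (dv k u))) - om (- e y - 1) (om (- e x - 1) (omegas_op bs e (dv k u))))) s2 else 0)" for e
    unfolding omega_series_def omegas_op_append omegas_op_Cons lin_fun_diff[OF lin_fun_op[OF lin_fun_Z1 linear_op_omegas_op]]
    by (simp add: sum_subtractf right_diff_distrib)
qed (use assms in auto)

text \<open>The denominator lists each pair in increasing order; reversing a difference only costs a
  sign.\<close>

lemma pole_forms_swap:
  assumes N: "2 \<le> N" and xy: "x \<noteq> y" "x < m" "y < m" "x < l \<longleftrightarrow> y < l"
    and 0: "mul_lins (replicate 4 (diff_form raw_var x y)) (\<lambda>e. f e - g e) = (\<lambda>e. 0)"
  shows "mul_lins (pole_forms raw_var l m N) f = mul_lins (pole_forms raw_var l m N) g"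
proof -
  define v w where "v = min x y" and "w = max x y"
  have vw: "(v, w) \<in> set (pairs l m)" using xy by (auto simp: v_def w_def set_pairs min_def max_def)
  have "mul_lins (replicate 4 (diff_form raw_var v w)) (\<lambda>e. f e - g e) = (\<lambda>e. 0)"
  proof (cases "x < y")
    case True
    then have "v = x" "w = y" by (auto simp: v_def w_def)
    then show ?thesis using 0 by (simp only:)
  next
    case False
    then have "v = y" "w = x" by (auto simp: v_def w_def)
    moreover have "mul_lins (replicate 4 (diff_form raw_var y x)) (\<lambda>e. f e - g e) e = 0" for e
      unfolding mul_lins_replicate_diff_swap[of 4 raw_var y x "\<lambda>e. f e - g e"] 0 by simp
    ultimately show ?thesis by blast
  qed
  then have "mul_lins (replicate 4 (diff_form raw_var v w)) f = mul_lins (replicate 4 (diff_form raw_var v w)) g"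
  proof -
    assume a: "mul_lins (replicate 4 (diff_form raw_var v w)) (\<lambda>e. f e - g e) = (\<lambda>e. 0)"
    have "mul_lins (replicate 4 (diff_form raw_var v w)) f e = mul_lins (replicate 4 (diff_form raw_var v w)) g e" for e
      using fun_cong[OF a[unfolded mul_lins_diff], of e] by (simp only: right_minus_eq)
    then show ?thesis by blast
  qed
  then show ?thesis by (rule mul_lins_factor[OF pole_forms_pair[OF vw N]])
qed

text \<open>Any two orders on one side are linked by exchanges of neighbours, and each resulting
  commutator is killed by a factor of the denominator. The two sides are treated in turn.\<close>

lemma omega_series_reorder:
  assumes N: "2 \<le> N" and lm: "l \<le> m"
    and xs: "mset xs = mset [0..<l]" "mset xs' = mset [0..<l]" and ys: "mset ys = mset [l..<m]" "mset ys' = mset [l..<m]"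
  shows "mul_lins (pole_forms raw_var l m N) (omega_series s1 s2 k m xs ys) = mul_lins (pole_forms raw_var l m N) (omega_series s1 s2 k m xs' ys')"
proof -
  have left: "set xs = {..<l} \<and> distinct xs" if "mset xs = mset [0..<l]" for xs :: "nat list"
  proof -
    note mset_eq_setD[OF that] mset_eq_imp_distinct_iff[OF that]
    then show ?thesis by (simp add: atLeast0LessThan)
  qed
  have right: "set ys = {l..<m} \<and> distinct ys" if "mset ys = mset [l..<m]" for ys :: "nat list"
  proof -
    note mset_eq_setD[OF that] mset_eq_imp_distinct_iff[OF that]
    then show ?thesis by simp
  qed
  have "mul_lins (pole_forms raw_var l m N) (omega_series s1 s2 k m xs ys) = mul_lins (pole_forms raw_var l m N) (omega_series s1 s2 k m xs' ys)"
  proof (rule adjacent_swaps[where Q = "\<lambda>xs. mul_lins (pole_forms raw_var l m N) (omega_series s1 s2 k m xs ys)", OF _ xs])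
    fix as x y bs assume a: "mset (as @ x # y # bs) = mset [0..<l]"
    note L = conjunct1[OF left[OF a]] conjunct2[OF left[OF a]] and R = conjunct1[OF right[OF ys(1)]] conjunct2[OF right[OF ys(1)]]
    have "distinct ((as @ x # y # bs) @ ys)" unfolding distinct_append[of "as @ x # y # bs" ys] L(1) R(1) using L(2) R(2) by auto
    moreover have "x \<in> {..<l}" "y \<in> {..<l}" unfolding L(1)[symmetric] by simp_all
    ultimately have d: "distinct (as @ x # y # bs @ ys)" "x < l" "y < l" by simp_all
    show "mul_lins (pole_forms raw_var l m N) (omega_series s1 s2 k m (as @ x # y # bs) ys) = mul_lins (pole_forms raw_var l m N) (omega_series s1 s2 k m (as @ y # x # bs) ys)"
    proof -
      have "x \<noteq> y" "x < m" "y < m" "x < l \<longleftrightarrow> y < l" using d lm by auto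
      from pole_forms_swap[OF N this omega_series_swap_left[OF d(1) this(2,3)]] show ?thesis .
    qed
  qed
  also have "\<dots> = mul_lins (pole_forms raw_var l m N) (omega_series s1 s2 k m xs' ys')"
  proof (rule adjacent_swaps[where Q = "\<lambda>ys. mul_lins (pole_forms raw_var l m N) (omega_series s1 s2 k m xs' ys)", OF _ ys])
    fix as x y bs assume a: "mset (as @ x # y # bs) = mset [l..<m]"
    note R = conjunct1[OF right[OF a]] conjunct2[OF right[OF a]] and L = conjunct1[OF left[OF xs(2)]] conjunct2[OF left[OF xs(2)]]
    have "distinct (xs' @ (as @ x # y # bs))" unfolding distinct_append[of xs' "as @ x # y # bs"] L(1) R(1) using L(2) R(2) by auto
    moreover have "x \<in> {l..<m}" "y \<in> {l..<m}" unfolding R(1)[symmetric] by simp_all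
    ultimately have d: "distinct (xs' @ as @ x # y # bs)" "x < m" "y < m" "l \<le> x" "l \<le> y" by simp_all
    show "mul_lins (pole_forms raw_var l m N) (omega_series s1 s2 k m xs' (as @ x # y # bs)) = mul_lins (pole_forms raw_var l m N) (omega_series s1 s2 k m xs' (as @ y # x # bs))"
    proof -
      have "x \<noteq> y" "x < l \<longleftrightarrow> y < l" using d by auto
      from pole_forms_swap[OF N this(1) d(2,3) this(2) omega_series_swap_right[OF d(1-3)]] show ?thesis .
    qed
  qed
  finally show ?thesis .
qed

lemma omega_series_series_in: "series_in {..<m} (omega_series s1 s2 k m xs ys)"
  by (auto simp: series_in_def omega_series_def supp_below_def split: if_splits)

lemma omega_series_nonzero:
  assumes "omega_series s1 s2 k m xs ys e \<noteq> 0"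
  obtains u where "u \<in> B k" "omegas_op xs e u \<noteq> 0" "omegas_op ys e (dv k u) \<noteq> 0"
proof -
  have "(\<Sum>u\<in>B k. Z1 V (omegas_op xs e u) s1 * Z1 V (omegas_op ys e (dv k u)) s2) \<noteq> 0"
    using assms unfolding omega_series_def by (simp split: if_splits)
  then obtain u where u: "u \<in> B k" "Z1 V (omegas_op xs e u) s1 * Z1 V (omegas_op ys e (dv k u)) s2 \<noteq> 0"
    by (rule sum.not_neutral_contains_not_neutral)
  have "Z1 V 0 s = 0" for s by (rule lin_fun_zero[OF lin_fun_Z1])
  then have "omegas_op xs e u \<noteq> 0" "omegas_op ys e (dv k u) \<noteq> 0" using u(2) by auto
  then show ?thesis using that u(1) by blast
qed

text \<open>The rightmost operator meets a vector of weight \<open>k\<close>. Since weights are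
  nonnegative, \<open>om n\<close> kills it for \<open>n > k + 1\<close>, which is
  \<open>e v < - k - 2\<close> for \<open>n = - e v - 1\<close>.\<close>

lemma omegas_op_last_ge:
  assumes "u \<in> Wt k" "omegas_op (vs @ [v]) e u \<noteq> 0" shows "- k - 2 \<le> e v"
proof (rule ccontr)
  assume "\<not> - k - 2 \<le> e v"
  then have "om (- e v - 1) u = 0" by (intro om_kills[OF assms(1) Wt_neg]) auto
  then show False using assms(2) by (simp add: omegas_op_append omegas_op_Cons linear_op_0[OF linear_op_omegas_op])
qed

text \<open>The order of the operators is chosen anew for each variable \<open>v\<close>, with
  \<open>v\<close> acting first. Its pole of order at most \<open>k + 2\<close> is cancelled by the
  \<open>N\<close> factors \<open>v\<close> in the denominator.\<close>

lemma omega_series_power_series: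
  assumes N: "2 \<le> N" "k + 2 \<le> int N" and lm: "l \<le> m"
    and xs: "mset xs = mset [0..<l]" and ys: "mset ys = mset [l..<m]"
  shows "power_series m (mul_lins (pole_forms raw_var l m N) (omega_series s1 s2 k m xs ys))"
proof -
  define D where "D = pole_forms raw_var l m N"
  have "series_in {..<m} (mul_lins D (omega_series s1 s2 k m xs ys))"
    unfolding D_def by (intro mul_lins_series_in omega_series_series_in pole_forms_vars)
  moreover have "0 \<le> e v" if nz: "mul_lins D (omega_series s1 s2 k m xs ys) e \<noteq> 0" for e v
  proof (cases "v < m")
    case False
    then show ?thesis using calculation nz by (auto simp: series_in_def)
  next
    case True
    obtain xs' ys' where xy: "mset xs' = mset [0..<l]" "mset ys' = mset [l..<m]"
      and W: "\<And>e. omega_series s1 s2 k m xs' ys' e \<noteq> 0 \<Longrightarrow> - k - 2 \<le> e v"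
    proof (cases "v < l")
      case True
      define xs' where "xs' = remove1 v [0..<l] @ [v]"
      have "mset xs' = mset [0..<l]" using True by (simp add: xs'_def)
      moreover have "- k - 2 \<le> e v" if "omega_series s1 s2 k m xs' ys e \<noteq> 0" for e
      proof -
        from omega_series_nonzero[OF that] obtain u where "u \<in> B k" "omegas_op (remove1 v [0..<l] @ [v]) e u \<noteq> 0"
          unfolding xs'_def by blast
        then show ?thesis using omegas_op_last_ge[OF B_Wt] by blast
      qed
      ultimately show ?thesis using that ys by blast
    next
      case False
      define ys' where "ys' = remove1 v [l..<m] @ [v]"
      have "mset ys' = mset [l..<m]" using False \<open>v < m\<close> by (simp add: ys'_def)
      moreover have "- k - 2 \<le> e v" if "omega_series s1 s2 k m xs ys' e \<noteq> 0" for e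
      proof -
        from omega_series_nonzero[OF that] obtain u where "u \<in> B k" "omegas_op (remove1 v [l..<m] @ [v]) e (dv k u) \<noteq> 0"
          unfolding ys'_def by blast
        then show ?thesis using omegas_op_last_ge[OF dual_vec(1)] by blast
      qed
      ultimately show ?thesis using that xs by blast
    qed
    have eq: "mul_lins D (omega_series s1 s2 k m xs ys) = mul_lins D (omega_series s1 s2 k m xs' ys')"
      unfolding D_def by (rule omega_series_reorder[OF N(1) lm xs xy(1) ys xy(2)])
    obtain rs where rs: "mset D = mset (rs @ replicate N (raw_var v))"
      using mul_lins_sub_mset[OF pole_forms_point[OF True, of N raw_var l]] D_def by blast
    have "mul_lins rs (mul_lins (replicate N (raw_var v)) (omega_series s1 s2 k m xs' ys')) e \<noteq> 0"
      using nz mul_lins_mset_cong[OF rs] unfolding eq by (simp add: mul_lins_append)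
    then have "(- k - 2) + int N \<le> e v"
      using mul_lins_ge[of "mul_lins (replicate N (raw_var v)) (omega_series s1 s2 k m xs' ys')" "- k - 2 + int N" v rs e]
        mul_lins_replicate_ge[of "omega_series s1 s2 k m xs' ys'" "- k - 2" v N] W by blast
    then show ?thesis using N(2) by simp
  qed
  ultimately show ?thesis unfolding power_series_def D_def by blast
qed

lemma om_trunc_uniform:
  assumes "finite Y" shows "\<exists>N. \<forall>y\<in>Y. \<forall>n<N. sq a (- n - 1) y = 0"
  using assms
proof (induction Y)
  case (insert y Y)
  obtain N1 where N1: "\<forall>y\<in>Y. \<forall>n<N1. sq a (- n - 1) y = 0" using insert.IH by blast
  obtain N2 where N2: "\<forall>n\<ge>N2. sq a n y = 0" using sq_trunc by blast
  show ?case by (rule exI[of _ "min N1 (- N2)"]) (use N1 N2 in auto)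
qed simp

lemma omegas_op_split_nonzero: "omegas_op (as @ v # bs) e u \<noteq> 0 \<Longrightarrow> om (- e v - 1) (omegas_op bs e u) \<noteq> 0"
  by (auto simp: omegas_op_append omegas_op_Cons linear_op_0[OF linear_op_omegas_op])

text \<open>Freezing the exponents of the operators that act before the one at \<open>v\<close>
  leaves it acting on finitely many fixed vectors, one per basis element, and lower truncation
  bounds its exponent.\<close>

lemma omega_series_iterated_laurent:
  assumes lm: "l \<le> m"
  shows "iterated_laurent ([0..<l] @ rev [l..<m]) (omega_series s1 s2 k m [0..<l] (rev [l..<m]))"
proof -
  have set: "set ([0..<l] @ rev [l..<m]) = {..<m}" using lm by auto
  have "iterated_laurent_rev ([l..<m] @ rev [0..<l]) (omega_series s1 s2 k m [0..<l] (rev [l..<m]))"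
  proof (rule iterated_laurent_revI)
    fix xs v ys o' assume s: "[l..<m] @ rev [0..<l] = xs @ v # ys"
    have "distinct ([l..<m] @ rev [0..<l])" by auto
    then have nd: "v \<notin> set xs" "v \<notin> set ys" unfolding s by auto
    have vm: "v < m" using arg_cong[OF s, of set] lm by auto
    show "\<exists>N. \<forall>e. (\<forall>w\<in>set xs. e w = o' w) \<longrightarrow> omega_series s1 s2 k m [0..<l] (rev [l..<m]) e \<noteq> 0 \<longrightarrow> N \<le> e v"
    proof (cases "v < l")
      case True
      have sp: "[0..<l] = [0..<v] @ v # [Suc v..<l]"
        using True upt_add_eq_append[of 0 v "l - v"] upt_conv_Cons[of v l] by simp
      have "([l..<m] @ rev [Suc v..<l]) @ v # rev [0..<v] = xs @ v # ys" using s by (simp add: sp)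
      then have xs: "xs = [l..<m] @ rev [Suc v..<l]" using nd append_Cons_eq_iff[of v xs ys] by metis
      obtain N where N: "\<forall>y\<in>(\<lambda>u. omegas_op [Suc v..<l] o' u) ` B k. \<forall>n<N. om (- n - 1) y = 0"
        using om_trunc_uniform[of "(\<lambda>u. omegas_op [Suc v..<l] o' u) ` B k"] finite_B by blast
      show ?thesis
      proof (intro exI[of _ N] allI impI)
        fix e assume e: "\<forall>w\<in>set xs. e w = o' w" and nz: "omega_series s1 s2 k m [0..<l] (rev [l..<m]) e \<noteq> 0"
        obtain u where u: "u \<in> B k" "omegas_op [0..<l] e u \<noteq> 0" using omega_series_nonzero[OF nz] by blast
        have "om (- e v - 1) (omegas_op [Suc v..<l] e u) \<noteq> 0" using u(2) unfolding sp by (rule omegas_op_split_nonzero)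
        moreover have "omegas_op [Suc v..<l] e u = omegas_op [Suc v..<l] o' u" by (rule omegas_op_cong) (use e xs in auto)
        ultimately show "N \<le> e v" using N u(1) by (metis image_eqI not_less)
      qed
    next
      case False
      have sp: "[l..<m] = [l..<v] @ v # [Suc v..<m]"
        using False vm upt_add_eq_append[of l v "m - v"] upt_conv_Cons[of v m] by simp
      have "[l..<v] @ v # ([Suc v..<m] @ rev [0..<l]) = xs @ v # ys" using s by (simp add: sp)
      then have xs: "xs = [l..<v]" using nd append_Cons_eq_iff[of v xs ys] by metis
      obtain N where N: "\<forall>y\<in>(\<lambda>u. omegas_op (rev [l..<v]) o' (dv k u)) ` B k. \<forall>n<N. om (- n - 1) y = 0"
        using om_trunc_uniform[of "(\<lambda>u. omegas_op (rev [l..<v]) o' (dv k u)) ` B k"] finite_B by blast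
      show ?thesis
      proof (intro exI[of _ N] allI impI)
        fix e assume e: "\<forall>w\<in>set xs. e w = o' w" and nz: "omega_series s1 s2 k m [0..<l] (rev [l..<m]) e \<noteq> 0"
        obtain u where u: "u \<in> B k" "omegas_op (rev [l..<m]) e (dv k u) \<noteq> 0" using omega_series_nonzero[OF nz] by blast
        have "rev [l..<m] = rev [Suc v..<m] @ v # rev [l..<v]" by (simp add: sp)
        then have "om (- e v - 1) (omegas_op (rev [l..<v]) e (dv k u)) \<noteq> 0" using u(2) omegas_op_split_nonzero by metis
        moreover have "omegas_op (rev [l..<v]) e (dv k u) = omegas_op (rev [l..<v]) o' (dv k u)" by (rule omegas_op_cong) (use e xs in auto)
        ultimately show "N \<le> e v" using N u(1) by (metis image_eqI not_less)
      qed
    qed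
  qed
  then show ?thesis unfolding iterated_laurent_def set by (simp add: omega_series_series_in)
qed

lemma omega_series_represents:
  assumes N: "2 \<le> N" "k + 2 \<le> int N" and lm: "l \<le> m"
  shows "represents l m N (mul_lins (pole_forms raw_var l m N) (omega_series s1 s2 k m [0..<l] (rev [l..<m]))) (omega_series s1 s2 k m [0..<l] (rev [l..<m]))"
  unfolding represents_def using omega_series_power_series[OF N lm, of "[0..<l]" "rev [l..<m]"] omega_series_iterated_laurent[OF lm] by simp

text \<open>Under \<open>w = \<epsilon>/z\<close> the quadratic differential sends the exponent
  \<open>e\<close> to \<open>- 4 - e\<close> and contributes \<epsilon>^(e+2). Operators cross the
  form one at a time, outermost first, and hence arrive in reversed order.\<close>

lemma move_all:
  assumes "lin_fun \<alpha>" "lin_fun \<beta>" "\<And>v. v \<in> set xs \<Longrightarrow> e' v = - 4 - e v"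
  shows "(\<Sum>u\<in>B (k + (\<Sum>v\<leftarrow>xs. e v + 2)). \<alpha> (omegas_op xs e' u) * \<beta> (dv (k + (\<Sum>v\<leftarrow>xs. e v + 2)) u)) =
    (\<Sum>u\<in>B k. \<alpha> u * \<beta> (omegas_op (rev xs) e (dv k u)))"
  using assms
proof (induction xs arbitrary: \<alpha> k)
  case (Cons x xs)
  \<comment> \<open>The mode on the left is \<open>- (- 4 - e x) - 1 = e x + 3\<close>; its adjoint
    \<open>2 - n\<close> is the mode \<open>- e x - 1\<close> on the right.\<close>
  define k1 n where "k1 = k + (e x + 2)" and "n = e x + 3"
  have ex: "- e' x - 1 = n" using Cons.prems(3)[of x] by (simp add: n_def)
  have kk: "k + (\<Sum>v\<leftarrow>x # xs. e v + 2) = k1 + (\<Sum>v\<leftarrow>xs. e v + 2)" by (simp add: k1_def)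
  have l: "lin_fun (\<lambda>w. \<alpha> (om n w))" by (rule lin_fun_op[OF Cons.prems(1) linear_op_sq])
  have "(\<Sum>u\<in>B (k1 + (\<Sum>v\<leftarrow>xs. e v + 2)). \<alpha> (om n (omegas_op xs e' u)) * \<beta> (dv (k1 + (\<Sum>v\<leftarrow>xs. e v + 2)) u)) =
    (\<Sum>u\<in>B k1. \<alpha> (om n u) * \<beta> (omegas_op (rev xs) e (dv k1 u)))"
    by (rule Cons.IH[OF l Cons.prems(2)]) (use Cons.prems(3) in auto)
  also have "\<dots> = (\<Sum>u\<in>B k. \<alpha> u * \<beta> (omegas_op (rev xs) e (om (2 - n) (dv k u))))"
  proof -
    have "k + n - 1 = k1" by (simp add: k1_def n_def)
    note move_om[OF Cons.prems(1) lin_fun_op[OF Cons.prems(2) linear_op_omegas_op[of "rev xs" e]], where k = k and n = n, unfolded this]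
    then show ?thesis .
  qed
  also have "\<dots> = (\<Sum>u\<in>B k. \<alpha> u * \<beta> (omegas_op (rev (x # xs)) e (dv k u)))"
  proof -
    have "2 - n = - e x - 1" by (simp add: n_def)
    then show ?thesis by (simp only: rev.simps omegas_op_append omegas_op_Cons omegas_op_Nil)
  qed
  finally show ?case unfolding kk omegas_op_Cons ex .
qed simp

lemma vir_G_eq: "vir_G V F B m s1 s2 k e =
  (if supp_below m e then \<Sum>u\<in>B k. Z1 V (omegas_op [0..<m] e u) s1 * Z1 V (dv k u) s2 else 0)"
proof -
  have "foldr (\<lambda>i w. sq (replicate m (sq_conf V) ! i) (- e i - 1) w) [0..<m] u = omegas_op [0..<m] e u" for u
    unfolding omegas_op_def by (rule foldr_cong) auto
  moreover have c: "(\<forall>v\<ge>length (replicate m (sq_conf V)) + length ([]::'v list). e v = 0) \<longleftrightarrow> supp_below m e"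
    by (simp add: supp_below_def)
  ultimately show ?thesis unfolding vir_G_def Z2_def c by simp
qed

lemma vir_G_eq_W: "vir_G V F B m s1 s2 k = omega_series s1 s2 k m [0..<m] []"
  by (rule ext) (simp only: vir_G_eq omega_series_def omegas_op_Nil)

lemma move_right_vir_G:
  assumes lm: "l \<le> m"
  shows "move_right l m (vir_G V F B m s1 s2) k = omega_series s1 s2 k m [0..<l] (rev [l..<m])"
proof
  fix e :: "nat \<Rightarrow> int"
  define e' where "e' v = (if l \<le> v \<and> v < m then - 4 - e v else e v)" for v
  have supp: "supp_below m e' \<longleftrightarrow> supp_below m e" by (auto simp: e'_def supp_below_def)
  have kk: "k + (\<Sum>v\<in>{l..<m}. e v + 2) = k + (\<Sum>v\<leftarrow>[l..<m]. e v + 2)"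
    by (simp add: interv_sum_list_conv_sum_set_nat)
  have sp: "[0..<m] = [0..<l] @ [l..<m]" using lm upt_add_eq_append[of 0 l "m - l"] by simp
  have "omegas_op [0..<m] e' u = omegas_op [0..<l] e (omegas_op [l..<m] e' u)" for u
    unfolding sp omegas_op_append by (rule omegas_op_cong) (auto simp: e'_def)
  then have "move_right l m (vir_G V F B m s1 s2) k e = (if supp_below m e then
     \<Sum>u\<in>B (k + (\<Sum>v\<leftarrow>[l..<m]. e v + 2)). Z1 V (omegas_op [0..<l] e (omegas_op [l..<m] e' u)) s1 * Z1 V (dv (k + (\<Sum>v\<leftarrow>[l..<m]. e v + 2)) u) s2 else 0)"
    unfolding move_right_def e'_def[symmetric] vir_G_eq supp kk by (simp only:)
  also have "(\<Sum>u\<in>B (k + (\<Sum>v\<leftarrow>[l..<m]. e v + 2)). Z1 V (omegas_op [0..<l] e (omegas_op [l..<m] e' u)) s1 * Z1 V (dv (k + (\<Sum>v\<leftarrow>[l..<m]. e v + 2)) u) s2)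
    = (\<Sum>u\<in>B k. Z1 V (omegas_op [0..<l] e u) s1 * Z1 V (omegas_op (rev [l..<m]) e (dv k u)) s2)"
    by (rule move_all[OF lin_fun_op[OF lin_fun_Z1 linear_op_omegas_op] lin_fun_Z1]) (simp add: e'_def)
  finally show "move_right l m (vir_G V F B m s1 s2) k e = omega_series s1 s2 k m [0..<l] (rev [l..<m]) e"
    by (simp only: omega_series_def)
qed

lemma vir_G_symmetric: "symmetric_function m (vir_G V F B m s1 s2 k)"
proof -
  define N where "N = max 2 (nat (k + 2))"
  have N: "2 \<le> N" "k + 2 \<le> int N" by (auto simp: N_def)
  define A where "A = omega_series s1 s2 k m [0..<m] []"
  define D where "D = pole_forms raw_var m m N"
  have "represents m m N (mul_lins D A) A"
    using omega_series_represents[OF N order_refl, of m s1 s2] by (simp add: A_def D_def)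
  moreover have "symmetric_series m (mul_lins D A)"
    unfolding symmetric_series_def
  proof (intro allI impI)
    fix p and e :: "nat \<Rightarrow> int" assume p: "p permutes {..<m}"
    have rp: "omegas_op (map p vs) e u = omegas_op vs (e \<circ> p) u" for vs e u
      by (induction vs) (auto simp: omegas_op_Cons)
    \<comment> \<open>Permuting the exponents amounts to permuting the order of the
      operators.\<close>
    have "(\<lambda>e. A (e \<circ> p)) = omega_series s1 s2 k m (map p [0..<m]) []"
    proof
      fix e :: "nat \<Rightarrow> int"
      have "supp_below m (e \<circ> p) \<longleftrightarrow> supp_below m e"
        using permutes_not_in[OF p] by (auto simp: supp_below_def)
      then show "A (e \<circ> p) = omega_series s1 s2 k m (map p [0..<m]) [] e" by (simp add: A_def omega_series_def rp)
    qed
    then have "mul_lins D A (e \<circ> p) = mul_lins (map (rename p) D) (omega_series s1 s2 k m (map p [0..<m]) []) e"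
      using mul_lins_rename[OF permutes_inj[OF p], of D A e] by simp
    also have "\<dots> = mul_lins D (omega_series s1 s2 k m (map p [0..<m]) []) e"
      unfolding D_def pole_forms_rename[OF p] ..
    also have "\<dots> = mul_lins D A e"
    proof -
      have "mset (map p [0..<m]) = image_mset p (mset_set {..<m})"
        by (simp add: atLeast0LessThan)
      also have "\<dots> = mset_set (p ` {..<m})" by (rule image_mset_mset_set) (rule inj_on_subset[OF permutes_inj[OF p]], simp)
      also have "\<dots> = mset [0..<m]" using permutes_image[OF p] by (simp add: atLeast0LessThan)
      finally have "mset (map p [0..<m]) = mset [0..<m]" .
      then show ?thesis unfolding D_def A_def
        using omega_series_reorder[OF N(1) order_refl, of "map p [0..<m]" m "[0..<m]" "[]" "[]" s1 s2 k] by simp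
    qed
    finally show "mul_lins D A (e \<circ> p) = mul_lins D A e" .
  qed
  ultimately show ?thesis unfolding symmetric_function_def vir_G_eq_W A_def by blast
qed

end

section \<open>Descendants as clusters of Virasoro insertions\<close>

section \<open>Clusters of insertion points\<close>

text \<open>\<open>Raw v\<close> stands for the insertion of the Virasoro vector at the point \<open>v\<close>, and \<open>Clu c vs\<close> for the
  insertion at the position \<open>Base c\<close> of the state which the Virasoro vectors at the points \<open>vs\<close>, in
  local coordinates, create from the vacuum.\<close>

datatype item = Raw nat | Clu nat "nat list"

fun ivars :: "item \<Rightarrow> cvar list" where
  "ivars (Raw v) = [Local v]"
| "ivars (Clu c vs) = Base c # map Local vs"

fun raw_points :: "item \<Rightarrow> nat list" where
  "raw_points (Raw v) = [v]"
| "raw_points (Clu c vs) = []"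

fun merged :: "item \<Rightarrow> nat list" where
  "merged (Raw v) = []"
| "merged (Clu c vs) = vs"

abbreviation "item_vars its \<equiv> concat (map ivars its)"
abbreviation "unmerged_points its \<equiv> concat (map raw_points its)"
abbreviation "merged_points its \<equiv> concat (map merged its)"

definition supp_in :: "'i set \<Rightarrow> ('i \<Rightarrow> int) \<Rightarrow> bool" where
  "supp_in J e \<longleftrightarrow> (\<forall>i. i \<notin> J \<longrightarrow> e i = 0)"

lemma supp_in_upd: "z \<in> J \<Longrightarrow> x \<in> J \<Longrightarrow> supp_in J (e(z := a, x := b)) = supp_in J e"
  by (auto simp: supp_in_def)

lemma unmerged_points_unmerged:
  assumes "merged_points its = []"
  shows "set (unmerged_points its) = {v. Local v \<in> set (item_vars its)}" "distinct (item_vars its) \<Longrightarrow> distinct (unmerged_points its)"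
proof -
  have "set (unmerged_points its) = {v. Local v \<in> set (item_vars its)} \<and> (distinct (item_vars its) \<longrightarrow> distinct (unmerged_points its))"
    using assms
  proof (induction its)
    case (Cons it its)
    then show ?case by (cases it) auto
  qed simp
  then show "set (unmerged_points its) = {v. Local v \<in> set (item_vars its)}" "distinct (item_vars its) \<Longrightarrow> distinct (unmerged_points its)" by blast+
qed

lemma merged_points_split:
  assumes "merged_points its \<noteq> []"
  obtains as c v vs bs where "its = as @ Clu c (v # vs) # bs"
proof -
  obtain it where it: "it \<in> set its" "merged it \<noteq> []" using assms by auto
  obtain as bs where "its = as @ it # bs" using split_list[OF it(1)] by blast
  moreover obtain c v vs where "it = Clu c (v # vs)"
    using it(2) by (cases it) (auto simp: neq_Nil_conv)
  ultimately show ?thesis using that by blast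
qed

text \<open>Both orders must have the same numerator over the same denominator. Merging
  \<open>v\<close> acts on the denominator by replacing \<open>Local v\<close> with
  \<open>Base (cl v) + Local v\<close> in every form.\<close>

lemma merge_step:
  assumes f: "power_series m f" and M: "M \<subseteq> {..<m}" and v: "v < m" "v \<notin> M"
    and P: "mul_lins (map (merge_lin cl M) ps) P = partial_subst m cl M f" "fibre_bdd (Local v) (Base (cl v)) (Base (cl v)) P"
    and P': "mul_lins (map (merge_lin cl M) ps) P' = partial_subst m cl M f" "fibre_bdd (Local v) (Base (cl v)) (Local v) P'"
    and Q: "\<And>e. Q e = assoc1 (Local v) (Base (cl v)) P e - assoc2 (Local v) (Base (cl v)) P' e"
  shows "mul_lins (map (merge_lin cl (insert v M)) ps) Q = partial_subst m cl (insert v M) f"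
proof -
  have zx: "Local v \<noteq> Base (cl v)" by simp
  define qs where "qs = map (merge_lin cl M) ps"
  have ml: "map (merge_lin cl (insert v M)) ps = map (subst_lin (Local v) (Base (cl v))) qs"
    unfolding qs_def by (simp add: subst_merge_lin[OF v(2)])
  have "Q = (\<lambda>e. assoc1 (Local v) (Base (cl v)) P e - assoc2 (Local v) (Base (cl v)) P' e)"
    using Q by blast
  then have "mul_lins (map (merge_lin cl (insert v M)) ps) Q =
    (\<lambda>e. assoc1 (Local v) (Base (cl v)) (mul_lins qs P) e - assoc2 (Local v) (Base (cl v)) (mul_lins qs P') e)"
    unfolding ml by (simp only: mul_lins_diff assoc1_mul_lins[OF P(2) zx] assoc2_mul_lins[OF P'(2) zx])
  also have "\<dots> = (\<lambda>e. partial_subst m cl (insert v M) f e - 0)"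
  proof -
    have "assoc2 (Local v) (Base (cl v)) (partial_subst m cl M f) = (\<lambda>e. 0)"
      by (rule assoc2_power_series) (use partial_subst_nonneg[OF f] in auto)
    then show ?thesis
      unfolding P(1)[folded qs_def] P'(1)[folded qs_def] partial_subst_insert[OF f M v, symmetric] by simp
  qed
  finally show ?thesis by simp
qed

context sew_loc begin

fun item_op :: "item \<Rightarrow> (cvar \<Rightarrow> int) \<Rightarrow> 'v \<Rightarrow> 'v" where
  "item_op (Raw v) e w = om (- e (Local v) - 1) w"
| "item_op (Clu c vs) e w = sq (omegas_op vs (\<lambda>v. e (Local v)) (vac V)) (- e (Base c) - 1) w"

definition items_op :: "item list \<Rightarrow> (cvar \<Rightarrow> int) \<Rightarrow> 'v \<Rightarrow> 'v" where
  "items_op its e u = foldr (\<lambda>it w. item_op it e w) its u"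

lemma items_op_Nil [simp]: "items_op [] e u = u"
  and items_op_Cons: "items_op (it # its) e u = item_op it e (items_op its e u)"
  and items_op_append: "items_op (its @ jts) e u = items_op its e (items_op jts e u)"
  by (simp_all add: items_op_def)

lemma linear_op_item_op: "linear_op (item_op it e)"
  using linear_op_sq by (cases it) (auto simp: linear_op_def sq_add2 sq_scale2)

lemma linear_op_items_op: "linear_op (items_op its e)"
  by (induction its) (use linear_op_item_op in \<open>auto simp: linear_op_def items_op_Cons\<close>)

lemma item_op_cong:
  assumes "\<And>i. i \<in> set (ivars it) \<Longrightarrow> e i = e' i" shows "item_op it e u = item_op it e' u"
proof (cases it)
  case (Clu c vs)
  have "omegas_op vs (\<lambda>v. e (Local v)) (vac V) = omegas_op vs (\<lambda>v. e' (Local v)) (vac V)"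
    by (rule omegas_op_cong) (use assms Clu in auto)
  then show ?thesis using assms[of "Base c"] Clu by simp
qed (use assms in auto)

lemma items_op_cong:
  assumes "\<And>i. i \<in> set (item_vars its) \<Longrightarrow> e i = e' i" shows "items_op its e u = items_op its e' u"
  using assms
proof (induction its)
  case (Cons it its)
  have "items_op its e u = items_op its e' u" by (rule Cons.IH) (use Cons.prems in auto)
  moreover have "item_op it e w = item_op it e' w" for w by (rule item_op_cong) (use Cons.prems in auto)
  ultimately show ?case by (simp only: items_op_Cons)
qed simp

lemma items_op_upd: "z \<notin> set (item_vars its) \<Longrightarrow> x \<notin> set (item_vars its) \<Longrightarrow> items_op its (e(z := a, x := b)) u = items_op its e u"
  by (rule items_op_cong) auto

text \<open>A cluster without points carries the vacuum, whose field is the identity, so its base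
  can only have exponent 0.\<close>

lemma items_op_unmerged:
  "merged_points its = [] \<Longrightarrow> items_op its e u = (if \<forall>c. Base c \<in> set (item_vars its) \<longrightarrow> e (Base c) = 0 then omegas_op (unmerged_points its) (\<lambda>v. e (Local v)) u else 0)"
proof (induction its)
  case (Cons it its)
  define A where "A \<longleftrightarrow> (\<forall>c. Base c \<in> set (item_vars its) \<longrightarrow> e (Base c) = 0)"
  have IH: "items_op its e u = (if A then omegas_op (unmerged_points its) (\<lambda>v. e (Local v)) u else 0)"
    unfolding A_def by (rule Cons.IH) (use Cons.prems in simp)
  show ?case
  proof (cases it)
    case (Raw v)
    have "(\<forall>c. Base c \<in> set (item_vars (it # its)) \<longrightarrow> e (Base c) = 0) \<longleftrightarrow> A" unfolding A_def Raw by simp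
    then show ?thesis by (simp only: items_op_Cons IH) (simp add: Raw omegas_op_Cons)
  next
    case (Clu c vs)
    have vs: "vs = []" using Cons.prems Clu by simp
    have "(- e (Base c) - 1 = - 1) = (e (Base c) = 0)" by auto
    then have "item_op it e w = (if e (Base c) = 0 then w else 0)" for w
      using Clu vs by (simp add: sq_vac)
    moreover have "(\<forall>c. Base c \<in> set (item_vars (it # its)) \<longrightarrow> e (Base c) = 0) \<longleftrightarrow> e (Base c) = 0 \<and> A"
      unfolding A_def Clu by auto
    ultimately show ?thesis by (simp only: items_op_Cons IH) (simp add: Clu)
  qed
qed simp

definition cluster_series :: "complex \<Rightarrow> complex \<Rightarrow> int \<Rightarrow> cvar set \<Rightarrow> item list \<Rightarrow> item list \<Rightarrow> cvar fseries" where
  "cluster_series s1 s2 k J ls rs e = (if supp_in J e then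
     (\<Sum>u\<in>B k. Z1 V (items_op ls e u) s1 * Z1 V (items_op rs e (dv k u)) s2) else 0)"

text \<open>\<open>b\<close> is the state of the cluster so far, \<open>y\<close> the vector acted
  on and \<Lambda> all that is applied afterwards. None of them involves the exponents of
  \<open>z\<close> and \<open>x\<close>, so \<open>sq_assoc\<close> applies for each
  \<open>u\<close> separately.\<close>

lemma assoc_step:
  fixes \<Lambda> :: "'v \<Rightarrow> ('i \<Rightarrow> int) \<Rightarrow> 'v \<Rightarrow> complex" and b :: "('i \<Rightarrow> int) \<Rightarrow> 'v" and y :: "'v \<Rightarrow> ('i \<Rightarrow> int) \<Rightarrow> 'v"
    and P P' Q :: "'i fseries"
  assumes zx: "z \<noteq> x" and J: "z \<in> J" "x \<in> J" and U: "finite U"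
    and lin: "\<And>u e. lin_fun (\<Lambda> u e)"
    and inv: "\<And>u (e :: 'i \<Rightarrow> int) p q. \<Lambda> u (e(z := p, x := q)) = \<Lambda> u e" "\<And>(e :: 'i \<Rightarrow> int) p q. b (e(z := p, x := q)) = b e"
      "\<And>u (e :: 'i \<Rightarrow> int) p q. y u (e(z := p, x := q)) = y u e"
    and P: "\<And>e. P e = (if supp_in J e then \<Sum>u\<in>U. \<Lambda> u e (sq a (- e z - 1) (sq (b e) (- e x - 1) (y u e))) else 0)"
    and P': "\<And>e. P' e = (if supp_in J e then \<Sum>u\<in>U. \<Lambda> u e (sq (b e) (- e x - 1) (sq a (- e z - 1) (y u e))) else 0)"
    and Q: "\<And>e. Q e = (if supp_in J e then \<Sum>u\<in>U. \<Lambda> u e (sq (sq a (- e z - 1) (b e)) (- e x - 1) (y u e)) else 0)"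
  shows "fibre_bdd z x x P \<and> fibre_bdd z x z P' \<and> (\<forall>e. Q e = assoc1 z x P e - assoc2 z x P' e)"
proof -
  have upd: "(e(z := p, x := q)) z = p" "(e(z := p, x := q)) x = q" for e :: "'i \<Rightarrow> int" and p q using zx by auto
  have Pu: "P (e(z := p, x := q)) = (if supp_in J e then \<Sum>u\<in>U. \<Lambda> u e (sq a (- p - 1) (sq (b e) (- q - 1) (y u e))) else 0)"
    and P'u: "P' (e(z := p, x := q)) = (if supp_in J e then \<Sum>u\<in>U. \<Lambda> u e (sq (b e) (- q - 1) (sq a (- p - 1) (y u e))) else 0)" for e p q
    unfolding P P' upd inv supp_in_upd[OF J] by (rule refl)+
  have bP: "fibre_bdd z x x P"
    unfolding fibre_bdd_def
  proof
    fix e :: "'i \<Rightarrow> int"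
    obtain N where N: "\<forall>w\<in>(\<lambda>u. y u e) ` U. \<forall>n<N. sq (b e) (- n - 1) w = 0"
      using om_trunc_uniform[of "(\<lambda>u. y u e) ` U" "b e"] U by blast
    have "N \<le> q" if "P (e(z := p, x := q)) \<noteq> 0" for p q
    proof (rule ccontr)
      assume "\<not> N \<le> q"
      then have "sq (b e) (- q - 1) (y u e) = 0" if "u \<in> U" for u using N that by auto
      then have "(\<Sum>u\<in>U. \<Lambda> u e (sq a (- p - 1) (sq (b e) (- q - 1) (y u e)))) = 0"
        by (intro sum.neutral) (simp add: lin_fun_zero[OF lin])
      then show False using that unfolding Pu by (simp split: if_splits)
    qed
    then show "\<exists>N. \<forall>n q. P (e(z := n, x := q)) \<noteq> 0 \<longrightarrow> N \<le> (e(z := n, x := q)) x" unfolding upd by blast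
  qed
  have bP': "fibre_bdd z x z P'"
    unfolding fibre_bdd_def
  proof
    fix e :: "'i \<Rightarrow> int"
    obtain N where N: "\<forall>w\<in>(\<lambda>u. y u e) ` U. \<forall>n<N. sq a (- n - 1) w = 0"
      using om_trunc_uniform[of "(\<lambda>u. y u e) ` U" a] U by blast
    have "N \<le> p" if "P' (e(z := p, x := q)) \<noteq> 0" for p q
    proof (rule ccontr)
      assume "\<not> N \<le> p"
      then have "sq a (- p - 1) (y u e) = 0" if "u \<in> U" for u using N that by auto
      then have "(\<Sum>u\<in>U. \<Lambda> u e (sq (b e) (- q - 1) (sq a (- p - 1) (y u e)))) = 0"
        by (intro sum.neutral) (simp add: lin_fun_zero[OF lin])
      then show False using that unfolding P'u by (simp split: if_splits)
    qed
    then show "\<exists>N. \<forall>n q. P' (e(z := n, x := q)) \<noteq> 0 \<longrightarrow> N \<le> (e(z := n, x := q)) z" unfolding upd by blast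
  qed
  have "Q e = assoc1 z x P e - assoc2 z x P' e" for e
  proof -
    define l r where "l = - e z - 1" and "r = - e x - 1"
    obtain K1 where K1: "\<And>L. K1 \<le> L \<Longrightarrow> assoc1 z x P e = (\<Sum>i<L. derivative_coeff (e z) i * P (e(z := e z + int i, x := e x - int i)))"
      by (rule assoc1_lessThan[OF bP zx, of e]) (rule that, assumption)
    obtain K2 where K2: "\<And>L. K2 \<le> L \<Longrightarrow> assoc2 z x P' e = (\<Sum>i<L. (-1) powi (- e z - 1) * derivative_coeff (e z) i * P' (e(z := - 1 - int i, x := e x + e z + 1 + int i)))"
      by (rule assoc2_lessThan[OF bP' zx, of e]) (rule that, assumption)
    \<comment> \<open>One cut-off for all vectors of the finite set \<open>U\<close>.\<close>
    have "\<exists>K. \<forall>u\<in>U. \<forall>L\<ge>K. sq (sq a l (b e)) r (y u e) =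
      (\<Sum>i<L. sc (lcoef l i) (sq a (l - int i) (sq (b e) (r + int i) (y u e)) - sc ((-1) powi l) (sq (b e) (r + l - int i) (sq a (int i) (y u e)))))"
      using U
    proof (induction U)
      case (insert u U)
      obtain K where K: "\<forall>u\<in>U. \<forall>L\<ge>K. sq (sq a l (b e)) r (y u e) =
        (\<Sum>i<L. sc (lcoef l i) (sq a (l - int i) (sq (b e) (r + int i) (y u e)) - sc ((-1) powi l) (sq (b e) (r + l - int i) (sq a (int i) (y u e)))))"
        using insert.IH by blast
      obtain K' where K': "\<forall>L\<ge>K'. sq (sq a l (b e)) r (y u e) =
        (\<Sum>i<L. sc (lcoef l i) (sq a (l - int i) (sq (b e) (r + int i) (y u e)) - sc ((-1) powi l) (sq (b e) (r + l - int i) (sq a (int i) (y u e)))))"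
        using sq_assoc[of a "b e" l r "y u e", unfolded sq_assoc_holds_def] by blast
      show ?case
      proof (intro exI[of _ "max K K'"] ballI allI impI)
        fix u' L assume "u' \<in> insert u U" "max K K' \<le> L"
        then show "sq (sq a l (b e)) r (y u' e) = (\<Sum>i<L. sc (lcoef l i) (sq a (l - int i) (sq (b e) (r + int i) (y u' e)) - sc ((-1) powi l) (sq (b e) (r + l - int i) (sq a (int i) (y u' e)))))"
          using K K' by (cases "u' = u") auto
      qed
    qed blast
    then obtain K3 where K3: "\<And>u L. u \<in> U \<Longrightarrow> K3 \<le> L \<Longrightarrow> sq (sq a l (b e)) r (y u e) =
      (\<Sum>i<L. sc (lcoef l i) (sq a (l - int i) (sq (b e) (r + int i) (y u e)) - sc ((-1) powi l) (sq (b e) (r + l - int i) (sq a (int i) (y u e)))))"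
      by blast
    define L where "L = max K1 (max K2 K3)"
    have A1: "assoc1 z x P e = (\<Sum>i<L. derivative_coeff (e z) i * P (e(z := e z + int i, x := e x - int i)))"
      by (rule K1) (simp add: L_def)
    have A2: "assoc2 z x P' e = (\<Sum>i<L. (-1) powi (- e z - 1) * derivative_coeff (e z) i * P' (e(z := - 1 - int i, x := e x + e z + 1 + int i)))"
      by (rule K2) (simp add: L_def)
    have A3: "sq (sq a l (b e)) r (y u e) =
      (\<Sum>i<L. sc (lcoef l i) (sq a (l - int i) (sq (b e) (r + int i) (y u e)) - sc ((-1) powi l) (sq (b e) (r + l - int i) (sq a (int i) (y u e)))))" if "u \<in> U" for u
      using that by (rule K3) (simp add: L_def)
    show ?thesis
    proof (cases "supp_in J e")
      case False
      then show ?thesis unfolding A1 A2 Pu P'u Q by simp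
    next
      case True
      \<comment> \<open>The mode \<open>l\<close> is \<open>- e z - 1\<close>, so the coefficients
        of associativity are those of \<open>assoc1\<close> and \<open>assoc2\<close>.\<close>
      have lc: "lcoef l i = derivative_coeff (e z) i" for i by (simp add: lcoef_def derivative_coeff_def l_def)
      have ix: "- (e z + int i) - 1 = l - int i" "- (e x - int i) - 1 = r + int i" "- (- 1 - int i) - 1 = int i"
        "- (e x + e z + 1 + int i) - 1 = r + l - int i" for i by (simp_all add: l_def r_def)
      have "Q e = (\<Sum>u\<in>U. \<Sum>i<L. derivative_coeff (e z) i * (\<Lambda> u e (sq a (l - int i) (sq (b e) (r + int i) (y u e))) - (-1) powi l * \<Lambda> u e (sq (b e) (r + l - int i) (sq a (int i) (y u e)))))"
        using True unfolding Q l_def[symmetric] r_def[symmetric]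
        by (simp add: A3 lin_fun_sum[OF lin] lin_fun_scale[OF lin] lin_fun_diff[OF lin] lc)
      also have "\<dots> = (\<Sum>i<L. \<Sum>u\<in>U. derivative_coeff (e z) i * (\<Lambda> u e (sq a (l - int i) (sq (b e) (r + int i) (y u e))) - (-1) powi l * \<Lambda> u e (sq (b e) (r + l - int i) (sq a (int i) (y u e)))))"
        by (rule sum.swap)
      also have "\<dots> = assoc1 z x P e - assoc2 z x P' e"
        unfolding A1 A2 Pu P'u ix l_def[symmetric] using True
        by (simp add: sum_subtractf[symmetric] sum_distrib_left right_diff_distrib mult_ac)
      finally show ?thesis .
    qed
  qed
  with bP bP' show ?thesis by blast
qed

lemma cluster_series_step_left:
  assumes J: "J = set (item_vars (as @ Clu c (v # vs) # bs) @ item_vars rs)" and d: "distinct (item_vars (as @ Clu c (v # vs) # bs) @ item_vars rs)"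
  shows "fibre_bdd (Local v) (Base c) (Base c) (cluster_series s1 s2 k J (as @ Raw v # Clu c vs # bs) rs) \<and>
    fibre_bdd (Local v) (Base c) (Local v) (cluster_series s1 s2 k J (as @ Clu c vs # Raw v # bs) rs) \<and>
    (\<forall>e. cluster_series s1 s2 k J (as @ Clu c (v # vs) # bs) rs e = assoc1 (Local v) (Base c) (cluster_series s1 s2 k J (as @ Raw v # Clu c vs # bs) rs) e -
      assoc2 (Local v) (Base c) (cluster_series s1 s2 k J (as @ Clu c vs # Raw v # bs) rs) e)"
proof (rule assoc_step[where U = "B k" and \<Lambda> = "\<lambda>u e w. Z1 V (items_op as e w) s1 * Z1 V (items_op rs e (dv k u)) s2"
    and b = "\<lambda>e. omegas_op vs (\<lambda>v. e (Local v)) (vac V)" and y = "\<lambda>u e. items_op bs e u" and a = "sq_conf V" and J = J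
    and z = "Local v" and x = "Base c"
    and P = "cluster_series s1 s2 k J (as @ Raw v # Clu c vs # bs) rs" and P' = "cluster_series s1 s2 k J (as @ Clu c vs # Raw v # bs) rs"
    and Q = "cluster_series s1 s2 k J (as @ Clu c (v # vs) # bs) rs"])
  have ni: "Local v \<notin> set (item_vars as)" "Base c \<notin> set (item_vars as)" "Local v \<notin> set (item_vars bs)" "Base c \<notin> set (item_vars bs)"
    "Local v \<notin> set (item_vars rs)" "Base c \<notin> set (item_vars rs)" "v \<notin> set vs"
    using d by auto
  show "lin_fun (\<lambda>w. Z1 V (items_op as e w) s1 * Z1 V (items_op rs e (dv k u)) s2)" for u e
    by (intro lin_fun_const_mult lin_fun_op[OF lin_fun_Z1] linear_op_items_op)
  show "(\<lambda>w. Z1 V (items_op as (e(Local v := p, Base c := q)) w) s1 * Z1 V (items_op rs (e(Local v := p, Base c := q)) (dv k u)) s2) =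
    (\<lambda>w. Z1 V (items_op as e w) s1 * Z1 V (items_op rs e (dv k u)) s2)" for u e p q
    by (simp only: items_op_upd[OF ni(1,2)] items_op_upd[OF ni(5,6)])
  show "items_op bs (e(Local v := p, Base c := q)) u = items_op bs e u" for u e p q by (rule items_op_upd[OF ni(3,4)])
  show "omegas_op vs (\<lambda>w. (e(Local v := p, Base c := q)) (Local w)) (vac V) = omegas_op vs (\<lambda>w. e (Local w)) (vac V)" for e p q
    by (rule omegas_op_cong) (use ni(7) in auto)
qed (auto simp: J finite_B cluster_series_def items_op_append items_op_Cons omegas_op_Cons)

lemma cluster_series_step_right:
  assumes J: "J = set (item_vars ls @ item_vars (as @ Clu c (v # vs) # bs))" and d: "distinct (item_vars ls @ item_vars (as @ Clu c (v # vs) # bs))"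
  shows "fibre_bdd (Local v) (Base c) (Base c) (cluster_series s1 s2 k J ls (as @ Raw v # Clu c vs # bs)) \<and>
    fibre_bdd (Local v) (Base c) (Local v) (cluster_series s1 s2 k J ls (as @ Clu c vs # Raw v # bs)) \<and>
    (\<forall>e. cluster_series s1 s2 k J ls (as @ Clu c (v # vs) # bs) e = assoc1 (Local v) (Base c) (cluster_series s1 s2 k J ls (as @ Raw v # Clu c vs # bs)) e -
      assoc2 (Local v) (Base c) (cluster_series s1 s2 k J ls (as @ Clu c vs # Raw v # bs)) e)"
proof (rule assoc_step[where U = "B k" and \<Lambda> = "\<lambda>u e w. Z1 V (items_op ls e u) s1 * Z1 V (items_op as e w) s2"
    and b = "\<lambda>e. omegas_op vs (\<lambda>v. e (Local v)) (vac V)" and y = "\<lambda>u e. items_op bs e (dv k u)" and a = "sq_conf V" and J = J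
    and z = "Local v" and x = "Base c"
    and P = "cluster_series s1 s2 k J ls (as @ Raw v # Clu c vs # bs)" and P' = "cluster_series s1 s2 k J ls (as @ Clu c vs # Raw v # bs)"
    and Q = "cluster_series s1 s2 k J ls (as @ Clu c (v # vs) # bs)"])
  have ni: "Local v \<notin> set (item_vars as)" "Base c \<notin> set (item_vars as)" "Local v \<notin> set (item_vars bs)" "Base c \<notin> set (item_vars bs)"
    "Local v \<notin> set (item_vars ls)" "Base c \<notin> set (item_vars ls)" "v \<notin> set vs"
    using d by auto
  show "lin_fun (\<lambda>w. Z1 V (items_op ls e u) s1 * Z1 V (items_op as e w) s2)" for u e
    by (intro lin_fun_const_mult lin_fun_op[OF lin_fun_Z1] linear_op_items_op)
  show "(\<lambda>w. Z1 V (items_op ls (e(Local v := p, Base c := q)) u) s1 * Z1 V (items_op as (e(Local v := p, Base c := q)) w) s2) =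
    (\<lambda>w. Z1 V (items_op ls e u) s1 * Z1 V (items_op as e w) s2)" for u e p q
    by (simp only: items_op_upd[OF ni(1,2)] items_op_upd[OF ni(5,6)])
  show "items_op bs (e(Local v := p, Base c := q)) (dv k u) = items_op bs e (dv k u)" for u e p q by (rule items_op_upd[OF ni(3,4)])
  show "omegas_op vs (\<lambda>w. (e(Local v := p, Base c := q)) (Local w)) (vac V) = omegas_op vs (\<lambda>w. e (Local w)) (vac V)" for e p q
    by (rule omegas_op_cong) (use ni(7) in auto)
qed (auto simp: J finite_B cluster_series_def items_op_append items_op_Cons omegas_op_Cons)

text \<open>The base case: no point has been moved, so empty clusters contribute exponent 0 and the
  variables are merely renamed.\<close>

lemma cluster_series_unmerged:
  assumes "merged_points ls = []" "merged_points rs = []" and J: "J = set (item_vars ls @ item_vars rs)" "\<And>v. Local v \<in> J \<longleftrightarrow> v < m"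
  shows "cluster_series s1 s2 k J ls rs = partial_subst m cl {} (omega_series s1 s2 k m (unmerged_points ls) (unmerged_points rs))"
proof
  fix h :: "cvar \<Rightarrow> int"
  define a b where "a \<longleftrightarrow> (\<forall>c. Base c \<in> set (item_vars ls) \<longrightarrow> h (Base c) = 0)" and "b \<longleftrightarrow> (\<forall>c. Base c \<in> set (item_vars rs) \<longrightarrow> h (Base c) = 0)"
  define p q where "p \<longleftrightarrow> (\<forall>v\<ge>m. h (Local v) = 0)" and "q \<longleftrightarrow> (\<forall>c. h (Base c) = 0)"
  have 1: "supp_in J h \<and> a \<and> b \<longleftrightarrow> p \<and> q"
  proof
    assume l: "supp_in J h \<and> a \<and> b"
    have "h (Local v) = 0" if "m \<le> v" for v using l J(2)[of v] that by (simp add: supp_in_def)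
    moreover have "h (Base c) = 0" for c
    proof (cases "Base c \<in> J")
      case True
      then have "Base c \<in> set (item_vars ls) \<or> Base c \<in> set (item_vars rs)" unfolding J(1) by simp
      then show ?thesis using l unfolding a_def b_def by blast
    qed (use l in \<open>simp add: supp_in_def\<close>)
    ultimately show "p \<and> q" unfolding p_def q_def by blast
  next
    assume r: "p \<and> q"
    have "h i = 0" if "i \<notin> J" for i
    proof (cases i)
      case (Local v)
      then have "m \<le> v" using that J(2)[of v] by simp
      then show ?thesis using r Local by (simp add: p_def)
    qed (use r q_def in simp)
    then show "supp_in J h \<and> a \<and> b" using r by (simp add: supp_in_def a_def b_def q_def)
  qed
  have 2: "supp_below m (\<lambda>v. h (Local v)) \<longleftrightarrow> p" by (simp add: supp_below_def p_def)
  have z: "Z1 V 0 s = 0" for s by (rule lin_fun_zero[OF lin_fun_Z1])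
  show "cluster_series s1 s2 k J ls rs h = partial_subst m cl {} (omega_series s1 s2 k m (unmerged_points ls) (unmerged_points rs)) h"
    unfolding partial_subst_empty cluster_series_def omega_series_def items_op_unmerged[OF assms(1)] items_op_unmerged[OF assms(2)] 2
      a_def[symmetric] b_def[symmetric] p_def[symmetric] q_def[symmetric]
    using 1 by (auto simp: z)
qed

text \<open>Induction on the number of merged points. The first point of a cluster belongs to the
  outermost mode of its state; taking it out and placing it before or after the cluster gives the
  two series of \<open>merge_step\<close>. The numerator on the right depends on the set of merged
  points but not on the order of the items, as \<open>merge_step\<close> demands.\<close>

theorem cluster_series_merge:
  assumes N: "2 \<le> N" "k + 2 \<le> int N" and lm: "l \<le> m"
    and ij: "distinct (is @ js)" "\<And>v. Local v \<in> set is \<longleftrightarrow> v < l" "\<And>v. Local v \<in> set js \<longleftrightarrow> l \<le> v \<and> v < m"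
    and "mset (item_vars ls) = mset is" "mset (item_vars rs) = mset js"
    and "\<And>c vs v. Clu c vs \<in> set (ls @ rs) \<Longrightarrow> v \<in> set vs \<Longrightarrow> cl v = c"
  shows "mul_lins (map (merge_lin cl (set (merged_points (ls @ rs)))) (pole_forms raw_var l m N)) (cluster_series s1 s2 k (set (is @ js)) ls rs) =
    partial_subst m cl (set (merged_points (ls @ rs))) (mul_lins (pole_forms raw_var l m N) (omega_series s1 s2 k m [0..<l] (rev [l..<m])))"
  using assms(7-9)
proof (induction "length (merged_points ls) + length (merged_points rs)" arbitrary: ls rs rule: less_induct)
  case less
  note pr = less.prems
  define D where "D = pole_forms raw_var l m N"
  define f where "f = mul_lins D (omega_series s1 s2 k m [0..<l] (rev [l..<m]))"
  define J where "J = set (is @ js)"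
  have JL: "Local v \<in> J \<longleftrightarrow> v < m" for v using ij(2,3)[of v] lm unfolding J_def by auto
  have f: "power_series m f"
    unfolding f_def D_def by (rule omega_series_power_series[OF N lm]) auto
  have Jiv: "J = set (item_vars ls @ item_vars rs)"
    using mset_eq_setD[OF pr(1)] mset_eq_setD[OF pr(2)] unfolding J_def by simp
  have div: "distinct (item_vars ls @ item_vars rs)"
    using ij(1) mset_eq_imp_distinct_iff[of "item_vars ls @ item_vars rs" "is @ js"] pr(1,2) by simp
  have cMJ: "set (merged_points ls') \<subseteq> {v. Local v \<in> set (item_vars ls')}" for ls'
  proof (induction ls')
    case (Cons it its) then show ?case by (cases it) auto
  qed simp
  consider "merged_points ls = []" "merged_points rs = []" | "merged_points ls \<noteq> []" | "merged_points rs \<noteq> []" by blast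
  then show ?case unfolding D_def[symmetric] f_def[symmetric] J_def[symmetric]
  proof cases
    case 1
    have sl: "set (unmerged_points ls) = {..<l}" "set (unmerged_points rs) = {l..<m}"
      unfolding unmerged_points_unmerged(1)[OF 1(1)] unmerged_points_unmerged(1)[OF 1(2)] mset_eq_setD[OF pr(1)] mset_eq_setD[OF pr(2)] ij(2,3) by auto
    have dl: "distinct (unmerged_points ls)" "distinct (unmerged_points rs)"
      using unmerged_points_unmerged(2)[OF 1(1)] unmerged_points_unmerged(2)[OF 1(2)] div by auto
    have ms: "mset (unmerged_points ls) = mset [0..<l]" "mset (unmerged_points rs) = mset [l..<m]"
      using sl set_eq_iff_mset_eq_distinct[OF dl(1) distinct_upt[of 0 l]] set_eq_iff_mset_eq_distinct[OF dl(2) distinct_upt[of l m]]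
      by (simp_all add: atLeast0LessThan)
    have M: "set (merged_points (ls @ rs)) = {}" using 1 by simp
    have "f = mul_lins D (omega_series s1 s2 k m (unmerged_points ls) (unmerged_points rs))"
      unfolding f_def D_def by (rule omega_series_reorder[OF N(1) lm]) (use ms in auto)
    moreover have "partial_subst m cl {} (mul_lins ps g) = mul_lins (map (merge_lin cl {}) ps) (partial_subst m cl {} g)"
      if "\<And>p. p \<in> set ps \<Longrightarrow> snd ` set p \<subseteq> {..<m}" for ps g
      using that
    proof (induction ps)
      case (Cons p ps)
      have "partial_subst m cl {} (mul_lin p (mul_lins ps g)) = mul_lin (merge_lin cl {} p) (partial_subst m cl {} (mul_lins ps g))"
        by (rule ext, rule partial_subst_empty_mul_lin) (use Cons.prems in simp)
      then show ?case using Cons by simp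
    qed simp
    ultimately have "partial_subst m cl {} f = mul_lins (map (merge_lin cl {}) D) (partial_subst m cl {} (omega_series s1 s2 k m (unmerged_points ls) (unmerged_points rs)))"
      unfolding D_def using pole_forms_vars by blast
    then show "mul_lins (map (merge_lin cl (set (merged_points (ls @ rs)))) D) (cluster_series s1 s2 k J ls rs) = partial_subst m cl (set (merged_points (ls @ rs))) f"
      unfolding M cluster_series_unmerged[OF 1 Jiv JL, where cl = cl] by simp
  next
    case 2
    obtain as c v vs bs where ls: "ls = as @ Clu c (v # vs) # bs" using merged_points_split[OF 2] by blast
    define M where "M = set (merged_points ((as @ Raw v # Clu c vs # bs) @ rs))"
    have M': "M = set (merged_points ((as @ Clu c vs # Raw v # bs) @ rs))" "insert v M = set (merged_points (ls @ rs))"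
      by (auto simp: M_def ls)
    have cv: "cl v = c" using pr(3)[of c "v # vs" v] by (simp add: ls)
    have vM: "v \<notin> M" "v < m" "M \<subseteq> {..<m}"
    proof -
      show "v \<notin> M" using div cMJ[of as] cMJ[of bs] cMJ[of rs] unfolding M_def ls by auto
      have "set (merged_points (ls @ rs)) \<subseteq> {v. Local v \<in> J}" using cMJ[of "ls @ rs"] unfolding Jiv by simp
      then show "v < m" "M \<subseteq> {..<m}" unfolding M'(2)[symmetric] using JL by auto
    qed
    \<comment> \<open>Both lists contain the variables of \<open>ls\<close> in another order and one
      merged point fewer, so the induction hypothesis gives the same numerator for both.\<close>
    have "mul_lins (map (merge_lin cl M) D) (cluster_series s1 s2 k J (as @ Raw v # Clu c vs # bs) rs) = partial_subst m cl M f"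
      unfolding M_def D_def f_def J_def
    proof (rule less.hyps)
      show "mset (item_vars (as @ Raw v # Clu c vs # bs)) = mset is" unfolding pr(1)[symmetric] ls by simp
      show "cl v' = c'" if "Clu c' vs' \<in> set ((as @ Raw v # Clu c vs # bs) @ rs)" "v' \<in> set vs'" for c' vs' v'
        using pr(3)[of c' vs' v'] pr(3)[of c "v # vs" v'] that unfolding ls by auto
    qed (use pr(2) in \<open>auto simp: ls\<close>)
    moreover have "mul_lins (map (merge_lin cl M) D) (cluster_series s1 s2 k J (as @ Clu c vs # Raw v # bs) rs) = partial_subst m cl M f"
      unfolding M' D_def f_def J_def
    proof (rule less.hyps)
      show "mset (item_vars (as @ Clu c vs # Raw v # bs)) = mset is" unfolding pr(1)[symmetric] ls by simp
      show "cl v' = c'" if "Clu c' vs' \<in> set ((as @ Clu c vs # Raw v # bs) @ rs)" "v' \<in> set vs'" for c' vs' v'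
        using pr(3)[of c' vs' v'] pr(3)[of c "v # vs" v'] that unfolding ls by auto
    qed (use pr(2) in \<open>auto simp: ls\<close>)
    ultimately show "mul_lins (map (merge_lin cl (set (merged_points (ls @ rs)))) D) (cluster_series s1 s2 k J ls rs) = partial_subst m cl (set (merged_points (ls @ rs))) f"
      unfolding M'(2)[symmetric]
      using merge_step[OF f vM(3,2,1), where cl = cl and Q = "cluster_series s1 s2 k J ls rs" and ps = D]
        cluster_series_step_left[OF Jiv[unfolded ls] div[unfolded ls], folded ls, of s1 s2 k] unfolding cv by blast
  next
    case 3
    obtain as c v vs bs where rs: "rs = as @ Clu c (v # vs) # bs" using merged_points_split[OF 3] by blast
    define M where "M = set (merged_points (ls @ (as @ Raw v # Clu c vs # bs)))"
    have M': "M = set (merged_points (ls @ (as @ Clu c vs # Raw v # bs)))" "insert v M = set (merged_points (ls @ rs))"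
      by (auto simp: M_def rs)
    have cv: "cl v = c" using pr(3)[of c "v # vs" v] by (simp add: rs)
    have vM: "v \<notin> M" "v < m" "M \<subseteq> {..<m}"
    proof -
      show "v \<notin> M" using div cMJ[of as] cMJ[of bs] cMJ[of ls] unfolding M_def rs by auto
      have "set (merged_points (ls @ rs)) \<subseteq> {v. Local v \<in> J}" using cMJ[of "ls @ rs"] unfolding Jiv by simp
      then show "v < m" "M \<subseteq> {..<m}" unfolding M'(2)[symmetric] using JL by auto
    qed
    have "mul_lins (map (merge_lin cl M) D) (cluster_series s1 s2 k J ls (as @ Raw v # Clu c vs # bs)) = partial_subst m cl M f"
      unfolding M_def D_def f_def J_def
    proof (rule less.hyps)
      show "mset (item_vars (as @ Raw v # Clu c vs # bs)) = mset js" unfolding pr(2)[symmetric] rs by simp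
      show "cl v' = c'" if "Clu c' vs' \<in> set (ls @ (as @ Raw v # Clu c vs # bs))" "v' \<in> set vs'" for c' vs' v'
        using pr(3)[of c' vs' v'] pr(3)[of c "v # vs" v'] that unfolding rs by auto
    qed (use pr(1) in \<open>auto simp: rs\<close>)
    moreover have "mul_lins (map (merge_lin cl M) D) (cluster_series s1 s2 k J ls (as @ Clu c vs # Raw v # bs)) = partial_subst m cl M f"
      unfolding M' D_def f_def J_def
    proof (rule less.hyps)
      show "mset (item_vars (as @ Clu c vs # Raw v # bs)) = mset js" unfolding pr(2)[symmetric] rs by simp
      show "cl v' = c'" if "Clu c' vs' \<in> set (ls @ (as @ Clu c vs # Raw v # bs))" "v' \<in> set vs'" for c' vs' v'
        using pr(3)[of c' vs' v'] pr(3)[of c "v # vs" v'] that unfolding rs by auto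
    qed (use pr(1) in \<open>auto simp: rs\<close>)
    ultimately show "mul_lins (map (merge_lin cl (set (merged_points (ls @ rs)))) D) (cluster_series s1 s2 k J ls rs) = partial_subst m cl (set (merged_points (ls @ rs))) f"
      unfolding M'(2)[symmetric]
      using merge_step[OF f vM(3,2,1), where cl = cl and Q = "cluster_series s1 s2 k J ls rs" and ps = D]
        cluster_series_step_right[OF Jiv[unfolded rs] div[unfolded rs], folded rs, of s1 s2 k] unfolding cv by blast
  qed
qed

end

section \<open>Cluster expansions: uniqueness, Laurent property and descendants\<close>

section \<open>Blocks of consecutive points\<close>

lemma sum_list_take_Suc: "c < length xs \<Longrightarrow> sum_list (take (Suc c) xs) = sum_list (take c xs) + xs ! c"
  by (simp add: take_Suc_conv_app_nth)

lemma sum_list_take_mono: "i \<le> j \<Longrightarrow> sum_list (take i xs) \<le> sum_list (take j (xs :: nat list))"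
proof -
  assume "i \<le> j"
  then obtain d where "j = i + d" using le_Suc_ex by blast
  then show ?thesis by (simp add: take_add)
qed

definition block :: "nat list \<Rightarrow> nat \<Rightarrow> nat list" where
  "block sizes c = [sum_list (take c sizes)..<sum_list (take (Suc c) sizes)]"

lemma concat_block:
  assumes "i \<le> j" "j \<le> length sizes"
  shows "concat (map (block sizes) [i..<j]) = [sum_list (take i sizes)..<sum_list (take j sizes)]"
  using assms
proof (induction j)
  case (Suc j)
  show ?case
  proof (cases "i = Suc j")
    case False
    then have ij: "i \<le> j" using Suc.prems by simp
    have st: "sum_list (take i sizes) \<le> sum_list (take j sizes)" "sum_list (take j sizes) \<le> sum_list (take (Suc j) sizes)"
      by (intro sum_list_take_mono; use ij in simp)+
    have "concat (map (block sizes) [i..<Suc j]) = [sum_list (take i sizes)..<sum_list (take j sizes)] @ block sizes j"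
      using Suc.IH[OF ij] Suc.prems ij by simp
    also have "\<dots> = [sum_list (take i sizes)..<sum_list (take (Suc j) sizes)]"
      unfolding block_def using st upt_add_eq_append[OF st(1), of "sum_list (take (Suc j) sizes) - sum_list (take j sizes)"] by simp
    finally show ?thesis .
  qed simp
qed simp

lemma block_less: "c < length sizes \<Longrightarrow> v \<in> set (block sizes c) \<Longrightarrow> v < sum_list sizes"
  using sum_list_take_mono[of "Suc c" "length sizes" sizes] by (auto simp: block_def)

lemma cluster_of_block:
  assumes "c < length sizes" "v \<in> set (block sizes c)"
  shows "cluster_of sizes v = c"
proof -
  define g where "g c = replicate (sizes ! c) c" for c
  have len: "length (concat (map g [0..<j])) = sum_list (take j sizes)" if "j \<le> length sizes" for j
    using that by (induction j) (auto simp: g_def sum_list_take_Suc)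
  have "[0..<length sizes] = [0..<c] @ c # [Suc c..<length sizes]"
    using assms(1) upt_add_eq_append[of 0 c "length sizes - c"] upt_conv_Cons[of c "length sizes"] by simp
  then have "concat (map g [0..<length sizes]) = concat (map g [0..<c]) @ g c @ concat (map g [Suc c..<length sizes])"
    by simp
  moreover have "sum_list (take c sizes) \<le> v" "v - sum_list (take c sizes) < sizes ! c"
    using assms by (auto simp: block_def sum_list_take_Suc)
  ultimately show ?thesis
    using len[of c] assms(1) unfolding cluster_of_def g_def by (simp add: nth_append)
qed

lemma cluster_of_less:
  assumes "v < sum_list sizes" shows "\<exists>c<length sizes. v \<in> set (block sizes c)"
proof -
  have "v \<in> set (concat (map (block sizes) [0..<length sizes]))"
    using concat_block[of 0 "length sizes" sizes] assms by simp
  then show ?thesis by auto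
qed

lemma map_nth_block:
  assumes "c < length xss"
  shows "map ((!) (concat xss)) (block (map length xss) c) = xss ! c"
proof -
  have a: "sum_list (take c (map length xss)) = length (concat (take c xss))"
    by (simp add: length_concat take_map)
  have b: "sum_list (take (Suc c) (map length xss)) = length (concat (take c xss)) + length (xss ! c)"
    using sum_list_take_Suc[of c "map length xss"] assms by (simp add: a)
  have "concat xss = concat (take c xss) @ xss ! c @ concat (drop (Suc c) xss)"
    using id_take_nth_drop[OF assms] by (metis concat.simps(2) concat_append)
  then show ?thesis unfolding block_def a b
    by (intro nth_equalityI) (auto simp: nth_append)
qed

lemma mset_concat_map_rev: "mset (concat (map g (rev cs))) = mset (concat (map g cs))"
  by (induction cs) auto

abbreviation cluster_var :: "(nat \<Rightarrow> nat) \<Rightarrow> nat \<Rightarrow> (complex \<times> cvar) list" where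
  "cluster_var cl v \<equiv> [(1, Base (cl v)), (1, Local v)]"

lemma pole_forms_clusters:
  "pole_forms (cluster_var cl) l m N = map (merge_lin cl {..<m}) (pole_forms raw_var l m N)"
proof -
  have 1: "replicate N (cluster_var cl v) = map (merge_lin cl {..<m}) (replicate N (raw_var v))" if "v \<in> set [0..<m]" for v
    using that by (simp add: merge_lin_def)
  have 2: "replicate (2 * N) (diff_form (cluster_var cl) v w) = map (merge_lin cl {..<m}) (replicate (2 * N) (diff_form raw_var v w))"
    if "(v, w) \<in> set (pairs l m)" for v w
    using that unfolding set_pairs by (simp add: merge_lin_def)
  have "map (\<lambda>v. replicate N (cluster_var cl v)) [0..<m] = map (\<lambda>v. map (merge_lin cl {..<m}) (replicate N (raw_var v))) [0..<m]"
    by (rule map_cong[OF refl 1])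
  moreover have "map (\<lambda>(v, w). replicate (2 * N) (diff_form (cluster_var cl) v w)) (pairs l m) =
    map (\<lambda>(v, w). map (merge_lin cl {..<m}) (replicate (2 * N) (diff_form raw_var v w))) (pairs l m)"
    by (rule map_cong[OF refl]) (use 2 in auto)
  ultimately show ?thesis
    unfolding pole_forms_pairs map_append map_concat map_map comp_def by (simp only: case_prod_unfold)
qed

text \<open>The two expansions may use different powers \<open>N\<close> and \<open>N'\<close>. Each
  is multiplied by the denominator of the other, and compatibility of substitution with linear forms
  equates the numerators. All forms are nonzero: even where the bases of one cluster cancel,
  \<open>Local v\<close> keeps coefficient 1.\<close>

lemma cluster_expansion_unique:
  assumes "cluster_expansion rs ss A H" "cluster_expansion rs ss A H'"
  shows "H = H'"
proof -
  define l m L n cl where "l = sum_list rs" and "m = l + sum_list ss" and "L = length rs" and "n = L + length ss"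
    and "cl = cluster_of (rs @ ss)"
  define vs where "vs = rev (map Base ([0..<L] @ rev [L..<n]) @ map Local [0..<m])"
  have setvs: "set vs = Base ` {..<n} \<union> Local ` {..<m}"
  proof -
    have "{..<n} = {0..<L} \<union> {L..<n}" by (auto simp: n_def)
    then show ?thesis unfolding vs_def by (auto simp: image_Un)
  qed
  note defs = l_def[symmetric] m_def[symmetric] L_def[symmetric] n_def[symmetric] cl_def[symmetric]
  define D E where "D N = pole_forms raw_var l m N" and "E N = pole_forms (cluster_var cl) l m N" for N
  obtain N f where f: "power_series m f" "mul_lins (D N) A = f" "mul_lins (E N) H = cluster_subst m cl f"
    and H: "iterated_laurent_rev vs H"
    using assms(1) unfolding cluster_expansion_def Let_def represents_def iterated_laurent_def defs D_def E_def vs_def by blast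
  obtain N' f' where f': "power_series m f'" "mul_lins (D N') A = f'" "mul_lins (E N') H' = cluster_subst m cl f'"
    and H': "iterated_laurent_rev vs H'"
    using assms(2) unfolding cluster_expansion_def Let_def represents_def iterated_laurent_def defs D_def E_def vs_def by blast
  have sub: "cluster_subst m cl (mul_lins (D K) g) = mul_lins (E K) (cluster_subst m cl g)" if "power_series m g" for K g
    unfolding cluster_subst_eq_partial_subst E_def pole_forms_clusters D_def
    by (rule partial_subst_mul_lins[OF that pole_forms_vars]) auto
  have "mul_lins (E N' @ E N) H = cluster_subst m cl (mul_lins (D N') f)"
    by (simp add: mul_lins_append f(3) sub[OF f(1)])
  also have "mul_lins (D N') f = mul_lins (D N) f'"
    unfolding f(2)[symmetric] f'(2)[symmetric] by (rule mul_lins_commute)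
  also have "cluster_subst m cl (mul_lins (D N) f') = mul_lins (E N' @ E N) H'"
    by (simp add: sub[OF f'(1)] f'(3)[symmetric] mul_lins_append mul_lins_commute)
  finally have "mul_lins (E N' @ E N) (\<lambda>e. H e - H' e) = (\<lambda>e. 0)"
    by (simp add: mul_lins_diff)
  moreover have "iterated_laurent_rev vs (\<lambda>e. H e - H' e)"
    using iterated_laurent_rev_lincomb[OF H H', of 1 "-1"] by simp
  moreover have "snd ` set p \<subseteq> set vs \<and> (\<exists>v. coef p v \<noteq> 0)" if "p \<in> set (E N' @ E N)" for p
  proof -
    have cl: "cl v < n" if v: "v < m" for v
    proof -
      have "v < sum_list (rs @ ss)" using v by (simp add: m_def l_def)
      then obtain c where "c < length (rs @ ss)" "v \<in> set (block (rs @ ss) c)" using cluster_of_less by blast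
      then show ?thesis using cluster_of_block unfolding cl_def n_def L_def by auto
    qed
    have "(\<exists>v<m. p = cluster_var cl v) \<or> (\<exists>v w. v < w \<and> w < m \<and> p = diff_form (cluster_var cl) v w)"
      using that set_pole_forms[of p "cluster_var cl" l m N] set_pole_forms[of p "cluster_var cl" l m N'] unfolding E_def by auto
    then show ?thesis
    proof (elim disjE exE conjE)
      fix v assume v: "v < m" "p = cluster_var cl v"
      have "coef p (Local v) = 1" by (simp add: v coef_def)
      moreover have "snd ` set p \<subseteq> set vs" using v cl[OF v(1)] unfolding setvs by auto
      ultimately show ?thesis by (metis zero_neq_one)
    next
      fix v w assume v: "v < w" "w < m" "p = diff_form (cluster_var cl) v w"
      have "coef p (Local v) = 1" using v(1) by (simp add: v(3) coef_def)
      moreover have "snd ` set p \<subseteq> set vs" using v cl[of v] cl[of w] unfolding setvs by auto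
      ultimately show ?thesis by (metis zero_neq_one)
    qed
  qed
  ultimately have "(\<lambda>e. H e - H' e) = (\<lambda>e. 0)" using mul_lins_eq_0[of vs] by blast
  then show ?thesis by (metis (no_types, lifting) ext right_minus_eq)
qed

abbreviation clusters :: "nat list \<Rightarrow> nat list \<Rightarrow> item list" where
  "clusters sizes cs \<equiv> map (\<lambda>c. Clu c (block sizes c)) cs"

lemma mset_item_vars_clusters: "mset (item_vars (clusters sizes cs)) = mset (map Base cs @ map Local (concat (map (block sizes) cs)))"
  by (induction cs) auto

lemma merged_points_clusters: "merged_points (clusters sizes cs) = concat (map (block sizes) cs)"
  by (simp add: comp_def)

context sew_loc begin

lemma cluster_series_nonzero:
  assumes "cluster_series s1 s2 k J ls rs e \<noteq> 0"
  obtains u where "u \<in> B k" "items_op ls e u \<noteq> 0" "items_op rs e (dv k u) \<noteq> 0"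
proof -
  have "(\<Sum>u\<in>B k. Z1 V (items_op ls e u) s1 * Z1 V (items_op rs e (dv k u)) s2) \<noteq> 0"
    using assms unfolding cluster_series_def by (simp split: if_splits)
  then obtain u where u: "u \<in> B k" "Z1 V (items_op ls e u) s1 * Z1 V (items_op rs e (dv k u)) s2 \<noteq> 0"
    by (rule sum.not_neutral_contains_not_neutral)
  have "Z1 V 0 s = 0" for s by (rule lin_fun_zero[OF lin_fun_Z1])
  then have "items_op ls e u \<noteq> 0" "items_op rs e (dv k u) \<noteq> 0" using u(2) by auto
  then show ?thesis using that u(1) by blast
qed

lemma items_op_split_nonzero: "items_op (as @ it # bs) e u \<noteq> 0 \<Longrightarrow> item_op it e (items_op bs e u) \<noteq> 0"
  by (auto simp: items_op_append items_op_Cons linear_op_0[OF linear_op_items_op])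

lemma items_op_cluster_nonzero:
  assumes "Clu c vs \<in> set its" "items_op its e u \<noteq> 0" shows "omegas_op vs (\<lambda>v. e (Local v)) (vac V) \<noteq> 0"
proof -
  obtain as bs where "its = as @ Clu c vs # bs" using split_list[OF assms(1)] by blast
  then have "item_op (Clu c vs) e (items_op bs e u) \<noteq> 0" using assms(2) items_op_split_nonzero by blast
  then show ?thesis by auto
qed

text \<open>Within a cluster the points after \<open>p\<close> act on the vacuum first. Freezing
  their exponents fixes the vector that the mode at \<open>p\<close> acts on.\<close>

lemma cluster_series_laurent_local:
  assumes c: "c < length sizes" "p \<in> set (block sizes c)"
  shows "\<exists>N. \<forall>e. (\<forall>q. p < q \<and> q < sum_list sizes \<longrightarrow> e (Local q) = o' (Local q)) \<longrightarrow>
    Clu c (block sizes c) \<in> set (ls @ rs) \<longrightarrow> cluster_series s1 s2 k J ls rs e \<noteq> 0 \<longrightarrow> N \<le> e (Local p)"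
proof -
  define a b where "a = sum_list (take c sizes)" and "b = sum_list (take (Suc c) sizes)"
  have ab: "a \<le> p" "p < b" "b \<le> sum_list sizes"
    using c sum_list_take_mono[of "Suc c" "length sizes" sizes] by (auto simp: block_def a_def b_def)
  have sp: "block sizes c = [a..<p] @ p # [Suc p..<b]"
    unfolding block_def a_def[symmetric] b_def[symmetric]
    using ab upt_add_eq_append[of a p "b - p"] upt_conv_Cons[of p b] by simp
  obtain N where N: "\<forall>n\<ge>N. om n (omegas_op [Suc p..<b] (\<lambda>v. o' (Local v)) (vac V)) = 0" using sq_trunc by blast
  show ?thesis
  proof (intro exI[of _ "- N"] allI impI)
    fix e assume e: "\<forall>q. p < q \<and> q < sum_list sizes \<longrightarrow> e (Local q) = o' (Local q)"
      and mem: "Clu c (block sizes c) \<in> set (ls @ rs)" and nz: "cluster_series s1 s2 k J ls rs e \<noteq> 0"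
    obtain u where "items_op ls e u \<noteq> 0" "items_op rs e (dv k u) \<noteq> 0" using cluster_series_nonzero[OF nz] by blast
    then have "omegas_op (block sizes c) (\<lambda>v. e (Local v)) (vac V) \<noteq> 0"
      using mem items_op_cluster_nonzero by (metis UnE set_append)
    then have "om (- e (Local p) - 1) (omegas_op [Suc p..<b] (\<lambda>v. e (Local v)) (vac V)) \<noteq> 0"
      unfolding sp by (rule omegas_op_split_nonzero)
    moreover have "omegas_op [Suc p..<b] (\<lambda>v. e (Local v)) (vac V) = omegas_op [Suc p..<b] (\<lambda>v. o' (Local v)) (vac V)"
      by (rule omegas_op_cong) (use e ab in auto)
    ultimately have "\<not> N \<le> - e (Local p) - 1" using N by metis
    then show "- N \<le> e (Local p)" by simp
  qed
qed

text \<open>With the local exponents of the cluster and all variables of the items to its right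
  frozen, both the inserted state and the finitely many vectors it acts on are fixed.\<close>

lemma items_op_laurent_base:
  assumes "finite U"
  shows "\<exists>N. \<forall>e u. (\<forall>i\<in>set (item_vars bs) \<union> Local ` set vs. e i = o' i) \<longrightarrow> u \<in> U \<longrightarrow> items_op (as @ Clu c vs # bs) e u \<noteq> 0 \<longrightarrow> N \<le> e (Base c)"
proof -
  define w where "w = omegas_op vs (\<lambda>v. o' (Local v)) (vac V)"
  obtain N where N: "\<forall>y\<in>(\<lambda>u. items_op bs o' u) ` U. \<forall>n<N. sq w (- n - 1) y = 0"
    using om_trunc_uniform[of "(\<lambda>u. items_op bs o' u) ` U" w] assms by blast
  show ?thesis
  proof (intro exI[of _ N] allI impI)
    fix e u assume e: "\<forall>i\<in>set (item_vars bs) \<union> Local ` set vs. e i = o' i" and u: "u \<in> U" and nz: "items_op (as @ Clu c vs # bs) e u \<noteq> 0"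
    have "omegas_op vs (\<lambda>v. e (Local v)) (vac V) = w" unfolding w_def by (rule omegas_op_cong) (use e in auto)
    moreover have "items_op bs e u = items_op bs o' u" by (rule items_op_cong) (use e in auto)
    ultimately have "sq w (- e (Base c) - 1) (items_op bs o' u) \<noteq> 0" using items_op_split_nonzero[OF nz] by simp
    then show "N \<le> e (Base c)" using N u by (metis image_eqI not_less)
  qed
qed

lemma cluster_series_iterated_laurent:
  fixes sizes :: "nat list"
  defines "n \<equiv> length sizes" and "m \<equiv> sum_list sizes"
  assumes L: "L \<le> n" and J: "J = Base ` {..<n} \<union> Local ` {..<m}"
  shows "iterated_laurent (map Base ([0..<L] @ rev [L..<n]) @ map Local [0..<m])
    (cluster_series s1 s2 k J (clusters sizes [0..<L]) (clusters sizes (rev [L..<n])))"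
proof -
  define G where "G = cluster_series s1 s2 k J (clusters sizes [0..<L]) (clusters sizes (rev [L..<n]))"
  define zs where "zs = rev (map Local [0..<m]) @ map Base ([L..<n] @ rev [0..<L])"
  have zs: "rev (map Base ([0..<L] @ rev [L..<n]) @ map Local [0..<m]) = zs"
    by (simp add: zs_def rev_map)
  have "distinct zs" unfolding zs_def by (auto simp: distinct_map inj_on_def)
  have setzs: "set zs = J"
  proof -
    have "{..<n} = {0..<L} \<union> {L..<n}" using L by auto
    then show ?thesis unfolding zs_def J by (auto simp: image_Un)
  qed
  have iv: "set (item_vars (clusters sizes cs)) \<subseteq> Base ` set cs \<union> Local ` {..<m}" if "set cs \<subseteq> {..<n}" for cs
  proof
    fix i assume "i \<in> set (item_vars (clusters sizes cs))"
    then obtain c where c: "c \<in> set cs" "i = Base c \<or> i \<in> Local ` set (block sizes c)" by auto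
    then have "c < length sizes" using that n_def by auto
    then show "i \<in> Base ` set cs \<union> Local ` {..<m}" using c block_less[of c sizes] unfolding m_def by auto
  qed
  have "iterated_laurent_rev zs G"
  proof (rule iterated_laurent_revI)
    fix xs v ys o' assume s: "zs = xs @ v # ys"
    have nd: "v \<notin> set xs" "v \<notin> set ys" using \<open>distinct zs\<close> unfolding s by auto
    have vJ: "v \<in> J" unfolding setzs[symmetric] s by simp
    have xs: "xs = as" if "zs = as @ v # bs" for as bs
      using that s nd append_Cons_eq_iff[of v xs ys] by metis
    show "\<exists>N. \<forall>e. (\<forall>w\<in>set xs. e w = o' w) \<longrightarrow> G e \<noteq> 0 \<longrightarrow> N \<le> e v"
    proof (cases v)
      case (Local p)
      have p: "p < m" using vJ Local by (auto simp: J)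
      obtain c where c: "c < n" "p \<in> set (block sizes c)" using cluster_of_less[of p sizes] p unfolding n_def m_def by blast
      have "[0..<m] = [0..<p] @ p # [Suc p..<m]"
        using p upt_add_eq_append[of 0 p "m - p"] upt_conv_Cons[of p m] by simp
      then have "zs = rev (map Local [Suc p..<m]) @ v # (rev (map Local [0..<p]) @ map Base ([L..<n] @ rev [0..<L]))"
        unfolding zs_def Local by simp
      then have xs': "xs = rev (map Local [Suc p..<m])" by (rule xs)
      have mem: "Clu c (block sizes c) \<in> set (clusters sizes [0..<L] @ clusters sizes (rev [L..<n]))"
        using c(1) by (cases "c < L") auto
      obtain N where N: "\<forall>e. (\<forall>q. p < q \<and> q < m \<longrightarrow> e (Local q) = o' (Local q)) \<longrightarrow> G e \<noteq> 0 \<longrightarrow> N \<le> e (Local p)"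
        using cluster_series_laurent_local[OF c(1)[unfolded n_def] c(2), of o' "clusters sizes [0..<L]" "clusters sizes (rev [L..<n])" s1 s2 k J] mem
        unfolding G_def m_def by blast
      show ?thesis
      proof (intro exI[of _ N] allI impI)
        fix e assume e: "\<forall>w\<in>set xs. e w = o' w" and nz: "G e \<noteq> 0"
        have "\<forall>q. p < q \<and> q < m \<longrightarrow> e (Local q) = o' (Local q)" using e unfolding xs' by auto
        then show "N \<le> e v" using N nz unfolding Local by blast
      qed
    next
      case (Base c)
      have c: "c < n" using vJ Base by (auto simp: J)
      have bl: "Local ` set (block sizes c) \<subseteq> Local ` {..<m}" using block_less c unfolding n_def m_def by blast
      show ?thesis
      proof (cases "c < L")
        case True
        have sp: "[0..<L] = [0..<c] @ c # [Suc c..<L]"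
          using True upt_add_eq_append[of 0 c "L - c"] upt_conv_Cons[of c L] by simp
        have "zs = (rev (map Local [0..<m]) @ map Base ([L..<n] @ rev [Suc c..<L])) @ v # map Base (rev [0..<c])"
          unfolding zs_def Base sp by simp
        then have xs': "xs = rev (map Local [0..<m]) @ map Base ([L..<n] @ rev [Suc c..<L])" by (rule xs)
        have ivc: "set (item_vars (clusters sizes [Suc c..<L])) \<subseteq> Base ` set [Suc c..<L] \<union> Local ` {..<m}"
          by (rule iv) (use L in auto)
        have sub: "set (item_vars (clusters sizes [Suc c..<L])) \<union> Local ` set (block sizes c) \<subseteq> set xs"
        proof -
          have S: "Base ` set [Suc c..<L] \<union> Local ` {..<m} \<subseteq> set xs" unfolding xs' by (auto simp: atLeast0LessThan image_Un)
          then show ?thesis by (intro Un_least order_trans[OF ivc S] order_trans[OF bl order_trans[OF Un_upper2 S]])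
        qed
        obtain N where N: "\<forall>e u. (\<forall>i\<in>set (item_vars (clusters sizes [Suc c..<L])) \<union> Local ` set (block sizes c). e i = o' i) \<longrightarrow> u \<in> B k \<longrightarrow>
          items_op (clusters sizes [0..<c] @ Clu c (block sizes c) # clusters sizes [Suc c..<L]) e u \<noteq> 0 \<longrightarrow> N \<le> e (Base c)"
          by (rule exE[OF items_op_laurent_base[OF finite_B[of k], where bs = "clusters sizes [Suc c..<L]" and vs = "block sizes c"
            and o' = o' and as = "clusters sizes [0..<c]" and c = c]]) (rule that)
        show ?thesis
        proof (intro exI[of _ N] allI impI)
          fix e assume e: "\<forall>w\<in>set xs. e w = o' w" and nz: "G e \<noteq> 0"
          have e': "\<forall>i\<in>set (item_vars (clusters sizes [Suc c..<L])) \<union> Local ` set (block sizes c). e i = o' i" using e sub by blast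
          obtain u where u: "u \<in> B k" "items_op (clusters sizes [0..<L]) e u \<noteq> 0" using cluster_series_nonzero[OF nz[unfolded G_def]] by blast
          have "items_op (clusters sizes [0..<c] @ Clu c (block sizes c) # clusters sizes [Suc c..<L]) e u \<noteq> 0"
            using u(2) unfolding sp by (simp only: map_append list.map not_False_eq_True)
          then show "N \<le> e v" using N e' u(1) unfolding Base by blast
        qed
      next
        case False
        have sp: "[L..<n] = [L..<c] @ c # [Suc c..<n]"
          using False c upt_add_eq_append[of L c "n - c"] upt_conv_Cons[of c n] by simp
        have "zs = (rev (map Local [0..<m]) @ map Base [L..<c]) @ v # map Base ([Suc c..<n] @ rev [0..<L])"
          unfolding zs_def Base sp by simp
        then have xs': "xs = rev (map Local [0..<m]) @ map Base [L..<c]" by (rule xs)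
        have ivc: "set (item_vars (clusters sizes (rev [L..<c]))) \<subseteq> Base ` set (rev [L..<c]) \<union> Local ` {..<m}"
          by (rule iv) (use c in auto)
        have sub: "set (item_vars (clusters sizes (rev [L..<c]))) \<union> Local ` set (block sizes c) \<subseteq> set xs"
        proof -
          have S: "Base ` set (rev [L..<c]) \<union> Local ` {..<m} \<subseteq> set xs" unfolding xs' by (auto simp: atLeast0LessThan image_Un)
          then show ?thesis by (intro Un_least order_trans[OF ivc S] order_trans[OF bl order_trans[OF Un_upper2 S]])
        qed
        have rsp: "clusters sizes (rev [L..<n]) = clusters sizes (rev [Suc c..<n]) @ Clu c (block sizes c) # clusters sizes (rev [L..<c])"
          by (simp add: sp)
        obtain N where N: "\<forall>e u. (\<forall>i\<in>set (item_vars (clusters sizes (rev [L..<c]))) \<union> Local ` set (block sizes c). e i = o' i) \<longrightarrow> u \<in> dv k ` B k \<longrightarrow>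
          items_op (clusters sizes (rev [Suc c..<n]) @ Clu c (block sizes c) # clusters sizes (rev [L..<c])) e u \<noteq> 0 \<longrightarrow> N \<le> e (Base c)"
          by (rule exE[OF items_op_laurent_base[OF finite_imageI[OF finite_B[of k], of "dv k"], where bs = "clusters sizes (rev [L..<c])" and vs = "block sizes c"
            and o' = o' and as = "clusters sizes (rev [Suc c..<n])" and c = c]]) (rule that)
        show ?thesis
        proof (intro exI[of _ N] allI impI)
          fix e assume e: "\<forall>w\<in>set xs. e w = o' w" and nz: "G e \<noteq> 0"
          have e': "\<forall>i\<in>set (item_vars (clusters sizes (rev [L..<c]))) \<union> Local ` set (block sizes c). e i = o' i" using e sub by blast
          obtain u where u: "u \<in> B k" "items_op (clusters sizes (rev [L..<n])) e (dv k u) \<noteq> 0" using cluster_series_nonzero[OF nz[unfolded G_def]] by blast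
          then show "N \<le> e v" using N e' unfolding Base rsp by blast
        qed
      qed
    qed
  qed
  moreover have "series_in J G"
    unfolding G_def series_in_def cluster_series_def supp_in_def by (auto split: if_splits)
  moreover have "set (map Base ([0..<L] @ rev [L..<n]) @ map Local [0..<m]) = J"
    using setzs unfolding zs[symmetric] by (simp only: set_rev)
  ultimately show ?thesis unfolding iterated_laurent_def zs G_def by simp
qed

definition descendant_series :: "complex \<Rightarrow> complex \<Rightarrow> int \<Rightarrow> nat list \<Rightarrow> nat list \<Rightarrow> cvar fseries" where
  "descendant_series s1 s2 k rs ss = cluster_series s1 s2 k (Base ` {..<length (rs @ ss)} \<union> Local ` {..<sum_list (rs @ ss)})
     (clusters (rs @ ss) [0..<length rs]) (clusters (rs @ ss) (rev [length rs..<length (rs @ ss)]))"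

text \<open>The fields of the cluster states themselves provide the expansion: with every point
  merged, \<open>cluster_series_merge\<close> is its defining equation.\<close>

lemma cluster_expansion_descendant_series:
  "cluster_expansion rs ss (move_right (sum_list rs) (sum_list rs + sum_list ss) (vir_G V F B (sum_list rs + sum_list ss) s1 s2) k) (descendant_series s1 s2 k rs ss)"
proof -
  define l m L n sizes where "l = sum_list rs" and "m = l + sum_list ss" and "L = length rs" and "n = L + length ss"
    and "sizes = rs @ ss"
  define cl where "cl = cluster_of sizes"
  have lm: "l \<le> m" and Ln: "L \<le> n" by (simp_all add: m_def n_def)
  have n: "n = length sizes" and m: "m = sum_list sizes" by (simp_all add: n_def m_def l_def L_def sizes_def)
  have stL: "sum_list (take L sizes) = l" "sum_list (take n sizes) = m" by (simp_all add: sizes_def L_def l_def n m)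
  define N where "N = max 2 (nat (k + 2))"
  have N: "2 \<le> N" "k + 2 \<le> int N" by (auto simp: N_def)
  define A where "A = omega_series s1 s2 k m [0..<l] (rev [l..<m])"
  define ir il where "ir = map Base [L..<n] @ map Local [l..<m]" and "il = map Base [0..<L] @ map Local [0..<l]"
  have J: "set (il @ ir) = Base ` {..<n} \<union> Local ` {..<m}"
  proof -
    have "{..<n} = {0..<L} \<union> {L..<n}" "{..<m} = {0..<l} \<union> {l..<m}" using Ln lm by auto
    then show ?thesis unfolding ir_def il_def by (auto simp: image_Un)
  qed
  have cb: "concat (map (block sizes) [0..<L]) = [0..<l]" "concat (map (block sizes) [L..<n]) = [l..<m]"
    using concat_block[of 0 L sizes] concat_block[of L n sizes] Ln n stL by simp_all
  define ls rss where "ls = clusters sizes [0..<L]" and "rss = clusters sizes (rev [L..<n])"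
  have mg: "set (merged_points (ls @ rss)) = {..<m}"
  proof -
    have "set (merged_points rss) = set (concat (map (block sizes) [L..<n]))" unfolding rss_def merged_points_clusters by simp
    moreover have "set (merged_points ls) = set (concat (map (block sizes) [0..<L]))" unfolding ls_def merged_points_clusters by simp
    ultimately have "set (merged_points (ls @ rss)) = {0..<l} \<union> {l..<m}" unfolding cb by simp
    then show ?thesis using lm by auto
  qed
  have H: "descendant_series s1 s2 k rs ss = cluster_series s1 s2 k (set (il @ ir)) ls rss"
    unfolding descendant_series_def sizes_def[symmetric] n[symmetric] m[symmetric] L_def[symmetric] J ls_def rss_def ..
  have "mul_lins (map (merge_lin cl (set (merged_points (ls @ rss)))) (pole_forms raw_var l m N)) (cluster_series s1 s2 k (set (il @ ir)) ls rss) =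
    partial_subst m cl (set (merged_points (ls @ rss))) (mul_lins (pole_forms raw_var l m N) (omega_series s1 s2 k m [0..<l] (rev [l..<m])))"
  proof (rule cluster_series_merge[OF N lm])
    show "distinct (il @ ir)" unfolding il_def ir_def by (auto simp: distinct_map inj_on_def)
    show "mset (item_vars ls) = mset il" unfolding ls_def mset_item_vars_clusters cb il_def ..
    show "mset (item_vars rss) = mset ir"
      unfolding rss_def mset_item_vars_clusters ir_def mset_append mset_map mset_concat_map_rev cb by simp
    show "cl v = c" if "Clu c vs \<in> set (ls @ rss)" "v \<in> set vs" for c vs v
      using that cluster_of_block[of c sizes v] Ln unfolding ls_def rss_def cl_def n by auto
  qed (auto simp: il_def ir_def)
  then have "mul_lins (pole_forms (cluster_var cl) l m N) (descendant_series s1 s2 k rs ss) = cluster_subst m cl (mul_lins (pole_forms raw_var l m N) A)"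
    unfolding mg pole_forms_clusters[symmetric] cluster_subst_eq_partial_subst H A_def .
  moreover have "represents l m N (mul_lins (pole_forms raw_var l m N) A) A"
    unfolding A_def by (rule omega_series_represents[OF N lm])
  moreover have "iterated_laurent (map Base ([0..<L] @ rev [L..<n]) @ map Local [0..<m]) (descendant_series s1 s2 k rs ss)"
    unfolding H ls_def rss_def J using cluster_series_iterated_laurent[of L sizes] Ln unfolding n m by blast
  ultimately show ?thesis
    unfolding cluster_expansion_def Let_def l_def[symmetric] m_def[symmetric] L_def[symmetric] n_def[symmetric] sizes_def[symmetric]
      cl_def[symmetric] move_right_vir_G[OF lm] A_def[symmetric] by blast
qed

lemma item_op_descendant:
  assumes "c < length kss"
  shows "item_op (Clu c (block (map length kss) c)) (desc_exponents kss p) w = sq (vir_desc V (kss ! c)) (- p c - 1) w"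
proof -
  define bl where "bl = block (map length kss) c"
  have lt: "v < length (concat kss)" if "v \<in> set bl" for v
    using block_less[of c "map length kss" v] assms that by (simp add: bl_def length_concat)
  have "omegas_op bl (\<lambda>v. desc_exponents kss p (Local v)) (vac V) = omegas_op bl (\<lambda>v. concat kss ! v - 2) (vac V)"
    by (rule omegas_op_cong) (simp add: desc_exponents_def lt)
  \<comment> \<open>The exponent \<open>k - 2\<close> selects the mode \<open>1 - k\<close> of the
    conformal vector, which is \<open>L[-k]\<close>.\<close>
  also have "\<dots> = foldr (\<lambda>k w. om (1 - k) w) (map ((!) (concat kss)) bl) (vac V)"
    unfolding omegas_op_def foldr_map by (rule foldr_cong) (auto simp: algebra_simps)
  also have "\<dots> = vir_desc V (kss ! c)"
    unfolding bl_def map_nth_block[OF assms] vir_desc_def Lm_def by (rule foldr_cong) (auto simp: algebra_simps)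
  finally show ?thesis by (simp add: bl_def desc_exponents_def)
qed

lemma descendant_series_descendants:
  "Z2 V F B (map (vir_desc V) kss) (map (vir_desc V) lss) s1 s2 k p =
   descendant_series s1 s2 k (map length kss) (map length lss) (desc_exponents (kss @ lss) p)"
proof -
  define tss L n where "tss = kss @ lss" and "L = length kss" and "n = length kss + length lss"
  define e where "e = desc_exponents tss p"
  define sizes where "sizes = map length tss"
  have n: "n = length tss" "length sizes = n" by (simp_all add: n_def tss_def sizes_def)
  have m: "sum_list sizes = length (concat tss)" by (simp add: sizes_def length_concat)
  have op: "item_op (Clu c (block sizes c)) e w = sq (vir_desc V (tss ! c)) (- p c - 1) w" if "c < n" for c w
    using item_op_descendant[of c tss p w] that unfolding n sizes_def e_def by simp
  have left: "foldr (\<lambda>i w. sq (map (vir_desc V) kss ! i) (- p i - 1) w) [0..<length (map (vir_desc V) kss)] u = items_op (clusters sizes [0..<L]) e u" for u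
    unfolding items_op_def foldr_map length_map L_def[symmetric]
    by (rule foldr_cong) (auto simp: op n_def L_def tss_def nth_append simp del: item_op.simps)
  \<comment> \<open>On the right \<open>fold\<close> makes the last insertion the outermost one,
    which is the reversed order of the clusters.\<close>
  have right: "fold (\<lambda>j w. sq (map (vir_desc V) lss ! j) (- p (length (map (vir_desc V) kss) + j) - 1) w) [0..<length (map (vir_desc V) lss)] u =
    items_op (clusters sizes (rev [L..<n])) e u" for u
  proof -
    have "[L..<n] = map ((+) L) [0..<length lss]"
      by (rule nth_equalityI) (auto simp: L_def n_def)
    then have "items_op (clusters sizes (rev [L..<n])) e u = foldr (\<lambda>j w. item_op (Clu (L + j) (block sizes (L + j))) e w) (rev [0..<length lss]) u"
      unfolding items_op_def by (simp add: rev_map foldr_map comp_def del: item_op.simps)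
    also have "\<dots> = foldr (\<lambda>j w. sq (map (vir_desc V) lss ! j) (- p (length (map (vir_desc V) kss) + j) - 1) w) (rev [0..<length lss]) u"
      by (rule foldr_cong) (auto simp: op n_def L_def tss_def nth_append simp del: item_op.simps)
    finally show ?thesis by (simp add: foldr_conv_fold)
  qed
  have supp: "supp_in (Base ` {..<n} \<union> Local ` {..<sum_list sizes}) e \<longleftrightarrow> (\<forall>c\<ge>n. p c = 0)"
  proof
    assume s: "supp_in (Base ` {..<n} \<union> Local ` {..<sum_list sizes}) e"
    show "\<forall>c\<ge>n. p c = 0"
    proof (intro allI impI)
      fix c assume "n \<le> c"
      then have "Base c \<notin> Base ` {..<n} \<union> Local ` {..<sum_list sizes}" by auto
      then have "e (Base c) = 0" using s unfolding supp_in_def by blast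
      then show "p c = 0" by (simp add: e_def desc_exponents_def)
    qed
  next
    assume z: "\<forall>c\<ge>n. p c = 0"
    show "supp_in (Base ` {..<n} \<union> Local ` {..<sum_list sizes}) e"
      unfolding supp_in_def
    proof (intro allI impI)
      fix i assume i: "i \<notin> Base ` {..<n} \<union> Local ` {..<sum_list sizes}"
      show "e i = 0"
      proof (cases i)
        case (Base c)
        then have "n \<le> c" using i by auto
        then show ?thesis using z by (simp add: e_def desc_exponents_def Base)
      next
        case (Local v)
        then have "\<not> v < length (concat tss)" using i unfolding m by auto
        then show ?thesis unfolding e_def desc_exponents_def Local cvar.case by simp
      qed
    qed
  qed
  have sz: "map length kss @ map length lss = sizes" "length (map length kss) = L"
    "length (map (vir_desc V) kss) + length (map (vir_desc V) lss) = n"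
    by (simp_all add: sizes_def tss_def L_def n_def)
  show ?thesis
    unfolding descendant_series_def cluster_series_def Z2_def left right sz n(2) e_def[symmetric] tss_def[symmetric] supp ..
qed

lemma vir_G_generates_descendants: "generates_descendants V F B (vir_G V F B)"
  unfolding generates_descendants_def Let_def
proof (intro allI conjI impI; (elim conjE)?)
  fix rs ss :: "nat list" and s1 s2 :: complex and k :: int
  show "\<exists>!H. cluster_expansion rs ss (move_right (sum_list rs) (sum_list rs + sum_list ss) (vir_G V F B (sum_list rs + sum_list ss) s1 s2) k) H"
    using cluster_expansion_descendant_series cluster_expansion_unique by blast
  fix H :: "cvar fseries" and kss lss :: "int list list" and p :: "nat \<Rightarrow> int"
  assume H: "cluster_expansion rs ss (move_right (sum_list rs) (sum_list rs + sum_list ss) (vir_G V F B (sum_list rs + sum_list ss) s1 s2) k) H"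
    and "map length kss = rs" "map length lss = ss"
  then show "Z2 V F B (map (vir_desc V) kss) (map (vir_desc V) lss) s1 s2 k p = H (desc_exponents (kss @ lss) p)"
    using descendant_series_descendants cluster_expansion_unique[OF H cluster_expansion_descendant_series] by simp
qed

end

theorem proposition3p1:
  fixes V :: "'v::ab_group_add voa_data"
    and F :: "'v \<Rightarrow> 'v \<Rightarrow> complex fls"
    and B :: "int \<Rightarrow> 'v set"
  assumes "strong_cft_type V"
    and "sewing_form V F"
    and "graded_basis V B"
  shows "(\<forall>m s1 s2 k. symmetric_function m (vir_G V F B m s1 s2 k)) \<and>
         generates_descendants V F B (vir_G V F B)"
proof -
  interpret sew_loc V F B
    by unfold_locales (use assms in \<open>auto simp: strong_cft_type_def\<close>)
  show ?thesis using vir_G_symmetric vir_G_generates_descendants by blast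
qed

end
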